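(* Let $\Omega\subset\mathbb{R}^d$ ($d\ge2$) be a bounded connected open set with smooth boundary, let $p>d$, $\mathbf{B}\in L^p(\Omega,\mathbb{R}^{n\times d\times n})$ and $k\in\{0,\dots,n\}$. Then $\dim N(\nabla+\mathbf{B}\cdot)=k$ if and only if $\mathbf{B}$ is $k$-conservative (in the $L^p$ sense defined below).
   Context: $N(\nabla+\mathbf{B}\cdot)$ is the set of $\boldsymbol\mu\in L^2(\Omega,\mathbb{R}^n)$ with $\nabla\boldsymbol\mu+\mathbf{B}\cdot\boldsymbol\mu=0$ in $H^{-1}(\Omega,\mathbb{R}^{n\times d})$, where $(\nabla\boldsymbol\mu)_{ij}=\partial_j\mu_i$ and $(\mathbf{B}\cdot\boldsymbol\mu)_{ij}=\sum_k\mathbf{B}_{ijk}\mu_k$. For a continuous field $\mathbf{B}'\in C^0(\overline\Omega,\mathbb{R}^{n\times d\times n})$: let $\Gamma(x,y)=\{\boldsymbol\gamma\in C^1([0,1],\Omega):\boldsymbol\gamma(0)=x,\boldsymbol\gamma(1)=y\}$; for $\boldsymbol\gamma\in\Gamma(x,y)$, $R^{\boldsymbol\gamma}_{\mathbf{B}'}(\mathbf{v})=\boldsymbol\varphi(1)$ where $\varphi_i'(t)=-\sum_{j,k}\mathbf{B}'_{ijk}(\boldsymbol\gamma(t))\varphi_k(t)\gamma_j'(t)$, $\boldsymbol\varphi(0)=\mathbf{v}$; $E^x_{\mathbf{B}'}=\{\mathbf{v}\in\mathbb{R}^n:\forall y\in\Omega,\forall\boldsymbol\gamma_1,\boldsymbol\gamma_2\in\Gamma(x,y),\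 R^{\boldsymbol\gamma_1}_{\mathbf{B}'}(\mathbf{v})=R^{\boldsymbol\gamma_2}_{\mathbf{B}'}(\mathbf{v})\}$; its dimension does not depend on $x$, and $\mathbf{B}'$ is called $k'$-conservative if $\dim E^x_{\mathbf{B}'}=k'$. For $\mathbf{B}\in L^p$: $\mathbf{B}$ is at least $k$-conservative if for every $\varepsilon>0$ there exists $\mathbf{B}_\varepsilon\in C^0(\overline\Omega,\mathbb{R}^{n\times d\times n})$ which is $k'$-conservative for some $k'\ge k$ and satisfies $\|\mathbf{B}-\mathbf{B}_\varepsilon\|_{L^p}<\varepsilon$; $\mathbf{B}$ is $k$-conservative if it is at least $k$-conservative and not at least $(k+1)$-conservative. *)

theory Defs
  imports "HOL-Analysis.Analysis"
begin

definition partial :: "'d::finite \<Rightarrow> (real^'d \<Rightarrow> real) \<Rightarrow> real^'d \<Rightarrow> real" where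
  "partial j g x = deriv (\<lambda>t. g (x + t *\<^sub>R axis j 1)) 0"

fun iter_partial :: "'d::finite list \<Rightarrow> (real^'d \<Rightarrow> real) \<Rightarrow> real^'d \<Rightarrow> real" where
  "iter_partial [] f = f"
| "iter_partial (j # js) f = partial j (iter_partial js f)"

definition smooth_on :: "(real^'d::finite) set \<Rightarrow> (real^'d \<Rightarrow> real) \<Rightarrow> bool" where
  "smooth_on S f \<longleftrightarrow>
     (\<forall>js. continuous_on S (iter_partial js f) \<and>
        (\<forall>j. \<forall>x\<in>S. (\<lambda>t. iter_partial js f (x + t *\<^sub>R axis j 1)) differentiable (at 0)))"

definition smooth_boundary :: "(real^'d::finite) set \<Rightarrow> bool" where
  "smooth_boundary \<Omega> \<longleftrightarrow>
     (\<forall>z\<in>frontier \<Omega>. \<exists>r>0. \<exists>\<psi>. smooth_on (ball z r) \<psi> \<and> \<psi> z = 0 \<and>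
        (\<exists>j. partial j \<psi> z \<noteq> 0) \<and>
        \<Omega> \<inter> ball z r = {x\<in>ball z r. \<psi> x < 0})"

definition test_fun :: "(real^'d::finite) set \<Rightarrow> (real^'d \<Rightarrow> real) \<Rightarrow> bool" where
  "test_fun \<Omega> \<phi> \<longleftrightarrow> smooth_on UNIV \<phi> \<and> compact (closure {x. \<phi> x \<noteq> 0}) \<and>
                      closure {x. \<phi> x \<noteq> 0} \<subseteq> \<Omega>"

definition Lp_on :: "real \<Rightarrow> 'a::euclidean_space set \<Rightarrow> ('a \<Rightarrow> 'b::euclidean_space) \<Rightarrow> bool" where
  "Lp_on p \<Omega> f \<longleftrightarrow> f \<in> borel_measurable (lebesgue_on \<Omega>) \<and>
                     integrable (lebesgue_on \<Omega>) (\<lambda>x. norm (f x) powr p)"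

definition Lp_dist :: "real \<Rightarrow> 'a::euclidean_space set \<Rightarrow> ('a \<Rightarrow> 'b::euclidean_space) \<Rightarrow> ('a \<Rightarrow> 'b) \<Rightarrow> real" where
  "Lp_dist p \<Omega> f g = (integral\<^sup>L (lebesgue_on \<Omega>) (\<lambda>x. norm (f x - g x) powr p)) powr (1 / p)"

text \<open>B x \$ i \$ j \$ k is the entry B_ijk (i, k in the n-index, j in the d-index).
  The equation \<nabla>\<mu> + B\<cdot>\<mu> = 0 is tested against C_c^\<infinity>(\<Omega>) functions:
  - \<integral> \<mu>_i \<partial>_j \<phi> + \<integral> (\<Sum>_k B_ijk \<mu>_k) \<phi> = 0.\<close>
definition kernelN :: "(real^'d::finite) set \<Rightarrow> (real^'d \<Rightarrow> real^'n::finite^'d^'n) \<Rightarrow> (real^'d \<Rightarrow> real^'n) set" where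
  "kernelN \<Omega> B = {\<mu>. Lp_on 2 \<Omega> \<mu> \<and>
      (\<forall>\<phi> i j. test_fun \<Omega> \<phi> \<longrightarrow>
         - integral\<^sup>L (lebesgue_on \<Omega>) (\<lambda>x. \<mu> x $ i * partial j \<phi> x)
         + integral\<^sup>L (lebesgue_on \<Omega>) (\<lambda>x. (\<Sum>k\<in>UNIV. B x $ i $ j $ k * \<mu> x $ k) * \<phi> x) = 0)}"

definition ae_lin_indep :: "'a::euclidean_space set \<Rightarrow> ('a \<Rightarrow> 'b::euclidean_space) list \<Rightarrow> bool" where
  "ae_lin_indep \<Omega> fs \<longleftrightarrow>
     (\<forall>c::nat \<Rightarrow> real. (AE x in lebesgue_on \<Omega>. (\<Sum>l<length fs. c l *\<^sub>R (fs ! l) x) = 0)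
        \<longrightarrow> (\<forall>l<length fs. c l = 0))"

definition ae_dim_eq :: "'a::euclidean_space set \<Rightarrow> ('a \<Rightarrow> 'b::euclidean_space) set \<Rightarrow> nat \<Rightarrow> bool" where
  "ae_dim_eq \<Omega> N k \<longleftrightarrow>
     (\<exists>fs. length fs = k \<and> set fs \<subseteq> N \<and> ae_lin_indep \<Omega> fs) \<and>
     \<not> (\<exists>fs. length fs = Suc k \<and> set fs \<subseteq> N \<and> ae_lin_indep \<Omega> fs)"

definition C1_paths :: "(real^'d::finite) set \<Rightarrow> real^'d \<Rightarrow> real^'d \<Rightarrow> (real \<Rightarrow> real^'d) set" where
  "C1_paths \<Omega> x y = {\<gamma>. \<gamma> 0 = x \<and> \<gamma> 1 = y \<and> \<gamma> ` {0..1} \<subseteq> \<Omega> \<and>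
      (\<exists>D. (\<forall>t\<in>{0..1}. (\<gamma> has_vector_derivative D t) (at t within {0..1})) \<and> continuous_on {0..1} D)}"

definition transport_sol :: "(real^'d::finite \<Rightarrow> real^'n::finite^'d^'n) \<Rightarrow> (real \<Rightarrow> real^'d) \<Rightarrow> real^'n \<Rightarrow> (real \<Rightarrow> real^'n) \<Rightarrow> bool" where
  "transport_sol B' \<gamma> v \<phi> \<longleftrightarrow> \<phi> 0 = v \<and>
     (\<forall>t\<in>{0..1}. (\<phi> has_vector_derivative
        (\<chi> i. - (\<Sum>j\<in>UNIV. \<Sum>k\<in>UNIV. B' (\<gamma> t) $ i $ j $ k * \<phi> t $ k *
                   vector_derivative \<gamma> (at t within {0..1}) $ j))) (at t within {0..1}))"

definition transport :: "(real^'d::finite \<Rightarrow> real^'n::finite^'d^'n) \<Rightarrow> (real \<Rightarrow> real^'d) \<Rightarrow> real^'n \<Rightarrow> real^'n" where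
  "transport B' \<gamma> v = (THE w. \<exists>\<phi>. transport_sol B' \<gamma> v \<phi> \<and> \<phi> 1 = w)"

definition Econs :: "(real^'d::finite) set \<Rightarrow> (real^'d \<Rightarrow> real^'n::finite^'d^'n) \<Rightarrow> real^'d \<Rightarrow> (real^'n) set" where
  "Econs \<Omega> B' x = {v. \<forall>y\<in>\<Omega>. \<forall>\<gamma>1\<in>C1_paths \<Omega> x y. \<forall>\<gamma>2\<in>C1_paths \<Omega> x y.
                        transport B' \<gamma>1 v = transport B' \<gamma>2 v}"

definition k_conservative_cont :: "(real^'d::finite) set \<Rightarrow> (real^'d \<Rightarrow> real^'n::finite^'d^'n) \<Rightarrow> nat \<Rightarrow> bool" where
  "k_conservative_cont \<Omega> B' k \<longleftrightarrow> (\<forall>x\<in>\<Omega>. dim (Econs \<Omega> B' x) = k)"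

definition at_least_conservative :: "real \<Rightarrow> (real^'d::finite) set \<Rightarrow> (real^'d \<Rightarrow> real^'n::finite^'d^'n) \<Rightarrow> nat \<Rightarrow> bool" where
  "at_least_conservative p \<Omega> B k \<longleftrightarrow>
     (\<forall>\<epsilon>>0. \<exists>B\<epsilon>. continuous_on (closure \<Omega>) B\<epsilon> \<and>
        (\<exists>k'\<ge>k. k_conservative_cont \<Omega> B\<epsilon> k') \<and> Lp_dist p \<Omega> B B\<epsilon> < \<epsilon>)"

definition Lp_conservative :: "real \<Rightarrow> (real^'d::finite) set \<Rightarrow> (real^'d \<Rightarrow> real^'n::finite^'d^'n) \<Rightarrow> nat \<Rightarrow> bool" where
  "Lp_conservative p \<Omega> B k \<longleftrightarrow>
     at_least_conservative p \<Omega> B k \<and> \<not> at_least_conservative p \<Omega> B (Suc k)"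

end

theory Submission
 imports Defs "HOL-Computational_Algebra.Polynomial"
begin

text \<open>
 Both directions rest on the potential estimate for W^{1,p} functions with p > d applied to
 |grad u| \<le> |B| |u|. A kernel element is therefore locally bounded and continuous, vanishes
 identically once it vanishes at a point, and so k independent kernel elements are linearly
 independent at every single point. For continuous B the parallel sections are exactly the C^1
 solutions of the equation, and the dimension of E^x is the dimension of their values at x.

 If B is approximated in L^p by fields with k orthonormal solutions at a base point, the estimate,
 made global by chains of interior cones, bounds these solutions and shows that they converge uniformly, to
 k independent kernel elements.

 Conversely, let M_l be mollifications of k independent kernel elements and w_l a dual family. On a
 compact subset of the domain, adding to a continuous approximation b of B the terms
 (- grad M_l - b M_l) \<otimes> w_l, which are small in L^p, makes every M_l an exact solution. Pulling everything back by a map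
 x + t (V x + a), with V pointing into the domain, yields a field that is continuous on the closure.
 Such a map need not be volume preserving, so a is chosen by averaging over a small ball in order
 to control the L^p norm of the composition.
\<close>

text \<open>A kernel element is only in L^2 and B only in L^p, so no sup norm is available for
  absorption at the start. Local boundedness comes from duality instead: the kernel of
  \<open>pot\<close> is symmetric, and the excess of |u| over a constant, integrated against |B|, is
  at most half of itself. Afterwards sup norms can be absorbed: at scale h the potential of |B| is a
  small fraction of the volume, because p > d leaves a factor h^(1 - d/p). Where Hoelder's
  inequality would be natural, the splitting t \<le> c + c^(1-p) t^p is used with c tuned to the
  situation. Two demands of uniformity shape the rest. When fields converge, the constant comparing
  |u(x)| with |u(x0)| must hold up to the boundary; cones of fixed shape and a finite cover give
  this. In the converse, the bound on the dual family must be fixed before the mollification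
  parameter, so it is derived from a quantitative form of independence alone. The equivalence is
  proved for every number m of independent elements and used at k and k + 1.\<close>

abbreviation borel_fun :: "('a::topological_space => 'b::topological_space) set" where
 "borel_fun \<equiv> borel_measurable borel"

abbreviation NN_lborel (binder "NN " 10) where
 "NN_lborel f \<equiv> nn_integral lborel f"

abbreviation INT_lborel (binder "INT " 10) where
 "INT_lborel f \<equiv> integral\<^sup>L lborel f"

notation scaleR (infixr "*R" 75)

abbreviation limit_seq (infixr "~~>" 60) where
 "X ~~> L \<equiv> (X \<longlonglongrightarrow> L)"

section \<open>Total derivatives from continuous partial derivatives\<close>

lemma has_real_derivative_line_shift:
 fixes f :: "'a::real_vector => real"
 assumes "((%s. f ((y + t *R e) + s *R e)) has_real_derivative D) (at 0)"
 shows "((%s. f (y + s *R e)) has_real_derivative D) (at t)"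
proof -
 define F where "F = (%s. f ((y + t *R e) + s *R e))"
 have "(F has_real_derivative D) (at (t - t))" using assms by (simp add: F_def)
 then have "((%s. F (s - t)) has_real_derivative D * 1) (at t)"
  by (rule DERIV_chain2) (auto intro!: derivative_eq_intros)
 moreover have "F (s - t) = f (y + s *R e)" for s
  unfolding F_def by (rule arg_cong[of _ _ f]) (simp add: algebra_simps)
 ultimately show ?thesis by simp
qed

text \<open>\<open>smooth_on\<close> speaks only of derivatives along the axes. The total derivative
  comes from changing one coordinate at a time: \<open>key\<close> inducts on a set A containing the
  nonzero coordinates of the increment h, and each step is a mean value estimate in a single
  coordinate.\<close>

lemma has_derivative_from_partials:
 fixes f :: "real^'d::finite => real"
 assumes S: "open S" "x \<in> S"
  and D: "\<And>j y. y \<in> S ==> ((%t. f (y + t *R axis j 1)) has_real_derivative D j y) (at 0)"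
  and cont: "\<And>j. continuous_on S (D j)"
 shows "(f has_derivative (%h. \<Sum>j\<in>UNIV. h $ j * D j x)) (at x)"
 unfolding has_derivative_at_alt
proof (intro conjI allI impI)
 show "bounded_linear (%h. \<Sum>j\<in>UNIV. h $ j * D j x)"
  by (intro bounded_linear_sum bounded_linear_mult_left[THEN bounded_linear_compose] bounded_linear_vec_nth)
next
 fix e :: real assume "e > 0"
 define N where "N = real CARD('d)"
 have N: "N > 0" by (simp add: N_def)
 define e' where "e' = e / N"
 have e': "e' > 0" using \<open>e > 0\<close> N by (simp add: e'_def)
 have "\<exists>r>0. \<forall>y\<in>S. dist y x < r --> dist (D j y) (D j x) < e'" for j
  using cont[of j] S(2) e' unfolding continuous_on_iff by blast
 then obtain r where r: "\<And>j. r j > 0" "\<And>j y. y \<in> S ==> dist y x < r j ==> dist (D j y) (D j x) < e'"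
  by metis
 obtain r0 where r0: "r0 > 0" "ball x r0 \<subseteq> S" using S openE by blast
 define dt where "dt = Min (insert r0 (range r))"
 have d: "dt > 0" "dt \<le> r0" using r0 r by (auto simp: dt_def)
 have d3: "dt \<le> r j" for j unfolding dt_def by (intro Min_le) auto
 have near: "y \<in> S \<and> \<bar>D j y - D j x\<bar> < e'" if "dist y x < dt" for y j
 proof -
  have "y \<in> ball x r0" using that d by (auto simp: dist_commute)
  then show ?thesis using r(2)[of y j] r0 that d3[of j] by (auto simp: dist_real_def)
 qed
 have key: "\<bar>f (x + h) - f x - (\<Sum>j\<in>A. h $ j * D j x)\<bar> \<le> e' * (\<Sum>j\<in>A. \<bar>h $ j\<bar>)"
  if "finite A" "\<And>j. j \<notin> A ==> h $ j = 0" "norm h < dt" for A h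
  using that
 proof (induction A arbitrary: h rule: finite_induct)
  case empty
  then have "h = 0" by (simp add: vec_eq_iff)
  then show ?case by simp
 next
  case (insert a A)
  define h' where "h' = (\<chi> j. if j = a then 0 else h $ j)"
  have hh': "h = h' + (h $ a) *R axis a 1"
   by (simp add: h'_def vec_eq_iff axis_def)
  have "norm h' \<le> norm h" by (rule norm_le_componentwise_cart) (simp add: h'_def)
  then have IH: "\<bar>f (x + h') - f x - (\<Sum>j\<in>A. h' $ j * D j x)\<bar> \<le> e' * (\<Sum>j\<in>A. \<bar>h' $ j\<bar>)"
   using insert.prems insert.hyps by (intro insert.IH) (auto simp: h'_def)
  have eqA: "(\<Sum>j\<in>A. h' $ j * D j x) = (\<Sum>j\<in>A. h $ j * D j x)" "(\<Sum>j\<in>A. \<bar>h' $ j\<bar>) = (\<Sum>j\<in>A. \<bar>h $ j\<bar>)"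
   using insert.hyps by (auto intro!: sum.cong simp: h'_def)
  \<comment> \<open>Subtracting the expected linear term leaves a function whose derivative is at
    most \<open>e'\<close>, so the mean value inequality bounds exactly the error added by the
    coordinate a.\<close>
  define g where "g = (%t. f (x + h' + t *R axis a 1) - t * D a x)"
  have pt: "dist (x + h' + t *R axis a 1) x < dt" if "t \<in> closed_segment 0 (h $ a)" for t
  proof -
   have "\<bar>t\<bar> \<le> \<bar>h $ a\<bar>" using that by (auto simp: closed_segment_eq_real_ivl split: if_splits)
   then have "norm (h' + t *R axis a 1) \<le> norm h"
    by (intro norm_le_componentwise_cart) (auto simp: h'_def axis_def)
   then show ?thesis using insert.prems by (simp add: dist_norm add.assoc)
  qed
  have "norm (g (h $ a) - g 0) \<le> e' * norm (h $ a - 0)"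
  proof (rule field_differentiable_bound[where S="closed_segment 0 (h $ a)"])
   fix t assume t: "t \<in> closed_segment 0 (h $ a)"
   have "((%s. f ((x + h' + t *R axis a 1) + s *R axis a 1)) has_real_derivative D a (x + h' + t *R axis a 1)) (at 0)"
    using near[OF pt[OF t]] D by blast
   then have "((%s. f (x + h' + s *R axis a 1)) has_real_derivative D a (x + h' + t *R axis a 1)) (at t)"
    by (rule has_real_derivative_line_shift)
   then show "(g has_field_derivative (D a (x + h' + t *R axis a 1) - D a x)) (at t within closed_segment 0 (h $ a))"
    unfolding g_def
    by (intro has_field_derivative_at_within[OF DERIV_diff] DERIV_cmult_right[OF DERIV_ident, THEN DERIV_cong])
     simp_all
   show "norm (D a (x + h' + t *R axis a 1) - D a x) \<le> e'"
    using near[OF pt[OF t]] by (simp add: less_imp_le)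
  qed auto
  moreover have "g (h $ a) - g 0 = f (x + h) - f (x + h') - h $ a * D a x"
  proof -
   have "f (x + h' + (h $ a) *R axis a 1) = f (x + h)" using hh' by (metis add.assoc)
   then show ?thesis unfolding g_def by simp
  qed
  ultimately show ?case
   using IH insert.hyps by (simp add: eqA distrib_left)
 qed
 show "\<exists>d>0. \<forall>y. norm (y - x) < d -->
   norm (f y - f x - (\<Sum>j\<in>UNIV. (y - x) $ j * D j x)) \<le> e * norm (y - x)"
 proof (intro exI[of _ dt] conjI allI impI d(1))
  fix y assume "norm (y - x) < dt"
  from key[of UNIV "y - x"] this
  have "norm (f y - f x - (\<Sum>j\<in>UNIV. (y - x) $ j * D j x)) \<le> e' * (\<Sum>j\<in>UNIV. \<bar>(y - x) $ j\<bar>)"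
   by simp
  also have "... \<le> e' * (\<Sum>j\<in>(UNIV::'d set). norm (y - x))"
   using e' by (intro mult_left_mono sum_mono component_le_norm_cart) auto
  also have "... = e * norm (y - x)" using N by (simp add: e'_def N_def)
  finally show "norm (f y - f x - (\<Sum>j\<in>UNIV. (y - x) $ j * D j x)) \<le> e * norm (y - x)" .
 qed
qed

lemma has_derivative_from_partials_vec:
 fixes f :: "real^'d::finite => real^'n::finite"
 assumes S: "open S" "x \<in> S"
  and D: "\<And>i j y. y \<in> S ==> ((%t. f (y + t *R axis j 1) $ i) has_real_derivative D i j y) (at 0)"
  and cont: "\<And>i j. continuous_on S (D i j)"
 shows "(f has_derivative (%h. \<chi> i. \<Sum>j\<in>UNIV. h $ j * D i j x)) (at x)"
proof -
 have "((%x. f x $ i) has_derivative (%h. \<Sum>j\<in>UNIV. h $ j * D i j x)) (at x)" for i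
  by (rule has_derivative_from_partials[OF S]) (use D cont in auto)
 then show ?thesis
  by (subst has_derivative_componentwise_within)
   (auto simp: Basis_vec_def cart_eq_inner_axis[symmetric])
qed

section \<open>Mollifiers\<close>

text \<open>This family is closed under differentiation: with s = 1/t, the derivative replaces P by
  s^2 (P - P'). One differentiation rule therefore yields all derivatives of e^(-1/t).\<close>

definition flat :: "real poly => real => real" where
 "flat P t = (if t > 0 then poly P (1 / t) * exp (- 1 / t) else 0)"

lemma poly_times_exp_neg_tendsto_0: "((%s. poly P s * exp (- s)) \<longlongrightarrow> (0::real)) at_top"
proof -
 have "((%s. \<Sum>i\<le>degree P. coeff P i * (s ^ i / exp s)) \<longlongrightarrow> (\<Sum>i\<le>degree P. coeff P i * 0)) at_top"
  by (intro tendsto_intros tendsto_power_div_exp_0)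
 then show ?thesis
  by (simp add: poly_altdef sum_distrib_right exp_minus divide_inverse mult.assoc)
qed

lemma flat_has_derivative:
 "(flat P has_real_derivative flat (monom 1 2 * (P - pderiv P)) t) (at t)"
proof (cases "t = 0")
 case False
 show ?thesis
 proof (cases "t > 0")
  case True
  have "((%t. poly P (1 / t) * exp (- 1 / t)) has_real_derivative flat (monom 1 2 * (P - pderiv P)) t) (at t)"
   using True
   by (auto simp: flat_def poly_monom power2_eq_square divide_simps algebra_simps
       intro!: derivative_eq_intros DERIV_chain2[OF poly_DERIV])
  then show ?thesis
   by (rule DERIV_cong_ev[OF refl _ refl, THEN iffD1, rotated])
    (use True in \<open>auto simp: flat_def eventually_nhds intro!: exI[of _ "{0<..}"]\<close>)
 next
  case neg: False
  then have "t < 0" using False by auto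
  have "((%t. 0) has_real_derivative flat (monom 1 2 * (P - pderiv P)) t) (at t)"
   using neg by (simp add: flat_def)
  then show ?thesis
   by (rule DERIV_cong_ev[OF refl _ refl, THEN iffD1, rotated])
    (use \<open>t < 0\<close> in \<open>auto simp: flat_def eventually_nhds intro!: exI[of _ "{..<0}"]\<close>)
 qed
next
 case True
 \<comment> \<open>At 0 the difference quotient is \<open>flat P h / h\<close>; from the right it
   equals s P(s) e^(-s) with s = 1/h, which vanishes as s tends to infinity.\<close>
 have "((%h. flat P h / h) \<longlongrightarrow> 0) (at 0)"
 proof (rule filterlim_split_at)
  show "((%h. flat P h / h) \<longlongrightarrow> 0) (at_left 0)"
   by (rule tendsto_eventually) (auto simp: flat_def eventually_at_left_field intro!: exI[of _ "-1"])
  have "((%h. poly (pCons 0 P) (inverse h) * exp (- (inverse h))) \<longlongrightarrow> 0) (at_right 0)"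
   by (rule filterlim_compose[OF poly_times_exp_neg_tendsto_0 filterlim_inverse_at_top_right])
  then show "((%h. flat P h / h) \<longlongrightarrow> 0) (at_right 0)"
   by (rule Lim_transform_eventually)
    (auto simp: flat_def eventually_at_right_field divide_inverse intro!: exI[of _ 1])
 qed
 then show ?thesis
  using True by (simp add: has_field_derivative_iff flat_def)
qed

text \<open>Smoothness is carried by a sequence in which each function is the derivative of the
  preceding one. A product must come with such a sequence too, and the binomial sums provide it; the
  step from n to n + 1 is Pascal's rule.\<close>

lemma Leibniz_derivative:
 fixes F G :: "nat => real => real"
 assumes F: "\<And>n t. (F n has_real_derivative F (Suc n) t) (at t)"
  and G: "\<And>n t. (G n has_real_derivative G (Suc n) t) (at t)"
 shows "((%t. \<Sum>i\<le>n. real (n choose i) * F i t * G (n - i) t) has_real_derivative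
     (\<Sum>i\<le>Suc n. real (Suc n choose i) * F i t * G (Suc n - i) t)) (at t)"
proof -
 have 1: "(\<Sum>i\<le>Suc n. real (Suc n choose i) * F i t * G (Suc n - i) t) =
   F 0 t * G (Suc n) t + (\<Sum>i\<le>n. real (n choose i) * F (Suc i) t * G (n - i) t)
    + (\<Sum>i\<le>n. real (n choose Suc i) * F (Suc i) t * G (n - i) t)"
  by (subst sum.atMost_Suc_shift) (simp add: sum.distrib[symmetric] algebra_simps)
 have 2: "(\<Sum>i\<le>Suc n. real (n choose i) * F i t * G (Suc n - i) t) =
   F 0 t * G (Suc n) t + (\<Sum>i\<le>n. real (n choose Suc i) * F (Suc i) t * G (n - i) t)"
  by (subst sum.atMost_Suc_shift) simp
 have 3: "(\<Sum>i\<le>Suc n. real (n choose i) * F i t * G (Suc n - i) t) =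
   (\<Sum>i\<le>n. real (n choose i) * F i t * G (Suc (n - i)) t)"
  by (simp add: Suc_diff_le)
 have eq: "(\<Sum>i\<le>Suc n. real (Suc n choose i) * F i t * G (Suc n - i) t) =
   (\<Sum>i\<le>n. real (n choose i) * (F (Suc i) t * G (n - i) t + F i t * G (Suc (n - i)) t))"
  using 1 2 3 by (simp only: sum.distrib distrib_left mult.assoc)
 show ?thesis
  unfolding eq
  by (auto intro!: derivative_eq_intros F G DERIV_sum simp: algebra_simps)
qed

lemma smooth_bump_1d:
 assumes "a > 0"
 obtains H :: "nat => real => real" where
  "\<And>n t. (H n has_real_derivative H (Suc n) t) (at t)"
  "\<And>n t. \<bar>t\<bar> \<ge> a ==> H n t = 0" "\<And>t. \<bar>t\<bar> < a ==> H 0 t > 0"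
proof -
 define P where "P = rec_nat (1 :: real poly) (%_ P. monom 1 2 * (P - pderiv P))"
 have P0: "P 0 = 1" and PS: "P (Suc n) = monom 1 2 * (P n - pderiv (P n))" for n
  by (auto simp: P_def)
 \<comment> \<open>The product of the two functions of order 0 is positive exactly on (-a, a). The
   sign in G absorbs the inner derivative of a - t.\<close>
 define F where "F = (%n t. flat (P n) (a + t))"
 define G where "G = (%n t. (-1) ^ n * flat (P n) (a - t))"
 have F: "(F n has_real_derivative F (Suc n) t) (at t)" for n t
  unfolding F_def PS
  by (rule DERIV_cong[OF DERIV_chain2[OF flat_has_derivative]]) (auto intro!: derivative_eq_intros)
 have G: "(G n has_real_derivative G (Suc n) t) (at t)" for n t
  unfolding G_def PS
  by (rule DERIV_cong[OF DERIV_cmult[OF DERIV_chain2[OF flat_has_derivative]]])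
   (auto intro!: derivative_eq_intros)
 show ?thesis
 proof (rule that[of "%n t. \<Sum>i\<le>n. real (n choose i) * F i t * G (n - i) t"])
  show "((%t. \<Sum>i\<le>n. real (n choose i) * F i t * G (n - i) t) has_real_derivative
     (\<Sum>i\<le>Suc n. real (Suc n choose i) * F i t * G (Suc n - i) t)) (at t)" for n t
   using Leibniz_derivative[of F G n t] F G by blast
  show "(\<Sum>i\<le>n. real (n choose i) * F i t * G (n - i) t) = 0" if "\<bar>t\<bar> \<ge> a" for n t
   using that by (intro sum.neutral) (auto simp: F_def G_def flat_def abs_if split: if_splits)
  show "(\<Sum>i\<le>0. real (0 choose i) * F i t * G (0 - i) t) > 0" if "\<bar>t\<bar> < a" for t
   using that by (auto simp: F_def G_def flat_def P0)
 qed
qed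

lemma smooth_on_product:
 fixes F :: "'d::finite => nat => real => real"
 assumes F: "\<And>j n t. (F j n has_real_derivative F j (Suc n) t) (at t)"
 shows "smooth_on UNIV (%x::real^'d. c * (\<Prod>j\<in>UNIV. F j 0 (x $ j)))"
  and "((%t. c * (\<Prod>j\<in>UNIV. F j 0 ((x + t *R axis i 1) $ j))) has_real_derivative
     c * (\<Prod>j\<in>UNIV. F j (if j = i then 1 else 0) (x $ j))) (at 0)"
  and "continuous_on UNIV (%x::real^'d. c * (\<Prod>j\<in>UNIV. F j (m j) (x $ j)))"
proof -
 have der: "((%t. c * (\<Prod>j\<in>UNIV. F j (m j) ((x + t *R axis i 1) $ j))) has_real_derivative
     c * (\<Prod>j\<in>UNIV. F j (m j + (if j = i then 1 else 0)) (x $ j))) (at 0)" for m x i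
 proof -
  have *: "(\<Prod>j\<in>UNIV. g j) = g i * (\<Prod>j\<in>UNIV - {i}. g j)" for g :: "'d => real"
   by (rule prod.remove) auto
  have "((%t. F i (m i) (x $ i + t)) has_real_derivative F i (Suc (m i)) (x $ i)) (at 0)"
   using DERIV_shift[of "F i (m i)" _ 0 "x $ i"] F[of i "m i" "x $ i"] by (simp add: add.commute)
  moreover define Q where "Q = (\<Prod>j\<in>UNIV - {i}. F j (m j) (x $ j))"
  moreover have "(\<Prod>j\<in>UNIV - {i}. F j (m j) ((x + t *R axis i 1) $ j)) = Q" for t
   unfolding Q_def by (intro prod.cong) (auto simp: axis_def)
  moreover have "(\<Prod>j\<in>UNIV - {i}. F j (m j + (if j = i then 1 else 0)) (x $ j)) = Q"
   unfolding Q_def by (intro prod.cong) auto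
  ultimately show ?thesis
   by (subst (1 2) *) (auto intro!: derivative_eq_intros simp: axis_def)
 qed
 show cont: "continuous_on UNIV (%x::real^'d. c * (\<Prod>j\<in>UNIV. F j (m j) (x $ j)))" for m
 proof -
  have "continuous_on UNIV (F j n)" for j n
   using F DERIV_isCont continuous_at_imp_continuous_on by blast
  then show ?thesis
   by (intro continuous_intros continuous_on_compose2[where g="F _ _" and f="%x. x $ _"]) auto
 qed
 \<comment> \<open>A partial derivative in direction i only raises the order of the i-th factor, so
   a list of directions matters only through its multiplicities.\<close>
 have it: "iter_partial js (%x::real^'d. c * (\<Prod>j\<in>UNIV. F j 0 (x $ j))) =
   (%x. c * (\<Prod>j\<in>UNIV. F j (count_list js j) (x $ j)))" for js
 proof (induction js)
  case (Cons i js)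
  show ?case
  proof
   fix x
   have "count_list (i # js) j = count_list js j + (if j = i then 1 else 0)" for j by simp
   then show "iter_partial (i # js) (%x::real^'d. c * (\<Prod>j\<in>UNIV. F j 0 (x $ j))) x =
    c * (\<Prod>j\<in>UNIV. F j (count_list (i # js) j) (x $ j))"
    using DERIV_imp_deriv[OF der[of "count_list js" x i]] by (simp add: Cons.IH partial_def)
  qed
 qed simp
 show "smooth_on UNIV (%x::real^'d. c * (\<Prod>j\<in>UNIV. F j 0 (x $ j)))"
  unfolding smooth_on_def it
  using cont der unfolding real_differentiable_def by blast
 show "((%t. c * (\<Prod>j\<in>UNIV. F j 0 ((x + t *R axis i 1) $ j))) has_real_derivative
     c * (\<Prod>j\<in>UNIV. F j (if j = i then 1 else 0) (x $ j))) (at 0)"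
  using der[of "%_. 0" x i] by simp
qed

text \<open>The gradient is carried along as D because derivatives of convolutions are written with
  it. Smoothness is asked of the reflected kernel y -> rh (x - y), the form in which it serves as a
  test function.\<close>

definition mollifier :: "real => (real^'d::finite => real) => ('d => real^'d => real) => bool" where
 "mollifier dt rh D \<longleftrightarrow> continuous_on UNIV rh \<and> (\<forall>x. rh x \<ge> 0) \<and> (\<forall>x. norm x \<ge> dt --> rh x = 0) \<and>
  integrable lborel rh \<and> integral\<^sup>L lborel rh = 1 \<and>
  (\<forall>j. continuous_on UNIV (D j) \<and> (\<forall>x. norm x \<ge> dt --> D j x = 0) \<and>
   (\<forall>x. ((%t. rh (x + t *R axis j 1)) has_real_derivative D j x) (at 0))) \<and>
  (\<forall>x. smooth_on UNIV (%y. rh (x - y)))"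

lemma mollifier_exists:
 assumes "dt > 0"
 shows "\<exists>rh D. mollifier dt (rh :: real^'d::finite => real) D"
proof -
 \<comment> \<open>If all coordinates are below a in absolute value, the l1 norm is below
   \<open>dt\<close>; hence the product of one-dimensional bumps vanishes outside the ball of radius
   \<open>dt\<close>.\<close>
 define a where "a = dt / CARD('d)"
 have a: "a > 0" using assms by (simp add: a_def)
 obtain H where H: "\<And>n t. (H n has_real_derivative H (Suc n) t) (at t)"
  "\<And>n t. \<bar>t\<bar> \<ge> a ==> H n t = 0" "\<And>t. \<bar>t\<bar> < a ==> H 0 t > 0"
  using smooth_bump_1d[OF a] by metis
 define et where "et = (%m (x::real^'d). \<Prod>j\<in>UNIV. H (m j) (x $ j))"
 have supp: "et m x = 0" if "norm x \<ge> dt" for m x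
 proof -
  have "\<exists>j. \<bar>x $ j\<bar> \<ge> a"
  proof (rule ccontr)
   assume "\<not> ?thesis"
   then have "(\<Sum>j\<in>UNIV. \<bar>x $ j\<bar>) < (\<Sum>j\<in>(UNIV::'d set). a)"
    by (intro sum_strict_mono) (auto simp: not_le)
   with norm_le_l1_cart[of x] that show False by (simp add: a_def)
  qed
  then show ?thesis using H(2) by (auto simp: et_def intro!: prod_zero)
 qed
 have cont: "continuous_on UNIV (et m)" for m
  using smooth_on_product(3)[of "%_. H" 1 m] H(1) by (simp add: et_def)
 have nn: "et (%_. 0) x \<ge> 0" for x
  unfolding et_def using H(2,3) by (intro prod_nonneg) (metis less_eq_real_def not_le)
 define rh0 where "rh0 = et (%_. 0)"
 have int: "integrable lborel rh0"
 proof -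
  have "integrable lborel (%x. indicator (cball 0 dt) x *R rh0 x)"
   by (rule borel_integrable_compact) (auto simp: rh0_def intro: continuous_on_subset[OF cont])
  moreover have "(%x. indicator (cball 0 dt) x *R rh0 x) = rh0"
   using supp by (auto simp: rh0_def fun_eq_iff indicator_def)
  ultimately show ?thesis by simp
 qed
 have "integral\<^sup>L lborel rh0 \<noteq> 0"
 proof
  assume "integral\<^sup>L lborel rh0 = 0"
  then have "AE x in lborel. rh0 x = 0"
   using integral_nonneg_eq_0_iff_AE[OF int] nn by (simp add: rh0_def)
  then have "emeasure lborel {x. rh0 x \<noteq> 0} = 0"
   using int by (subst (asm) AE_iff_measurable[OF _ refl]) auto
  moreover have "open {x. rh0 x \<noteq> 0}"
   unfolding rh0_def by (intro open_Collect_neq cont continuous_on_const)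
  ultimately have "{x. rh0 x \<noteq> 0} = {}"
   using open_not_negligible negligible_iff_null_sets null_sets_completionI
   by (metis (no_types, lifting) borel_open null_setsI sets_lborel)
  moreover have "rh0 0 > 0" using a H(3) by (auto simp: rh0_def et_def intro!: prod_pos)
  ultimately show False by auto
 qed
 then have I: "integral\<^sup>L lborel rh0 > 0"
  using nn Bochner_Integration.integral_nonneg[of lborel rh0] by (metis rh0_def order_le_less)
 define c where "c = 1 / integral\<^sup>L lborel rh0"
 have c: "c > 0" "c * integral\<^sup>L lborel rh0 = 1" using I by (auto simp: c_def)
 define D where "D = (%i x. c * et (%j. if j = i then 1 else 0) x)"
 have "mollifier dt (%x. c * rh0 x) D"
  unfolding mollifier_def
 proof (intro conjI allI impI)
  show "continuous_on UNIV (%x. c * rh0 x)" by (auto simp: rh0_def intro!: continuous_intros cont)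
  show "0 \<le> c * rh0 x" for x using c nn by (simp add: rh0_def)
  show "c * rh0 x = 0" if "norm x \<ge> dt" for x using supp[OF that] by (simp add: rh0_def)
  show "integrable lborel (%x. c * rh0 x)" using int by simp
  show "(LINT x|lborel. c * rh0 x) = 1" using c by simp
  show "continuous_on UNIV (D j)" for j unfolding D_def by (intro continuous_intros cont)
  show "D j x = 0" if "norm x \<ge> dt" for j x using supp[OF that] by (simp add: D_def)
  show "((%t. c * rh0 (x + t *R axis j 1)) has_real_derivative D j x) (at 0)" for j x
   using smooth_on_product(2)[of "%_. H" c x j] H(1) by (simp add: rh0_def et_def D_def if_distrib if_distribR cong: if_cong)
  show "smooth_on UNIV (%y. c * rh0 (x - y))" for x
  proof -
   define F where "F = (%j n t. (-1) ^ n * H n (x $ j - t))"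
   have "(F j n has_real_derivative F j (Suc n) t) (at t)" for j n t
    unfolding F_def
    by (rule DERIV_cong[OF DERIV_cmult[OF DERIV_chain2[OF H(1)]]]) (auto intro!: derivative_eq_intros)
   from smooth_on_product(1)[of F c, OF this] show ?thesis
    by (simp add: rh0_def et_def F_def)
  qed
 qed
 then show ?thesis by blast
qed

section \<open>Integrals of p-th powers estimates and mollification\<close>

text \<open>The p-th power of the L^p norm with values in \<open>ennreal\<close>: limits and Tonelli
  need no integrability side conditions, and finiteness is stated where it matters. Leaving out the
  root costs only constants 2^p in place of Minkowski's inequality.\<close>

definition pint :: "real => ('a::euclidean_space => 'b::real_normed_vector) => ennreal" where
 "pint p f = (NN x. ennreal (norm (f x) powr p))"

lemma powr_sum_le:
 assumes "a \<ge> 0" "b \<ge> 0" "p > 0"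
 shows "(a + b) powr p \<le> 2 powr p * (a powr p + b powr p :: real)"
proof -
 have "(a + b) powr p \<le> (2 * max a b) powr p" using assms by (intro powr_mono2) auto
 also have "... = 2 powr p * (max a b) powr p" using assms by (simp add: powr_mult)
 also have "... \<le> 2 powr p * (a powr p + b powr p)" by (intro mult_left_mono) (auto simp: max_def)
 finally show ?thesis .
qed

lemma pint_add_le:
 fixes f g :: "'a::euclidean_space => 'b::euclidean_space"
 assumes [measurable]: "f \<in> borel_fun" "g \<in> borel_fun" and p: "p > 0"
  and h: "\<And>x. norm (h x) \<le> norm (f x) + norm (g x)"
 shows "pint p h \<le> ennreal (2 powr p) * (pint p f + pint p g)"
proof -
 have "pint p h \<le> (NN x. ennreal (2 powr p) * (ennreal (norm (f x) powr p) + ennreal (norm (g x) powr p)))"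
  unfolding pint_def
 proof (rule nn_integral_mono)
  fix x
  have "norm (h x) powr p \<le> (norm (f x) + norm (g x)) powr p"
   using p h by (intro powr_mono2) auto
  also have "... \<le> 2 powr p * (norm (f x) powr p + norm (g x) powr p)"
   using p by (intro powr_sum_le) auto
  finally show "ennreal (norm (h x) powr p) \<le>
    ennreal (2 powr p) * (ennreal (norm (f x) powr p) + ennreal (norm (g x) powr p))"
   by (simp add: ennreal_mult' [symmetric] ennreal_plus[symmetric] ennreal_leI del: ennreal_plus)
 qed
 also have "... = ennreal (2 powr p) * (pint p f + pint p g)"
  by (simp add: nn_integral_cmult nn_integral_add pint_def)
 finally show ?thesis .
qed

lemma pint_mono:
 assumes "\<And>x. norm (f x) \<le> norm (g x)" "p > 0"
 shows "pint p f \<le> pint p g"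
 unfolding pint_def using assms by (intro nn_integral_mono ennreal_leI powr_mono2) auto

lemma pint_scale_le:
 fixes g :: "'a::euclidean_space => 'b::euclidean_space"
 assumes [measurable]: "g \<in> borel_fun" and "\<And>x. norm (f x) \<le> c * norm (g x)" "p > 0" "c \<ge> 0"
 shows "pint p f \<le> ennreal (c powr p) * pint p g"
proof -
 have "pint p f \<le> (NN x. ennreal (c powr p) * ennreal (norm (g x) powr p))"
  unfolding pint_def
 proof (rule nn_integral_mono)
  fix x
  have "norm (f x) powr p \<le> (c * norm (g x)) powr p" using assms by (intro powr_mono2) auto
  then show "ennreal (norm (f x) powr p) \<le> ennreal (c powr p) * ennreal (norm (g x) powr p)"
   using assms by (simp add: powr_mult ennreal_mult'[symmetric] ennreal_leI)
 qed
 also have "... = ennreal (c powr p) * pint p g" by (simp add: nn_integral_cmult pint_def)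
 finally show ?thesis .
qed

lemma pint_bounded_le:
 assumes "\<And>x. norm (f x) \<le> c" "\<And>x. x \<notin> S ==> f x = 0" "S \<in> sets borel" "p > 0" "c \<ge> 0"
 shows "pint p f \<le> ennreal (c powr p) * emeasure lborel S"
proof -
 have "pint p f \<le> (NN x. ennreal (c powr p) * indicator S x)"
  unfolding pint_def
  by (intro nn_integral_mono) (use assms in \<open>auto simp: indicator_def intro!: ennreal_leI powr_mono2\<close>)
 also have "... = ennreal (c powr p) * emeasure lborel S"
  using assms by (simp add: nn_integral_cmult_indicator)
 finally show ?thesis .
qed

lemma emeasure_lborel_cball_less_top: "emeasure lborel (cball (a::'a::euclidean_space) r) < \<infinity>"
 using emeasure_bounded_finite[of "cball a r"] by (simp add: bounded_cball)

lemma dense_continuous_bounded: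
 fixes f :: "'a::euclidean_space => 'b::euclidean_space"
 assumes [measurable]: "f \<in> borel_fun" and R: "\<And>x. norm x > R ==> f x = 0"
  and N: "\<And>x. norm (f x) \<le> N" and p: "p > 0" and e: "e > (0::ennreal)"
 shows "\<exists>h. continuous_on UNIV h \<and> (\<forall>x. norm x > R + 1 --> h x = 0) \<and> pint p (%x. f x - h x) < e"
proof -
 have "f measurable_on UNIV"
  by (intro lebesgue_measurable_imp_measurable_on measurable_completion) auto
 then obtain Z g where Z: "negligible Z" and g: "\<And>n. continuous_on UNIV (g n)"
  and lim: "\<And>x. x \<notin> Z ==> (%n. g n x) ~~> f x"
  unfolding measurable_on_def by auto
 have N0: "N \<ge> 0" using N norm_ge_zero order_trans by blast
 define th where "th = (%x::'a. max 0 (min 1 (R + 1 - norm x)))"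
 \<comment> \<open>Rescales vectors longer than N + 1 to that length and fixes the others; the
   additive 1 keeps the denominator positive when N = 0.\<close>
 define cl where "cl = (%v::'b. ((N + 1) / max (N + 1) (norm v)) *R v)"
 have cl: "norm (cl v) \<le> N + 1" for v
 proof -
  have "norm v / max (N + 1) (norm v) \<le> 1" using N0 by (auto simp: divide_le_eq_1 max_def)
  then have "(N + 1) * (norm v / max (N + 1) (norm v)) \<le> (N + 1) * 1"
   using N0 by (intro mult_left_mono) auto
  then show ?thesis using N0 by (simp add: cl_def)
 qed
 have clc: "continuous_on UNIV cl" unfolding cl_def
  using N0 by (intro continuous_intros) auto
 have clf: "cl (f x) = f x" for x using N[of x] N0 by (simp add: cl_def max_def)
 have cl0: "cl 0 = 0" by (simp add: cl_def)
 define h where "h = (%n x. th x *R cl (g n x))"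
 have hc: "continuous_on UNIV (h n)" for n
  unfolding h_def th_def by (intro continuous_intros continuous_on_compose2[OF clc g]) auto
 have hz: "h n x = 0" if "norm x > R + 1" for n x using that by (simp add: h_def th_def)
 have hb: "norm (h n x) \<le> N + 1" for n x
  using cl[of "g n x"] mult_mono[of "th x" 1 "norm (cl (g n x))" "N + 1"] by (simp add: h_def th_def)
 have [measurable]: "h n \<in> borel_fun" for n
  using hc borel_measurable_continuous_onI by blast
 have hlim: "(%n. h n x) ~~> f x" if "x \<notin> Z" for x
 proof -
  have "(%n. cl (g n x)) ~~> cl (f x)"
   using clc lim[OF that] by (metis UNIV_I continuous_on_eq_continuous_at isCont_tendsto_compose open_UNIV)
  then have "(%n. th x *R cl (g n x)) ~~> th x *R cl (f x)" by (intro tendsto_intros)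
  moreover have "th x *R cl (f x) = f x" using R[of x] by (cases "norm x > R") (auto simp: clf th_def cl0)
  ultimately show ?thesis by (simp add: h_def)
 qed
 have "(%n. pint p (%x. f x - h n x)) ~~> (\<integral>\<^sup>+x. 0 \<partial>(lborel::'a measure))"
  unfolding pint_def
 proof (rule nn_integral_dominated_convergence[where w="%x. ennreal ((2 * N + 1) powr p) * indicator (cball 0 (R + 1)) x"])
  show "AE x in lborel. ennreal (norm (f x - h n x) powr p) \<le> ennreal ((2 * N + 1) powr p) * indicator (cball 0 (R + 1)) x" for n
  proof (rule AE_I2)
   fix x
   have "norm (f x - h n x) \<le> 2 * N + 1"
    using norm_triangle_ineq4[of "f x" "h n x"] N[of x] hb[of n x] by linarith
   then show "ennreal (norm (f x - h n x) powr p) \<le> ennreal ((2 * N + 1) powr p) * indicator (cball 0 (R + 1)) x"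
    using p R[of x] hz[of x n] by (auto simp: indicator_def intro!: ennreal_leI powr_mono2)
  qed
  show "(\<integral>\<^sup>+x. ennreal ((2 * N + 1) powr p) * indicator (cball 0 (R + 1)) x \<partial>(lborel::'a measure)) < \<infinity>"
   using emeasure_lborel_cball_less_top[of "0::'a" "R + 1"]
   by (simp add: nn_integral_cmult_indicator ennreal_mult_less_top)
  have "AE x in lborel. x \<notin> Z"
   using Z AE_not_in[of Z lebesgue] by (simp add: negligible_iff_null_sets AE_completion_iff)
  then show "AE x in lborel. (%n. ennreal (norm (f x - h n x) powr p)) ~~> 0"
  proof eventually_elim
   case (elim x)
   have "(%n. norm (f x - h n x)) ~~> norm (f x - f x)"
    by (intro tendsto_intros hlim elim)
   then have "(%n. norm (f x - h n x) powr p) ~~> 0"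
    using p tendsto_powr'[of "%n. norm (f x - h n x)" 0 sequentially "%_. p" p] by auto
   then show ?case using tendsto_ennrealI by fastforce
  qed
  show "(%x. ennreal (norm (f x - h n x) powr p)) \<in> borel_measurable lborel" for n by measurable
  show "(%x. 0) \<in> borel_measurable lborel" by (rule borel_measurable_const)
  show "(%x. ennreal ((2 * N + 1) powr p) * indicator (cball 0 (R + 1)) x) \<in> borel_measurable lborel"
   by (intro borel_measurable_times_ennreal borel_measurable_const borel_measurable_indicator) simp
 qed
 then have "(%n. pint p (%x. f x - h n x)) ~~> 0" by simp
 then have "eventually (%n. pint p (%x. f x - h n x) < e) sequentially"
  using e by (rule order_tendstoD)
 then obtain n where "pint p (%x. f x - h n x) < e" by (auto simp: eventually_sequentially)
 then show ?thesis using hc hz by blast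
qed

lemma dense_continuous:
 fixes f :: "'a::euclidean_space => 'b::euclidean_space"
 assumes [measurable]: "f \<in> borel_fun" and R: "\<And>x. norm x > R ==> f x = 0"
  and fin: "pint p f < \<infinity>" and p: "p > 0" and e: "e > (0::real)"
 shows "\<exists>h. continuous_on UNIV h \<and> (\<forall>x. norm x > R + 1 --> h x = 0) \<and> pint p (%x. f x - h x) < ennreal e"
proof -
 define F where "F = (%n::nat. %x. if norm (f x) \<le> real n then f x else 0)"
 have [measurable]: "F n \<in> borel_fun" for n unfolding F_def by measurable
 have "(%n. pint p (%x. f x - F n x)) ~~> (\<integral>\<^sup>+x. 0 \<partial>(lborel::'a measure))"
  unfolding pint_def
 proof (rule nn_integral_dominated_convergence[where w="%x. ennreal (norm (f x) powr p)"])
  show "AE x in lborel. (%n. ennreal (norm (f x - F n x) powr p)) ~~> 0"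
  proof (rule AE_I2)
   fix x
   obtain m where m: "norm (f x) \<le> real m" using real_arch_simple by blast
   have "F n x = f x" if "n \<ge> m" for n
    using that m by (simp add: F_def)
   then have "eventually (%n. ennreal (norm (f x - F n x) powr p) = 0) sequentially"
    by (intro eventually_sequentiallyI[of m]) simp
   then show "(%n. ennreal (norm (f x - F n x) powr p)) ~~> 0" by (rule tendsto_eventually)
  qed
 qed (use fin in \<open>auto simp: pint_def F_def\<close>)
 then have "(%n. pint p (%x. f x - F n x)) ~~> 0" by simp
 \<comment> \<open>Two errors of size \<open>e'\<close>, multiplied by the 2^p of
   \<open>pint_add_le\<close>, add up to e.\<close>
 moreover define e' where "e' = e / 2 / 2 powr p"
 have e': "e' > 0" using e by (simp add: e'_def)
 ultimately have "eventually (%n. pint p (%x. f x - F n x) < ennreal e') sequentially"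
  by (intro order_tendstoD(2)) auto
 then obtain n where n: "pint p (%x. f x - F n x) < ennreal e'" by (auto simp: eventually_sequentially)
 obtain h where h: "continuous_on UNIV h" "\<forall>x. norm x > R + 1 --> h x = 0" "pint p (%x. F n x - h x) < ennreal e'"
 proof -
  have "norm (F n x) \<le> real n" "norm x > R ==> F n x = 0" for x using R by (auto simp: F_def)
  then show ?thesis using dense_continuous_bounded[of "F n" R "real n" p "ennreal e'"] p e' that by auto
 qed
 have [measurable]: "h \<in> borel_fun" using h(1) borel_measurable_continuous_onI by blast
 have "pint p (%x. f x - h x) \<le> ennreal (2 powr p) * (pint p (%x. f x - F n x) + pint p (%x. F n x - h x))"
  by (rule pint_add_le) (use p in \<open>auto simp: norm_triangle_ineq[of "f x - F n x" "F n x - h x" for x, simplified]\<close>)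
 also have "... < ennreal (2 powr p) * (ennreal e' + ennreal e')"
  by (intro ennreal_mult_strict_left_mono add_strict_mono n h(3)) (auto simp: ennreal_mult_less_top)
 also have "... = ennreal e" using e e' by (simp add: ennreal_mult'[symmetric] ennreal_plus[symmetric] e'_def del: ennreal_plus)
 finally show ?thesis using h by blast
qed


lemma nn_integral_lborel_affine:
 fixes f :: "'a::euclidean_space => ennreal"
 assumes [measurable]: "f \<in> borel_fun" and "c \<noteq> 0"
 shows "(NN x. f x) = ennreal (\<bar>c\<bar> ^ DIM('a)) * (NN x. f (t + c *R x))"
 by (subst lborel_affine[OF assms(2), of t]) (simp add: nn_integral_density nn_integral_distr nn_integral_cmult)

lemma compact_support_bounded:
 fixes ck :: "'a::euclidean_space => real"
 assumes "continuous_on UNIV ck" "\<And>x. norm x \<ge> dt ==> ck x = 0"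
 shows "\<exists>M\<ge>0. \<forall>x. \<bar>ck x\<bar> \<le> M"
proof -
 have "compact (ck ` cball 0 dt)"
  by (intro compact_continuous_image continuous_on_subset[OF assms(1)]) auto
 then have "bounded (ck ` cball 0 dt)" by (rule compact_imp_bounded)
 then obtain M where "\<forall>z\<in>ck ` cball 0 dt. norm z \<le> M"
  unfolding bounded_iff by blast
 then have M: "\<And>x. x \<in> cball 0 dt ==> \<bar>ck x\<bar> \<le> M" by simp
 have "\<bar>ck x\<bar> \<le> max M 0" for x
  using M[of x] assms(2)[of x] by (cases "norm x \<ge> dt") auto
 then show ?thesis by (intro exI[of _ "max M 0"]) auto
qed

lemma integrable_kernel:
 fixes f :: "'a::euclidean_space => 'b::euclidean_space"
 assumes "continuous_on UNIV ck" "\<And>x. \<bar>ck x\<bar> \<le> M" and f: "integrable lborel f"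
 shows "integrable lborel (%y. ck (x - y) *R f y)"
proof (rule Bochner_Integration.integrable_bound)
 show "integrable lborel (%y. M * norm (f y))" using f by auto
 have [measurable]: "ck \<in> borel_fun" using assms(1) by (rule borel_measurable_continuous_onI)
 have [measurable]: "f \<in> borel_fun" using f by auto
 show "(%y. ck (x - y) *R f y) \<in> borel_measurable lborel" by measurable
 have "\<bar>ck z\<bar> \<le> \<bar>M\<bar>" for z using assms(2)[of z] by linarith
 then show "AE y in lborel. norm (ck (x - y) *R f y) \<le> norm (M * norm (f y))"
  by (intro AE_I2) (auto simp: abs_mult intro!: mult_right_mono)
qed

lemma kernel_conv_continuous:
 fixes f :: "'a::euclidean_space => 'b::euclidean_space"
 assumes c: "continuous_on UNIV ck" and M: "\<And>x. \<bar>ck x\<bar> \<le> M" and f: "integrable lborel f"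
 shows "continuous_on UNIV (%x. INT y. ck (x - y) *R f y)"
proof (rule continuous_at_imp_continuous_on, intro ballI, unfold continuous_at_sequentially comp_def, intro allI impI)
 fix X x assume X: "X ~~> (x::'a)"
 show "(%n. INT y. ck (X n - y) *R f y) ~~> (INT y. ck (x - y) *R f y)"
 proof (rule integral_dominated_convergence[where w="%y. M * norm (f y)"])
  show "integrable lborel (%y. M * norm (f y))" using f by auto
  show "(%y. ck (x - y) *R f y) \<in> borel_measurable lborel"
   "(%y. ck (X n - y) *R f y) \<in> borel_measurable lborel" for n
   using integrable_kernel[OF c M f] by (rule borel_measurable_integrable)+
  have "isCont ck z" for z using c by (simp add: continuous_on_eq_continuous_at)
  then show "AE y in lborel. (%n. ck (X n - y) *R f y) ~~> ck (x - y) *R f y"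
   by (intro AE_I2 tendsto_intros isCont_tendsto_compose[where g=ck] X)
  show "AE y in lborel. norm (ck (X n - y) *R f y) \<le> M * norm (f y)" for n
   using M by (intro AE_I2) (auto intro!: mult_right_mono)
 qed
qed

text \<open>Differentiation under the integral: by the mean value inequality the bound
  \<open>M'\<close> on D also bounds all difference quotients of \<open>ck\<close>, which makes
  \<open>M'\<close> |f| a dominating function.\<close>

lemma kernel_conv_derivative:
 fixes f :: "real^'d::finite => real"
 assumes c: "continuous_on UNIV ck" and M: "\<And>x. \<bar>ck x\<bar> \<le> M"
  and c': "continuous_on UNIV D" and M': "\<And>x. \<bar>D x\<bar> \<le> M'"
  and D: "\<And>x. ((%t. ck (x + t *R axis j 1)) has_real_derivative D x) (at 0)"
  and f: "integrable lborel f"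
 shows "((%t. INT y. ck ((x + t *R axis j 1) - y) * f y) has_real_derivative
     (INT y. D (x - y) * f y)) (at 0)"
 unfolding has_field_derivative_iff tendsto_at_iff_sequentially comp_def
proof (intro allI impI)
 fix X :: "nat => real" assume X: "\<forall>n. X n \<in> UNIV - {0}" "X ~~> 0"
 note [measurable] = borel_measurable_continuous_onI[OF c] borel_measurable_continuous_onI[OF c']
 have [measurable]: "f \<in> borel_fun" using f by auto
 define e where "e = (axis j 1 :: real^'d)"
 have int: "integrable lborel (%y. ck (z - y) * f y)" for z
  using integrable_kernel[OF c M f, of z] by simp
 have quot: "\<bar>(ck (z + t *R e) - ck z) / t\<bar> \<le> M'" if "t \<noteq> 0" for z t
 proof -
  have dl: "((%s. ck (z + s *R e)) has_real_derivative D (z + s *R e)) (at s)" for s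
   by (rule has_real_derivative_line_shift[OF D[folded e_def]])
  have "norm (ck (z + t *R e) - ck (z + 0 *R e)) \<le> M' * norm (t - 0)"
   by (rule field_differentiable_bound[where S=UNIV and f'="%s. D (z + s *R e)"])
    (use M' dl in auto)
  then show ?thesis using that by (simp add: divide_le_eq)
 qed
 have "(%n. INT y. (ck ((x - y) + X n *R e) - ck (x - y)) / X n * f y) ~~> (INT y. D (x - y) * f y)"
 proof (rule integral_dominated_convergence[where w="%y. M' * norm (f y)"])
  show "integrable lborel (%y. M' * norm (f y))" using f by auto
  show "AE y in lborel. (%n. (ck ((x - y) + X n *R e) - ck (x - y)) / X n * f y) ~~> D (x - y) * f y"
  proof (intro AE_I2 tendsto_intros)
   fix y
   have "((%t. (ck ((x - y) + t *R e) - ck ((x - y) + 0 *R e)) / (t - 0)) \<longlongrightarrow> D (x - y)) (at 0)"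
    using D[of "x - y", folded e_def] unfolding has_field_derivative_iff by simp
   then show "(%n. (ck ((x - y) + X n *R e) - ck (x - y)) / X n) ~~> D (x - y)"
    unfolding tendsto_at_iff_sequentially comp_def using X by auto
  qed
  show "AE y in lborel. norm ((ck ((x - y) + X n *R e) - ck (x - y)) / X n * f y) \<le> M' * norm (f y)" for n
  proof (rule AE_I2)
   fix y
   have "\<bar>(ck ((x - y) + X n *R e) - ck (x - y)) / X n\<bar> \<le> M'" using X quot by auto
   then show "norm ((ck ((x - y) + X n *R e) - ck (x - y)) / X n * f y) \<le> M' * norm (f y)"
    unfolding norm_mult by (intro mult_right_mono) auto
  qed
 qed measurable
 moreover have "(INT y. (ck ((x - y) + X n *R e) - ck (x - y)) / X n * f y) =
  ((INT y. ck ((x + X n *R e) - y) * f y) - (INT y. ck ((x + 0 *R e) - y) * f y)) / (X n - 0)" for n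
 proof -
  have "(INT y. (ck ((x - y) + X n *R e) - ck (x - y)) / X n * f y) =
   (INT y. (ck ((x + X n *R e) - y) * f y - ck (x - y) * f y) / X n)"
   by (intro Bochner_Integration.integral_cong refl) (simp add: algebra_simps diff_divide_distrib)
  then show ?thesis using int by simp
 qed
 ultimately show "(%n. ((INT y. ck ((x + X n *R axis j 1) - y) * f y) -
   (INT y. ck ((x + 0 *R axis j 1) - y) * f y)) / (X n - 0)) ~~> (INT y. D (x - y) * f y)"
  by (simp only: e_def)
qed

definition mollify :: "('a::euclidean_space => real) => ('a => 'b::euclidean_space) => 'a => 'b" where
 "mollify rh f x = (INT y. rh (x - y) *R f y)"

lemma mollifierD:
 assumes "mollifier dt rh D"
 shows "continuous_on UNIV rh" "\<And>x. rh x \<ge> 0" "\<And>x. norm x \<ge> dt ==> rh x = 0" "rh \<in> borel_fun"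
  "\<exists>M\<ge>0. \<forall>x. \<bar>rh x\<bar> \<le> M" "(NN x. ennreal (rh x)) = 1"
  "\<And>x. (NN y. ennreal (rh (x - y))) = 1" "\<And>y. (NN x. ennreal (rh (x - y))) = 1"
  "\<And>x. integrable lborel (%y. rh (x - y))" "\<And>x. integral\<^sup>L lborel (%y. rh (x - y)) = 1"
proof -
 show c: "continuous_on UNIV rh" and nn: "rh x \<ge> 0" and s: "norm x \<ge> dt ==> rh x = 0" for x
  using assms by (auto simp: mollifier_def)
 show m[measurable]: "rh \<in> borel_fun" using c by (rule borel_measurable_continuous_onI)
 show "\<exists>M\<ge>0. \<forall>x. \<bar>rh x\<bar> \<le> M" using compact_support_bounded[OF c s] by blast
 show 1: "(NN x. ennreal (rh x)) = 1"
  using assms nn by (subst nn_integral_eq_integral) (auto simp: mollifier_def)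
 show 2: "(NN y. ennreal (rh (x - y))) = 1" for x
  using nn_integral_lborel_affine[of "%x. ennreal (rh x)" "-1" x] 1 by simp
 show "(NN x. ennreal (rh (x - y))) = 1" for y
  using nn_integral_lborel_affine[of "%x. ennreal (rh x)" "1" "-y"] 1 by simp
 show i: "integrable lborel (%y. rh (x - y))" for x
  using 2[of x] nn by (intro integrableI_nonneg) auto
 show "integral\<^sup>L lborel (%y. rh (x - y)) = 1" for x
  using nn_integral_eq_integral[OF i[of x]] 2[of x] nn by (simp add: ennreal_eq_1)
qed

lemma mollify_continuous:
 fixes f :: "real^'d::finite => 'b::euclidean_space"
 assumes "mollifier dt rh D" "integrable lborel f"
 shows "continuous_on UNIV (mollify rh f)"
proof -
 obtain M where "\<And>x. \<bar>rh x\<bar> \<le> M" using mollifierD(5)[OF assms(1)] by blast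
 then show ?thesis
  unfolding mollify_def[abs_def]
  using kernel_conv_continuous[of rh M f] mollifierD(1)[OF assms(1)] assms(2) by blast
qed

lemma integrable_mollify_kernel:
 fixes f :: "real^'d::finite => 'b::euclidean_space"
 assumes "mollifier dt rh D" "integrable lborel f"
 shows "integrable lborel (%y. rh (x - y) *R f y)"
proof -
 obtain M where "\<And>x. \<bar>rh x\<bar> \<le> M" using mollifierD(5)[OF assms(1)] by blast
 then show ?thesis
  using integrable_kernel[of rh M f] mollifierD(1)[OF assms(1)] assms(2) by blast
qed

lemma mollify_diff:
 fixes f g :: "real^'d::finite => 'b::euclidean_space"
 assumes "mollifier dt rh D" "integrable lborel f" "integrable lborel g"
 shows "mollify rh (%x. f x - g x) x = mollify rh f x - mollify rh g x"
 using integrable_mollify_kernel[OF assms(1,2)] integrable_mollify_kernel[OF assms(1,3)]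
 by (simp add: mollify_def scaleR_diff_right)

lemma mollify_cong:
 fixes f g :: "real^'d::finite => 'b::euclidean_space"
 assumes "mollifier dt rh D" "\<And>y. dist x y < dt ==> f y = g y"
 shows "mollify rh f x = mollify rh g x"
 unfolding mollify_def
proof (rule Bochner_Integration.integral_cong[OF refl])
 fix y show "rh (x - y) *R f y = rh (x - y) *R g y"
  using assms(2)[of y] mollifierD(3)[OF assms(1), of "x - y"] by (cases "dist x y < dt") (auto simp: dist_norm)
qed

lemma mollify_near:
 fixes f :: "real^'d::finite => 'b::euclidean_space"
 assumes m: "mollifier dt rh D" and f: "integrable lborel f"
  and b: "\<And>y. dist x y < dt ==> norm (f y - c) \<le> e"
 shows "norm (mollify rh f x - c) \<le> e"
proof -
 have i: "integrable lborel (%y. rh (x - y) *R c)" using mollifierD(9)[OF m] by simp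
 have "mollify rh f x - c = (INT y. rh (x - y) *R f y) - (INT y. rh (x - y) *R c)"
  using mollifierD(9,10)[OF m] by (simp add: mollify_def)
 also have "... = (INT y. rh (x - y) *R (f y - c))"
  using integrable_mollify_kernel[OF m f] i by (simp add: scaleR_diff_right)
 also have "norm ... \<le> (INT y. norm (rh (x - y) *R (f y - c)))"
  by (rule integral_norm_bound)
 also have "... \<le> (INT y. rh (x - y) * e)"
 proof (rule Bochner_Integration.integral_mono)
  have "integrable lborel (%y. rh (x - y) *R (f y - c))"
   using integrable_mollify_kernel[OF m f] i by (simp add: scaleR_diff_right)
  then show "integrable lborel (%y. norm (rh (x - y) *R (f y - c)))" by (rule integrable_norm)
  show "integrable lborel (%y. rh (x - y) * e)" using mollifierD(9)[OF m] by simp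
  fix y show "norm (rh (x - y) *R (f y - c)) \<le> rh (x - y) * e"
   using b[of y] mollifierD(3)[OF m, of "x - y"] mollifierD(2)[OF m, of "x - y"]
   by (cases "dist x y < dt") (auto simp: dist_norm intro!: mult_left_mono)
 qed
 also have "... = e" using mollifierD(10)[OF m] by simp
 finally show ?thesis .
qed

text \<open>Jensen's inequality would give the constant 1. A cruder argument suffices: with c half
  the norm of the average at x, the splitting below gives 2c \<le> c + c^(1-p) I, hence c^p \<le> I,
  and the factor 2^p is the price of the half.\<close>

lemma mollify_pint_le:
 fixes f :: "'a::euclidean_space => 'b::euclidean_space"
 assumes rh: "\<And>x. rh x \<ge> 0" and [measurable]: "rh \<in> borel_fun"
  and r1: "\<And>x. (NN y. ennreal (rh (x - y))) = 1" and r2: "\<And>y. (NN x. ennreal (rh (x - y))) = 1"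
  and i: "\<And>x. integrable lborel (%y. rh (x - y) *R f y)"
  and [measurable]: "f \<in> borel_fun" and p: "p \<ge> 1"
 shows "pint p (mollify rh f) \<le> ennreal (2 powr p) * pint p f"
proof -
 have pt: "ennreal (norm (mollify rh f x) powr p) \<le>
   ennreal (2 powr p) * (NN y. ennreal (rh (x - y)) * ennreal (norm (f y) powr p))" for x
 proof (cases "mollify rh f x = 0")
  case True
  then show ?thesis using p by simp
 next
  case False
  define c where "c = norm (mollify rh f x) / 2"
  define I where "I = (NN y. ennreal (rh (x - y)) * ennreal (norm (f y) powr p))"
  have c: "c > 0" using False by (simp add: c_def)
  \<comment> \<open>For t > c write t = t^(1-p) t^p, where t^(1-p) \<le> c^(1-p) because p \<ge> 1.
    The same splitting returns wherever an integral has to be compared with an integral of p-th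
    powers.\<close>
  have yng: "t \<le> c + c powr (1 - p) * t powr p" if "t \<ge> 0" for t
  proof (cases "t \<le> c")
   case False
   have "t = t powr (1 - p) * t powr p" using False c by (simp add: powr_add[symmetric])
   also have "... \<le> c powr (1 - p) * t powr p"
    using False c p by (intro mult_right_mono powr_mono2') auto
   finally show ?thesis using c by linarith
  qed (use c in \<open>simp add: add_increasing2\<close>)
  have "ennreal (2 * c) \<le> (NN y. norm (rh (x - y) *R f y))"
   unfolding c_def mollify_def using integral_norm_bound_ennreal[OF i[of x]] by simp
  also have "... \<le> (NN y. ennreal c * ennreal (rh (x - y)) + ennreal (c powr (1 - p)) * (ennreal (rh (x - y)) * ennreal (norm (f y) powr p)))"
  proof (rule nn_integral_mono)
   fix y
   have "rh (x - y) * norm (f y) \<le> rh (x - y) * (c + c powr (1 - p) * norm (f y) powr p)"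
    by (intro mult_left_mono yng rh) auto
   then have "norm (rh (x - y) *R f y) \<le> c * rh (x - y) + c powr (1 - p) * (rh (x - y) * norm (f y) powr p)"
    using rh by (simp add: algebra_simps)
   then have "ennreal (norm (rh (x - y) *R f y)) \<le> ennreal (c * rh (x - y) + c powr (1 - p) * (rh (x - y) * norm (f y) powr p))"
    by (rule ennreal_leI)
   then show "ennreal (norm (rh (x - y) *R f y)) \<le> ennreal c * ennreal (rh (x - y)) + ennreal (c powr (1 - p)) * (ennreal (rh (x - y)) * ennreal (norm (f y) powr p))"
    using c rh by (simp add: ennreal_mult'[symmetric] ennreal_plus[symmetric] del: ennreal_plus)
  qed
  also have "... = ennreal c + ennreal (c powr (1 - p)) * I"
   using r1[of x] by (simp add: nn_integral_add nn_integral_cmult I_def)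
  finally have le: "ennreal c + ennreal c \<le> ennreal c + ennreal (c powr (1 - p)) * I"
   using c by (simp add: ennreal_plus[symmetric] del: ennreal_plus)
  then have "ennreal c \<le> ennreal (c powr (1 - p)) * I"
   by (simp add: ennreal_add_left_cancel_le)
  then have "ennreal (c powr (p - 1)) * ennreal c \<le> ennreal (c powr (p - 1)) * (ennreal (c powr (1 - p)) * I)"
   by (rule mult_left_mono) simp
  also have "... = I" using c by (simp add: mult.assoc[symmetric] ennreal_mult'[symmetric] powr_add[symmetric])
  also have "ennreal (c powr (p - 1)) * ennreal c = ennreal (c powr p)"
  proof -
   have "c powr (p - 1) * c = c powr (p - 1) * c powr 1" using c by simp
   also have "... = c powr p" by (simp only: powr_add[symmetric]) simp
   finally show ?thesis using c by (simp add: ennreal_mult'[symmetric])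
  qed
  finally have "ennreal (c powr p) \<le> I" .
  then have "ennreal (2 powr p) * ennreal (c powr p) \<le> ennreal (2 powr p) * I" by (rule mult_left_mono) simp
  moreover have "norm (mollify rh f x) powr p = 2 powr p * c powr p"
   using c by (subst powr_mult[symmetric]) (auto simp: c_def)
  ultimately show ?thesis by (simp add: ennreal_mult' I_def)
 qed
 have "pint p (mollify rh f) \<le> (NN x. ennreal (2 powr p) * (NN y. ennreal (rh (x - y)) * ennreal (norm (f y) powr p)))"
  unfolding pint_def by (intro nn_integral_mono pt)
 also have "... = ennreal (2 powr p) * (NN x. (NN y. ennreal (rh (x - y)) * ennreal (norm (f y) powr p)))"
  by (rule nn_integral_cmult) measurable
 also have "(NN x. (NN y. ennreal (rh (x - y)) * ennreal (norm (f y) powr p)))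
  = (NN y. (NN x. ennreal (rh (x - y)) * ennreal (norm (f y) powr p)))"
  by (rule lborel_pair.Fubini') measurable
 also have "... = pint p f"
  using r2 by (simp add: nn_integral_multc pint_def)
 finally show ?thesis .
qed

text \<open>A density argument. For a continuous h with bounded support the convergence is uniform;
  the remainder f - h and its mollification are controlled by \<open>mollify_pint_le\<close>,
  uniformly in the mollifier.\<close>

lemma mollify_Lp_convergence:
 fixes f :: "real^'d::finite => 'b::euclidean_space"
 assumes f: "integrable lborel f" and R: "\<And>x. norm x > R ==> f x = 0"
  and fin: "pint p f < \<infinity>" and p: "p \<ge> 1" and e: "e > (0::real)"
 shows "\<exists>dt0>0. \<forall>dt rh D. dt \<le> dt0 --> mollifier dt rh D --> pint p (%x. mollify rh f x - f x) < ennreal e"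
proof -
 have [measurable]: "f \<in> borel_fun" using f by auto
 \<comment> \<open>The total constant: an outer and an inner use of \<open>pint_add_le\<close>,
   together with the 2^p of \<open>mollify_pint_le\<close>.\<close>
 define C where "C = 2 powr p * (2 powr p + 2 powr p * 2)"
 have C: "C > 0" by (auto simp: C_def intro!: mult_pos_pos add_pos_pos)
 define e1 where "e1 = e / C"
 have e1: "e1 > 0" using e C by (simp add: e1_def)
 obtain h where h: "continuous_on UNIV h" "\<And>x. norm x > R + 1 ==> h x = 0"
  and fh: "pint p (%x. f x - h x) < ennreal e1"
  using dense_continuous[of f R p e1] R fin p e1 by auto
 have [measurable]: "h \<in> borel_fun" using h(1) by (rule borel_measurable_continuous_onI)
 have hint: "integrable lborel h"
 proof -
  have "integrable lborel (%x. indicator (cball 0 (R + 1)) x *R h x)"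
   by (rule borel_integrable_compact) (auto intro: continuous_on_subset[OF h(1)])
  moreover have "(%x. indicator (cball 0 (R + 1)) x *R h x) = h"
   using h(2) by (force simp: fun_eq_iff indicator_def)
  ultimately show ?thesis by simp
 qed
 define V where "V = measure lborel (cball (0::real^'d) (R + 2))"
 have V: "emeasure lborel (cball (0::real^'d) (R + 2)) = ennreal V" "V \<ge> 0"
  using emeasure_eq_ennreal_measure[of lborel "cball (0::real^'d) (R + 2)"] emeasure_lborel_cball_less_top[of "0::real^'d" "R + 2"]
  by (auto simp: V_def)
 define w where "w = (e1 / (V + 1)) powr (1 / p)"
 have w: "w > 0" using e1 V by (simp add: w_def)
 have wV: "w powr p * V < e1"
 proof -
  have "w powr p = e1 / (V + 1)" using e1 V p by (simp add: w_def powr_powr)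
  moreover from this have "w powr p * V + w powr p = e1" using V by (simp add: field_simps)
  moreover have "w powr p > 0" using w by simp
  ultimately show ?thesis by linarith
 qed
 \<comment> \<open>h lives in radius R + 1 and, as \<open>dt\<close> \<le> 1, its mollification in
   radius R + 2; points within \<open>dt\<close> of these stay within radius R + 3.\<close>
 have "uniformly_continuous_on (cball 0 (R + 3)) h"
  by (intro compact_uniformly_continuous continuous_on_subset[OF h(1)]) auto
 then obtain d where d: "d > 0" "\<And>x y. x \<in> cball 0 (R + 3) ==> y \<in> cball 0 (R + 3) ==> dist y x < d ==> dist (h y) (h x) < w"
  using w unfolding uniformly_continuous_on_def by metis
 show ?thesis
 proof (intro exI[of _ "min d 1"] conjI allI impI)
  show "min d 1 > 0" using d by simp
  fix dt rh D assume dt: "dt \<le> min d 1" and m: "mollifier dt rh (D :: 'd => real^'d => real)"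
  have gint: "integrable lborel (%x. f x - h x)" using f hint by simp
  have [measurable]: "mollify rh f \<in> borel_fun" "mollify rh h \<in> borel_fun"
   "mollify rh (%x. f x - h x) \<in> borel_fun"
   by (intro borel_measurable_continuous_onI mollify_continuous[OF m] f hint gint)+
  have b: "norm (mollify rh h x - h x) \<le> w" for x
  proof (cases "x \<in> cball 0 (R + 2)")
   case True
   show ?thesis
   proof (rule mollify_near[OF m hint])
    fix y assume "dist x y < dt"
    moreover have "norm y \<le> norm x + dist x y" by (metis dist_0_norm dist_triangle)
    ultimately show "norm (h y - h x) \<le> w"
     using d(2)[of x y] True dt by (auto simp: dist_norm norm_minus_commute)
   qed
  next
   case False
   have "h y = 0" if "dist x y < dt" for y
   proof (rule h(2))
    have "norm x \<le> norm y + dist x y" by (metis dist_0_norm dist_commute dist_triangle)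
    then show "norm y > R + 1" using False dt that by auto
   qed
   then have "mollify rh h x = mollify rh (%_. 0) x" by (rule mollify_cong[OF m])
   then show ?thesis using h(2)[of x] False w by (simp add: mollify_def)
  qed
  have z: "mollify rh h x - h x = 0" if "x \<notin> cball 0 (R + 2)" for x
  proof -
   have "h y = 0" if "dist x y < dt" for y
   proof (rule h(2))
    have "norm x \<le> norm y + dist x y" by (metis dist_0_norm dist_commute dist_triangle)
    then show "norm y > R + 1" using \<open>x \<notin> _\<close> dt that by auto
   qed
   then have "mollify rh h x = mollify rh (%_. 0) x" by (rule mollify_cong[OF m])
   then show ?thesis using h(2)[of x] that by (simp add: mollify_def)
  qed
  have B: "pint p (%x. mollify rh h x - h x) < ennreal e1"
  proof -
   have "pint p (%x. mollify rh h x - h x) \<le> ennreal (w powr p) * ennreal V"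
    using pint_bounded_le[of "%x. mollify rh h x - h x" w "cball 0 (R + 2)" p] b z w p V by simp
   also have "... < ennreal e1" using wV V e1 by (simp add: ennreal_mult'[symmetric] ennreal_lessI)
   finally show ?thesis .
  qed
  have A: "pint p (mollify rh (%x. f x - h x)) \<le> ennreal (2 powr p) * pint p (%x. f x - h x)"
   by (rule mollify_pint_le)
    (use mollifierD[OF m] integrable_mollify_kernel[OF m gint] p in auto)
  have "pint p (%x. mollify rh f x - f x) \<le> ennreal (2 powr p) *
    (pint p (mollify rh (%x. f x - h x)) + pint p (%x. (mollify rh h x - h x) - (f x - h x)))"
  proof (rule pint_add_le)
   fix x
   have "mollify rh f x - f x = mollify rh (%x. f x - h x) x + ((mollify rh h x - h x) - (f x - h x))"
    by (simp add: mollify_diff[OF m f hint])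
   then show "norm (mollify rh f x - f x) \<le> norm (mollify rh (%x. f x - h x) x) + norm ((mollify rh h x - h x) - (f x - h x))"
    by (metis norm_triangle_ineq)
  qed (use p in auto)
  also have "... \<le> ennreal (2 powr p) *
    (ennreal (2 powr p) * pint p (%x. f x - h x) + ennreal (2 powr p) * (pint p (%x. mollify rh h x - h x) + pint p (%x. f x - h x)))"
   by (intro mult_left_mono add_mono A pint_add_le[OF _ _ _ norm_triangle_ineq4]) (use p in auto)
  also have "... < ennreal (2 powr p) * (ennreal (2 powr p) * ennreal e1 + ennreal (2 powr p) * (ennreal e1 + ennreal e1))"
   using fh B by (intro ennreal_mult_strict_left_mono add_strict_mono) (auto simp: ennreal_mult_less_top)
  also have "... = ennreal (C * e1)"
   using e1 by (simp add: C_def ennreal_mult'[symmetric] ennreal_plus[symmetric] algebra_simps del: ennreal_plus)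
  also have "C * e1 = e" using C by (simp add: e1_def)
  finally show "pint p (%x. mollify rh f x - f x) < ennreal e" .
 qed
qed

section \<open>A potential estimate\<close>

text \<open>In the slice s, the substitution z = x + s (w - x) over the ball of radius h about x produces
 the weight s^{-d}; keeping the integral over s avoids polar coordinates.\<close>

definition pot :: "real => ('a::euclidean_space => ennreal) => 'a => ennreal" where
 "pot h g x = (NN s. (if 0 < s \<and> s < 1 then ennreal (s powr (- real DIM('a))) else 0) *
        (NN w. (if dist x w < h * s then g w else 0)))"

lemma pot_mono: "(\<And>z. g z \<le> g' z) ==> pot h g x \<le> pot h g' x"
 unfolding pot_def by (intro nn_integral_mono mult_left_mono) auto

lemma pot_measurable [measurable]:
 assumes [measurable]: "g \<in> borel_fun"
 shows "pot h g \<in> borel_fun"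
proof -
 have "(%x. pot h g x) \<in> borel_measurable (borel :: 'a measure)"
  unfolding pot_def by measurable
 then show ?thesis by simp
qed

lemma pot_add:
 assumes [measurable]: "f \<in> borel_fun" "g \<in> borel_fun"
 shows "pot h (%z. f z + g z) x = pot h f x + pot h g x"
proof -
 have "pot h (%z. f z + g z) x = (NN s. (if 0 < s \<and> s < 1 then ennreal (s powr (- real DIM('a))) else 0) *
  ((NN w. (if dist x w < h * s then f w else 0)) + (NN w. (if dist x w < h * s then g w else 0))))"
  unfolding pot_def
  by (subst nn_integral_add[symmetric]) (auto intro!: nn_integral_cong arg_cong2[where f="(*)"])
 also have "... = pot h f x + pot h g x"
  unfolding pot_def distrib_left by (rule nn_integral_add) measurable
 finally show ?thesis .
qed

lemma pot_cmult:
 assumes [measurable]: "f \<in> borel_fun"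
 shows "pot h (%z. c * f z) x = c * pot h f x"
proof -
 have "(NN w. (if dist x w < h * s then c * f w else 0)) = c * (NN w. (if dist x w < h * s then f w else 0))" for s
  by (subst nn_integral_cmult[symmetric]) (auto intro!: nn_integral_cong)
 then show ?thesis
  unfolding pot_def by (simp add: mult.left_commute nn_integral_cmult)
qed

text \<open>The kernel depends on x and w only through their distance, so Tonelli makes the operator
  self-adjoint. This moves the potential from a function that is merely integrable onto one whose
  potential is bounded.\<close>

lemma pot_symmetric:
 fixes f g :: "'a::euclidean_space => ennreal"
 assumes [measurable]: "f \<in> borel_fun" "g \<in> borel_fun"
 shows "(NN x. f x * pot h g x) = (NN x. g x * pot h f x)"
proof -
 define k where "k = (%s::real. if 0 < s \<and> s < 1 then ennreal (s powr (- real DIM('a))) else 0)"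
 have [measurable]: "k \<in> borel_fun" unfolding k_def by measurable
 define J where "J = (%(s::real) (x::'a) (w::'a). if dist x w < h * s then (1::ennreal) else 0)"
 have [measurable]: "J s x \<in> borel_fun" for s x
  unfolding J_def by measurable
 have exp: "(NN x. f x * pot h g x) =
   (NN s. NN x. NN w. k s * (f x * (J s x w * g w)))"
  if [measurable]: "f \<in> borel_fun" "g \<in> borel_fun" for f g
 proof -
  have "(NN x. f x * pot h g x) =
   (NN x. NN s. NN w. k s * (f x * (J s x w * g w)))"
  proof (rule nn_integral_cong)
   fix x
   have "f x * pot h g x = (NN s. f x * (k s * (NN w. J s x w * g w)))"
    unfolding pot_def k_def J_def
    by (subst nn_integral_cmult[symmetric]) (auto intro!: nn_integral_cong arg_cong2[where f="(*)"])
   also have "... = (NN s. NN w. k s * (f x * (J s x w * g w)))"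
   proof (rule nn_integral_cong)
    fix s
    have "(NN w. k s * (f x * (J s x w * g w))) = k s * (f x * (NN w. J s x w * g w))"
     by (simp add: nn_integral_cmult)
    then show "f x * (k s * (NN w. J s x w * g w)) = (NN w. k s * (f x * (J s x w * g w)))"
     by (simp add: mult.left_commute)
   qed
   finally show "f x * pot h g x = (NN s. NN w. k s * (f x * (J s x w * g w)))" .
  qed
  also have "... = (NN s. NN x. NN w. k s * (f x * (J s x w * g w)))"
   unfolding J_def by (rule lborel_pair.Fubini') measurable
  finally show ?thesis .
 qed
 have "(NN x. f x * pot h g x) =
   (NN s. NN x. NN w. k s * (f x * (J s x w * g w)))"
  by (rule exp) measurable
 also have "... = (NN s. NN w. NN x. k s * (f x * (J s x w * g w)))"
  unfolding J_def by (intro nn_integral_cong lborel_pair.Fubini') measurable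
 also have "... = (NN s. NN w. NN x. k s * (g w * (J s w x * f x)))"
  by (intro nn_integral_cong) (simp add: J_def dist_commute mult_ac)
 also have "... = (NN x. g x * pot h f x)"
  by (rule exp[symmetric]) measurable
 finally show ?thesis .
qed

text \<open>This is where p > d enters. The slice s contributes s^(-d) times an integral over a ball
  of radius h s, which is at most a multiple of s^(d - d/p); the remaining weight s^(-d/p) is
  integrable at 0. The parameter \<open>La\<close> trades the volume term against the p-th power
  term and is chosen at each use.\<close>

lemma pot_le:
 fixes g :: "'a::euclidean_space => 'b::euclidean_space"
 assumes [measurable]: "g \<in> borel_fun" and p: "p > real DIM('a)" and La: "La > 0" and h: "h > 0"
 shows "pot h (%z. ennreal (norm (g z))) x \<le> ennreal (1 / (1 - real DIM('a) / p)) *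
  (ennreal (La * unit_ball_vol (real DIM('a)) * h ^ DIM('a)) + ennreal (La powr (1 - p)) * pint p g)"
proof -
 define d where "d = real DIM('a)"
 have d: "d \<ge> 1" "d < p" using p DIM_positive[where 'a='a] by (auto simp: d_def Suc_le_eq)
 define v where "v = unit_ball_vol d"
 have v: "v \<ge> 0" by (simp add: v_def d_def)
 define Q where "Q = ennreal (La * v * h ^ DIM('a)) + ennreal (La powr (1 - p)) * pint p g"
 have inner: "(NN w. (if dist x w < h * s then ennreal (norm (g w)) else 0)) \<le> ennreal (s powr (d - d / p)) * Q"
  if s: "0 < s" "s < 1" for s
 proof -
  \<comment> \<open>This power of s makes both terms of the splitting, c times the volume and
    c^(1-p), scale like s^(d - d/p).\<close>
  define c where "c = La * s powr (- d / p)"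
  have c: "c > 0" using s La by (simp add: c_def)
  have yng: "t \<le> c + c powr (1 - p) * t powr p" if "t \<ge> 0" for t
  proof (cases "t \<le> c")
   case False
   have "t = t powr (1 - p) * t powr p" using False c by (simp add: powr_add[symmetric])
   also have "... \<le> c powr (1 - p) * t powr p"
    using False c d by (intro mult_right_mono powr_mono2') auto
   finally show ?thesis using c by linarith
  qed (use c in \<open>simp add: add_increasing2\<close>)
  have "(NN w. (if dist x w < h * s then ennreal (norm (g w)) else 0)) \<le>
   (NN w. ennreal c * indicator (ball x (h * s)) w + ennreal (c powr (1 - p)) * ennreal (norm (g w) powr p))"
   by (intro nn_integral_mono)
    (use c yng in \<open>auto simp: indicator_def ennreal_mult'[symmetric] ennreal_plus[symmetric] intro!: ennreal_leI simp del: ennreal_plus\<close>)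
  also have "... = ennreal c * emeasure lborel (ball x (h * s)) + ennreal (c powr (1 - p)) * pint p g"
  proof -
   have [measurable]: "(%w. indicator (ball x (h * s)) w :: ennreal) \<in> borel_fun"
   by (intro borel_measurable_indicator) simp
   show ?thesis
    by (subst nn_integral_add) (auto simp: nn_integral_cmult nn_integral_cmult_indicator pint_def)
  qed
  also have "ennreal c * emeasure lborel (ball x (h * s)) = ennreal (s powr (d - d / p)) * ennreal (La * v * h ^ DIM('a))"
  proof -
   have em: "emeasure lborel (ball x (h * s)) = ennreal (v * (h * s) ^ DIM('a))"
    using h s by (simp add: emeasure_ball v_def d_def)
   have eq: "c * (v * (h * s) ^ DIM('a)) = s powr (d - d / p) * (La * v * h ^ DIM('a))"
   proof -
    have "s ^ DIM('a) = s powr d" using s by (simp add: d_def powr_realpow)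
    then have "s powr (- d / p) * s ^ DIM('a) = s powr (d - d / p)"
     by (simp add: powr_add[symmetric])
    then show ?thesis by (simp add: c_def power_mult_distrib algebra_simps)
   qed
   have "ennreal c * ennreal (v * (h * s) ^ DIM('a)) = ennreal (c * (v * (h * s) ^ DIM('a)))"
    using c by (simp add: ennreal_mult')
   also have "... = ennreal (s powr (d - d / p)) * ennreal (La * v * h ^ DIM('a))"
    unfolding eq by (simp add: ennreal_mult')
   finally show ?thesis by (simp only: em)
  qed
  also have "ennreal (c powr (1 - p)) = ennreal (s powr (d - d / p)) * ennreal (La powr (1 - p))"
  proof -
   have "c powr (1 - p) = La powr (1 - p) * (s powr (- d / p)) powr (1 - p)"
    using s La by (simp add: c_def powr_mult)
   also have "(s powr (- d / p)) powr (1 - p) = s powr (d - d / p)"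
   proof -
    have "(- d / p) * (1 - p) = d - d / p" using d by (simp add: field_simps)
    then show ?thesis by (simp only: powr_powr)
   qed
   finally show ?thesis by (simp add: ennreal_mult'[symmetric] mult.commute)
  qed
  finally show ?thesis by (simp add: Q_def distrib_left mult.assoc)
 qed
 have "pot h (%z. ennreal (norm (g z))) x \<le> (NN s. ennreal (indicator {0..1} s * s powr (- d / p)) * Q)"
  unfolding pot_def
 proof (rule nn_integral_mono)
  fix s :: real
  show "(if 0 < s \<and> s < 1 then ennreal (s powr - real DIM('a)) else 0) *
    (NN  w. (if dist x w < h * s then ennreal (norm (g w)) else 0))
    \<le> ennreal (indicator {0..1} s * s powr (- d / p)) * Q"
  proof (cases "0 < s \<and> s < 1")
   case True
   have "ennreal (s powr - d) * (NN  w. (if dist x w < h * s then ennreal (norm (g w)) else 0))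
    \<le> ennreal (s powr - d) * (ennreal (s powr (d - d / p)) * Q)"
    using inner[of s] True by (intro mult_left_mono) auto
   also have "... = ennreal (s powr (- d / p)) * Q"
    by (simp add: mult.assoc[symmetric] ennreal_mult'[symmetric] powr_add[symmetric])
   finally show ?thesis using True by (simp add: d_def)
  qed auto
 qed
 also have "... = (NN s. ennreal (indicator {0..1} s * s powr (- d / p))) * Q"
  by (rule nn_integral_multc) measurable
 also have "(NN s. ennreal (indicator {0..1} s * s powr (- d / p))) = ennreal (1 / (1 - d / p))"
 proof -
  have "((%s::real. s powr (- d / p)) has_integral (1 powr (- d / p + 1) / (- d / p + 1))) {0..1}"
   using d by (intro has_integral_powr_from_0) (auto simp: field_simps)
  then have "((%s::real. indicator {0..1} s * s powr (- d / p)) has_integral 1 / (1 - d / p)) UNIV"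
  proof -
   have "(%s::real. indicator {0..1} s * s powr (- d / p)) = (%s. if s \<in> {0..1} then s powr (- d / p) else 0)"
    by (auto simp: fun_eq_iff)
   moreover assume "((%s::real. s powr (- d / p)) has_integral (1 powr (- d / p + 1) / (- d / p + 1))) {0..1}"
   ultimately show ?thesis by (simp only: has_integral_restrict_UNIV) (simp add: add.commute)
  qed
  then show ?thesis
   by (intro nn_integral_has_integral_lborel) auto
 qed
 finally show ?thesis by (simp add: Q_def d_def v_def)
qed

text \<open>The fundamental theorem of calculus along the segments from x to the points of B, all
  inside the convex set H. Interchanging the integrals over s and w and substituting z = x + s (w -
  x) gives the potential; the bound h on the length of the segments gives the factor in
  front.\<close>

lemma oscillation_le_pot:
 fixes u :: "'a::euclidean_space => 'b::euclidean_space"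
 assumes H: "convex H" "H \<in> sets borel" "x \<in> H" and B: "B \<subseteq> H" "B \<in> sets borel"
  and h: "\<And>w. w \<in> B ==> dist x w < h"
  and u: "\<And>z. z \<in> H ==> (u has_derivative u' z) (at z)"
  and G: "continuous_on H G" "\<And>z v. z \<in> H ==> norm (u' z v) \<le> G z * norm v" "\<And>z. z \<in> H ==> G z \<ge> 0"
 shows "(NN w. indicator B w * ennreal (norm (u x - u w)))
    \<le> ennreal h * pot h (%z. indicator H z * ennreal (G z)) x"
proof -
 define F where "F = (%z. indicator H z * ennreal (G z))"
 have [measurable]: "(%z. indicator H z *R G z) \<in> borel_fun"
  using borel_measurable_continuous_on_indicator[OF H(2) G(1)] by simp
 have Feq: "F = (%z. ennreal (indicator H z *R G z))"
  by (auto simp: F_def fun_eq_iff indicator_def)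
 have [measurable]: "F \<in> borel_fun" unfolding Feq by measurable
 note [measurable] = B(2)
 have pt: "ennreal (norm (u x - u w)) \<le> (NN s. (if 0 < s \<and> s < 1 then ennreal h * F (x + s *R (w - x)) else 0))"
  if w: "w \<in> B" for w
 proof -
  define ga where "ga = (%s::real. x + s *R (w - x))"
  have ga: "ga s \<in> H" if "s \<in> {0..1}" for s
  proof -
   have "(1 - s) *R x + s *R w \<in> H" using H w B that by (intro convexD) auto
   then show ?thesis by (simp add: ga_def algebra_simps)
  qed
  define g where "g = (%s. G (ga s) * norm (w - x))"
  have cg: "continuous_on {0..1} g"
   unfolding g_def by (intro continuous_intros continuous_on_compose2[OF G(1)]) (use ga in \<open>auto simp: ga_def intro!: continuous_intros\<close>)
  \<comment> \<open>An antiderivative of the gradient bound, so that the mean value inequality with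
    a variable bound compares the increment of u with the integral of g.\<close>
  define ph where "ph = (%s. integral {0..s} g)"
  have ph: "(ph has_vector_derivative g s) (at s within {0..1})" if "s \<in> {0..1}" for s
   unfolding ph_def by (rule integral_has_vector_derivative[OF cg that])
  have ud: "((%s. u (ga s)) has_vector_derivative u' (ga s) (w - x)) (at s)" if "s \<in> {0..1}" for s
  proof -
   have "(ga has_derivative (%t. t *R (w - x))) (at s)" unfolding ga_def by (auto intro!: derivative_eq_intros)
   then have "((%s. u (ga s)) has_derivative (%t. u' (ga s) (t *R (w - x)))) (at s)"
    by (rule has_derivative_compose) (rule u[OF ga[OF that]])
   moreover have "linear (u' (ga s))" using u[OF ga[OF that]] has_derivative_linear by blast
   ultimately show ?thesis by (simp add: has_vector_derivative_def linear_cmul)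
  qed
  have "norm (u (ga 1) - u (ga 0)) \<le> ph 1 - ph 0"
  proof (rule differentiable_bound_general[where f'="%s. u' (ga s) (w - x)" and \<phi>'=g])
   show "continuous_on {0..1} (%s. u (ga s))"
    using has_vector_derivative_continuous[OF ud] by (intro continuous_at_imp_continuous_on ballI)
   show "continuous_on {0..1} ph"
    using has_vector_derivative_continuous[OF ph] by (simp add: continuous_on_eq_continuous_within)
   fix s :: real assume s: "0 < s" "s < 1"
   show "((%s. u (ga s)) has_vector_derivative u' (ga s) (w - x)) (at s)" using ud s by auto
   have "(ph has_vector_derivative g s) (at s within {0<..<1})"
    using ph[of s] s by (auto intro: has_vector_derivative_within_subset)
   then show "(ph has_vector_derivative g s) (at s)"
    using s by (simp add: has_vector_derivative_def at_within_open[of s "{0<..<1}"])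
   show "norm (u' (ga s) (w - x)) \<le> g s" using G(2)[OF ga, of s "w - x"] s by (simp add: g_def)
  qed simp
  then have 1: "norm (u x - u w) \<le> integral {0..1} g"
   by (simp add: ga_def ph_def norm_minus_commute)
  have "(g has_integral integral {0..1} g) {0..1}"
   using cg integrable_continuous_real integrable_integral by blast
  then have "(g has_integral integral {0..1} g) {0<..<1}" by (simp add: has_integral_Icc_iff_Ioo)
  then have hi: "((%s. if s \<in> {0<..<1} then g s else 0) has_integral integral {0..1} g) UNIV"
   by (simp only: has_integral_restrict_UNIV)
  have gm: "(%s. if s \<in> {0<..<1} then g s else 0) \<in> borel_fun"
  proof -
   have "(%s. indicator {0<..<1} s *R g s) \<in> borel_fun"
    by (rule borel_measurable_continuous_on_indicator) (auto intro: continuous_on_subset[OF cg])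
   moreover have "(%s. indicator {0<..<1} s *R g s) = (%s. if s \<in> {0<..<1} then g s else 0)"
    by (auto simp: fun_eq_iff)
   ultimately show ?thesis by simp
  qed
  have "(NN s. ennreal (if s \<in> {0<..<1} then g s else 0)) = ennreal (integral {0..1} g)"
   by (rule nn_integral_has_integral_lborel[OF gm _ hi]) (use G(3) ga in \<open>auto simp: g_def\<close>)
  moreover have "(NN s. ennreal (if s \<in> {0<..<1} then g s else 0)) \<le>
   (NN s. (if 0 < s \<and> s < 1 then ennreal h * F (x + s *R (w - x)) else 0))"
  proof (rule nn_integral_mono)
   fix s
   have "ennreal (g s) \<le> ennreal h * F (x + s *R (w - x))" if "s \<in> {0..1}"
   proof -
    have "norm (w - x) \<le> h" using h[OF w] by (simp add: dist_norm norm_minus_commute)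
    then have "g s \<le> h * G (ga s)"
     unfolding g_def using G(3)[OF ga[OF that]] by (metis mult.commute mult_left_mono)
    then show ?thesis
     using ga[OF that] G(3)[OF ga[OF that]] by (simp add: F_def ga_def ennreal_mult''[symmetric] ennreal_leI)
   qed
   then show "ennreal (if s \<in> {0<..<1} then g s else 0) \<le> (if 0 < s \<and> s < 1 then ennreal h * F (x + s *R (w - x)) else 0)"
    by auto
  qed
  ultimately have "ennreal (integral {0..1} g) \<le>
   (NN s. (if 0 < s \<and> s < 1 then ennreal h * F (x + s *R (w - x)) else 0))" by (rule ord_eq_le_trans[OF sym])
  with ennreal_leI[OF 1] show ?thesis by (rule order_trans)
 qed
 have "(NN w. indicator B w * ennreal (norm (u x - u w))) \<le>
  (NN w. NN s. indicator B w * (if 0 < s \<and> s < 1 then ennreal h * F (x + s *R (w - x)) else 0))"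
  by (intro nn_integral_mono) (auto simp: indicator_def pt)
 also have "... = (NN s. NN w. indicator B w * (if 0 < s \<and> s < 1 then ennreal h * F (x + s *R (w - x)) else 0))"
  by (rule lborel_pair.Fubini') measurable
 also have "... \<le> (NN s. ennreal h * ((if 0 < s \<and> s < 1 then ennreal (s powr (- real DIM('a))) else 0) *
        (NN w. (if dist x w < h * s then F w else 0))))"
 proof (rule nn_integral_mono)
  fix s :: real
  show "(NN w. indicator B w * (if 0 < s \<and> s < 1 then ennreal h * F (x + s *R (w - x)) else 0)) \<le>
   ennreal h * ((if 0 < s \<and> s < 1 then ennreal (s powr (- real DIM('a))) else 0) *
        (NN w. (if dist x w < h * s then F w else 0)))"
  proof (cases "0 < s \<and> s < 1")
   case True
   define K where "K = (%w. if dist x w < h * s then F w else 0)"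
   have [measurable]: "K \<in> borel_fun" unfolding K_def by measurable
   have "(NN w. indicator B w * (if 0 < s \<and> s < 1 then ennreal h * F (x + s *R (w - x)) else 0))
    \<le> (NN w. ennreal h * K ((x - s *R x) + s *R w))"
   proof (rule nn_integral_mono)
    fix w
    have eq: "x - s *R x + s *R w = x + s *R (w - x)" by (simp add: algebra_simps)
    have "dist x (x + s *R (w - x)) < h * s" if "w \<in> B"
     using h[OF that] True by (simp add: dist_norm norm_minus_commute mult.commute)
    then show "indicator B w * (if 0 < s \<and> s < 1 then ennreal h * F (x + s *R (w - x)) else 0)
     \<le> ennreal h * K ((x - s *R x) + s *R w)"
     unfolding eq by (auto simp: K_def indicator_def)
   qed
   also have "... = ennreal h * (NN w. K ((x - s *R x) + s *R w))"
    by (rule nn_integral_cmult) measurable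
   also have "(NN w. K ((x - s *R x) + s *R w)) = ennreal (s powr (- real DIM('a))) * (NN w. K w)"
   proof -
    have "ennreal (s powr (- real DIM('a))) * (NN w. K w) =
     ennreal (s powr (- real DIM('a))) * (ennreal (s ^ DIM('a)) * (NN w. K ((x - s *R x) + s *R w)))"
     using nn_integral_lborel_affine[of K s "x - s *R x"] True by simp
    also have "... = (NN w. K ((x - s *R x) + s *R w))"
    proof -
     have "s powr (- real DIM('a)) * s ^ DIM('a) = 1"
      using True by (simp add: powr_minus powr_realpow)
     then show ?thesis by (simp add: mult.assoc[symmetric] ennreal_mult'[symmetric])
    qed
    finally show ?thesis by simp
   qed
   finally show ?thesis using True by (simp add: K_def)
  qed auto
 qed
 also have "... = ennreal h * pot h F x"
  unfolding pot_def by (rule nn_integral_cmult) measurable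
 finally show ?thesis by (simp add: F_def)
qed

text \<open>The norm on matrices is the Frobenius norm, so Cauchy-Schwarz row by row
  suffices.\<close>

lemma norm_matrix_vector_mult_le: "norm (A *v x) \<le> norm A * norm (x :: real^'n::finite)" for A :: "real^'n^'m::finite"
proof -
 have "norm (A *v x) = L2_set (%i. \<bar>A $ i \<bullet> x\<bar>) UNIV"
  by (simp add: norm_vec_def matrix_vector_mul_component)
 also have "... \<le> L2_set (%i. norm x * norm (A $ i)) UNIV"
  by (intro L2_set_mono) (simp_all add: Cauchy_Schwarz_ineq2 mult.commute[of "norm x"])
 also have "... = norm A * norm x"
  by (subst L2_set_right_distrib[symmetric]) (auto simp: norm_vec_def mult.commute)
 finally show ?thesis .
qed

lemma oscillation_matrix_le_pot:
 fixes u :: "real^'d::finite => real^'n::finite"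
 assumes H: "convex H" "H \<in> sets borel" "x \<in> H" and B: "B \<subseteq> H" "B \<in> sets borel"
  and h: "\<And>w. w \<in> B ==> dist x w < h"
  and u: "\<And>z. z \<in> H ==> (u has_derivative (%v. A z *v v)) (at z)"
  and A: "continuous_on H A"
 shows "(NN w. indicator B w * ennreal (norm (u x - u w)))
    \<le> ennreal h * pot h (%z. indicator H z * ennreal (norm (A z))) x"
 by (rule oscillation_le_pot[OF H B h u])
  (auto intro!: continuous_intros A norm_matrix_vector_mult_le)

section \<open>Weak solutions\<close>

text \<open>The integrals run over the whole space but see f and g only on U, where the test
  functions are supported. Functions on a domain are extended by zero, so that they can be mollified
  everywhere.\<close>

definition weak_grad :: "(real^'d::finite) set => (real^'d => real^'n::finite) => (real^'d => real^'d^'n) => bool" where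
 "weak_grad U f g \<longleftrightarrow> (\<forall>ph i j. test_fun U ph -->
  (INT y. f y $ i * partial j ph y) = - (INT y. g y $ i $ j * ph y))"

text \<open>The mollification of f is differentiable everywhere, with derivative given by
  convolution with D; only the identification with the mollified g needs U. For it the reflected
  kernel y -> rh (x - y) is used as a test function, admissible because its support lies in the ball
  of radius \<open>dt\<close> about x.\<close>

lemma mollify_has_derivative:
 fixes f :: "real^'d::finite => real^'n::finite"
 assumes m: "mollifier dt rh D" and f: "integrable lborel f" and g: "integrable lborel g"
  and w: "weak_grad U f g" and U: "cball x dt \<subseteq> U"
 shows "(mollify rh f has_derivative (%h. mollify rh g x *v h)) (at x)"
proof -
 have comp: "integrable lborel (%y. f y $ i)" for i
  using f by (rule integrable_bounded_linear[OF bounded_linear_vec_nth])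
 obtain M where M: "\<And>x. \<bar>rh x\<bar> \<le> M" using mollifierD(5)[OF m] by blast
 have Dc: "continuous_on UNIV (D j)" and Dz: "norm x \<ge> dt ==> D j x = 0"
  and Dd: "((%t. rh (x + t *R axis j 1)) has_real_derivative D j x) (at 0)" for j x
  using m by (auto simp: mollifier_def)
 have "\<exists>M'\<ge>0. \<forall>x. \<bar>D j x\<bar> \<le> M'" for j
  by (rule compact_support_bounded[OF Dc Dz])
 then obtain M' where M': "\<And>j x. \<bar>D j x\<bar> \<le> M' j" by metis
 define E where "E = (%i j x. INT y. D j (x - y) * f y $ i)"
 have mi: "mollify rh f x $ i = (INT y. rh (x - y) * f y $ i)" for x i
  unfolding mollify_def
  using integral_bounded_linear[OF bounded_linear_vec_nth integrable_mollify_kernel[OF m f, of x], of i]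
  by simp
 have der: "((%t. mollify rh f (y + t *R axis j 1) $ i) has_real_derivative E i j y) (at 0)" for i j y
  unfolding mi E_def
  by (rule kernel_conv_derivative[OF mollifierD(1)[OF m] M Dc M' Dd comp])
 have Ec: "continuous_on UNIV (E i j)" for i j
  unfolding E_def using kernel_conv_continuous[OF Dc M' comp, of j] by simp
 have "(mollify rh f has_derivative (%h. \<chi> i. \<Sum>j\<in>UNIV. h $ j * E i j x)) (at x)"
  by (rule has_derivative_from_partials_vec[OF open_UNIV UNIV_I der Ec])
 moreover have "E i j x = mollify rh g x $ i $ j" for i j
 proof -
  define ph where "ph = (%y. rh (x - y))"
  have sub: "{y. ph y \<noteq> 0} \<subseteq> cball x dt"
   using mollifierD(3)[OF m] by (force simp: ph_def dist_norm)
  then have cl: "closure {y. ph y \<noteq> 0} \<subseteq> cball x dt" by (rule closure_minimal) simp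
  have "compact (closure {y. ph y \<noteq> 0})"
   using bounded_subset[OF bounded_cball sub] by (simp add: compact_closure)
  then have "test_fun U ph"
   using m cl U by (auto simp: test_fun_def mollifier_def ph_def)
  then have eq: "(INT y. f y $ i * partial j ph y) = - (INT y. g y $ i $ j * ph y)"
   using w unfolding weak_grad_def by blast
  have "partial j ph y = - D j (x - y)" for y
  proof -
   have "((%s. rh ((x - y) + s *R axis j 1)) has_real_derivative D j (x - y)) (at (- 0))"
    using Dd[of "x - y" j] by simp
   then have "((%t. rh ((x - y) + (- t) *R axis j 1)) has_real_derivative D j (x - y) * (- 1)) (at 0)"
    by (rule DERIV_chain2[where g="%t. - t"]) (auto intro!: derivative_eq_intros)
   then have "((%t. ph (y + t *R axis j 1)) has_real_derivative - D j (x - y)) (at 0)"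
    by (simp add: ph_def algebra_simps)
   then show ?thesis unfolding partial_def by (rule DERIV_imp_deriv)
  qed
  then have "E i j x = - (INT y. f y $ i * partial j ph y)"
   by (simp add: E_def mult.commute)
  also have "... = (INT y. g y $ i $ j * ph y)" using eq by simp
  also have "... = mollify rh g x $ i $ j"
   unfolding mollify_def ph_def
   using integral_bounded_linear[OF bounded_linear_compose[OF bounded_linear_vec_nth[of j] bounded_linear_vec_nth[of i]] integrable_mollify_kernel[OF m g, of x]]
   by (simp add: mult.commute)
  finally show ?thesis .
 qed
 ultimately show ?thesis
  by (simp add: matrix_vector_mult_def mult.commute)
qed

definition moll :: "nat => real^'d::finite => real" where
 "moll n = (SOME rh. \<exists>D. mollifier (1 / real (Suc n)) rh D)"

lemma moll: "\<exists>D. mollifier (1 / real (Suc n)) (moll n :: real^'d::finite => real) D"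
 unfolding moll_def using someI_ex[OF mollifier_exists[of "1 / real (Suc n)"]] by simp

lemma moll_pint_tendsto:
 fixes f :: "real^'d::finite => 'b::euclidean_space"
 assumes f: "integrable lborel f" and R: "\<And>x. norm x > R ==> f x = 0"
  and fin: "pint p f < \<infinity>" and p: "p \<ge> 1"
 shows "(%n. pint p (%x. mollify (moll n) f x - f x)) ~~> 0"
proof (rule order_tendstoI)
 fix a :: ennreal assume "0 < a"
 then obtain e :: real where e: "e > 0" "ennreal e \<le> a"
  by (metis ennreal_cases ennreal_less_zero_iff order_refl top_greatest zero_less_one)
 obtain dt0 where d: "dt0 > 0" "\<And>dt rh D. dt \<le> dt0 ==> mollifier dt rh D ==> pint p (%x. mollify rh f x - f x) < ennreal e"
  using mollify_Lp_convergence[OF f R fin p e(1)] by blast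
 obtain N where N: "1 / real (Suc N) < dt0" using d(1) nat_approx_posE by blast
 have "pint p (%x. mollify (moll n) f x - f x) < a" if "n \<ge> N" for n
 proof -
  have "1 / real (Suc n) \<le> 1 / real (Suc N)" using that by (intro divide_left_mono) auto
  then show ?thesis using moll[of n] d(2) N e(2) by (meson less_imp_le order_trans less_le_trans)
 qed
 then show "\<forall>\<^sub>F n in sequentially. pint p (%x. mollify (moll n) f x - f x) < a"
  by (auto simp: eventually_sequentially)
qed simp

text \<open>Scaling: with \<open>La\<close> = h^(-d/p) both terms of \<open>pot_le\<close> become
  multiples of h^(d - d/p), so h times the potential is O(h^(1 - d/p)) relative to the volume h^d.
  The threshold depends on g only through the bound P.\<close>

lemma pot_small:
 fixes ck et P p :: real
 assumes p: "p > real DIM('a::euclidean_space)" and "P \<ge> 0" "ck > 0" "et > 0"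
 shows "\<exists>h0>0. \<forall>h. 0 < h \<and> h \<le> h0 --> (\<forall>g :: 'a => 'b::euclidean_space. \<forall>x z :: 'a.
  g \<in> borel_fun --> pint p g \<le> ennreal P -->
  ennreal h * pot h (%z. ennreal (norm (g z))) x \<le> ennreal et * emeasure lborel (ball z (ck * h)))"
proof -
 define d where "d = real DIM('a)"
 have d: "d \<ge> 1" "d < p" using p DIM_positive[where 'a='a] by (auto simp: d_def Suc_le_eq)
 define v where "v = unit_ball_vol d"
 have v: "v > 0" by (simp add: v_def d_def)
 define C where "C = 1 / (1 - d / p)"
 have C: "C > 0" using d by (simp add: C_def)
 define al where "al = 1 - d / p"
 have al: "al > 0" using d by (simp add: al_def)
 \<comment> \<open>The value of h^(1 - d/p) at which the bound equals et times the volume of the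
   ball of radius ck h.\<close>
 define q where "q = et * v * ck ^ DIM('a) / (C * (v + P))"
 have q: "q > 0" using assms v C by (simp add: q_def add_pos_nonneg)
 show ?thesis
 proof (intro exI[of _ "q powr (1 / al)"] conjI allI impI)
  show "q powr (1 / al) > 0" using q by simp
  fix h and g :: "'a => 'b" and x z :: 'a assume h: "0 < h \<and> h \<le> q powr (1 / al)"
   and g: "g \<in> borel_fun" and P: "pint p g \<le> ennreal P"
  define La where "La = h powr (- d / p)"
  have L: "La > 0" using h by (simp add: La_def)
  have "h powr al \<le> (q powr (1 / al)) powr al" using h al by (intro powr_mono2) auto
  then have hq: "h powr al \<le> q" using al q by (simp add: powr_powr)
  have L2: "La powr (1 - p) = La * h ^ DIM('a)"
  proof -
   have "(- d / p) * (1 - p) = - d / p + d" using d by (simp add: field_simps)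
   then have "La powr (1 - p) = h powr (- d / p + d)" by (simp only: La_def powr_powr)
   also have "... = h powr (- d / p) * h powr d" by (rule powr_add)
   also have "h powr d = h ^ DIM('a)" using h by (simp add: d_def powr_realpow)
   finally show ?thesis by (simp only: La_def)
  qed
  have "ennreal h * pot h (%z. ennreal (norm (g z))) x \<le> ennreal h * (ennreal C *
   (ennreal (La * v * h ^ DIM('a)) + ennreal (La powr (1 - p)) * pint p g))"
   using pot_le[OF g p L] h by (intro mult_left_mono) (auto simp: C_def d_def v_def)
  also have "... \<le> ennreal h * (ennreal C * (ennreal (La * v * h ^ DIM('a)) + ennreal (La powr (1 - p)) * ennreal P))"
   by (intro mult_left_mono add_left_mono P) auto
  also have "... = ennreal (h * (C * (La * v * h ^ DIM('a) + La powr (1 - p) * P)))"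
   using h C L v \<open>P \<ge> 0\<close> by (simp add: ennreal_mult' ennreal_plus)
  also have "h * (C * (La * v * h ^ DIM('a) + La powr (1 - p) * P)) = h powr al * (C * (v + P)) * h ^ DIM('a)"
  proof -
   have "h powr al = h powr (1 + (- d / p))" by (simp add: al_def)
   also have "... = h powr 1 * h powr (- d / p)" by (rule powr_add)
   also have "... = h * La" using h by (simp add: La_def)
   finally show ?thesis by (simp add: L2 algebra_simps)
  qed
  also have "ennreal ... \<le> ennreal (q * (C * (v + P)) * h ^ DIM('a))"
   using hq C v \<open>P \<ge> 0\<close> h by (intro ennreal_leI mult_right_mono) auto
  also have "q * (C * (v + P)) = et * v * ck ^ DIM('a)"
   using C v \<open>P \<ge> 0\<close> by (simp add: q_def)
  also have "ennreal (et * v * ck ^ DIM('a) * h ^ DIM('a)) = ennreal et * emeasure lborel (ball z (ck * h))"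
   using assms h v by (simp add: emeasure_ball v_def d_def ennreal_mult'[symmetric] power_mult_distrib mult_ac)
  finally show "ennreal h * pot h (%z. ennreal (norm (g z))) x \<le> ennreal et * emeasure lborel (ball z (ck * h))" .
 qed
qed

text \<open>For fixed h the choice of \<open>La\<close> makes the volume term equal to et, at the
  price of the constant K. So when the p-th powers of a sequence tend to 0, its potentials tend to 0
  uniformly in x.\<close>

lemma pot_small_fixed:
 fixes h p :: real
 assumes p: "p > real DIM('a::euclidean_space)" and h: "h > 0"
 shows "\<exists>C>0. \<forall>et>0. \<exists>K>0. \<forall>g :: 'a => 'b::euclidean_space. \<forall>x. g \<in> borel_fun -->
  ennreal h * pot h (%z. ennreal (norm (g z))) x \<le> ennreal C * (ennreal et + ennreal K * pint p g)"
proof -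
 define d where "d = real DIM('a)"
 have d: "d \<ge> 1" "d < p" using p DIM_positive[where 'a='a] by (auto simp: d_def Suc_le_eq)
 define v where "v = unit_ball_vol d"
 have v: "v > 0" by (simp add: v_def d_def)
 define C where "C = 1 / (1 - d / p)"
 have C: "C > 0" using d by (simp add: C_def)
 have "\<exists>K>0. \<forall>g :: 'a => 'b. \<forall>x. g \<in> borel_fun -->
  ennreal h * pot h (%z. ennreal (norm (g z))) x \<le> ennreal (h * C) * (ennreal et + ennreal K * pint p g)"
  if et: "et > 0" for et :: real
 proof -
  define La where "La = et / (v * h ^ DIM('a))"
  have L: "La > 0" using et v h by (simp add: La_def)
  have "ennreal h * pot h (%z. ennreal (norm (g z))) x \<le> ennreal (h * C) * (ennreal et + ennreal (La powr (1 - p)) * pint p g)"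
   if g: "g \<in> borel_fun" for g :: "'a => 'b" and x
  proof -
   have "ennreal h * pot h (%z. ennreal (norm (g z))) x \<le> ennreal h * (ennreal C *
    (ennreal (La * v * h ^ DIM('a)) + ennreal (La powr (1 - p)) * pint p g))"
    using pot_le[OF g p L h] by (intro mult_left_mono) (auto simp: C_def d_def v_def)
   also have "La * v * h ^ DIM('a) = et" using v h by (simp add: La_def)
   finally show ?thesis
    using h C by (simp add: ennreal_mult' mult.assoc)
  qed
  moreover have "La powr (1 - p) > 0" using L by simp
  ultimately show ?thesis by blast
 qed
 moreover have "h * C > 0" using h C by simp
 ultimately show ?thesis by blast
qed

text \<open>Subtraction in \<open>ennreal\<close> is truncated, so f - F is the positive part of the
  difference. It is bounded by every e n, hence has integral 0. Convergence of the errors in L^1 is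
  enough, with no passage to a subsequence.\<close>

lemma AE_le_of_null_error:
 fixes f F :: "'a => ennreal"
 assumes [measurable]: "f \<in> borel_measurable M" "F \<in> borel_measurable M" "\<And>n. e n \<in> borel_measurable M"
  and le: "\<And>n. AE x in M. f x \<le> F x + e n x" and fin: "\<And>x. f x < \<infinity>"
  and lim: "(%n. \<integral>\<^sup>+x. e n x \<partial>M) ~~> 0"
 shows "AE x in M. f x \<le> F x"
proof -
 have "(\<integral>\<^sup>+x. f x - F x \<partial>M) \<le> (\<integral>\<^sup>+x. e n x \<partial>M)" for n
 proof (rule nn_integral_mono_AE)
  show "AE x in M. f x - F x \<le> e n x"
   using le[of n]
  proof eventually_elim
   case (elim x)
   then show ?case using fin[of x] by (subst ennreal_minus_le_iff) auto
  qed
 qed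
 then have "(\<integral>\<^sup>+x. f x - F x \<partial>M) \<le> 0"
  by (intro LIMSEQ_le_const[OF lim]) auto
 then have "(\<integral>\<^sup>+x. f x - F x \<partial>M) = 0" by simp
 then have "AE x in M. f x - F x = 0" by (subst (asm) nn_integral_0_iff_AE) auto
 then show ?thesis
 proof eventually_elim
  case (elim x)
  then have "f x - F x \<le> 0" by simp
  then show ?case using fin[of x] by (subst (asm) ennreal_minus_le_iff) auto
 qed
qed

lemma pot_eq_0:
 assumes [measurable]: "g \<in> borel_fun" and "(NN x. g x) = 0"
 shows "pot h g x = 0"
proof -
 have "(NN w. (if dist x w < h * s then g w else 0)) \<le> (NN w. g w)" for s
  by (intro nn_integral_mono) auto
 then have "(NN w. (if dist x w < h * s then g w else 0)) = 0" for s
  using assms(2) by (metis le_zero_eq)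
 then show ?thesis by (simp add: pot_def)
qed

lemma pot_mono_AE:
 assumes "AE z in lborel. g z \<le> g' z"
 shows "pot h g x \<le> pot h g' x"
 unfolding pot_def
proof (rule nn_integral_mono, rule mult_left_mono, rule nn_integral_mono_AE)
 fix s show "AE w in lborel. (if dist x w < h * s then g w else 0) \<le> (if dist x w < h * s then g' w else 0)"
  using assms by eventually_elim auto
qed auto

lemma norm_mollify_osc:
 fixes f :: "real^'d::finite => real^'n::finite"
 assumes f: "integrable lborel f" and g: "integrable lborel g" and w: "weak_grad U f g"
  and U: "\<And>x. x \<in> ball z r ==> cball x (1 / real (Suc n)) \<subseteq> U" and x: "x \<in> ball z r"
 shows "(NN y. indicator (ball z r) y * ennreal (norm (mollify (moll n) f x - mollify (moll n) f y)))
  \<le> ennreal (2 * r) * pot (2 * r) (%y. indicator (ball z r) y * ennreal (norm (mollify (moll n) g y))) x"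
proof -
 obtain D where m: "mollifier (1 / real (Suc n)) (moll n :: real^'d => real) D" using moll by blast
 show ?thesis
 proof (rule oscillation_matrix_le_pot)
  show "dist x y < 2 * r" if "y \<in> ball z r" for y
   using that x dist_triangle3[of x y z] by auto
  show "(mollify (moll n) f has_derivative (*v) (mollify (moll n) g y)) (at y)" if "y \<in> ball z r" for y
   by (rule mollify_has_derivative[OF m f g w U[OF that]])
  show "continuous_on (ball z r) (mollify (moll n) g)"
   using continuous_on_subset[OF mollify_continuous[OF m g]] by auto
 qed (use x in auto)
qed

text \<open>The limit of the oscillation estimate is V |f| \<le> a + 2r pot(|g|) almost everywhere,
  with V the volume of the ball and a the L^1 norm of f. Let q be the excess of V |f| over 2a. Since
  |g| \<le> b |f| and the potential of b is small, q \<le> (2r/V) pot(b q). Integrating against b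
  and using symmetry gives I \<le> I/2 for the integral I of b q, which is finite because b |f| is
  integrable. Hence I = 0, so q vanishes and |f| \<le> 2a/V.\<close>

lemma weak_solution_locally_bounded:
 fixes f :: "real^'d::finite => real^'n::finite" and b :: "real^'d => real"
 assumes f: "integrable lborel f" and g: "integrable lborel g" and w: "weak_grad U f g"
  and R: "\<And>x. norm x > R ==> f x = 0" "\<And>x. norm x > R ==> g x = 0"
  and U: "cball z (2 * r) \<subseteq> U" and r: "r > 0"
  and [measurable]: "b \<in> borel_fun" and b0: "\<And>x. b x \<ge> 0"
  and gb: "\<And>x. norm (g x) \<le> b x * norm (f x)"
  and bf: "(NN x. ennreal (b x * norm (f x))) < \<infinity>"
  and small: "\<And>x. ennreal (2 * r) * pot (2 * r) (%y. indicator (ball z r) y * ennreal (b y)) x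
         \<le> ennreal (1 / 2) * emeasure lborel (ball z r)"
 shows "\<exists>C. AE x in lborel. x \<in> ball z r --> norm (f x) \<le> C"
proof -
 let ?B = "ball z r" and ?h = "2 * r"
 have [measurable]: "f \<in> borel_fun" "g \<in> borel_fun" using f g by auto
 define V where "V = measure lborel ?B"
 have V: "V > 0" "emeasure lborel ?B = ennreal V"
  using r content_ball_pos[of r z] emeasure_eq_ennreal_measure[of lborel ?B] emeasure_lborel_ball_finite[of z r]
  by (auto simp: V_def)
 define F where "F = (%n. mollify (moll n) f)"
 define G where "G = (%n. mollify (moll n) g)"
 have FG[measurable]: "F n \<in> borel_fun" "G n \<in> borel_fun" for n
  using moll[of n, where 'd='d] mollify_continuous f g unfolding F_def G_def
  by (meson borel_measurable_continuous_onI)+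
 have p1: "pint 1 ph = (NN x. ennreal (norm (ph x)))" for ph :: "real^'d => 'z::real_normed_vector"
  by (simp add: pint_def)
 have pf: "pint 1 f < \<infinity>" "pint 1 g < \<infinity>"
  using f g by (auto simp: p1 integrable_iff_bounded)
 have Fl: "(%n. pint 1 (%x. F n x - f x)) ~~> 0" and Gl: "(%n. pint 1 (%x. G n x - g x)) ~~> 0"
  unfolding F_def G_def using moll_pint_tendsto[OF f R(1) pf(1)] moll_pint_tendsto[OF g R(2) pf(2)] by auto
 obtain n0 where n0: "1 / real (Suc n0) < r" using r nat_approx_posE by blast
 have Un: "cball x (1 / real (Suc n)) \<subseteq> U" if "x \<in> ?B" "n \<ge> n0" for x n
 proof -
  have "1 / real (Suc n) \<le> 1 / real (Suc n0)" using that by (intro divide_left_mono) auto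
  then have "cball x (1 / real (Suc n)) \<subseteq> cball z (2 * r)"
   using that n0 by (intro cball_subset_cball_iff[THEN iffD2] disjI1) (auto simp: dist_commute)
  then show ?thesis using U by auto
 qed
 define i where "i = (%y. indicator ?B y :: ennreal)"
 have [measurable]: "i \<in> borel_fun" unfolding i_def by (intro borel_measurable_indicator) simp
 define a where "a = pint 1 f"
 have a: "a < \<infinity>" using pf by (simp add: a_def)
 \<comment> \<open>The last bracket collects the errors of mollification, whose integrals over the
   ball tend to 0.\<close>
 have main: "ennreal V * ennreal (norm (f x)) * i x \<le>
   (a + ennreal ?h * pot ?h (%y. i y * ennreal (norm (g y))) x) +
   (ennreal V * ennreal (norm (F n x - f x)) + pint 1 (%x. F n x - f x)
    + ennreal ?h * (i x * pot ?h (%y. i y * ennreal (norm (G n y - g y))) x))" if n: "n \<ge> n0" for n x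
 proof (cases "x \<in> ?B")
  case True
  have osc: "(NN y. i y * ennreal (norm (F n x - F n y))) \<le> ennreal ?h * pot ?h (%y. i y * ennreal (norm (G n y))) x"
   unfolding F_def G_def i_def by (rule norm_mollify_osc[OF f g w Un[OF _ n] True])
  have "ennreal V * ennreal (norm (F n x)) = (NN y. ennreal (norm (F n x)) * i y)"
   by (simp add: i_def nn_integral_cmult_indicator V mult.commute)
  also have "... \<le> (NN y. i y * ennreal (norm (F n x - F n y)) + ennreal (norm (F n y - f y)) + ennreal (norm (f y)))"
  proof (rule nn_integral_mono)
   fix y
   have "norm (F n x) \<le> norm (F n x - F n y) + norm (F n y - f y) + norm (f y)"
    using norm_triangle_ineq[of "F n x - F n y" "F n y"] norm_triangle_ineq[of "F n y - f y" "f y"] by simp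
   then show "ennreal (norm (F n x)) * i y \<le> i y * ennreal (norm (F n x - F n y)) + ennreal (norm (F n y - f y)) + ennreal (norm (f y))"
    by (auto simp: i_def indicator_def ennreal_plus[symmetric] ennreal_leI simp del: ennreal_plus)
  qed
  also have "... = (NN y. i y * ennreal (norm (F n x - F n y))) + pint 1 (%x. F n x - f x) + a"
   by (simp add: nn_integral_add p1 a_def)
  also have "... \<le> ennreal ?h * pot ?h (%y. i y * ennreal (norm (G n y))) x + pint 1 (%x. F n x - f x) + a"
   by (intro add_right_mono osc)
  finally have 1: "ennreal V * ennreal (norm (F n x)) \<le> ..." .
  have "pot ?h (%y. i y * ennreal (norm (G n y))) x \<le> pot ?h (%y. i y * ennreal (norm (G n y - g y)) + i y * ennreal (norm (g y))) x"
  proof (rule pot_mono)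
   fix y
   have "norm (G n y) \<le> norm (G n y - g y) + norm (g y)"
    using norm_triangle_ineq[of "G n y - g y" "g y"] by simp
   then show "i y * ennreal (norm (G n y)) \<le> i y * ennreal (norm (G n y - g y)) + i y * ennreal (norm (g y))"
    by (auto simp: i_def indicator_def ennreal_plus[symmetric] ennreal_leI simp del: ennreal_plus)
  qed
  also have "... = pot ?h (%y. i y * ennreal (norm (G n y - g y))) x + pot ?h (%y. i y * ennreal (norm (g y))) x"
   by (rule pot_add) measurable
  finally have 2: "ennreal ?h * pot ?h (%y. i y * ennreal (norm (G n y))) x \<le>
   ennreal ?h * pot ?h (%y. i y * ennreal (norm (G n y - g y))) x + ennreal ?h * pot ?h (%y. i y * ennreal (norm (g y))) x"
   by (simp only: distrib_left[symmetric]) (rule mult_left_mono, auto)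
  have "norm (f x) \<le> norm (F n x - f x) + norm (F n x)"
   using norm_triangle_ineq4[of "F n x" "F n x - f x"] by simp
  then have "ennreal V * ennreal (norm (f x)) \<le> ennreal V * (ennreal (norm (F n x - f x)) + ennreal (norm (F n x)))"
   by (intro mult_left_mono) (auto simp: ennreal_plus[symmetric] ennreal_leI simp del: ennreal_plus)
  also have "... \<le> ennreal V * ennreal (norm (F n x - f x)) +
   ((ennreal ?h * pot ?h (%y. i y * ennreal (norm (G n y - g y))) x + ennreal ?h * pot ?h (%y. i y * ennreal (norm (g y))) x)
    + pint 1 (%x. F n x - f x) + a)"
   unfolding distrib_left by (intro add_left_mono order_trans[OF 1] add_right_mono 2)
  finally show ?thesis using True by (simp add: i_def add_ac)
 qed (simp add: i_def)
 \<comment> \<open>The potential of the indicator of the ball is bounded. By symmetry this turns the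
   potential of the error |G n - g| into a multiple of its L^1 norm. The exponent only has to exceed
   the dimension.\<close>
 obtain C where C: "\<And>x. ennreal ?h * pot ?h (%y. i y) x \<le> ennreal C" "C \<ge> 0"
 proof -
  define p where "p = real CARD('d) + 1"
  have "p > real DIM(real^'d)" by (simp add: p_def)
  from pot_small_fixed[where 'a="real^'d" and 'b=real and h="?h", OF this] r obtain C0
   where C0: "C0 > 0" and "\<forall>et>0. \<exists>K>0. \<forall>g :: real^'d => real. \<forall>x. g \<in> borel_fun -->
    ennreal ?h * pot ?h (%z. ennreal (norm (g z))) x \<le> ennreal C0 * (ennreal et + ennreal K * pint p g)"
   by auto
  then obtain K where K: "K > 0" "\<And>g :: real^'d => real. \<And>x. g \<in> borel_fun ==>
    ennreal ?h * pot ?h (%z. ennreal (norm (g z))) x \<le> ennreal C0 * (ennreal 1 + ennreal K * pint p g)"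
   using zero_less_one by blast
  have pi: "pint p (indicator ?B :: real^'d => real) \<le> ennreal (1 powr p) * emeasure lborel ?B"
   by (rule pint_bounded_le) (auto simp: p_def indicator_def)
  have "ennreal ?h * pot ?h (%y. i y) x \<le> ennreal (C0 * (1 + K * V))" for x
  proof -
   have "ennreal ?h * pot ?h (%y. i y) x = ennreal ?h * pot ?h (%y. ennreal (norm (indicator ?B y :: real))) x"
    by (simp add: i_def ennreal_indicator)
   also have "... \<le> ennreal C0 * (ennreal 1 + ennreal K * pint p (indicator ?B :: real^'d => real))"
    by (intro K(2) borel_measurable_indicator) simp
   also have "... \<le> ennreal C0 * (ennreal 1 + ennreal K * ennreal V)"
    using pi V by (intro mult_left_mono add_left_mono) auto
   also have "... = ennreal (C0 * (1 + K * V))"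
    using C0 K(1) V by (simp add: ennreal_mult' ennreal_plus)
   finally show ?thesis .
  qed
  moreover have "C0 * (1 + K * V) \<ge> 0" using C0 K(1) V by simp
  ultimately show ?thesis using that by blast
 qed
 have X: "AE x in lborel. ennreal V * ennreal (norm (f x)) * i x \<le> a + ennreal ?h * pot ?h (%y. i y * ennreal (norm (g y))) x"
 proof (rule AE_le_of_null_error[where e="%n x. ennreal V * ennreal (norm (F (n + n0) x - f x)) * 1 + pint 1 (%x. F (n + n0) x - f x) * i x
    + ennreal ?h * (i x * pot ?h (%y. i y * ennreal (norm (G (n + n0) y - g y))) x)"])
  show "AE x in lborel. ennreal V * ennreal (norm (f x)) * i x \<le>
   (a + ennreal ?h * pot ?h (%y. i y * ennreal (norm (g y))) x) +
   (ennreal V * ennreal (norm (F (n + n0) x - f x)) * 1 + pint 1 (%x. F (n + n0) x - f x) * i x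
    + ennreal ?h * (i x * pot ?h (%y. i y * ennreal (norm (G (n + n0) y - g y))) x))" for n
  proof (rule AE_I2)
   fix x
   show "ennreal V * ennreal (norm (f x)) * i x \<le>
   (a + ennreal ?h * pot ?h (%y. i y * ennreal (norm (g y))) x) +
   (ennreal V * ennreal (norm (F (n + n0) x - f x)) * 1 + pint 1 (%x. F (n + n0) x - f x) * i x
    + ennreal ?h * (i x * pot ?h (%y. i y * ennreal (norm (G (n + n0) y - g y))) x))"
    using main[of "n + n0" x] by (cases "x \<in> ?B") (auto simp: i_def)
  qed
  show "ennreal V * ennreal (norm (f x)) * i x < \<infinity>" for x
   by (auto simp: i_def indicator_def ennreal_mult'[symmetric] ennreal_mult_less_top)
  have eb: "(NN x. ennreal V * ennreal (norm (F n x - f x)) * 1 + pint 1 (%x. F n x - f x) * i x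
    + ennreal ?h * (i x * pot ?h (%y. i y * ennreal (norm (G n y - g y))) x))
   \<le> ennreal V * pint 1 (%x. F n x - f x) + pint 1 (%x. F n x - f x) * ennreal V + ennreal C * pint 1 (%x. G n x - g x)" for n
  proof -
   have "(NN x. i x * pot ?h (%y. i y * ennreal (norm (G n y - g y))) x) =
    (NN x. i x * ennreal (norm (G n x - g x)) * pot ?h i x)"
    by (rule pot_symmetric) measurable
   then have "ennreal ?h * (NN x. i x * pot ?h (%y. i y * ennreal (norm (G n y - g y))) x) =
    (NN x. ennreal ?h * (i x * ennreal (norm (G n x - g x)) * pot ?h i x))"
    by (simp only:) (rule nn_integral_cmult[symmetric], measurable)
   also have "... \<le> (NN x. ennreal C * ennreal (norm (G n x - g x)))"
   proof (rule nn_integral_mono)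
    fix x
    have "ennreal (norm (G n x - g x)) * (ennreal ?h * pot ?h i x) \<le> ennreal (norm (G n x - g x)) * ennreal C"
     using C(1) by (intro mult_left_mono) auto
    then show "ennreal ?h * (i x * ennreal (norm (G n x - g x)) * pot ?h i x) \<le> ennreal C * ennreal (norm (G n x - g x))"
     by (auto simp: i_def indicator_def mult_ac)
   qed
   also have "... = ennreal C * pint 1 (%x. G n x - g x)"
    unfolding p1 by (rule nn_integral_cmult) measurable
   finally have 3: "ennreal ?h * (NN x. i x * pot ?h (%y. i y * ennreal (norm (G n y - g y))) x) \<le> ennreal C * pint 1 (%x. G n x - g x)" .
   have "(NN x. i x) = ennreal V" using V by (simp add: i_def)
   then show ?thesis
    using 3 by (simp add: nn_integral_add nn_integral_cmult p1 add_left_mono)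
  qed
  have bl: "(%n. ennreal V * pint 1 (%x. F n x - f x) + pint 1 (%x. F n x - f x) * ennreal V + ennreal C * pint 1 (%x. G n x - g x)) ~~> ennreal V * 0 + 0 * ennreal V + ennreal C * 0"
   using Fl Gl by (intro tendsto_add tendsto_mult_ennreal tendsto_const) auto
  then have "(%n. (NN x. ennreal V * ennreal (norm (F n x - f x)) * 1 + pint 1 (%x. F n x - f x) * i x
    + ennreal ?h * (i x * pot ?h (%y. i y * ennreal (norm (G n y - g y))) x))) ~~> 0"
   by (intro tendsto_sandwich[OF _ _ tendsto_const bl[simplified]] always_eventually allI) (use eb in auto)
  then show "(%n. (NN x. ennreal V * ennreal (norm (F (n + n0) x - f x)) * 1 + pint 1 (%x. F (n + n0) x - f x) * i x
    + ennreal ?h * (i x * pot ?h (%y. i y * ennreal (norm (G (n + n0) y - g y))) x))) ~~> 0"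
   by (rule LIMSEQ_ignore_initial_segment)
 qed measurable
 \<comment> \<open>The threshold is 2a and not a: one a is the constant in \<open>X\<close>, the
   other absorbs the contribution of the part of V |f| below the threshold, which is at most a
   because the potential of b is at most V/2.\<close>
 define q where "q = (%x. ennreal V * ennreal (norm (f x)) * i x - 2 * a)"
 have [measurable]: "q \<in> borel_fun" unfolding q_def by measurable
 define be where "be = (%y. i y * ennreal (b y))"
 have [measurable]: "be \<in> borel_fun" unfolding be_def by measurable
 define iv where "iv = ennreal (1 / V)"
 have iv: "iv * ennreal V = 1" using V by (simp add: iv_def ennreal_mult'[symmetric])
 have q1: "ennreal V * ennreal (norm (f x)) * i x \<le> 2 * a + q x" for x
  unfolding q_def using a
  by (metis (no_types, lifting) add_diff_inverse_ennreal diff_add_cancel_ennreal ennreal_minus_le_iff le_add_diff_inverse linorder_linear order_refl add.commute add_increasing2 zero_le)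
 have pb: "ennreal ?h * pot ?h be x \<le> ennreal (1 / 2) * ennreal V" for x
  using small[of x] by (simp add: be_def i_def V)
 have half: "2 * ennreal (1 / 2) = (1::ennreal)"
  by (metis ennreal_1 ennreal_mult' ennreal_numeral field_sum_of_halves mult_2 zero_le_numeral)
 have pg: "ennreal ?h * pot ?h (%y. i y * ennreal (norm (g y))) x \<le> a + iv * (ennreal ?h * pot ?h (%y. be y * q y) x)" for x
 proof -
  have "pot ?h (%y. i y * ennreal (norm (g y))) x \<le> pot ?h (%y. iv * (2 * a) * be y + iv * (be y * q y)) x"
  proof (rule pot_mono)
   fix y
   show "i y * ennreal (norm (g y)) \<le> iv * (2 * a) * be y + iv * (be y * q y)"
   proof (cases "y \<in> ?B")
    case True
    have "ennreal (norm (g y)) \<le> ennreal (b y) * ennreal (norm (f y))"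
     using gb[of y] b0[of y] by (simp add: ennreal_mult'[symmetric] ennreal_leI)
    also have "... = ennreal (b y) * (iv * (ennreal V * ennreal (norm (f y)) * i y))"
     using True by (simp add: mult.assoc[symmetric] iv i_def)
    also have "... \<le> ennreal (b y) * (iv * (2 * a + q y))"
     by (intro mult_left_mono q1) auto
    finally show ?thesis using True by (simp add: i_def be_def distrib_left mult_ac)
   qed (simp add: i_def)
  qed
  also have "... = iv * (2 * a) * pot ?h be x + iv * pot ?h (%y. be y * q y) x"
   by (subst pot_add) (auto simp: pot_cmult)
  finally have "ennreal ?h * pot ?h (%y. i y * ennreal (norm (g y))) x
   \<le> ennreal ?h * (iv * (2 * a) * pot ?h be x + iv * pot ?h (%y. be y * q y) x)"
   by (rule mult_left_mono) simp
  also have "... = iv * (2 * a) * (ennreal ?h * pot ?h be x) + iv * (ennreal ?h * pot ?h (%y. be y * q y) x)"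
   by (simp only: distrib_left mult_ac)
  also have "... \<le> iv * (2 * a) * (ennreal (1 / 2) * ennreal V) + iv * (ennreal ?h * pot ?h (%y. be y * q y) x)"
   by (intro add_right_mono mult_left_mono pb) auto
  also have "iv * (2 * a) * (ennreal (1 / 2) * ennreal V) = (iv * ennreal V) * (2 * ennreal (1 / 2)) * a"
   by (simp only: mult_ac)
  also have "... = a" by (simp only: iv half mult_1)
  finally show ?thesis .
 qed
 have qAE: "AE x in lborel. q x \<le> iv * (ennreal ?h * pot ?h (%y. be y * q y) x)"
  using X
 proof eventually_elim
  case (elim x)
  have "ennreal V * ennreal (norm (f x)) * i x \<le> a + (a + iv * (ennreal ?h * pot ?h (%y. be y * q y) x))"
   by (rule order_trans[OF elim add_left_mono[OF pg]])
  also have "... = iv * (ennreal ?h * pot ?h (%y. be y * q y) x) + 2 * a"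
   by (simp only: mult_2 add_ac)
  finally show ?case
   unfolding q_def using a by (subst ennreal_minus_le_iff) (auto simp: ennreal_mult_eq_top_iff add.commute)
 qed
 define I where "I = (NN x. be x * q x)"
 have Ifin: "I < \<infinity>"
 proof -
  have "I \<le> (NN x. ennreal V * ennreal (b x * norm (f x)))"
   unfolding I_def
  proof (rule nn_integral_mono)
   fix x
   have "q x \<le> ennreal V * ennreal (norm (f x)) * i x" unfolding q_def by (rule diff_le_self_ennreal)
   then have "be x * q x \<le> be x * (ennreal V * ennreal (norm (f x)) * i x)" by (rule mult_left_mono) simp
   also have "... \<le> ennreal V * ennreal (b x * norm (f x))"
    using b0[of x] by (auto simp: be_def i_def indicator_def ennreal_mult' mult_ac)
   finally show "be x * q x \<le> ennreal V * ennreal (b x * norm (f x))" .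
  qed
  also have "... = ennreal V * (NN x. ennreal (b x * norm (f x)))"
   by (rule nn_integral_cmult) measurable
  also have "... < \<infinity>" using bf by (simp add: ennreal_mult_less_top)
  finally show ?thesis .
 qed
 have "I \<le> ennreal (1 / 2) * I"
 proof -
  have "I \<le> (NN x. be x * (iv * (ennreal ?h * pot ?h (%y. be y * q y) x)))"
   unfolding I_def
  proof (rule nn_integral_mono_AE)
   show "AE x in lborel. be x * q x \<le> be x * (iv * (ennreal ?h * pot ?h (%y. be y * q y) x))"
    using qAE by eventually_elim (rule mult_left_mono, auto)
  qed
  also have "... = (NN x. (iv * ennreal ?h) * (be x * pot ?h (%y. be y * q y) x))"
   by (simp only: mult_ac)
  also have "... = (iv * ennreal ?h) * (NN x. be x * pot ?h (%y. be y * q y) x)"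
   by (rule nn_integral_cmult) measurable
  also have "(NN x. be x * pot ?h (%y. be y * q y) x) = (NN x. (be x * q x) * pot ?h be x)"
   by (rule pot_symmetric) measurable
  also have "(iv * ennreal ?h) * ... = (NN x. (iv * ennreal ?h) * ((be x * q x) * pot ?h be x))"
   by (rule nn_integral_cmult[symmetric]) measurable
  also have "... \<le> (NN x. ennreal (1 / 2) * (be x * q x))"
  proof (rule nn_integral_mono)
   fix x
   have "(iv * ennreal ?h) * ((be x * q x) * pot ?h be x) = iv * (be x * q x) * (ennreal ?h * pot ?h be x)"
    by (simp only: mult_ac)
   also have "... \<le> iv * (be x * q x) * (ennreal (1 / 2) * ennreal V)"
    by (intro mult_left_mono pb) auto
   also have "... = (iv * ennreal V) * (ennreal (1 / 2) * (be x * q x))" by (simp only: mult_ac)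
   also have "... = ennreal (1 / 2) * (be x * q x)" by (simp only: iv mult_1)
   finally show "(iv * ennreal ?h) * ((be x * q x) * pot ?h be x) \<le> ennreal (1 / 2) * (be x * q x)" .
  qed
  also have "... = ennreal (1 / 2) * I" unfolding I_def by (rule nn_integral_cmult) measurable
  finally show ?thesis .
 qed
 then have "I = 0"
 proof (cases I)
  case (real s)
  have "ennreal (1 / 2) * ennreal s = ennreal (1 / 2 * s)" by (rule ennreal_mult'[symmetric]) simp
  then have "ennreal s \<le> ennreal (1 / 2 * s)" using \<open>I \<le> _\<close> real by (simp only:)
  then have "s \<le> 1 / 2 * s" using real by (subst (asm) ennreal_le_iff) auto
  then show ?thesis using real by simp
 qed (use Ifin in simp)
 then have "pot ?h (%y. be y * q y) x = 0" for x
  unfolding I_def by (intro pot_eq_0) auto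
 with qAE have "AE x in lborel. q x \<le> 0" by simp
 obtain a' where a': "a = ennreal a'" "a' \<ge> 0" using a by (cases a) auto
 have "AE x in lborel. x \<in> ?B --> norm (f x) \<le> 2 * a' / V"
  using \<open>AE x in lborel. q x \<le> 0\<close>
 proof eventually_elim
  case (elim x)
  have "ennreal V * ennreal (norm (f x)) * i x \<le> 2 * a + 0" using order_trans[OF q1 add_left_mono[OF elim]] .
  also have "... = ennreal (2 * a')" using a' by (simp add: ennreal_mult')
  finally have "ennreal V * ennreal (norm (f x)) * i x \<le> ennreal (2 * a')" .
  then have "x \<in> ?B ==> ennreal (V * norm (f x)) \<le> ennreal (2 * a')"
   using V by (simp add: i_def ennreal_mult')
  then show ?case using V a' by (auto simp: ennreal_le_iff field_simps)
 qed
 then show ?thesis by blast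
qed

section \<open>Continuity and unique continuation for weak solutions\<close>

locale weak_solution =
 fixes U :: "(real^'d::finite) set" and f :: "real^'d => real^'n::finite" and g :: "real^'d => real^'d^'n"
  and b :: "real^'d => real" and p R :: real
 assumes openU: "open U" and f_int: "integrable lborel f" and g_int: "integrable lborel g"
  and f_out: "\<And>x. norm x > R ==> f x = 0" and g_out: "\<And>x. norm x > R ==> g x = 0"
  and weak: "weak_grad U f g"
  and b_meas [measurable]: "b \<in> borel_fun" and b_nonneg: "\<And>x. b x \<ge> 0"
  and g_le: "\<And>x. norm (g x) \<le> b x * norm (f x)"
  and bf_int: "(NN x. ennreal (b x * norm (f x))) < \<infinity>"
  and b_Lp: "pint p b < \<infinity>" and p_gt: "p > real CARD('d)"
begin

lemma p_ge1: "p \<ge> 1"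
proof -
 have "real CARD('d) \<ge> 1" by (simp add: Suc_le_eq)
 then show ?thesis using p_gt by linarith
qed

lemma fg_meas [measurable]: "f \<in> borel_fun" "g \<in> borel_fun"
 using f_int g_int by auto

definition F :: "nat => real^'d => real^'n" where "F n = mollify (moll n) f"
definition G :: "nat => real^'d => real^'d^'n" where "G n = mollify (moll n) g"

lemma F_cont: "continuous_on UNIV (F n)" and G_cont: "continuous_on UNIV (G n)"
 using moll[of n, where 'd='d] mollify_continuous f_int g_int unfolding F_def G_def by blast+

lemma FG_meas [measurable]: "F n \<in> borel_fun" "G n \<in> borel_fun"
 using F_cont G_cont by (auto intro: borel_measurable_continuous_onI)

lemma F_L1: "(%n. pint 1 (%x. F n x - f x)) ~~> 0"
proof -
 have "pint 1 f < \<infinity>" using f_int by (auto simp: pint_def integrable_iff_bounded)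
 then show ?thesis unfolding F_def using moll_pint_tendsto[OF f_int f_out] by auto
qed

lemma F_deriv: "cball x (1 / real (Suc n)) \<subseteq> U ==> (F n has_derivative (%h. G n x *v h)) (at x)"
 using moll[of n, where 'd='d] mollify_has_derivative[OF _ f_int g_int weak] unfolding F_def G_def by blast

text \<open>The threshold is uniform in the point and in S, since restricting b to S only decreases
  its L^p norm.\<close>

lemma b_small:
 assumes "ck > 0" "et > 0"
 shows "\<exists>h0>0. \<forall>h. 0 < h \<and> h \<le> h0 --> (\<forall>S\<in>sets borel. \<forall>x z :: real^'d.
  ennreal h * pot h (%y. indicator S y * ennreal (b y)) x \<le> ennreal et * emeasure lborel (ball z (ck * h)))"
proof -
 obtain P where P: "pint p b = ennreal P" "P \<ge> 0" using b_Lp by (cases "pint p b") auto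
 have "\<exists>h0>0. \<forall>h. 0 < h \<and> h \<le> h0 --> (\<forall>g :: real^'d => real. \<forall>x z :: real^'d.
  g \<in> borel_fun --> pint p g \<le> ennreal P -->
  ennreal h * pot h (%z. ennreal (norm (g z))) x \<le> ennreal et * emeasure lborel (ball z (ck * h)))"
  by (rule pot_small) (use p_gt P assms in auto)
 then obtain h0 where h0: "h0 > 0" and H: "\<forall>h. 0 < h \<and> h \<le> h0 --> (\<forall>g :: real^'d => real. \<forall>x z :: real^'d.
  g \<in> borel_fun --> pint p g \<le> ennreal P -->
  ennreal h * pot h (%z. ennreal (norm (g z))) x \<le> ennreal et * emeasure lborel (ball z (ck * h)))"
  by (elim exE conjE)
 have "ennreal h * pot h (%y. indicator S y * ennreal (b y)) x \<le> ennreal et * emeasure lborel (ball z (ck * h))"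
  if h: "0 < h \<and> h \<le> h0" and S: "S \<in> sets borel" for h S and x z :: "real^'d"
 proof -
  have "pint p (%y. indicator S y * b y) \<le> pint p b"
   using p_ge1 b_nonneg by (intro pint_mono) (auto simp: indicator_def)
  moreover have "(%y. indicator S y * b y) \<in> borel_fun"
   using S by (intro borel_measurable_times borel_measurable_indicator) auto
  moreover have "indicator S y * ennreal (b y) = ennreal (norm (indicator S y * b y))" for y
   using b_nonneg by (auto simp: indicator_def)
  ultimately show ?thesis using H[rule_format, OF h, of "%y. indicator S y * b y" x z] P by simp
 qed
 then show ?thesis using h0 by (intro exI[of _ h0] conjI) auto
qed

lemma f_locally_bounded:
 assumes "z \<in> U"
 shows "\<exists>r>0. cball z (2 * r) \<subseteq> U \<and> (\<exists>C\<ge>0. AE x in lborel. x \<in> ball z r --> norm (f x) \<le> C)"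
proof -
 obtain h0 where h0: "h0 > 0" "\<And>h S x z. 0 < h \<and> h \<le> h0 ==> S \<in> sets borel ==>
  ennreal h * pot h (%y. indicator S y * ennreal (b y)) x \<le> ennreal (1/2) * emeasure lborel (ball (z::real^'d) ((1/2) * h))"
  using b_small[of "1/2" "1/2"] by auto
 obtain e where e: "e > 0" "cball z e \<subseteq> U" using openU assms open_contains_cball by blast
 define r where "r = min e h0 / 2"
 have r: "r > 0" "2 * r \<le> e" "2 * r \<le> h0" using e h0(1) by (auto simp: r_def)
 have sub: "cball z (2 * r) \<subseteq> U" using e(2) r(2) by (meson order_trans subset_cball)
 have "\<exists>C. AE x in lborel. x \<in> ball z r --> norm (f x) \<le> C"
  by (rule weak_solution_locally_bounded[OF f_int g_int weak f_out g_out sub r(1) b_meas b_nonneg g_le bf_int])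
   (use h0(2)[of "2 * r" "ball z r" _ z] r in auto)
 then obtain C where "AE x in lborel. x \<in> ball z r --> norm (f x) \<le> C" by blast
 then have "AE x in lborel. x \<in> ball z r --> norm (f x) \<le> max C 0" by eventually_elim auto
 then show ?thesis using r sub by (intro exI[of _ r]) (auto intro!: exI[of _ "max C 0"])
qed

lemma g_Lp_on:
 assumes S: "S \<in> sets borel" and C: "AE x in lborel. x \<in> S --> norm (f x) \<le> C" "C \<ge> 0"
 shows "pint p (%x. indicator S x *R g x) < \<infinity>"
proof -
 have "pint p (%x. indicator S x *R g x) \<le> (NN x. ennreal (C powr p) * ennreal (norm (b x) powr p))"
  unfolding pint_def
 proof (rule nn_integral_mono_AE, use C(1) in eventually_elim)
  case (elim x)
  have "norm (indicator S x *R g x) \<le> C * b x"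
  proof (cases "x \<in> S")
   case True
   have "norm (g x) \<le> b x * norm (f x)" by (rule g_le)
   also have "... \<le> b x * C" using elim True b_nonneg by (intro mult_left_mono) auto
   finally show ?thesis using True by (simp add: mult.commute)
  qed (use C b_nonneg in auto)
  then have "norm (indicator S x *R g x) powr p \<le> (C * b x) powr p"
   using p_ge1 by (intro powr_mono2) auto
  then show ?case using C(2) b_nonneg[of x] by (simp add: powr_mult ennreal_mult'[symmetric] ennreal_leI)
 qed
 also have "... = ennreal (C powr p) * pint p b" unfolding pint_def by (rule nn_integral_cmult) measurable
 also have "... < \<infinity>" using b_Lp by (simp add: ennreal_mult_less_top)
 finally show ?thesis .
qed

text \<open>Where f is bounded, g is bounded by a multiple of b and hence in L^p. Cutting g off
  there gives a function whose mollifications converge in L^p and agree with those of g well inside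
  S.\<close>

definition gS :: "(real^'d) set => real^'d => real^'d^'n" where "gS S x = indicator S x *R g x"

lemma gS_int: "S \<in> sets borel ==> integrable lborel (gS S)"
 unfolding gS_def[abs_def] using g_int by (intro integrable_mult_indicator) auto

lemma gS_Lp_tendsto:
 assumes S: "S \<in> sets borel" and C: "AE x in lborel. x \<in> S --> norm (f x) \<le> C" "C \<ge> 0"
 shows "(%n. pint p (%x. mollify (moll n) (gS S) x - gS S x)) ~~> 0"
proof (rule moll_pint_tendsto[OF gS_int[OF S]])
 show "gS S x = 0" if "norm x > R" for x using g_out[OF that] by (simp add: gS_def)
 show "pint p (gS S) < \<infinity>" unfolding gS_def[abs_def] by (rule g_Lp_on[OF S C])
qed (rule p_ge1)

lemma G_eq_gS:
 assumes "cball x dt \<subseteq> S" "1 / real (Suc n) \<le> dt"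
 shows "G n x = mollify (moll n) (gS S) x"
proof -
 obtain D where m: "mollifier (1 / real (Suc n)) (moll n :: real^'d => real) D" using moll by blast
 show ?thesis unfolding G_def
 proof (rule mollify_cong[OF m])
  fix y assume "dist x y < 1 / real (Suc n)"
  then have "y \<in> cball x dt" using assms(2) by simp
  then show "g y = gS S y" using assms(1) by (auto simp: gS_def)
 qed
qed

text \<open>Locally g is now in L^p, so G n - G m is small in L^p and, by
  \<open>pot_small_fixed\<close>, the oscillation of F n - F m is uniformly small. Convergence in
  L^1 controls the mean, and the sequence is uniformly Cauchy.\<close>

lemma F_uniform_limit_local:
 assumes "z \<in> U"
 shows "\<exists>r>0. cball z (2 * r) \<subseteq> U \<and> uniformly_convergent_on (ball z r) F"
proof -
 obtain r0 C where r0: "r0 > 0" "cball z (2 * r0) \<subseteq> U" and C: "AE x in lborel. x \<in> ball z r0 --> norm (f x) \<le> C" "C \<ge> 0"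
  using f_locally_bounded[OF assms] by blast
 \<comment> \<open>Halving the radius keeps mollification at points of the smaller ball inside the
   ball where f is bounded.\<close>
 define r where "r = r0 / 2"
 have r: "r > 0" "r0 = 2 * r" using r0 by (auto simp: r_def)
 let ?B = "ball z r" and ?S = "ball z r0" and ?h = "2 * r"
 define i where "i = (%y. indicator ?B y :: ennreal)"
 have [measurable]: "i \<in> borel_fun" unfolding i_def by (intro borel_measurable_indicator) simp
 define V where "V = measure lborel ?B"
 have V: "V > 0" "emeasure lborel ?B = ennreal V"
  using r content_ball_pos[of r z] emeasure_eq_ennreal_measure[of lborel ?B] emeasure_lborel_ball_finite[of z r]
  by (auto simp: V_def)
 obtain n0 where n0: "1 / real (Suc n0) < r" using r(1) nat_approx_posE by blast
 have small: "1 / real (Suc n) \<le> 1 / real (Suc n0)" if "n \<ge> n0" for n using that by (intro divide_left_mono) auto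
 have cb: "cball x (1 / real (Suc n0)) \<subseteq> ?S" if "x \<in> ?B" for x
 proof
  fix y assume "y \<in> cball x (1 / real (Suc n0))"
  then have "dist x y < r" using n0 by simp
  then show "y \<in> ?S" using that r dist_triangle[of z y x] by simp
 qed
 have Gl: "G n x = mollify (moll n) (gS ?S) x" if "x \<in> ?B" "n \<ge> n0" for n x
  using cb[OF that(1)] small[OF that(2)] by (rule G_eq_gS)
 define A where "A = (%n. pint p (%x. mollify (moll n) (gS ?S) x - gS ?S x))"
 define Q where "Q = (%n. pint 1 (%x. F n x - f x))"
 have Al: "A ~~> 0" unfolding A_def by (rule gS_Lp_tendsto[OF _ C]) simp
 have Ql: "Q ~~> 0" unfolding Q_def by (rule F_L1)
 have gSm: "mollify (moll n) (gS ?S) \<in> borel_fun" for n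
  using moll[of n, where 'd='d] mollify_continuous gS_int[of ?S]
  by (meson borel_measurable_continuous_onI borel_open open_ball)
 note [measurable] = gSm borel_measurable_integrable[OF gS_int[of ?S], simplified]
 have "?h > 0" using r by simp
 from pot_small_fixed[where 'a="real^'d" and 'b="real^'d^'n" and p=p, OF _ this] p_gt obtain C0
  where C0: "C0 > 0" "\<forall>et>0. \<exists>K>0. \<forall>g :: real^'d => real^'d^'n. \<forall>x. g \<in> borel_fun -->
    ennreal ?h * pot ?h (%z. ennreal (norm (g z))) x \<le> ennreal C0 * (ennreal et + ennreal K * pint p g)"
  by auto
 have "uniformly_Cauchy_on ?B F"
  unfolding uniformly_Cauchy_on_def
 proof (intro allI impI)
  fix e :: real assume e: "e > 0"
  \<comment> \<open>The budget is V e in quarters: one for \<open>et\<close>, one each for T n and T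
    m; the last one makes the inequality strict.\<close>
  define et where "et = V * e / (4 * C0)"
  have et: "et > 0" using V C0 e by (simp add: et_def)
  obtain K where K: "K > 0" "\<And>g :: real^'d => real^'d^'n. \<And>x. g \<in> borel_fun ==>
    ennreal ?h * pot ?h (%z. ennreal (norm (g z))) x \<le> ennreal C0 * (ennreal et + ennreal K * pint p g)"
   using C0(2) et by blast
  define T where "T = (%n. ennreal (C0 * K * 2 powr p) * A n + Q n)"
  have "T ~~> ennreal (C0 * K * 2 powr p) * 0 + 0"
   unfolding T_def by (intro tendsto_add tendsto_mult_ennreal tendsto_const Al Ql) auto
  then have "\<forall>\<^sub>F n in sequentially. T n < ennreal (V * e / 4)"
   by (intro order_tendstoD(2)) (use V e in auto)
  then obtain N where N: "\<And>n. n \<ge> N ==> T n < ennreal (V * e / 4)" by (auto simp: eventually_sequentially)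
  have "dist (F n x) (F m x) < e" if x: "x \<in> ?B" and n: "n \<ge> max N n0" and m: "m \<ge> max N n0" for x n m
  proof -
   define u where "u = (%y. F n y - F m y)"
   have [measurable]: "u \<in> borel_fun" unfolding u_def by measurable
   have osc: "(NN y. indicator ?B y * ennreal (norm (u x - u y))) \<le>
     ennreal ?h * pot ?h (%y. indicator ?B y * ennreal (norm (G n y - G m y))) x"
   proof (rule oscillation_matrix_le_pot)
    show "dist x y < ?h" if "y \<in> ?B" for y using that x dist_triangle3[of x y z] by auto
    fix y assume y: "y \<in> ?B"
    have sub: "cball y (1 / real (Suc k)) \<subseteq> U" if "k \<ge> n0" for k
    proof -
     have "cball y (1 / real (Suc k)) \<subseteq> cball y (1 / real (Suc n0))" using small[OF that] by (rule subset_cball)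
     also have "... \<subseteq> ?S" by (rule cb[OF y])
     also have "... \<subseteq> U" using r0 by (auto intro!: subsetD[OF r0(2)])
     finally show ?thesis .
    qed
    have "(F n has_derivative (%h. G n y *v h)) (at y)" "(F m has_derivative (%h. G m y *v h)) (at y)"
     using F_deriv[OF sub[of n]] F_deriv[OF sub[of m]] n m by auto
    then have "(u has_derivative (%h. G n y *v h - G m y *v h)) (at y)"
     unfolding u_def by (rule has_derivative_diff)
    moreover have "(%h. G n y *v h - G m y *v h) = (*v) (G n y - G m y)"
     by (simp add: fun_eq_iff matrix_vector_mult_diff_rdistrib)
    ultimately show "(u has_derivative (*v) (G n y - G m y)) (at y)" by simp
   next
    show "continuous_on ?B (%y. G n y - G m y)"
     by (intro continuous_intros continuous_on_subset[OF G_cont]) auto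
   qed (use x in auto)
   also have "ennreal ?h * pot ?h (%y. indicator ?B y * ennreal (norm (G n y - G m y))) x \<le>
     ennreal ?h * pot ?h (%y. ennreal (norm (mollify (moll n) (gS ?S) y - mollify (moll m) (gS ?S) y))) x"
    by (intro mult_left_mono pot_mono) (use Gl n m in \<open>auto simp: indicator_def\<close>)
   also have "... \<le> ennreal C0 * (ennreal et + ennreal K * pint p (%y. mollify (moll n) (gS ?S) y - mollify (moll m) (gS ?S) y))"
    by (rule K(2)) measurable
   also have "... \<le> ennreal C0 * (ennreal et + ennreal K * (ennreal (2 powr p) * (A n + A m)))"
   proof -
    have "norm (mollify (moll n) (gS ?S) y - mollify (moll m) (gS ?S) y) \<le>
     norm (mollify (moll n) (gS ?S) y - gS ?S y) + norm (mollify (moll m) (gS ?S) y - gS ?S y)" for y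
     using norm_triangle_ineq4[of "mollify (moll n) (gS ?S) y - gS ?S y" "mollify (moll m) (gS ?S) y - gS ?S y"] by simp
    then have "pint p (%y. mollify (moll n) (gS ?S) y - mollify (moll m) (gS ?S) y) \<le> ennreal (2 powr p) * (A n + A m)"
     unfolding A_def by (intro pint_add_le) (use p_ge1 in auto)
    then show ?thesis by (intro mult_left_mono add_left_mono) auto
   qed
   also have "... = ennreal (V * e / 4) + (ennreal (C0 * K * 2 powr p) * A n + ennreal (C0 * K * 2 powr p) * A m)"
   proof -
    have 1: "ennreal C0 * ennreal et = ennreal (V * e / 4)"
     using C0 by (simp add: et_def ennreal_mult'[symmetric])
    have 2: "ennreal (C0 * K * 2 powr p) = ennreal C0 * ennreal K * ennreal (2 powr p)"
     using C0 K(1) by (simp add: ennreal_mult')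
    show ?thesis unfolding 2 1[symmetric] by (simp only: distrib_left mult.assoc)
   qed
   finally have o2: "(NN y. i y * ennreal (norm (u x - u y))) \<le> ..." unfolding i_def .
   have "ennreal V * ennreal (norm (u x)) = (NN y. ennreal (norm (u x)) * i y)"
    by (simp add: i_def nn_integral_cmult_indicator V mult.commute)
   also have "... \<le> (NN y. i y * ennreal (norm (u x - u y)) + (ennreal (norm (F n y - f y)) + ennreal (norm (F m y - f y))))"
   proof (rule nn_integral_mono)
    fix y
    have "norm (u x) \<le> norm (u x - u y) + (norm (F n y - f y) + norm (F m y - f y))"
     using norm_triangle_ineq[of "u x - u y" "u y"] norm_triangle_ineq4[of "F n y - f y" "F m y - f y"] by (simp add: u_def)
    then show "ennreal (norm (u x)) * i y \<le> i y * ennreal (norm (u x - u y)) + (ennreal (norm (F n y - f y)) + ennreal (norm (F m y - f y)))"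
     by (auto simp: i_def indicator_def ennreal_plus[symmetric] ennreal_leI simp del: ennreal_plus)
   qed
   also have "... = (NN y. i y * ennreal (norm (u x - u y))) + (Q n + Q m)"
    by (simp add: nn_integral_add Q_def pint_def)
   also have "... \<le> (ennreal (V * e / 4) + (ennreal (C0 * K * 2 powr p) * A n + ennreal (C0 * K * 2 powr p) * A m)) + (Q n + Q m)"
    by (intro add_right_mono o2)
   also have "... = ennreal (V * e / 4) + (T n + T m)" by (simp only: T_def add_ac)
   also have "... \<le> ennreal (V * e / 4) + (ennreal (V * e / 4) + ennreal (V * e / 4))"
    using N[of n] N[of m] n m by (intro add_left_mono add_mono) auto
   also have "... = ennreal (3 / 4 * (V * e))"
    using V e by (simp add: ennreal_plus[symmetric] del: ennreal_plus)
   finally have "ennreal (V * norm (u x)) \<le> ennreal (3 / 4 * (V * e))"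
    using V by (simp add: ennreal_mult')
   then have "V * norm (u x) \<le> V * (3 / 4 * e)"
    using V e by (subst (asm) ennreal_le_iff) (auto simp: mult_ac)
   then have "norm (u x) \<le> 3 / 4 * e" using V by simp
   then show ?thesis using e by (simp add: u_def dist_norm)
  qed
  then show "\<exists>M. \<forall>x\<in>?B. \<forall>m\<ge>M. \<forall>n\<ge>M. dist (F m x) (F n x) < e" by blast
 qed
 then have "uniformly_convergent_on ?B F" by (rule Cauchy_uniformly_convergent)
 moreover have "cball z (2 * r) \<subseteq> U" using r0 r by (auto intro!: subsetD[OF r0(2)])
 ultimately show ?thesis using r by blast
qed

text \<open>The continuous representative of f on U; only its values on U are used.\<close>

definition Fl :: "real^'d => real^'n" where "Fl x = lim (%n. F n x)"

lemma Fl_uniform_local: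
 assumes "z \<in> U"
 shows "\<exists>r>0. cball z (2 * r) \<subseteq> U \<and> uniform_limit (ball z r) F Fl sequentially"
proof -
 obtain r where r: "r > 0" "cball z (2 * r) \<subseteq> U" "uniformly_convergent_on (ball z r) F"
  using F_uniform_limit_local[OF assms] by blast
 then have "uniform_limit (ball z r) F Fl sequentially"
  unfolding Fl_def by (simp add: uniformly_convergent_uniform_limit_iff)
 then show ?thesis using r by blast
qed

lemma Fl_uniform_limit:
 assumes "compact K" "K \<subseteq> U"
 shows "uniform_limit K F Fl sequentially"
proof -
 obtain r where r: "\<And>z. z \<in> K ==> r z > 0" "\<And>z. z \<in> K ==> uniform_limit (ball z (r z)) F Fl sequentially"
 proof -
  have "\<forall>z. \<exists>r. z \<in> K --> r > 0 \<and> uniform_limit (ball z r) F Fl sequentially"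
   using Fl_uniform_local assms(2) by blast
  then show ?thesis using that by (metis (no_types))
 qed
 obtain Z where Z: "Z \<subseteq> K" "finite Z" "K \<subseteq> (\<Union>z\<in>Z. ball z (r z))"
 proof -
  have "K \<subseteq> (\<Union>z\<in>K. ball z (r z))" using r(1) by auto
  then show ?thesis using compactE_image[OF assms(1), of K "%z. ball z (r z)"] that by auto
 qed
 have "uniform_limit (\<Union>z\<in>Z. ball z (r z)) F Fl sequentially"
  using Z r(2) by (intro uniform_limit_on_UNION) auto
 then show ?thesis using Z(3) by (rule uniform_limit_on_subset)
qed

lemma Fl_cont: "continuous_on U Fl"
proof -
 have "\<exists>r>0. ball z r \<subseteq> U \<and> continuous_on (ball z r) Fl" if z: "z \<in> U" for z
 proof -
  obtain r where r: "r > 0" "cball z (2 * r) \<subseteq> U" "uniform_limit (ball z r) F Fl sequentially"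
   using Fl_uniform_local[OF z] by blast
  have "continuous_on (ball z r) Fl"
   by (rule uniform_limit_theorem[OF _ r(3)]) (auto intro!: always_eventually continuous_on_subset[OF F_cont])
  moreover have "ball z r \<subseteq> U" using r by (auto intro!: subsetD[OF r(2)])
  ultimately show ?thesis using r by blast
 qed
 then show ?thesis
  by (intro continuous_at_imp_continuous_on ballI) (metis centre_in_ball continuous_on_eq_continuous_at open_ball)
qed

lemma f_eq_Fl: "AE x in lborel. x \<in> U --> f x = Fl x"
proof -
 have loc: "\<exists>r>0. negligible {x \<in> ball z r. f x \<noteq> Fl x}" if z: "z \<in> U" for z
 proof -
  obtain r where r: "r > 0" "cball z (2 * r) \<subseteq> U" "uniform_limit (ball z r) F Fl sequentially"
   using Fl_uniform_local[OF z] by blast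
  let ?B = "ball z r"
  have sub: "?B \<subseteq> U" using r by (auto intro!: subsetD[OF r(2)])
  define V where "V = measure lborel ?B"
  have V: "V > 0" "emeasure lborel ?B = ennreal V"
   using r content_ball_pos[of r z] emeasure_eq_ennreal_measure[of lborel ?B] emeasure_lborel_ball_finite[of z r]
   by (auto simp: V_def)
  define q where "q = (%x. indicator ?B x *R Fl x)"
  have [measurable]: "q \<in> borel_fun"
   unfolding q_def by (rule borel_measurable_continuous_on_indicator) (auto intro: continuous_on_subset[OF Fl_cont sub])
  have [measurable]: "(%x. indicator ?B x :: real) \<in> borel_fun" "(%x. indicator ?B x :: ennreal) \<in> borel_fun"
   by (auto intro!: borel_measurable_indicator)
  define I where "I = (NN x. ennreal (norm (indicator ?B x *R f x - q x)))"
  have IV: "I \<le> ennreal (V * e)" if e: "e > 0" for e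
  proof -
   have "\<forall>\<^sub>F n in sequentially. \<forall>x\<in>?B. dist (F n x) (Fl x) < e / 2"
    using uniform_limitD[OF r(3), of "e / 2"] e by simp
   moreover have "\<forall>\<^sub>F n in sequentially. pint 1 (%x. F n x - f x) < ennreal (V * e / 2)"
    using F_L1 by (rule order_tendstoD(2)) (use V e in simp)
   ultimately have "\<forall>\<^sub>F n in sequentially. (\<forall>x\<in>?B. dist (F n x) (Fl x) < e / 2) \<and> pint 1 (%x. F n x - f x) < ennreal (V * e / 2)"
    by eventually_elim blast
   then obtain n where n: "\<And>x. x \<in> ?B ==> dist (F n x) (Fl x) < e / 2" "pint 1 (%x. F n x - f x) < ennreal (V * e / 2)"
    using eventually_happens'[OF sequentially_bot] by blast
   have "I \<le> (NN x. ennreal (norm (F n x - f x)) + ennreal (e / 2) * indicator ?B x)"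
    unfolding I_def
   proof (rule nn_integral_mono)
    fix x
    show "ennreal (norm (indicator ?B x *R f x - q x)) \<le> ennreal (norm (F n x - f x)) + ennreal (e / 2) * indicator ?B x"
    proof (cases "x \<in> ?B")
     case True
     have "norm (f x - Fl x) \<le> norm (F n x - f x) + e / 2"
      using norm_triangle_ineq4[of "F n x - Fl x" "F n x - f x"] n(1)[OF True] by (simp add: dist_norm)
     then show ?thesis using True e by (simp add: q_def ennreal_plus[symmetric] ennreal_leI del: ennreal_plus)
    qed (simp add: q_def)
   qed
   also have "... = pint 1 (%x. F n x - f x) + ennreal (e / 2) * ennreal V"
    using V by (simp add: nn_integral_add nn_integral_cmult_indicator pint_def)
   also have "... \<le> ennreal (V * e / 2) + ennreal (e / 2) * ennreal V"
    using n(2) by (intro add_right_mono) simp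
   also have "... = ennreal (V * e)"
    using e V by (simp add: ennreal_mult'[symmetric] ennreal_plus[symmetric] mult.commute del: ennreal_plus)
   finally show ?thesis .
  qed
  have Ie: "I \<le> 0 + ennreal e" if "e > 0" for e
   using that V(1) IV[of "e / V"] by simp
  have "I \<le> 0" by (rule ennreal_le_epsilon) (rule Ie)
  then have "I = 0" by simp
  then have "AE x in lborel. indicator ?B x *R f x - q x = 0"
   unfolding I_def by (subst (asm) nn_integral_0_iff_AE) auto
  then have "AE x in lebesgue. x \<notin> {x \<in> ?B. f x \<noteq> Fl x}"
   by (intro AE_completion, eventually_elim) (auto simp: q_def indicator_def split: if_splits)
  then have "negligible {x \<in> ?B. f x \<noteq> Fl x}"
   by (simp add: negligible_iff_null_sets completion.null_sets_iff_AE)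
  then show ?thesis using r by blast
 qed
 have "negligible {x \<in> U. f x \<noteq> Fl x}"
 proof (rule locally_negligible_alt[THEN iffD2], rule ballI)
  fix z assume z: "z \<in> {x \<in> U. f x \<noteq> Fl x}"
  then obtain r where r: "r > 0" "negligible {x \<in> ball z r. f x \<noteq> Fl x}" using loc by blast
  let ?T = "{x \<in> U. f x \<noteq> Fl x} \<inter> ball z r"
  have "openin (top_of_set {x \<in> U. f x \<noteq> Fl x}) ?T" by (intro openin_open_Int) simp
  moreover have "negligible ?T" by (rule negligible_subset[OF r(2)]) auto
  moreover have "z \<in> ?T" using z r by auto
  ultimately show "\<exists>T. openin (top_of_set {x \<in> U. f x \<noteq> Fl x}) T \<and> z \<in> T \<and> negligible T" by blast
 qed
 then have "AE x in lebesgue. x \<notin> {x \<in> U. f x \<noteq> Fl x}"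
  using AE_not_in[of "{x \<in> U. f x \<noteq> Fl x}" lebesgue] by (simp add: negligible_iff_null_sets)
 then show ?thesis by (simp add: AE_completion_iff)
qed

lemma f_bounded_on_compact:
 assumes "compact S" "S \<subseteq> U"
 shows "\<exists>C\<ge>0. (\<forall>x\<in>S. norm (Fl x) \<le> C) \<and> (AE x in lborel. x \<in> S --> norm (f x) \<le> C)"
proof -
 have "bounded (Fl ` S)"
  by (intro compact_imp_bounded compact_continuous_image continuous_on_subset[OF Fl_cont] assms)
 then obtain C where "\<forall>z\<in>Fl ` S. norm z \<le> C" unfolding bounded_iff by blast
 then have C: "\<forall>x\<in>S. norm (Fl x) \<le> max C 0" by auto
 moreover from f_eq_Fl have "AE x in lborel. x \<in> S --> norm (f x) \<le> max C 0"
  by eventually_elim (use assms(2) C in auto)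
 ultimately show ?thesis by (intro exI[of _ "max C 0"]) auto
qed

lemma G_Lp_tendsto_compact:
 assumes K: "compact K" "K \<subseteq> U"
 shows "(%n. pint p (%x. indicator K x *R (G n x - g x))) ~~> 0"
proof -
 obtain e where e: "e > 0" "(\<Union>x\<in>K. cball x e) \<subseteq> U"
  using compact_subset_open_imp_cball_epsilon_subset[OF K(1) openU K(2)] by blast
 \<comment> \<open>A compact neighbourhood of K inside U: f is bounded on it, and mollification at
   points of K sees only S.\<close>
 define S where "S = {x + y |x y. x \<in> K \<and> y \<in> cball 0 e}"
 have S: "compact S" unfolding S_def by (intro compact_sums K) simp
 have S1: "S \<subseteq> U"
 proof
  fix w assume "w \<in> S"
  then obtain x y where "w = x + y" "x \<in> K" "y \<in> cball 0 e" by (auto simp: S_def)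
  then have "w \<in> (\<Union>x\<in>K. cball x e)" by (auto intro!: bexI[of _ x] simp: dist_norm)
  then show "w \<in> U" using e(2) by blast
 qed
 have S2: "cball x e \<subseteq> S" if "x \<in> K" for x
 proof
  fix w assume "w \<in> cball x e"
  then show "w \<in> S" unfolding S_def using that
   by (intro CollectI exI[of _ x] exI[of _ "w - x"]) (auto simp: dist_norm norm_minus_commute)
 qed
 obtain C where C: "C \<ge> 0" "AE x in lborel. x \<in> S --> norm (f x) \<le> C"
  using f_bounded_on_compact[OF S S1] by blast
 have Sb: "S \<in> sets borel" by (rule borel_compact[OF S])
 have lim: "(%n. pint p (%x. mollify (moll n) (gS S) x - gS S x)) ~~> 0"
  by (rule gS_Lp_tendsto[OF Sb C(2,1)])
 obtain n0 where n0: "1 / real (Suc n0) < e" using e(1) nat_approx_posE by blast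
 show ?thesis
 proof (rule tendsto_sandwich[OF _ _ tendsto_const lim])
  show "\<forall>\<^sub>F n in sequentially. pint p (%x. indicator K x *R (G n x - g x)) \<le> pint p (%x. mollify (moll n) (gS S) x - gS S x)"
  proof (rule eventually_sequentiallyI[of n0])
   fix n assume n: "n0 \<le> n"
   have d: "1 / real (Suc n) \<le> 1 / real (Suc n0)" using n by (intro divide_left_mono) auto
   have le: "1 / real (Suc n) \<le> e" using d n0 by linarith
   show "pint p (%x. indicator K x *R (G n x - g x)) \<le> pint p (%x. mollify (moll n) (gS S) x - gS S x)"
   proof (rule pint_mono)
    fix x
    show "norm (indicator K x *R (G n x - g x)) \<le> norm (mollify (moll n) (gS S) x - gS S x)"
    proof (cases "x \<in> K")
     case True
     have "x \<in> S" using S2[OF True] e(1) by auto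
     then have "gS S x = g x" by (simp add: gS_def)
     then show ?thesis using True G_eq_gS[OF S2[OF True] le] by simp
    qed simp
   qed (use p_ge1 in simp)
  qed
 qed simp
qed

text \<open>The limit of the oscillation estimates at x and at y, compared through the mean over the
  ball. Knowing |Fl| \<le> S there replaces |g| by S b, which leaves a bound proportional to
  S.\<close>

lemma Fl_oscillation:
 assumes r: "r > 0" "cball z (2 * r) \<subseteq> U" and x: "x \<in> ball z r" and y: "y \<in> ball z r"
  and S: "S \<ge> 0" "\<And>w. w \<in> ball z r ==> norm (Fl w) \<le> S"
 shows "emeasure lborel (ball z r) * ennreal (norm (Fl x - Fl y)) \<le>
  ennreal S * (ennreal (2 * r) * pot (2 * r) (%w. indicator (ball z r) w * ennreal (b w)) x +
         ennreal (2 * r) * pot (2 * r) (%w. indicator (ball z r) w * ennreal (b w)) y)"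
proof -
 let ?B = "ball z r" and ?h = "2 * r"
 have sub: "?B \<subseteq> U" using r by (auto intro!: subsetD[OF r(2)])
 define i where "i = (%y. indicator ?B y :: ennreal)"
 have [measurable]: "i \<in> borel_fun" unfolding i_def by (intro borel_measurable_indicator) simp
 define V where "V = emeasure lborel ?B"
 have Vf: "V < \<infinity>" using emeasure_lborel_ball_finite[of z r] by (simp add: V_def)
 define L where "L = (%x. ennreal ?h * pot ?h (%w. i w * ennreal (b w)) x)"
 define A where "A = (%n. pint p (%x. indicator (cball z r) x *R (G n x - g x)))"
 have "cball z r \<subseteq> U" using r by (auto intro!: subsetD[OF r(2)])
 then have Al: "A ~~> 0" unfolding A_def by (intro G_Lp_tendsto_compact) auto
 have gm: "(%x. indicator (cball z r) x *R (G n x - g x)) \<in> borel_fun" for n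
  by (intro borel_measurable_scaleR borel_measurable_indicator borel_measurable_diff FG_meas fg_meas) simp
 have "?h > 0" using r by simp
 from pot_small_fixed[where 'a="real^'d" and 'b="real^'d^'n" and p=p, OF _ this] p_gt obtain C0
  where C0: "C0 > 0" "\<forall>et>0. \<exists>K>0. \<forall>g :: real^'d => real^'d^'n. \<forall>x. g \<in> borel_fun -->
    ennreal ?h * pot ?h (%z. ennreal (norm (g z))) x \<le> ennreal C0 * (ennreal et + ennreal K * pint p g)"
  by auto
 have bound: "V * ennreal (norm (Fl x - Fl y)) \<le> ennreal S * (L x + L y) + ennreal e" if e: "e > 0" for e
 proof -
  define et where "et = e / (2 * C0)"
  have et: "et > 0" using C0 e by (simp add: et_def)
  obtain K where K: "K > 0" "\<And>g :: real^'d => real^'d^'n. \<And>x. g \<in> borel_fun ==>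
    ennreal ?h * pot ?h (%z. ennreal (norm (g z))) x \<le> ennreal C0 * (ennreal et + ennreal K * pint p g)"
   using C0(2) et by blast
  obtain n0 where n0: "1 / real (Suc n0) < r" using r(1) nat_approx_posE by blast
  have osc: "(NN w. i w * ennreal (norm (F n x - F n w))) \<le> ennreal S * L x + ennreal C0 * (ennreal et + ennreal K * A n)"
   if n: "n \<ge> n0" and x: "x \<in> ?B" for n x
  proof -
   have Un: "cball y (1 / real (Suc n)) \<subseteq> U" if "y \<in> ?B" for y
   proof -
    have "1 / real (Suc n) \<le> 1 / real (Suc n0)" using n by (intro divide_left_mono) auto
    then have "cball y (1 / real (Suc n)) \<subseteq> cball z (2 * r)"
     using that n0 by (intro cball_subset_cball_iff[THEN iffD2] disjI1) (auto simp: dist_commute)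
    then show ?thesis using r(2) by auto
   qed
   have "(NN w. i w * ennreal (norm (F n x - F n w))) \<le> ennreal ?h * pot ?h (%y. i y * ennreal (norm (G n y))) x"
    unfolding F_def G_def i_def by (rule norm_mollify_osc[OF f_int g_int weak Un x])
   also have "... \<le> ennreal ?h * pot ?h (%w. ennreal (norm (indicator (cball z r) w *R (G n w - g w))) + ennreal S * (i w * ennreal (b w))) x"
   proof (intro mult_left_mono pot_mono_AE)
    show "AE w in lborel. i w * ennreal (norm (G n w)) \<le> ennreal (norm (indicator (cball z r) w *R (G n w - g w))) + ennreal S * (i w * ennreal (b w))"
     using f_eq_Fl
    proof eventually_elim
     case (elim w)
     show ?case
     proof (cases "w \<in> ?B")
      case True
      have "norm (G n w) \<le> norm (G n w - g w) + norm (g w)"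
       using norm_triangle_ineq[of "G n w - g w" "g w"] by simp
      also have "norm (g w) \<le> b w * norm (f w)" by (rule g_le)
      also have "b w * norm (f w) \<le> b w * S"
       using elim True sub S(2)[OF True] by (intro mult_left_mono b_nonneg) auto
      finally have "norm (G n w) \<le> norm (G n w - g w) + S * b w" by (simp add: mult.commute)
      then show ?thesis using True S(1) b_nonneg[of w]
       by (simp add: i_def ennreal_mult'[symmetric] ennreal_plus[symmetric] ennreal_leI del: ennreal_plus)
     qed (simp add: i_def)
    qed
   qed simp
   also have "... = ennreal ?h * pot ?h (%w. ennreal (norm (indicator (cball z r) w *R (G n w - g w)))) x + ennreal S * L x"
   proof -
    have m1: "(%w. ennreal (norm (indicator (cball z r) w *R (G n w - g w)))) \<in> borel_fun"
     by (rule measurable_compose[OF measurable_compose[OF gm borel_measurable_norm] measurable_ennreal])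
    show ?thesis
     unfolding L_def
     by (subst pot_add[OF m1]) (auto simp: pot_cmult distrib_left mult.left_commute)
   qed
   also have "... \<le> ennreal C0 * (ennreal et + ennreal K * A n) + ennreal S * L x"
    unfolding A_def by (intro add_right_mono K(2) gm)
   finally show ?thesis by (simp only: add.commute)
  qed
  have ineq: "V * ennreal (norm (F n x - F n y)) \<le> (ennreal S * (L x + L y) + ennreal e) + (ennreal (2 * C0 * K) * A n)" if n: "n \<ge> n0" for n
  proof -
   have "V * ennreal (norm (F n x - F n y)) = (NN w. ennreal (norm (F n x - F n y)) * i w)"
    unfolding i_def V_def by (subst nn_integral_cmult_indicator) (simp_all add: mult.commute)
   also have "... \<le> (NN w. i w * ennreal (norm (F n x - F n w)) + i w * ennreal (norm (F n y - F n w)))"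
   proof (rule nn_integral_mono)
    fix w
    have "norm (F n x - F n y) \<le> norm (F n x - F n w) + norm (F n y - F n w)"
     using norm_triangle_ineq4[of "F n x - F n w" "F n y - F n w"] by simp
    then show "ennreal (norm (F n x - F n y)) * i w \<le> i w * ennreal (norm (F n x - F n w)) + i w * ennreal (norm (F n y - F n w))"
     by (auto simp: i_def indicator_def ennreal_plus[symmetric] ennreal_leI simp del: ennreal_plus)
   qed
   also have "... = (NN w. i w * ennreal (norm (F n x - F n w))) + (NN w. i w * ennreal (norm (F n y - F n w)))"
    by (rule nn_integral_add) measurable
   also have "... \<le> (ennreal S * L x + ennreal C0 * (ennreal et + ennreal K * A n)) + (ennreal S * L y + ennreal C0 * (ennreal et + ennreal K * A n))"
    by (intro add_mono osc n x y)
   also have "... = (ennreal S * (L x + L y) + 2 * (ennreal C0 * ennreal et)) + (2 * (ennreal C0 * ennreal K)) * A n"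
    by (simp only: mult_2 distrib_left distrib_right mult.assoc add_ac)
   also have "2 * (ennreal C0 * ennreal et) = ennreal e"
   proof -
    have "ennreal e = ennreal (2 * (C0 * et))" using C0 by (simp add: et_def)
    then show ?thesis using C0(1) et by (simp add: ennreal_mult')
   qed
   also have "2 * (ennreal C0 * ennreal K) = ennreal (2 * C0 * K)"
    using C0(1) K(1) by (simp add: ennreal_mult' mult.assoc)
   finally show ?thesis .
  qed
  have lim: "(%n. F n w) ~~> Fl w" if "w \<in> ?B" for w
   using tendsto_uniform_limitI[OF Fl_uniform_limit[of "{w}"]] that sub by auto
  have l1: "(%n. V * ennreal (norm (F n x - F n y))) ~~> V * ennreal (norm (Fl x - Fl y))"
   using Vf by (intro tendsto_mult_ennreal tendsto_const tendsto_ennrealI tendsto_intros lim x y) auto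
  have l2: "(%n. (ennreal S * (L x + L y) + ennreal e) + (ennreal (2 * C0 * K) * A n)) ~~> (ennreal S * (L x + L y) + ennreal e) + (ennreal (2 * C0 * K) * 0)"
   by (intro tendsto_add tendsto_mult_ennreal tendsto_const Al) auto
  have "V * ennreal (norm (Fl x - Fl y)) \<le> (ennreal S * (L x + L y) + ennreal e) + (ennreal (2 * C0 * K) * 0)"
   by (rule LIMSEQ_le[OF l1 l2]) (use ineq in blast)
  then show ?thesis by simp
 qed
 have "V * ennreal (norm (Fl x - Fl y)) \<le> ennreal S * (L x + L y)"
  by (rule ennreal_le_epsilon) (rule bound)
 then show ?thesis by (simp add: V_def L_def i_def)
qed

text \<open>With a zero at the centre, the oscillation estimate improves any bound for |Fl| on the
  ball to a quarter of it, namely twice the fraction 1/8. Iteration forces Fl = 0.\<close>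

lemma Fl_zero_local:
 assumes z: "z \<in> U" "Fl z = 0"
 shows "\<exists>r>0. ball z r \<subseteq> U \<and> (\<forall>x\<in>ball z r. Fl x = 0)"
proof -
 obtain h0 where h0: "h0 > 0" "\<And>h S x z. 0 < h \<and> h \<le> h0 ==> S \<in> sets borel ==>
  ennreal h * pot h (%y. indicator S y * ennreal (b y)) x \<le> ennreal (1/8) * emeasure lborel (ball (z::real^'d) ((1/2) * h))"
  using b_small[of "1/2" "1/8"] by auto
 obtain e where e: "e > 0" "cball z e \<subseteq> U" using openU z open_contains_cball by blast
 define r where "r = min e h0 / 2"
 have r: "r > 0" "2 * r \<le> e" "2 * r \<le> h0" using e h0(1) by (auto simp: r_def)
 have sub: "cball z (2 * r) \<subseteq> U" using e(2) r(2) by (meson order_trans subset_cball)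
 have bsub: "ball z r \<subseteq> cball z (2 * r)" using r by auto
 obtain S where S: "S \<ge> 0" "\<And>x. x \<in> ball z r ==> norm (Fl x) \<le> S"
  using f_bounded_on_compact[OF compact_cball sub] bsub by blast
 define V where "V = measure lborel (ball z r)"
 have V: "V > 0" "emeasure lborel (ball z r) = ennreal V"
  using r content_ball_pos[of r z] emeasure_eq_ennreal_measure[of lborel "ball z r"] emeasure_lborel_ball_finite[of z r]
  by (auto simp: V_def)
 have step: "norm (Fl x) \<le> s / 4" if s: "s \<ge> 0" "\<And>x. x \<in> ball z r ==> norm (Fl x) \<le> s" and x: "x \<in> ball z r" for s x
 proof -
  have p8: "ennreal (2 * r) * pot (2 * r) (%w. indicator (ball z r) w * ennreal (b w)) y \<le> ennreal (1 / 8 * V)" for y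
  proof -
   have "ennreal (1 / 8 * V) = ennreal (1 / 8) * ennreal V" by (rule ennreal_mult') simp
   then show ?thesis using h0(2)[of "2 * r" "ball z r" y z] r V by simp
  qed
  have "emeasure lborel (ball z r) * ennreal (norm (Fl x - Fl z)) \<le> ennreal s * (ennreal (1 / 8 * V) + ennreal (1 / 8 * V))"
   using r(1) by (intro order_trans[OF Fl_oscillation[OF r(1) sub x _ s]] mult_left_mono add_mono p8) auto
  also have "... = ennreal (s * (V / 4))"
   using V s(1) by (simp add: ennreal_mult'[symmetric] ennreal_plus[symmetric] del: ennreal_plus)
  finally have "ennreal (V * norm (Fl x)) \<le> ennreal (s * (V / 4))"
   using V z(2) by (simp add: ennreal_mult')
  then have "V * norm (Fl x) \<le> V * (s / 4)"
   using V s(1) by (subst (asm) ennreal_le_iff) (auto simp: mult_ac)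
  then show ?thesis using V by simp
 qed
 have "norm (Fl x) \<le> S * (1 / 4) ^ n" if "x \<in> ball z r" for n x
  using that
 proof (induction n arbitrary: x)
  case (Suc n)
  have "norm (Fl x) \<le> (S * (1 / 4) ^ n) / 4"
   by (rule step) (use S Suc in auto)
  then show ?case by simp
 qed (use S in simp)
 moreover have "(%n. S * (1 / 4) ^ n) ~~> S * 0"
  by (intro tendsto_mult_left LIMSEQ_power_zero) simp
 ultimately have "norm (Fl x) \<le> S * 0" if "x \<in> ball z r" for x
  using that by (intro LIMSEQ_le_const) auto
 then show ?thesis using r(1) sub bsub by (intro exI[of _ r]) auto
qed

lemma Fl_unique_continuation:
 assumes "connected U" "z \<in> U" "Fl z = 0" "x \<in> U"
 shows "Fl x = 0"
proof -
 let ?Z = "{x \<in> U. Fl x = 0}"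
 have "closedin (top_of_set U) ?Z" by (rule continuous_closedin_preimage_constant[OF Fl_cont])
 moreover have "open ?Z"
  unfolding open_contains_ball
 proof
  fix y assume "y \<in> ?Z"
  then obtain r where "r > 0" "ball y r \<subseteq> U" "\<forall>x\<in>ball y r. Fl x = 0" using Fl_zero_local[of y] by auto
  then show "\<exists>e>0. ball y e \<subseteq> ?Z" by (intro exI[of _ r]) auto
 qed
 then have "openin (top_of_set U) ?Z" by (intro open_subset) auto
 ultimately have "?Z = {} \<or> ?Z = U" using assms(1) unfolding connected_clopen by blast
 then show ?thesis using assms by blast
qed

end

section \<open>Linear ordinary differential equations on the unit interval\<close>

lemma linear_ode_exists:
 fixes A :: "real => real^'n::finite^'n" and v :: "real^'n"
 assumes A: "continuous_on {0..1} A"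
 shows "\<exists>ph. ph 0 = v \<and> (\<forall>t\<in>{0..1}. (ph has_vector_derivative A t *v ph t) (at t within {0..1}))"
proof -
 have "bounded (A ` {0..1})" by (intro compact_imp_bounded compact_continuous_image A) simp
 then obtain M where "\<forall>z\<in>A ` {0..1}. norm z \<le> M" unfolding bounded_iff by blast
 then have M: "\<And>t. t \<in> {0..1} ==> norm (A t) \<le> max M 1" by force
 \<comment> \<open>Twice the Lipschitz constant: in the weight e^(-L t) the Picard map contracts by
   1/2 on the whole interval at once. The maximum with 1 keeps L positive.\<close>
 define L where "L = 2 * max M 1"
 have L: "L > 0" by (simp add: L_def)
 \<comment> \<open>Clamping time to [0,1] turns the iterates into bounded continuous functions on
   the real line, which form a complete space.\<close>
 define c where "c = (%t::real. max 0 (min 1 t))"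
 have c01: "c t \<in> {0..1}" for t by (auto simp: c_def)
 have cc: "continuous_on UNIV c" unfolding c_def by (intro continuous_intros)
 \<comment> \<open>Here f stands for e^(-L s) times the unknown, so the exponential restores the
   unknown inside the integral.\<close>
 define I where "I = (%(f :: real => real^'n) t. v + integral {0..t} (%s. exp (L * s) *R (A s *v f s)))"
 define T where "T = (%(f :: real => real^'n) t. exp (- L * c t) *R I f (c t))"
 have ci: "continuous_on {0..1} (%s. exp (L * s) *R (A s *v f s))" if "continuous_on UNIV f" for f :: "real => real^'n"
  unfolding matrix_vector_mult_def
  by (intro continuous_intros continuous_on_vec_lambda A continuous_on_subset[OF that]) auto
 have cI: "continuous_on {0..1} (I f)" if "continuous_on UNIV f" for f
  unfolding I_def
  by (intro continuous_intros indefinite_integral_continuous_1 integrable_continuous_real ci that)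
 have cT: "continuous_on UNIV (T f)" if "continuous_on UNIV f" for f
  unfolding T_def
  by (intro continuous_intros cc continuous_on_compose2[OF cI[OF that] cc]) (use c01 in auto)
 have bT: "T f \<in> bcontfun" if f: "continuous_on UNIV f" for f
 proof -
  have "bounded (T f ` {0..1})"
   by (intro compact_imp_bounded compact_continuous_image continuous_on_subset[OF cT[OF f]]) auto
  then obtain b where b: "\<forall>z\<in>T f ` {0..1}. norm z \<le> b" unfolding bounded_iff by blast
  have "norm (T f x) \<le> b" for x
  proof -
   have "T f x = T f (c x)" by (simp add: T_def c_def)
   then show ?thesis using b c01[of x] by auto
  qed
  then show ?thesis by (intro bcontfun_normI cT f)
 qed
 define P where "P = (%f :: real \<Rightarrow>\<^sub>C (real^'n). Bcontfun (T (apply_bcontfun f)))"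
 have P: "apply_bcontfun (P f) = T (apply_bcontfun f)" for f
  unfolding P_def by (rule Bcontfun_inverse) (rule bT, simp)
 have "dist (P f) (P g) \<le> (1 / 2) * dist f g" for f g
 proof (rule dist_bound)
  fix t :: real
  define ta where "ta = c t"
  have ta: "0 \<le> ta" "ta \<le> 1" using c01[of t] by (auto simp: ta_def)
  let ?F = "%f s. exp (L * s) *R (A s *v apply_bcontfun f s)"
  have int: "?F f integrable_on {0..ta}" for f
   by (intro integrable_continuous_real continuous_on_subset[OF ci]) (use ta in auto)
  have "I (apply_bcontfun f) ta - I (apply_bcontfun g) ta = integral {0..ta} (%s. ?F f s - ?F g s)"
   unfolding I_def using integral_diff[OF int int, of f g] by simp
  also have "norm ... \<le> integral {0..ta} (%s. (max M 1 * dist f g) * exp (L * s))"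
  proof (rule integral_norm_bound_integral)
   show "(%s. ?F f s - ?F g s) integrable_on {0..ta}" by (intro integrable_diff int)
   show "(%s. (max M 1 * dist f g) * exp (L * s)) integrable_on {0..ta}"
    by (intro integrable_continuous_real continuous_intros)
   fix s assume s: "s \<in> {0..ta}"
   have "?F f s - ?F g s = exp (L * s) *R (A s *v (apply_bcontfun f s - apply_bcontfun g s))"
    by (simp add: matrix_vector_mult_diff_distrib scaleR_diff_right)
   also have "norm ... \<le> exp (L * s) * (norm (A s) * norm (apply_bcontfun f s - apply_bcontfun g s))"
    by (simp add: norm_matrix_vector_mult_le)
   also have "... \<le> exp (L * s) * (max M 1 * dist f g)"
    using M[of s] s ta dist_bounded[of f s g] by (intro mult_left_mono mult_mono) (auto simp: dist_norm)
   finally show "norm (?F f s - ?F g s) \<le> (max M 1 * dist f g) * exp (L * s)" by (simp add: mult.commute)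
  qed
  also have "... = (max M 1 * dist f g) * ((exp (L * ta) - 1) / L)"
  proof -
   have "((%s. exp (L * s)) has_integral (exp (L * ta) / L - exp (L * 0) / L)) {0..ta}"
    by (rule fundamental_theorem_of_calculus)
     (use ta L in \<open>auto intro!: derivative_eq_intros simp flip: has_real_derivative_iff_has_vector_derivative\<close>)
   then have "integral {0..ta} (%s. exp (L * s)) = (exp (L * ta) - 1) / L"
    by (simp add: integral_unique diff_divide_distrib)
   then show ?thesis by simp
  qed
  also have "... \<le> (max M 1 * dist f g) * (exp (L * ta) / L)"
   using L by (intro mult_left_mono divide_right_mono) auto
  also have "... = (1 / 2) * dist f g * exp (L * ta)" by (simp add: L_def field_simps)
  finally have *: "norm (I (apply_bcontfun f) ta - I (apply_bcontfun g) ta) \<le> (1 / 2) * dist f g * exp (L * ta)" .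
  have "dist (apply_bcontfun (P f) t) (apply_bcontfun (P g) t)
   = exp (- L * ta) * norm (I (apply_bcontfun f) ta - I (apply_bcontfun g) ta)"
   by (simp add: P T_def ta_def dist_norm scaleR_diff_right[symmetric])
  also have "... \<le> exp (- L * ta) * ((1 / 2) * dist f g * exp (L * ta))"
   by (intro mult_left_mono *) simp
  also have "... = (exp (- L * ta) * exp (L * ta)) * ((1 / 2) * dist f g)" by (simp only: mult_ac)
  also have "exp (- L * ta) * exp (L * ta) = 1" by (simp add: exp_add[symmetric])
  finally show "dist (apply_bcontfun (P f) t) (apply_bcontfun (P g) t) \<le> (1 / 2) * dist f g" by simp
 qed
 then have "\<exists>!f. P f = f" by (intro banach_fix_type[where c="1/2"]) auto
 then obtain f where f: "P f = f" by blast
 define w where "w = apply_bcontfun f"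
 have wT: "T w = w" using P[of f] f by (simp add: w_def)
 have wc: "continuous_on UNIV w" by (simp add: w_def)
 define ph where "ph = (%t. exp (L * t) *R w t)"
 have ph: "ph t = I w t" if "t \<in> {0..1}" for t
 proof -
  have "c t = t" using that by (auto simp: c_def)
  then have "w t = exp (- L * t) *R I w t" using fun_cong[OF wT, of t] by (simp add: T_def)
  then show ?thesis by (simp add: ph_def exp_add[symmetric])
 qed
 have "(ph has_vector_derivative A t *v ph t) (at t within {0..1})" if t: "t \<in> {0..1}" for t
 proof -
  have "((%t. v + integral {0..t} (%s. exp (L * s) *R (A s *v w s))) has_vector_derivative
   0 + exp (L * t) *R (A t *v w t)) (at t within {0..1})"
   by (intro has_vector_derivative_add has_vector_derivative_const integral_has_vector_derivative ci wc t)
  then have "(I w has_vector_derivative A t *v ph t) (at t within {0..1})"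
   by (simp add: I_def ph_def matrix_vector_mult_scaleR)
  then show ?thesis
   by (rule has_vector_derivative_transform[OF t, rotated]) (use ph in auto)
 qed
 moreover have "ph 0 = v" using ph[of 0] by (simp add: I_def)
 ultimately show ?thesis by blast
qed

lemma linear_ode_unique:
 fixes A :: "real => real^'n::finite^'n"
 assumes A: "continuous_on {0..1} A"
  and ph: "\<And>t. t \<in> {0..1} ==> (ph has_vector_derivative A t *v ph t) (at t within {0..1})"
  and pz: "\<And>t. t \<in> {0..1} ==> (pz has_vector_derivative A t *v pz t) (at t within {0..1})"
  and eq: "ph 0 = pz 0" and t: "t \<in> {0..1}"
 shows "ph t = pz t"
proof -
 have "bounded (A ` {0..1})" by (intro compact_imp_bounded compact_continuous_image A) simp
 then obtain M where "\<forall>z\<in>A ` {0..1}. norm z \<le> M" unfolding bounded_iff by blast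
 then have M: "\<And>t. t \<in> {0..1} ==> norm (A t) \<le> M" by force
 define w where "w = (%t. ph t - pz t)"
 have w: "(w has_vector_derivative A t *v w t) (at t within {0..1})" if "t \<in> {0..1}" for t
  unfolding w_def using has_vector_derivative_diff[OF ph[OF that] pz[OF that]]
  by (simp add: matrix_vector_mult_diff_distrib)
 \<comment> \<open>Gronwall's argument in differential form: the weight e^(-2 M t) makes |w|^2
   nonincreasing, and it starts at 0.\<close>
 define h where "h = (%t. exp (- 2 * M * t) * (w t \<bullet> w t))"
 have hd: "(h has_real_derivative exp (- 2 * M * t) * (2 * (w t \<bullet> (A t *v w t)) - 2 * M * (w t \<bullet> w t))) (at t within {0..1})"
  if "t \<in> {0..1}" for t
 proof -
  have "((%t. w t \<bullet> w t) has_derivative (%s. w t \<bullet> (s *R (A t *v w t)) + (s *R (A t *v w t)) \<bullet> w t)) (at t within {0..1})"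
   using w[OF that] unfolding has_vector_derivative_def by (intro has_derivative_inner)
  moreover have "(%s. w t \<bullet> (s *R (A t *v w t)) + (s *R (A t *v w t)) \<bullet> w t) = (*) (2 * (w t \<bullet> (A t *v w t)))"
   by (auto simp: fun_eq_iff inner_commute)
  ultimately have "((%t. w t \<bullet> w t) has_real_derivative 2 * (w t \<bullet> (A t *v w t))) (at t within {0..1})"
   by (simp add: has_field_derivative_def)
  moreover have "((%t. exp (- 2 * M * t)) has_real_derivative - 2 * M * exp (- 2 * M * t)) (at t within {0..1})"
   by (auto intro!: derivative_eq_intros)
  ultimately show ?thesis
   unfolding h_def by (auto intro!: derivative_eq_intros simp: algebra_simps)
 qed
 have "h t \<le> h 0"
 proof (rule DERIV_nonpos_imp_decreasing_open[of 0 t h])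
  have "continuous_on {0..1} h"
   using DERIV_continuous[OF hd] by (simp add: continuous_on_eq_continuous_within)
  then show "continuous_on {0..t} h" by (rule continuous_on_subset) (use t in auto)
  fix s assume s: "0 < s" "s < t"
  let ?D = "exp (- 2 * M * s) * (2 * (w s \<bullet> (A s *v w s)) - 2 * M * (w s \<bullet> w s))"
  have "(h has_real_derivative ?D) (at s within {0<..<1})"
   by (rule has_field_derivative_subset[OF hd]) (use s t in auto)
  then have "(h has_real_derivative ?D) (at s)" using s t by (simp add: at_within_open[of s "{0<..<1}"])
  moreover have "?D \<le> 0"
  proof -
   have "w s \<bullet> (A s *v w s) \<le> norm (w s) * norm (A s *v w s)" by (rule norm_cauchy_schwarz)
   also have "... \<le> norm (w s) * (M * norm (w s))"
    using M[of s] s t by (intro mult_left_mono order_trans[OF norm_matrix_vector_mult_le] mult_right_mono) auto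
   also have "... = M * (w s \<bullet> w s)" by (simp add: power2_norm_eq_inner[symmetric] power2_eq_square)
   finally show ?thesis by (intro mult_nonneg_nonpos) auto
  qed
  ultimately show "\<exists>y. (h has_real_derivative y) (at s) \<and> y \<le> 0" by blast
 qed (use t in auto)
 then have "exp (- 2 * M * t) * (w t \<bullet> w t) \<le> 0" using eq by (simp add: h_def w_def)
 then have "w t \<bullet> w t \<le> 0" by (simp add: mult_le_0_iff not_le)
 then have "w t \<bullet> w t = 0" using inner_ge_zero[of "w t"] by linarith
 then have "w t = 0" by simp
 then show ?thesis by (simp add: w_def)
qed

section \<open>Parallel sections of continuous fields\<close>

definition bmul :: "real^'n::finite^'d::finite^'n => real^'n => real^'d^'n" where
 "bmul b v = (\<chi> i. b $ i *v v)"

lemma bmul_nth: "bmul b v $ i $ j = (\<Sum>k\<in>UNIV. b $ i $ j $ k * v $ k)"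
 by (simp add: bmul_def matrix_vector_mult_def)

lemma norm_bmul_le: "norm (bmul b v) \<le> norm b * norm v"
proof -
 have "norm (bmul b v) = L2_set (%i. norm (b $ i *v v)) UNIV"
  by (simp add: bmul_def norm_vec_def)
 also have "... \<le> L2_set (%i. norm v * norm (b $ i)) UNIV"
  by (intro L2_set_mono) (simp_all add: norm_matrix_vector_mult_le mult.commute[of "norm v"])
 also have "... = norm b * norm v"
  by (subst L2_set_right_distrib[symmetric]) (auto simp: norm_vec_def mult.commute)
 finally show ?thesis .
qed

lemma bmul_diff_left: "bmul (a - b) v = bmul a v - bmul b v"
 and bmul_add_left: "bmul (a + b) v = bmul a v + bmul b v"
 and bmul_diff_right: "bmul a (v - w) = bmul a v - bmul a w"
 and bmul_add_right: "bmul a (v + w) = bmul a v + bmul a w"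
 and bmul_scaleR_right: "bmul a (c *R v) = c *R bmul a v"
 and bmul_zero_right: "bmul a 0 = 0"
 by (simp_all add: bmul_def vec_eq_iff matrix_vector_mult_diff_rdistrib matrix_vector_mult_add_rdistrib
   matrix_vector_mult_diff_distrib matrix_vector_right_distrib matrix_vector_mult_scaleR)

lemma continuous_on_bmul:
 assumes "continuous_on S f" "continuous_on S g"
 shows "continuous_on S (%x. bmul (f x) (g x))"
 unfolding bmul_def matrix_vector_mult_def
 by (intro continuous_on_vec_lambda continuous_intros assms)

lemma borel_measurable_bmul:
 assumes "f \<in> borel_measurable M" "g \<in> borel_measurable M"
 shows "(%x. bmul (f x) (g x)) \<in> borel_measurable M"
proof -
 have "(%x. (f x, g x)) \<in> borel_measurable M" by (intro borel_measurable_Pair assms)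
 moreover have "continuous_on UNIV (%z :: (real^'n^'d^'n) \<times> (real^'n). bmul (fst z) (snd z))"
  by (intro continuous_on_bmul continuous_intros)
 ultimately show ?thesis
  using borel_measurable_continuous_on[of "%z. bmul (fst z) (snd z)" "%x. (f x, g x)" M] by simp
qed

definition csol :: "(real^'d::finite) set => (real^'d => real^'n::finite^'d^'n) => (real^'d => real^'n) => bool" where
 "csol Om B u \<longleftrightarrow> (\<forall>x\<in>Om. (u has_derivative (%h. - (bmul (B x) (u x) *v h))) (at x))"

text \<open>The velocity is a parameter D rather than a \<open>vector_derivative\<close>, so that
  the equation along a joined path can be written down directly.\<close>

definition tsol :: "(real^'d::finite => real^'n::finite^'d^'n) => (real => real^'d) => (real => real^'d) => (real => real^'n) => bool" where
 "tsol B ga D ph \<longleftrightarrow> (\<forall>t\<in>{0..1}. (ph has_vector_derivative - (bmul (B (ga t)) (ph t) *v D t)) (at t within {0..1}))"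

definition C1_path :: "(real^'d::finite) set => (real => real^'d) => (real => real^'d) => bool" where
 "C1_path Om ga D \<longleftrightarrow> ga ` {0..1} \<subseteq> Om \<and> continuous_on {0..1} D \<and>
  (\<forall>t\<in>{0..1}. (ga has_vector_derivative D t) (at t within {0..1}))"

lemma C1_paths_iff: "ga \<in> C1_paths Om x y \<longleftrightarrow> ga 0 = x \<and> ga 1 = y \<and> (\<exists>D. C1_path Om ga D)"
 by (auto simp: C1_paths_def C1_path_def)

lemma C1_path_continuous: "C1_path Om ga D ==> continuous_on {0..1} ga"
 unfolding C1_path_def
 by (auto simp: continuous_on_eq_continuous_within intro: has_vector_derivative_continuous)

lemma transport_sol_iff:
 assumes "C1_path Om ga D"
 shows "transport_sol B ga v ph \<longleftrightarrow> ph 0 = v \<and> tsol B ga D ph"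
proof -
 \<comment> \<open>On a nondegenerate closed interval the one-sided derivatives at the end points
   are unique as well.\<close>
 have "vector_derivative ga (at t within {0..1}) = D t" if "t \<in> {0..1}" for t
  using assms that unfolding C1_path_def by (intro vector_derivative_within_closed_interval) auto
 then have "(\<chi> i. - (\<Sum>j\<in>UNIV. \<Sum>k\<in>UNIV. B (ga t) $ i $ j $ k * ph t $ k *
   vector_derivative ga (at t within {0..1}) $ j)) = - (bmul (B (ga t)) (ph t) *v D t)" if "t \<in> {0..1}" for t
  using that by (simp add: vec_eq_iff matrix_vector_mult_def bmul_nth sum_distrib_right)
 then show ?thesis unfolding transport_sol_def tsol_def by auto
qed

lemma tsol_as_ode:
 fixes B :: "real^'d::finite => real^'n::finite^'d^'n"
 assumes "C1_path Om ga D" and "continuous_on Om B"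
 obtains A :: "real => real^'n^'n" where "continuous_on {0..1} A" "\<And>t v. A t *v v = - (bmul (B (ga t)) v *v D t)"
proof -
 define A :: "real => real^'n^'n" where "A = (%t. \<chi> i k. - (\<Sum>j\<in>UNIV. B (ga t) $ i $ j $ k * D t $ j))"
 have "continuous_on {0..1} (%t. B (ga t))"
  by (rule continuous_on_compose2[OF assms(2) C1_path_continuous[OF assms(1)]])
   (use assms(1) in \<open>auto simp: C1_path_def\<close>)
 moreover have "continuous_on {0..1} D" using assms(1) by (simp add: C1_path_def)
 ultimately have "continuous_on {0..1} A"
  unfolding A_def by (intro continuous_on_vec_lambda continuous_intros)
 moreover have "A t *v v = - (bmul (B (ga t)) v *v D t)" for t v
 proof -
  have "(\<Sum>k\<in>UNIV. (- (\<Sum>j\<in>UNIV. B (ga t) $ i $ j $ k * D t $ j)) * v $ k) =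
   - (\<Sum>j\<in>UNIV. (\<Sum>k\<in>UNIV. B (ga t) $ i $ j $ k * v $ k) * D t $ j)" for i
  proof -
   have "(\<Sum>k\<in>UNIV. (\<Sum>j\<in>UNIV. B (ga t) $ i $ j $ k * D t $ j) * v $ k) =
    (\<Sum>k\<in>UNIV. \<Sum>j\<in>UNIV. B (ga t) $ i $ j $ k * v $ k * D t $ j)"
    by (simp add: sum_distrib_right sum_distrib_left mult_ac)
   also have "... = (\<Sum>j\<in>UNIV. \<Sum>k\<in>UNIV. B (ga t) $ i $ j $ k * v $ k * D t $ j)" by (rule sum.swap)
   also have "... = (\<Sum>j\<in>UNIV. (\<Sum>k\<in>UNIV. B (ga t) $ i $ j $ k * v $ k) * D t $ j)"
    by (simp add: sum_distrib_right)
   finally show ?thesis by (simp add: sum_negf)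
  qed
  then show ?thesis by (simp add: vec_eq_iff matrix_vector_mult_def bmul_nth A_def)
 qed
 ultimately show ?thesis using that by blast
qed

lemma tsol_exists:
 assumes "C1_path Om ga D" and "continuous_on Om B"
 shows "\<exists>ph. ph 0 = v \<and> tsol B ga D ph"
proof -
 obtain A where A: "continuous_on {0..1} A" "\<And>t v. A t *v v = - (bmul (B (ga t)) v *v D t)"
  using tsol_as_ode[OF assms] by blast
 show ?thesis using linear_ode_exists[OF A(1), of v] by (auto simp: tsol_def A(2))
qed

lemma tsol_unique:
 assumes "C1_path Om ga D" and "continuous_on Om B" "tsol B ga D ph" "tsol B ga D pz" "ph 0 = pz 0" "t \<in> {0..1}"
 shows "ph t = pz t"
proof -
 obtain A where A: "continuous_on {0..1} A" "\<And>t v. A t *v v = - (bmul (B (ga t)) v *v D t)"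
  using tsol_as_ode[OF assms(1,2)] by blast
 show ?thesis
  by (rule linear_ode_unique[OF A(1)]) (use assms in \<open>auto simp: tsol_def A(2)\<close>)
qed

text \<open>Uniqueness of the solution is what makes the definite description in
  \<open>transport\<close> denote.\<close>

lemma transport_eq:
 assumes "C1_path Om ga D" and "continuous_on Om B" "tsol B ga D ph"
 shows "transport B ga (ph 0) = ph 1"
 unfolding transport_def transport_sol_iff[OF assms(1)]
proof (rule the_equality)
 show "\<exists>ph'. (ph' 0 = ph 0 \<and> tsol B ga D ph') \<and> ph' 1 = ph 1" using assms(3) by blast
 fix w assume "\<exists>ph'. (ph' 0 = ph 0 \<and> tsol B ga D ph') \<and> ph' 1 = w"
 then show "w = ph 1" using tsol_unique[OF assms(1,2) _ assms(3), of _ 1] by force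
qed

lemma csol_along_path:
 assumes "C1_path Om ga D" "csol Om B u"
 shows "tsol B ga D (%t. u (ga t))"
 unfolding tsol_def
proof
 fix t :: real assume t: "t \<in> {0..1}"
 have "(ga has_derivative (%s. s *R D t)) (at t within {0..1})"
  using assms(1) t by (simp add: C1_path_def has_vector_derivative_def)
 moreover have "(u has_derivative (%h. - (bmul (B (ga t)) (u (ga t)) *v h))) (at (ga t))"
  using assms t unfolding csol_def C1_path_def by blast
 ultimately have "((%t. u (ga t)) has_derivative (%s. - (bmul (B (ga t)) (u (ga t)) *v (s *R D t)))) (at t within {0..1})"
  by (rule has_derivative_compose)
 then show "((%t. u (ga t)) has_vector_derivative - (bmul (B (ga t)) (u (ga t)) *v D t)) (at t within {0..1})"
  by (simp add: has_vector_derivative_def matrix_vector_mult_scaleR)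
qed

definition pjoin :: "(real => 'a) => (real => 'a) => real => 'a" where
 "pjoin f g t = (if t \<in> {0..1/2} then f (2 * t) else g (2 * t - 1))"

lemma pjoin_deriv:
 fixes f g :: "real => 'a::real_normed_vector"
 assumes f: "\<And>t. t \<in> {0..1} ==> (f has_vector_derivative f' t) (at t within {0..1})"
  and g: "\<And>t. t \<in> {0..1} ==> (g has_vector_derivative g' t) (at t within {0..1})"
  and eq: "f 1 = g 0" "f' 1 = g' 0" and t: "t \<in> {0..1}"
 shows "(pjoin f g has_vector_derivative 2 *R pjoin f' g' t) (at t within {0..1})"
proof -
 have cl: "closure {0..1/2::real} = {0..1/2}" "closure {1/2<..1::real} = {1/2..1}" by auto
 have int: "{0..1/2} \<inter> {1/2..1} = {1/2::real}" by auto
 have f2: "((%t. f (2 * t)) has_vector_derivative 2 *R f' (2 * t)) (at t within {0..1/2})" if "t \<in> {0..1/2}" for t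
 proof -
  have "((%t::real. 2 * t) has_vector_derivative 2) (at t within {0..1/2})"
   by (auto intro!: derivative_eq_intros simp flip: has_real_derivative_iff_has_vector_derivative)
  moreover have "(f has_vector_derivative f' (2 * t)) (at (2 * t) within (%t. 2 * t) ` {0..1/2})"
   by (rule has_vector_derivative_within_subset[OF f]) (use that in auto)
  ultimately have "(f \<circ> (%t. 2 * t) has_vector_derivative 2 *R f' (2 * t)) (at t within {0..1/2})"
   by (rule vector_diff_chain_within)
  then show ?thesis by (simp add: o_def)
 qed
 have g2: "((%t. g (2 * t - 1)) has_vector_derivative 2 *R g' (2 * t - 1)) (at t within {1/2..1})" if "t \<in> {1/2..1}" for t
 proof -
  have "((%t::real. 2 * t - 1) has_vector_derivative 2) (at t within {1/2..1})"
   by (auto intro!: derivative_eq_intros simp flip: has_real_derivative_iff_has_vector_derivative)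
  moreover have "(g has_vector_derivative g' (2 * t - 1)) (at (2 * t - 1) within (%t. 2 * t - 1) ` {1/2..1})"
   by (rule has_vector_derivative_within_subset[OF g]) (use that in auto)
  ultimately have "(g \<circ> (%t. 2 * t - 1) has_vector_derivative 2 *R g' (2 * t - 1)) (at t within {1/2..1})"
   by (rule vector_diff_chain_within)
  then show ?thesis by (simp add: o_def)
 qed
 have "((%t. if t \<in> {0..1/2} then f (2 * t) else g (2 * t - 1)) has_vector_derivative
  (if t \<in> {0..1/2} then 2 *R f' (2 * t) else 2 *R g' (2 * t - 1))) (at t within {0..1})"
 proof (rule has_vector_derivative_If_within_closures[where T="{1/2<..1}"])
  show "t \<in> {0..1/2} \<union> {1/2<..1}" "{0..1} = {0..1/2} \<union> {1/2<..1::real}" using t by auto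
  have e1: "{0..1/2} \<union> closure {0..1/2} \<inter> closure {1/2<..1} = {0..1/2::real}" unfolding cl by auto
  have e2: "{1/2<..1} \<union> closure {0..1/2} \<inter> closure {1/2<..1} = {1/2..1::real}" unfolding cl by auto
  show "((%t. f (2 * t)) has_vector_derivative 2 *R f' (2 * t)) (at t within {0..1/2} \<union> closure {0..1/2} \<inter> closure {1/2<..1})"
   if "t \<in> {0..1/2} \<union> closure {0..1/2} \<inter> closure {1/2<..1}"
   using that unfolding e1 by (rule f2)
  show "((%t. g (2 * t - 1)) has_vector_derivative 2 *R g' (2 * t - 1)) (at t within {1/2<..1} \<union> closure {0..1/2} \<inter> closure {1/2<..1})"
   if "t \<in> {1/2<..1} \<union> closure {0..1/2} \<inter> closure {1/2<..1}"
   using that unfolding e2 by (rule g2)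
  show "f (2 * t) = g (2 * t - 1)" "2 *R f' (2 * t) = 2 *R g' (2 * t - 1)"
   if "t \<in> closure {0..1/2}" "t \<in> closure {1/2<..1}"
  proof -
   have "2 * t = 1" "2 * t - 1 = 0" using that unfolding cl by auto
   then show "f (2 * t) = g (2 * t - 1)" "2 *R f' (2 * t) = 2 *R g' (2 * t - 1)" using eq by (simp_all only:)
  qed
 qed
 then show ?thesis by (simp add: pjoin_def[abs_def] if_distrib cong: if_cong)
qed

lemma pjoin_continuous:
 fixes f g :: "real => 'a::topological_space"
 assumes f: "continuous_on {0..1} f" and g: "continuous_on {0..1} g" and eq: "f 1 = g 0"
 shows "continuous_on {0..1} (pjoin f g)"
proof -
 have "continuous_on ({0..1/2} \<union> {1/2..1}) (%t. if t \<in> {0..1/2} then f (2 * t) else g (2 * t - 1))"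
 proof (rule continuous_on_cases)
  show "continuous_on {0..1/2} (%t. f (2 * t))"
   by (rule continuous_on_compose2[OF f]) (auto intro!: continuous_intros)
  show "continuous_on {1/2..1} (%t. g (2 * t - 1))"
   by (rule continuous_on_compose2[OF g]) (auto intro!: continuous_intros)
  show "\<forall>t. t \<in> {0..1/2} \<and> t \<notin> {0..1/2} \<or> t \<in> {1/2..1} \<and> t \<in> {0..1/2} --> f (2 * t) = g (2 * t - 1)"
  proof (intro allI impI)
   fix t :: real assume "t \<in> {0..1/2} \<and> t \<notin> {0..1/2} \<or> t \<in> {1/2..1} \<and> t \<in> {0..1/2}"
   then have "2 * t = 1" "2 * t - 1 = 0" by auto
   then show "f (2 * t) = g (2 * t - 1)" using eq by (simp only:)
  qed
 qed auto
 moreover have "{0..1/2} \<union> {1/2..1} = {0..1::real}" by auto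
 ultimately show ?thesis by (simp add: pjoin_def[abs_def])
qed

lemma pjoin_image: "pjoin f g ` {0..1} \<subseteq> f ` {0..1} \<union> g ` {0..1}"
 by (auto simp: pjoin_def)

lemma pjoin_ends: "pjoin f g 0 = f 0" "pjoin f g 1 = g 1"
 by (auto simp: pjoin_def)

text \<open>Velocity 0 at both ends makes the concatenation of two such paths C^1 again, so
  transports can be composed within the class of paths that defines E^x.\<close>

definition good_path :: "(real^'d::finite) set => real^'d => real^'d => (real => real^'d) => (real => real^'d) => bool" where
 "good_path Om x y ga D \<longleftrightarrow> C1_path Om ga D \<and> ga 0 = x \<and> ga 1 = y \<and> D 0 = 0 \<and> D 1 = 0"

lemma good_path_join:
 assumes 1: "good_path Om x y ga1 D1" and 2: "good_path Om y z ga2 D2"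
 shows "good_path Om x z (pjoin ga1 ga2) (%t. 2 *R pjoin D1 D2 t)"
proof -
 note a = assms[unfolded good_path_def C1_path_def]
 have "continuous_on {0..1} (pjoin D1 D2)" by (rule pjoin_continuous) (use a in auto)
 moreover have "(pjoin ga1 ga2 has_vector_derivative 2 *R pjoin D1 D2 t) (at t within {0..1})" if "t \<in> {0..1}" for t
  by (rule pjoin_deriv) (use a that in auto)
 moreover have "pjoin ga1 ga2 ` {0..1} \<subseteq> Om" using pjoin_image[of ga1 ga2] a by blast
 ultimately show ?thesis
  using a by (auto simp: good_path_def C1_path_def pjoin_ends intro!: continuous_intros)
qed

lemma tsol_join:
 assumes 1: "good_path Om x y ga1 D1" and 2: "good_path Om y z ga2 D2"
  and ph: "tsol B ga1 D1 ph1" "tsol B ga2 D2 ph2" "ph1 1 = ph2 0"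
 shows "tsol B (pjoin ga1 ga2) (%t. 2 *R pjoin D1 D2 t) (pjoin ph1 ph2)"
 unfolding tsol_def
proof
 fix t :: real assume t: "t \<in> {0..1}"
 let ?f = "%t. - (bmul (B (ga1 t)) (ph1 t) *v D1 t)" and ?g = "%t. - (bmul (B (ga2 t)) (ph2 t) *v D2 t)"
 have "(pjoin ph1 ph2 has_vector_derivative 2 *R pjoin ?f ?g t) (at t within {0..1})"
  by (rule pjoin_deriv) (use assms t in \<open>auto simp: good_path_def tsol_def\<close>)
 moreover have "2 *R pjoin ?f ?g t = - (bmul (B (pjoin ga1 ga2 t)) (pjoin ph1 ph2 t) *v (2 *R pjoin D1 D2 t))"
  by (simp add: pjoin_def matrix_vector_mult_scaleR)
 ultimately show "(pjoin ph1 ph2 has_vector_derivative - (bmul (B (pjoin ga1 ga2 t)) (pjoin ph1 ph2 t) *v (2 *R pjoin D1 D2 t))) (at t within {0..1})"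
  by simp
qed

text \<open>A segment run through with vanishing speed at both ends, so that concatenations stay C^1.\<close>

definition seg :: "real^'d::finite => real^'d => real => real^'d" where
 "seg x h t = x + (3 * t\<^sup>2 - 2 * t ^ 3) *R h"

definition segD :: "real^'d::finite => real => real^'d" where
 "segD h t = (6 * t - 6 * t\<^sup>2) *R h"

lemma smoothstep_01: "0 \<le> t ==> t \<le> 1 ==> 0 \<le> 3 * t\<^sup>2 - 2 * t ^ 3 \<and> 3 * t\<^sup>2 - 2 * t ^ 3 \<le> (1::real)"
proof
 assume t: "0 \<le> t" "t \<le> 1"
 have "3 * t\<^sup>2 - 2 * t ^ 3 = t\<^sup>2 * (3 - 2 * t)" by (simp add: algebra_simps power2_eq_square power3_eq_cube)
 moreover have "... \<ge> 0" using t by (intro mult_nonneg_nonneg) auto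
 ultimately show "0 \<le> 3 * t\<^sup>2 - 2 * t ^ 3" by simp
 have "1 - (3 * t\<^sup>2 - 2 * t ^ 3) = (1 - t)\<^sup>2 * (1 + 2 * t)" by (simp add: algebra_simps power2_eq_square power3_eq_cube)
 moreover have "... \<ge> 0" using t by (intro mult_nonneg_nonneg) auto
 ultimately show "3 * t\<^sup>2 - 2 * t ^ 3 \<le> 1" by linarith
qed

lemma seg_deriv: "(seg x h has_vector_derivative segD h t) (at t within S)"
proof -
 have "((%t::real. 3 * t\<^sup>2 - 2 * t ^ 3) has_real_derivative 6 * t - 6 * t\<^sup>2) (at t within S)"
  by (auto intro!: derivative_eq_intros simp: power2_eq_square)
 then show ?thesis
  unfolding seg_def[abs_def] segD_def
  by (auto intro!: derivative_eq_intros simp: has_real_derivative_iff_has_vector_derivative)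
qed

lemma good_path_seg:
 assumes "\<And>s. s \<in> {0..1} ==> x + s *R h \<in> Om"
 shows "good_path Om x (x + h) (seg x h) (segD h)"
proof -
 have "seg x h t \<in> Om" if "t \<in> {0..1}" for t
  unfolding seg_def using smoothstep_01[of t] that by (intro assms) auto
 then show ?thesis
  using seg_deriv[of x h] by (auto simp: good_path_def C1_path_def seg_def segD_def intro!: continuous_intros)
qed

lemma good_path_reverse:
 assumes "good_path Om x y ga D"
 shows "good_path Om y x (%t. ga (1 - t)) (%t. - D (1 - t))"
proof -
 note a = assms[unfolded good_path_def C1_path_def]
 have "((%t. ga (1 - t)) has_vector_derivative - D (1 - t)) (at t within {0..1})" if "t \<in> {0..1}" for t
 proof -
  have "((%t::real. 1 - t) has_vector_derivative - 1) (at t within {0..1})"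
   by (auto intro!: derivative_eq_intros simp flip: has_real_derivative_iff_has_vector_derivative)
  moreover have "(ga has_vector_derivative D (1 - t)) (at (1 - t) within (%t. 1 - t) ` {0..1})"
   by (rule has_vector_derivative_within_subset[of _ _ _ "{0..1}"]) (use a that in auto)
  ultimately have "(ga \<circ> (%t. 1 - t) has_vector_derivative (- 1) *R D (1 - t)) (at t within {0..1})"
   by (rule vector_diff_chain_within)
  then show ?thesis by (simp add: o_def)
 qed
 moreover have "continuous_on {0..1} (%t. D (1 - t))"
  by (rule continuous_on_compose2[of "{0..1}" D]) (use a in \<open>auto intro!: continuous_intros\<close>)
 moreover have "(%t. ga (1 - t)) ` {0..1} \<subseteq> Om"
  using a by auto
 ultimately show ?thesis using a by (auto simp: good_path_def C1_path_def intro!: continuous_intros)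
qed

text \<open>Being joined by such a path is an equivalence relation with open classes, so a connected
  domain is a single class.\<close>

lemma good_path_exists:
 fixes Om :: "(real^'d::finite) set"
 assumes "open Om" "connected Om" "x \<in> Om" "y \<in> Om"
 shows "\<exists>ga D. good_path Om x y ga D"
proof (rule connected_equivalence_relation[OF assms(2,3,4), where R="%x y. \<exists>ga D. good_path Om x y ga D"])
 show "\<exists>ga D. good_path Om b a ga D" if "\<exists>ga D. good_path Om a b ga D" for a b
  using that good_path_reverse by blast
 show "\<exists>ga D. good_path Om a c ga D" if "\<exists>ga D. good_path Om a b ga D" "\<exists>ga D. good_path Om b c ga D" for a b c
  using that good_path_join by blast
 fix a assume "a \<in> Om"
 then obtain r where r: "r > 0" "ball a r \<subseteq> Om" using assms(1) openE by blast
 have "\<exists>ga D. good_path Om a z ga D" if z: "z \<in> ball a r" for z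
 proof -
  have "a + s *R (z - a) \<in> Om" if "s \<in> {0..1}" for s
  proof -
   have "norm (s *R (z - a)) \<le> norm (z - a)" using that by (simp add: mult_left_le_one_le)
   then have "a + s *R (z - a) \<in> ball a r" using z by (simp add: dist_norm norm_minus_commute)
   then show ?thesis using r by blast
  qed
  then show ?thesis using good_path_seg[of a "z - a" Om] by auto
 qed
 moreover have "openin (top_of_set Om) (ball a r)" using r by (intro open_subset) auto
 ultimately show "\<exists>T. openin (top_of_set Om) T \<and> a \<in> T \<and> (\<forall>z\<in>T. \<exists>ga D. good_path Om a z ga D)"
  using r by (intro exI[of _ "ball a r"]) auto
qed

lemma onorm_scaleR_left_le:
 fixes w :: "'a::real_normed_vector"
 assumes "norm w \<le> b"
 shows "onorm (%s::real. s *R w) \<le> b"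
proof (rule onorm_bound)
 show "b \<ge> 0" using assms norm_ge_zero order_trans by blast
 show "norm (s *R w) \<le> b * norm s" for s :: real
  using mult_right_mono[OF assms, of "\<bar>s\<bar>"] by (simp add: mult.commute)
qed

text \<open>First order expansion of the transport along a short segment with explicit remainder,
  where \<open>om\<close> bounds the oscillation of B on the segment. It supplies the derivative of
  a transported section.\<close>

lemma tsol_segment_estimate:
 fixes B :: "real^'d::finite => real^'n::finite^'d^'n"
 assumes ph: "tsol B (seg y h) (segD h) ph"
  and om: "\<And>s. s \<in> {0..1} ==> norm (B (seg y h s) - B y) \<le> om" "om \<ge> 0" and M: "norm (B y) + om \<le> M" "M * norm h \<le> 1 / 4"
 shows "norm (ph 1 - ph 0 + bmul (B y) (ph 0) *v h) \<le> (2 * om + 4 * M\<^sup>2 * norm h) * norm (ph 0) * (2 * norm h)"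
proof -
 have M0: "M \<ge> 0" "norm (B y) \<le> M" using M(1) om(2) norm_ge_zero[of "B y"] by linarith+
 have d: "(ph has_vector_derivative - (bmul (B (seg y h t)) (ph t) *v segD h t)) (at t within {0..1})" if "t \<in> {0..1}" for t
  using ph that by (auto simp: tsol_def)
 have BM: "norm (B (seg y h t)) \<le> M" if "t \<in> {0..1}" for t
  using norm_triangle_ineq[of "B (seg y h t) - B y" "B y"] om(1)[OF that] M(1) by simp
 have sD: "norm (segD h t) \<le> 2 * norm h" if "t \<in> {0..1}" for t
 proof -
  have "0 \<le> 6 * t - 6 * t\<^sup>2" using that mult_left_le_one_le[of t t] by (simp add: power2_eq_square)
  moreover have "6 * t - 6 * t\<^sup>2 \<le> 2"
   using zero_le_power2[of "t - 1/2"] by (simp add: power2_eq_square algebra_simps)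
  ultimately show ?thesis by (simp add: segD_def mult_right_mono)
 qed
 have "continuous_on {0..1} ph"
  using has_vector_derivative_continuous[OF d] by (simp add: continuous_on_eq_continuous_within)
 then have "\<exists>s\<in>{0..1}. \<forall>t\<in>{0..1}. norm (ph t) \<le> norm (ph s)"
  by (intro continuous_attains_sup continuous_intros) auto
 then obtain s where s: "s \<in> {0..1}" "\<And>t. t \<in> {0..1} ==> norm (ph t) \<le> norm (ph s)" by blast
 \<comment> \<open>The maximum of |ph| will be at most twice the initial value: since M |h| \<le>
   1/4, the increment is at most half the maximum.\<close>
 let ?S = "norm (ph s)"
 have bd: "norm (ph t - ph 0) \<le> M * ?S * (2 * norm h)" if t: "t \<in> {0..1}" for t
 proof -
  have "norm (ph t - ph 0) \<le> (M * ?S * (2 * norm h)) * norm (t - 0)"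
  proof (rule differentiable_bound[where S="{0..1}" and f'="%t s. s *R (- (bmul (B (seg y h t)) (ph t) *v segD h t))"])
   fix t :: real assume t: "t \<in> {0..1}"
   show "(ph has_derivative (%s. s *R - (bmul (B (seg y h t)) (ph t) *v segD h t))) (at t within {0..1})"
    using d[OF t] by (simp add: has_vector_derivative_def)
   have "norm (bmul (B (seg y h t)) (ph t) *v segD h t) \<le> norm (bmul (B (seg y h t)) (ph t)) * norm (segD h t)"
    by (rule norm_matrix_vector_mult_le)
   also have "... \<le> (norm (B (seg y h t)) * norm (ph t)) * norm (segD h t)"
    by (intro mult_right_mono norm_bmul_le) auto
   also have "... \<le> M * ?S * (2 * norm h)"
    using BM[OF t] s(2)[OF t] sD[OF t] M0 by (intro mult_mono) auto
   finally show "onorm (%s. s *R - (bmul (B (seg y h t)) (ph t) *v segD h t)) \<le> M * ?S * (2 * norm h)"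
    using onorm_scaleR_left_le[of "- (bmul (B (seg y h t)) (ph t) *v segD h t)"] by simp
  qed (use t in auto)
  also have "... \<le> (M * ?S * (2 * norm h)) * 1"
   using t M0 by (intro mult_left_mono) auto
  finally show ?thesis by simp
 qed
 have "M * ?S * (2 * norm h) = (M * norm h) * 2 * ?S" by simp
 also have "... \<le> (1 / 4) * 2 * ?S" using M(2) by (intro mult_right_mono) auto
 finally have "norm (ph s - ph 0) \<le> ?S / 2" using bd[OF s(1)] by simp
 then have S2: "?S \<le> 2 * norm (ph 0)" using norm_triangle_sub[of "ph s" "ph 0"] by linarith
 have bd2: "norm (ph t - ph 0) \<le> 4 * M * norm h * norm (ph 0)" if t: "t \<in> {0..1}" for t
 proof -
  have "M * ?S * (2 * norm h) \<le> M * (2 * norm (ph 0)) * (2 * norm h)"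
   using M0 S2 by (intro mult_right_mono mult_left_mono) auto
  then show ?thesis using bd[OF t] by (simp add: mult_ac)
 qed
 \<comment> \<open>Adding the linear term with coefficients frozen at y cancels the leading part;
   the remaining derivative contains only B(seg) - B(y) and ph(t) - ph(0).\<close>
 define pz where "pz = (%t. ph t + bmul (B y) (ph 0) *v (seg y h t))"
 have "norm (pz 1 - pz 0) \<le> ((2 * om + 4 * M\<^sup>2 * norm h) * norm (ph 0) * (2 * norm h)) * norm (1 - 0 :: real)"
 proof (rule differentiable_bound[where S="{0..1}" and f'="%t s. s *R (- (bmul (B (seg y h t)) (ph t) *v segD h t) + bmul (B y) (ph 0) *v segD h t)"])
  fix t :: real assume t: "t \<in> {0..1}"
  have "((%t. bmul (B y) (ph 0) *v (seg y h t)) has_vector_derivative bmul (B y) (ph 0) *v segD h t) (at t within {0..1})"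
   by (rule bounded_linear.has_vector_derivative[OF matrix_vector_mul_bounded_linear seg_deriv])
  then have "(pz has_vector_derivative - (bmul (B (seg y h t)) (ph t) *v segD h t) + bmul (B y) (ph 0) *v segD h t) (at t within {0..1})"
   unfolding pz_def by (intro has_vector_derivative_add d t)
  then show "(pz has_derivative (%s. s *R (- (bmul (B (seg y h t)) (ph t) *v segD h t) + bmul (B y) (ph 0) *v segD h t))) (at t within {0..1})"
   by (simp add: has_vector_derivative_def)
  have "- (bmul (B (seg y h t)) (ph t) *v segD h t) + bmul (B y) (ph 0) *v segD h t =
   - ((bmul (B (seg y h t) - B y) (ph t) + bmul (B y) (ph t - ph 0)) *v segD h t)"
   by (simp add: bmul_diff_left bmul_diff_right matrix_vector_mult_diff_rdistrib)
  also have "norm ... \<le> norm (bmul (B (seg y h t) - B y) (ph t) + bmul (B y) (ph t - ph 0)) * norm (segD h t)"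
   by (simp only: norm_minus_cancel norm_matrix_vector_mult_le)
  also have "... \<le> (om * (2 * norm (ph 0)) + M * (4 * M * norm h * norm (ph 0))) * (2 * norm h)"
  proof (rule mult_mono)
   have "norm (bmul (B (seg y h t) - B y) (ph t)) \<le> om * (2 * norm (ph 0))"
    using om(1)[OF t] s(2)[OF t] S2 om(2) by (intro order_trans[OF norm_bmul_le] mult_mono) auto
   moreover have "norm (bmul (B y) (ph t - ph 0)) \<le> M * (4 * M * norm h * norm (ph 0))"
    using bd2[OF t] M0 by (intro order_trans[OF norm_bmul_le] mult_mono) auto
   ultimately show "norm (bmul (B (seg y h t) - B y) (ph t) + bmul (B y) (ph t - ph 0)) \<le>
     om * (2 * norm (ph 0)) + M * (4 * M * norm h * norm (ph 0))"
    by (meson add_mono norm_triangle_ineq order_trans)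
  qed (use sD[OF t] om(2) M0 in auto)
  also have "... = (2 * om + 4 * M\<^sup>2 * norm h) * norm (ph 0) * (2 * norm h)"
   by (simp add: algebra_simps power2_eq_square)
  finally show "onorm (%s. s *R (- (bmul (B (seg y h t)) (ph t) *v segD h t) + bmul (B y) (ph 0) *v segD h t))
    \<le> (2 * om + 4 * M\<^sup>2 * norm h) * norm (ph 0) * (2 * norm h)"
   by (rule onorm_scaleR_left_le)
 qed auto
 moreover have "pz 1 - pz 0 = ph 1 - ph 0 + bmul (B y) (ph 0) *v h"
  by (simp add: pz_def seg_def matrix_vector_right_distrib)
 ultimately show ?thesis by simp
qed

text \<open>Transport v along one chosen path to each point. Path independence lets the chosen path
  to y + h be replaced by the one to y followed by a segment, and the expansion along the segment
  shows that the resulting function solves the equation.\<close>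

lemma Econs_subset:
 fixes B :: "real^'d::finite => real^'n::finite^'d^'n"
 assumes Om: "open Om" "connected Om" and B: "continuous_on Om B" and x: "x \<in> Om" and v: "v \<in> Econs Om B x"
 shows "\<exists>u. csol Om B u \<and> u x = v"
proof -
 have "\<forall>y. \<exists>ga D. y \<in> Om --> good_path Om x y ga D" using good_path_exists[OF Om x] by blast
 then obtain ga D where g: "\<And>y. y \<in> Om ==> good_path Om x y (ga y) (D y)" by metis
 define u where "u = (%y. transport B (ga y) v)"
 have C1: "C1_path Om sg E" if "good_path Om a b sg E" for sg E a b using that by (simp add: good_path_def)
 have tr: "transport B sg v = u y" if "good_path Om x y sg E" "y \<in> Om" for sg E y
 proof -
  have "sg \<in> C1_paths Om x y" "ga y \<in> C1_paths Om x y"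
   using that g[OF that(2)] by (auto simp: C1_paths_iff good_path_def)
  then show ?thesis using v that(2) unfolding Econs_def u_def by blast
 qed
 have step: "\<exists>ph. tsol B (seg y h) (segD h) ph \<and> ph 0 = u y \<and> ph 1 = u (y + h)"
  if y: "y \<in> Om" and s: "\<And>s. s \<in> {0..1} ==> y + s *R h \<in> Om" for y h
 proof -
  have gs: "good_path Om y (y + h) (seg y h) (segD h)" by (rule good_path_seg[OF s])
  obtain ph1 where p1: "ph1 0 = v" "tsol B (ga y) (D y) ph1" using tsol_exists[OF C1[OF g[OF y]] B, of v] by blast
  have e1: "ph1 1 = u y" using transport_eq[OF C1[OF g[OF y]] B p1(2)] p1(1) by (simp add: u_def)
  obtain ph2 where p2: "ph2 0 = u y" "tsol B (seg y h) (segD h) ph2" using tsol_exists[OF C1[OF gs] B, of "u y"] by blast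
  have gj: "good_path Om x (y + h) (pjoin (ga y) (seg y h)) (%t. 2 *R pjoin (D y) (segD h) t)"
   by (rule good_path_join[OF g[OF y] gs])
  have "tsol B (pjoin (ga y) (seg y h)) (%t. 2 *R pjoin (D y) (segD h) t) (pjoin ph1 ph2)"
   by (rule tsol_join[OF g[OF y] gs p1(2) p2(2)]) (simp add: e1 p2)
  from transport_eq[OF C1[OF gj] B this] have "transport B (pjoin (ga y) (seg y h)) v = ph2 1"
   by (simp add: pjoin_ends p1)
  moreover have "y + h \<in> Om" using s[of 1] by simp
  ultimately have "u (y + h) = ph2 1" using tr[OF gj] by simp
  then show ?thesis using p2 by auto
 qed
 have "csol Om B u"
  unfolding csol_def has_derivative_at_alt
 proof (intro ballI conjI allI impI)
  fix y assume y: "y \<in> Om"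
  show "bounded_linear (%h. - (bmul (B y) (u y) *v h))"
   by (intro bounded_linear_minus matrix_vector_mul_bounded_linear)
  fix e :: real assume e: "e > 0"
  define n0 where "n0 = norm (u y) + 1"
  have n0: "n0 > 0" "norm (u y) \<le> n0" by (auto simp: n0_def add_nonneg_pos)
  \<comment> \<open>The remainder is at most (4 om n0 + 8 M^2 n0 |h|) |h|. The value of
    \<open>om\<close> makes the first term e/2, the last entry of \<open>dt\<close> does so for the
    second, and the entry 1/(4M) meets the hypothesis of the expansion.\<close>
  define om where "om = e / (8 * n0)"
  have om: "om > 0" using e n0 by (simp add: om_def)
  define M where "M = norm (B y) + om"
  have M: "M > 0" using om by (simp add: M_def add_nonneg_pos)
  obtain r where r: "r > 0" "ball y r \<subseteq> Om" using Om(1) y openE by blast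
  obtain d where d: "d > 0" "\<And>z. z \<in> Om ==> dist z y < d ==> dist (B z) (B y) < om"
   using B y om unfolding continuous_on_iff by blast
  define dt where "dt = min (min r d) (min (1 / (4 * M)) (e / (16 * M\<^sup>2 * n0)))"
  have dt: "dt > 0" using r d M e n0 by (simp add: dt_def)
  show "\<exists>d>0. \<forall>z. norm (z - y) < d --> norm (u z - u y - - (bmul (B y) (u y) *v (z - y))) \<le> e * norm (z - y)"
  proof (intro exI[of _ dt] conjI allI impI dt)
   fix z assume z: "norm (z - y) < dt"
   define h where "h = z - y"
   have h: "norm h < r" "norm h < d" "norm h \<le> 1 / (4 * M)" "norm h \<le> e / (16 * M\<^sup>2 * n0)"
    using z by (auto simp: dt_def h_def)
   have inb: "norm (s *R h) \<le> norm h" if "s \<in> {0..1}" for s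
    using that by (simp add: mult_left_le_one_le)
   have sOm: "y + s *R h \<in> Om" if "s \<in> {0..1}" for s
    using inb[OF that] h(1) r(2) by (intro subsetD[OF r(2)]) (simp add: dist_norm)
   obtain ph where ph: "tsol B (seg y h) (segD h) ph" "ph 0 = u y" "ph 1 = u (y + h)"
    using step[OF y sOm] by blast
   have "norm (ph 1 - ph 0 + bmul (B y) (ph 0) *v h) \<le> (2 * om + 4 * M\<^sup>2 * norm h) * norm (ph 0) * (2 * norm h)"
   proof (rule tsol_segment_estimate[OF ph(1)])
    fix s :: real assume s: "s \<in> {0..1}"
    have ss: "3 * s\<^sup>2 - 2 * s ^ 3 \<in> {0..1}" using smoothstep_01[of s] s by auto
    have "dist (B (seg y h s)) (B y) < om"
     unfolding seg_def using inb[OF ss] h(2) sOm[OF ss] by (intro d(2)) (auto simp: dist_norm)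
    then show "norm (B (seg y h s) - B y) \<le> om" by (simp add: dist_norm)
   next
    show "M * norm h \<le> 1 / 4" using h(3) M by (simp add: field_simps)
   qed (use om in \<open>auto simp: M_def\<close>)
   also have "... \<le> (2 * om + 4 * M\<^sup>2 * norm h) * n0 * (2 * norm h)"
    using n0 ph(2) om by (intro mult_right_mono mult_left_mono) auto
   also have "... = (4 * om * n0 + 8 * M\<^sup>2 * n0 * norm h) * norm h" by (simp add: algebra_simps)
   also have "... \<le> (e / 2 + e / 2) * norm h"
   proof (intro mult_right_mono add_mono)
    show "4 * om * n0 \<le> e / 2" using n0 by (simp add: om_def)
    have "8 * M\<^sup>2 * n0 * norm h \<le> 8 * M\<^sup>2 * n0 * (e / (16 * M\<^sup>2 * n0))"
     using n0 M h(4) by (intro mult_left_mono) auto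
    also have "... = e / 2" using n0 M by simp
    finally show "8 * M\<^sup>2 * n0 * norm h \<le> e / 2" .
   qed auto
   finally show "norm (u z - u y - - (bmul (B y) (u y) *v (z - y))) \<le> e * norm (z - y)"
    using ph by (simp add: h_def)
  qed
 qed
 moreover have "u x = v"
 proof -
  \<comment> \<open>Transport along the constant path identifies the value at the base
    point.\<close>
  have gx: "good_path Om x x (seg x 0) (segD 0)" using good_path_seg[of x 0 Om] x by simp
  have "tsol B (seg x 0) (segD 0) (%_. v)" by (auto simp: tsol_def segD_def)
  from transport_eq[OF C1[OF gx] B this] tr[OF gx x] show ?thesis by simp
 qed
 ultimately show ?thesis by blast
qed

lemma Econs_eq:
 fixes B :: "real^'d::finite => real^'n::finite^'d^'n"
 assumes Om: "open Om" "connected Om" and B: "continuous_on Om B" and x: "x \<in> Om"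
 shows "Econs Om B x = {u x |u. csol Om B u}"
proof
 show "Econs Om B x \<subseteq> {u x |u. csol Om B u}" using Econs_subset[OF assms] by blast
 show "{u x |u. csol Om B u} \<subseteq> Econs Om B x"
 proof
  fix v assume "v \<in> {u x |u. csol Om B u}"
  then obtain u where u: "csol Om B u" "v = u x" by blast
  have "transport B ga v = u y" if "ga \<in> C1_paths Om x y" for ga y
  proof -
   obtain D where D: "C1_path Om ga D" "ga 0 = x" "ga 1 = y" using \<open>ga \<in> C1_paths Om x y\<close> C1_paths_iff by blast
   show ?thesis using transport_eq[OF D(1) B csol_along_path[OF D(1) u(1)]] D u by simp
  qed
  then show "v \<in> Econs Om B x" unfolding Econs_def by simp
 qed
qed

lemma csol_zero: "csol Om B (%_. 0)"
 by (simp add: csol_def bmul_zero_right)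

lemma csol_add: "csol Om B u ==> csol Om B w ==> csol Om B (%x. u x + w x)"
 unfolding csol_def
proof
 fix x assume "\<forall>x\<in>Om. (u has_derivative (%h. - (bmul (B x) (u x) *v h))) (at x)"
  "\<forall>x\<in>Om. (w has_derivative (%h. - (bmul (B x) (w x) *v h))) (at x)" "x \<in> Om"
 then have "((%x. u x + w x) has_derivative (%h. - (bmul (B x) (u x) *v h) + - (bmul (B x) (w x) *v h))) (at x)"
  by (intro has_derivative_add) auto
 then show "((%x. u x + w x) has_derivative (%h. - (bmul (B x) (u x + w x) *v h))) (at x)"
  by (simp add: bmul_add_right matrix_vector_mult_add_rdistrib)
qed

lemma csol_scale: "csol Om B u ==> csol Om B (%x. c *R u x)"
 unfolding csol_def
proof
 fix x assume "\<forall>x\<in>Om. (u has_derivative (%h. - (bmul (B x) (u x) *v h))) (at x)" "x \<in> Om"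
 then have "((%x. c *R u x) has_derivative (%h. c *R (- (bmul (B x) (u x) *v h)))) (at x)"
  by (intro has_derivative_scaleR_right) auto
 then show "((%x. c *R u x) has_derivative (%h. - (bmul (B x) (c *R u x) *v h))) (at x)"
  by (simp add: bmul_scaleR_right scaleR_matrix_vector_assoc)
qed

lemma csol_sum: "finite I ==> (\<And>i. i \<in> I ==> csol Om B (u i)) ==> csol Om B (%x. \<Sum>i\<in>I. c i *R u i x)"
proof (induction I rule: finite_induct)
 case (insert a I)
 then show ?case using csol_add[OF csol_scale[OF insert.prems[of a], of "c a"] insert.IH] by simp
qed (simp add: csol_zero)

lemma csol_unique:
 fixes B :: "real^'d::finite => real^'n::finite^'d^'n"
 assumes Om: "open Om" "connected Om" and B: "continuous_on Om B" and x: "x \<in> Om" "y \<in> Om"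
  and u: "csol Om B u" "csol Om B w" "u x = w x"
 shows "u y = w y"
proof -
 obtain ga D where g: "good_path Om x y ga D" using good_path_exists[OF Om x] by blast
 then have C: "C1_path Om ga D" by (simp add: good_path_def)
 have "u (ga 1) = w (ga 1)"
  by (rule tsol_unique[OF C B csol_along_path[OF C u(1)] csol_along_path[OF C u(2)]])
   (use g u(3) in \<open>auto simp: good_path_def\<close>)
 then show ?thesis using g by (simp add: good_path_def)
qed

lemma subspace_csol_values: "subspace {u x |u. csol Om B u}"
 unfolding subspace_def by (auto intro: csol_zero csol_add csol_scale)

text \<open>By uniqueness a solution is determined by its value at any single point, so solutions
  through a basis of values at x have independent values at y.\<close>

lemma Econs_dim_le:
 fixes B :: "real^'d::finite => real^'n::finite^'d^'n"
 assumes Om: "open Om" "connected Om" and B: "continuous_on Om B" and x: "x \<in> Om" "y \<in> Om"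
 shows "dim (Econs Om B x) \<le> dim (Econs Om B y)"
proof -
 let ?E = "%x. {u x |u. csol Om B u}"
 obtain b where b: "b \<subseteq> ?E x" "independent b" "?E x \<subseteq> span b" "card b = dim (?E x)"
  using basis_exists by blast
 have fin: "finite b" using b(2) independent_imp_finite by blast
 have "\<forall>s. \<exists>u. s \<in> b --> csol Om B u \<and> u x = s" using b(1) by blast
 then obtain u where u: "\<And>s. s \<in> b ==> csol Om B (u s)" "\<And>s. s \<in> b ==> u s x = s" by metis
 have zero: "(\<forall>s\<in>b. c s = 0)" if "(\<Sum>s\<in>b. c s *R u s y) = 0" for c
 proof -
  have "csol Om B (%z. \<Sum>s\<in>b. c s *R u s z)" by (rule csol_sum[OF fin u(1)])
  from csol_unique[OF Om B x(2,1) this csol_zero] that have "(\<Sum>s\<in>b. c s *R u s x) = 0" by simp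
  then have "(\<Sum>s\<in>b. c s *R s) = 0" using u(2) by simp
  then show ?thesis using b(2) fin by (simp add: independent_explicit)
 qed
 have inj: "inj_on (%s. u s y) b"
 proof (rule inj_onI, rule ccontr)
  fix s t assume st: "s \<in> b" "t \<in> b" "u s y = u t y" "s \<noteq> t"
  define c where "c = (%r. if r = s then 1 else if r = t then - 1 else 0 :: real)"
  have "(\<Sum>r\<in>b. c r *R u r y) = (\<Sum>r\<in>{s,t}. c r *R u r y)"
   by (rule sum.mono_neutral_right) (use fin st in \<open>auto simp: c_def\<close>)
  also have "... = 0" using st by (simp add: c_def)
  finally show False using zero[of c] st(1) by (auto simp: c_def)
 qed
 have "independent ((%s. u s y) ` b)"
  unfolding independent_explicit
 proof (intro conjI allI impI)
  show "finite ((%s. u s y) ` b)" using fin by simp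
  fix c assume "(\<Sum>v\<in>(%s. u s y) ` b. c v *R v) = 0"
  then have "(\<Sum>s\<in>b. c (u s y) *R u s y) = 0" by (simp add: sum.reindex[OF inj])
  then show "\<forall>v\<in>(%s. u s y) ` b. c v = 0" using zero[of "%s. c (u s y)"] by auto
 qed
 moreover have "(%s. u s y) ` b \<subseteq> ?E y" using u(1) by blast
 ultimately have "card ((%s. u s y) ` b) \<le> dim (?E y)" by (rule independent_card_le_dim[rotated])
 then show ?thesis using card_image[OF inj] b(4) Econs_eq[OF Om B x(1)] Econs_eq[OF Om B x(2)] by simp
qed

text \<open>The dimension does not change from point to point, so the existential over
  \<open>k'\<close> in \<open>at_least_conservative\<close> becomes an inequality at one base
  point.\<close>

lemma k_conservative_cont_iff:
 fixes B :: "real^'d::finite => real^'n::finite^'d^'n"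
 assumes Om: "open Om" "connected Om" and B: "continuous_on Om B" and x: "x \<in> Om"
 shows "(\<exists>k'\<ge>k. k_conservative_cont Om B k') \<longleftrightarrow> k \<le> dim {u x |u. csol Om B u}"
proof
 assume "\<exists>k'\<ge>k. k_conservative_cont Om B k'"
 then show "k \<le> dim {u x |u. csol Om B u}" using x Econs_eq[OF assms] by (auto simp: k_conservative_cont_def)
next
 assume "k \<le> dim {u x |u. csol Om B u}"
 moreover have "dim (Econs Om B y) = dim (Econs Om B x)" if "y \<in> Om" for y
  using Econs_dim_le[OF Om B x that] Econs_dim_le[OF Om B that x] by simp
 ultimately show "\<exists>k'\<ge>k. k_conservative_cont Om B k'"
  using Econs_eq[OF assms] by (auto simp: k_conservative_cont_def)
qed

section \<open>Interior cones at a smooth boundary\<close>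

lemma finite_positive_lower_bound:
 assumes "finite Z" "\<And>z. z \<in> Z ==> f z > (0::real)"
 shows "\<exists>m>0. \<forall>z\<in>Z. m \<le> f z"
proof -
 have "Min (insert 1 (f ` Z)) > 0" using assms by (subst Min_gr_iff) auto
 moreover have "Min (insert 1 (f ` Z)) \<le> f z" if "z \<in> Z" for z using assms that by (intro Min_le) auto
 ultimately show ?thesis by blast
qed

text \<open>Along its negative gradient the defining function \<open>pz\<close> decreases at z; by
  continuity this persists for nearby points and nearby directions. Starting in the closure, where
  \<open>pz\<close> is at most 0, it is negative after any short step in such a direction.\<close>

lemma boundary_cone:
 fixes Om :: "(real^'d::finite) set"
 assumes sb: "smooth_boundary Om" and z: "z \<in> frontier Om"
 shows "\<exists>e c r. c > 0 \<and> r > 0 \<and> (\<forall>x s w. x \<in> closure Om \<and> x \<in> ball z r \<and> 0 < s \<and> s < r \<and> norm (w - e) < c --> x + s *R w \<in> Om)"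
proof -
 obtain r0 pz j0 where r0: "r0 > 0" and sm: "smooth_on (ball z r0) pz"
  and j0: "partial j0 pz z \<noteq> 0" and eq: "Om \<inter> ball z r0 = {x \<in> ball z r0. pz x < 0}"
  using sb z unfolding smooth_boundary_def by blast
 have Dc: "continuous_on (ball z r0) (partial j pz)" for j
  using sm[unfolded smooth_on_def, rule_format, of "[j]"] by simp
 have pzc: "continuous_on (ball z r0) pz"
  using sm[unfolded smooth_on_def, rule_format, of "[]"] by simp
 have Dd: "((%t. pz (y + t *R axis j 1)) has_real_derivative partial j pz y) (at 0)" if "y \<in> ball z r0" for y j
 proof -
  have "(%t. pz (y + t *R axis j 1)) differentiable (at 0)"
   using sm[unfolded smooth_on_def, rule_format, of "[]"] that by simp
  then show ?thesis unfolding partial_def by (simp add: DERIV_deriv_iff_real_differentiable)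
 qed
 define L where "L = (%y (h :: real^'d). \<Sum>j\<in>UNIV. h $ j * partial j pz y)"
 have der: "(pz has_derivative L y) (at y)" if "y \<in> ball z r0" for y
  unfolding L_def by (rule has_derivative_from_partials[OF open_ball that Dd Dc])
 define e where "e = (\<chi> j. - partial j pz z)"
 have "(\<Sum>j\<in>UNIV. (partial j pz z)\<^sup>2) > 0"
  using j0 by (intro sum_pos2[of _ j0]) auto
 then have Le: "L z e < 0" by (simp add: L_def e_def sum_negf power2_eq_square)
 have "continuous_on (ball z r0 \<times> UNIV) (%q. L (fst q) (snd q))"
  unfolding L_def
  by (intro continuous_intros continuous_on_compose2[OF Dc continuous_on_fst]) auto
 moreover have zin: "(z, e) \<in> ball z r0 \<times> UNIV" using r0 by simp
 moreover have "open (ball z r0 \<times> (UNIV :: (real^'d) set))" by (intro open_Times) auto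
 ultimately have "isCont (%q. L (fst q) (snd q)) (z, e)"
  by (simp only: continuous_on_eq_continuous_at)
 then have "((%q. L (fst q) (snd q)) \<longlongrightarrow> L z e) (nhds (z, e))"
  by (simp add: isCont_def tendsto_nhds_iff)
 then have "\<forall>\<^sub>F q in nhds (z, e). L (fst q) (snd q) < 0" using Le by (rule order_tendstoD)
 then obtain dt where dt: "dt > 0" "\<And>q. dist q (z, e) < dt ==> L (fst q) (snd q) < 0"
  unfolding eventually_nhds_metric by blast
 have neg: "L y w < 0" if "dist y z < dt / 2" "norm (w - e) < dt / 2" for y w
 proof -
  have "dist (y, w) (z, e) \<le> dist y z + dist w e"
   by (simp add: dist_Pair_Pair sqrt_sum_squares_le_sum)
  then show ?thesis using dt(2)[of "(y, w)"] that by (simp add: dist_norm)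
 qed
 have pzle: "pz x \<le> 0" if x: "x \<in> closure Om" "x \<in> ball z r0" for x
 proof (rule ccontr)
  assume "\<not> pz x \<le> 0"
  have "open (ball z r0 \<inter> pz -` {0<..})"
   by (rule continuous_open_preimage[OF pzc]) auto
  moreover have "x \<in> ball z r0 \<inter> pz -` {0<..}" using x \<open>\<not> pz x \<le> 0\<close> by auto
  ultimately obtain y where "y \<in> Om" "y \<in> ball z r0 \<inter> pz -` {0<..}"
   using x(1) unfolding closure_iff_nhds_not_empty by blast
  then have "y \<in> {x \<in> ball z r0. pz x < 0}" "pz y > 0" using eq by blast+
  then show False by simp
 qed
 define W where "W = norm e + dt / 2"
 have W: "W > 0" using dt by (simp add: W_def add_nonneg_pos)
 \<comment> \<open>Chosen so that r + r W is the smaller of \<open>r0\<close> and dt/2: a step of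
   parameter below r in a direction of norm at most W stays where the sign of the derivative is
   known.\<close>
 define r where "r = min r0 (dt / 2) / (1 + W)"
 have r: "r > 0" using r0 dt W by (simp add: r_def)
 have "r * (1 + W) = min r0 (dt / 2)" using W by (simp add: r_def)
 then have rW: "r + r * W = min r0 (dt / 2)" by (simp add: distrib_left)
 have main: "x + s *R w \<in> Om" if x: "x \<in> closure Om" "x \<in> ball z r" and s: "0 < s" "s < r" and w: "norm (w - e) < dt / 2" for x s w
 proof -
  have nw: "norm w \<le> W" using norm_triangle_ineq[of "w - e" e] w by (simp add: W_def)
  have near: "dist (x + t *R w) z < min r0 (dt / 2)" if "0 \<le> t" "t \<le> s" for t
  proof -
   have "dist (x + t *R w) z \<le> dist x z + norm (t *R w)"
    using norm_triangle_ineq[of "x - z" "t *R w"] by (simp add: dist_norm algebra_simps)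
   also have "norm (t *R w) \<le> r * W"
    using that s nw W by (simp add: mult_mono)
   finally have "dist (x + t *R w) z \<le> dist x z + r * W" by simp
   moreover have "dist x z < r" using x(2) by (simp add: dist_commute)
   ultimately show ?thesis using rW by linarith
  qed
  have inb: "x + t *R w \<in> ball z r0" if "0 \<le> t" "t \<le> s" for t
   using near[OF that] by (simp add: dist_commute)
  have dl: "((%t. pz (x + t *R w)) has_real_derivative L (x + t *R w) w) (at t)" if "0 \<le> t" "t \<le> s" for t
  proof -
   have "((%t. x + t *R w) has_derivative (%s. s *R w)) (at t)" by (auto intro!: derivative_eq_intros)
   from has_derivative_compose[OF this der[OF inb[OF that]]]
   have "((%t. pz (x + t *R w)) has_derivative (%s. L (x + t *R w) (s *R w))) (at t)" .
   moreover have "(%s. L (x + t *R w) (s *R w)) = (*) (L (x + t *R w) w)"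
    by (auto simp: L_def fun_eq_iff sum_distrib_left mult_ac)
   ultimately show ?thesis by (simp add: has_field_derivative_def)
  qed
  have "pz (x + s *R w) < pz (x + 0 *R w)"
  proof (rule DERIV_neg_imp_decreasing[OF s(1)])
   fix t assume "0 \<le> t" "t \<le> s"
   then show "\<exists>y. ((%t. pz (x + t *R w)) has_real_derivative y) (at t) \<and> y < 0"
    using dl[of t] neg[of "x + t *R w" w] near[of t] w by (intro exI[of _ "L (x + t *R w) w"]) auto
  qed
  moreover have "pz x \<le> 0" using inb[of 0] s x(1) by (intro pzle) auto
  ultimately have "pz (x + s *R w) < 0" by simp
  then have "x + s *R w \<in> {x \<in> ball z r0. pz x < 0}" using inb[of s] s by simp
  then show ?thesis using eq by blast
 qed
 show ?thesis
 proof (rule exI[of _ e], rule exI[of _ "dt / 2"], rule exI[of _ r], intro conjI allI impI)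
  fix x s w assume "x \<in> closure Om \<and> x \<in> ball z r \<and> 0 < s \<and> s < r \<and> norm (w - e) < dt / 2"
  then show "x + s *R w \<in> Om" using main[of x s w] by (elim conjE)
 qed (use dt r in auto)
qed

section \<open>Domains with interior cones\<close>

text \<open>All that is used of the smooth boundary. Points outside the half balls are well inside
  the domain, while the cones are valid on the full balls; the margin lets a point make several cone
  steps in a row.\<close>

locale cone_domain =
 fixes Om :: "(real^'d::finite) set" and Z :: "(real^'d) set" and e :: "real^'d => real^'d" and c r :: "real^'d => real" and rh :: real
 assumes open_Om: "open Om" and finZ: "finite Z"
  and pos: "\<And>z. z \<in> Z ==> c z > 0" "\<And>z. z \<in> Z ==> r z > 0"
  and cone: "\<And>z x s w. z \<in> Z ==> x \<in> closure Om ==> x \<in> ball z (r z) ==> 0 < s ==> s < r z ==> norm (w - e z) < c z ==> x + s *R w \<in> Om"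
  and rh: "rh > 0" "\<And>x. x \<in> closure Om ==> (\<And>z. z \<in> Z ==> x \<notin> ball z (r z / 2)) ==> cball x rh \<subseteq> Om"

lemma cone_domain_exists:
 fixes Om :: "(real^'d::finite) set"
 assumes Om: "open Om" "bounded Om" "smooth_boundary Om"
 shows "\<exists>Z e c r rh. cone_domain Om Z e c r rh"
proof -
 have "\<forall>z. \<exists>e c r. z \<in> frontier Om --> c > 0 \<and> r > 0 \<and> (\<forall>x s w. x \<in> closure Om \<and> x \<in> ball z r \<and> 0 < s \<and> s < r \<and> norm (w - e) < c --> x + s *R w \<in> Om)"
  using boundary_cone[OF Om(3)] by blast
 then obtain e c r where ecr: "\<And>z. z \<in> frontier Om ==> c z > 0 \<and> r z > 0 \<and> (\<forall>x s w. x \<in> closure Om \<and> x \<in> ball z (r z) \<and> 0 < s \<and> s < r z \<and> norm (w - e z) < c z --> x + s *R w \<in> Om)"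
  by metis
 have "compact (frontier Om)" using Om(2) by (rule compact_frontier_bounded)
 moreover have "frontier Om \<subseteq> (\<Union>z\<in>frontier Om. ball z (r z / 2))" using ecr by fastforce
 ultimately obtain Z where Z: "Z \<subseteq> frontier Om" "finite Z" "frontier Om \<subseteq> (\<Union>z\<in>Z. ball z (r z / 2))"
  using compactE_image[of "frontier Om" "frontier Om" "%z. ball z (r z / 2)"] by auto
 define K where "K = closure Om - (\<Union>z\<in>Z. ball z (r z / 2))"
 have "compact K" unfolding K_def using Om(2) by (intro compact_diff) (auto simp: compact_closure)
 moreover have "K \<subseteq> Om" using Z(3) Om(1) unfolding K_def frontier_def by (auto simp: interior_open)
 ultimately obtain rh where rh: "rh > 0" "(\<Union>x\<in>K. cball x rh) \<subseteq> Om"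
  using compact_subset_open_imp_cball_epsilon_subset[of K Om] Om(1) by blast
 have "cone_domain Om Z e c r rh"
 proof
  show "c z > 0" "r z > 0" if "z \<in> Z" for z using ecr Z(1) that by blast+
  show "x + s *R w \<in> Om" if "z \<in> Z" "x \<in> closure Om" "x \<in> ball z (r z)" "0 < s" "s < r z" "norm (w - e z) < c z" for z x s w
   using ecr[of z] Z(1) that by blast
  show "cball x rh \<subseteq> Om" if "x \<in> closure Om" "\<And>z. z \<in> Z ==> x \<notin> ball z (r z / 2)" for x
   using rh(2) that unfolding K_def by blast
 qed (use Om Z rh in auto)
 then show ?thesis by blast
qed

context cone_domain
begin

lemma bounds_exist:
 obtains rm cm E where "rm > 0" "cm > 0" "E > 0" "\<And>z. z \<in> Z ==> rm \<le> r z" "\<And>z. z \<in> Z ==> cm \<le> c z" "\<And>z. z \<in> Z ==> norm (e z) \<le> E"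
proof -
 obtain rm where "rm > 0" "\<forall>z\<in>Z. rm \<le> r z" using finite_positive_lower_bound[OF finZ, of r] pos by blast
 moreover obtain cm where "cm > 0" "\<forall>z\<in>Z. cm \<le> c z" using finite_positive_lower_bound[OF finZ, of c] pos by blast
 moreover have "norm (e z) \<le> (\<Sum>z\<in>Z. norm (e z)) + 1" if "z \<in> Z" for z
  using member_le_sum[of z Z "%z. norm (e z)"] finZ that by simp
 moreover have "(\<Sum>z\<in>Z. norm (e z)) + 1 > 0" by (intro add_nonneg_pos sum_nonneg) auto
 ultimately show ?thesis using that by blast
qed

text \<open>Puts every point, with constants uniform up to the boundary, at the tip of a convex set
  containing a ball of radius comparable to the diameter of the set. On such sets the oscillation
  estimate loses only a fixed factor.\<close>

lemma interior_cone:
 "\<exists>ck>0. \<exists>h1>0. \<forall>x\<in>Om. \<forall>h. 0 < h \<and> h \<le> h1 -->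
  (\<exists>z. convex hull (insert x (cball z (ck * h))) \<subseteq> Om \<and> (\<forall>w\<in>convex hull (insert x (cball z (ck * h))). dist x w < h / 2))"
proof -
 obtain rm cm E where b: "rm > 0" "cm > 0" "E > 0" "\<And>z. z \<in> Z ==> rm \<le> r z" "\<And>z. z \<in> Z ==> cm \<le> c z" "\<And>z. z \<in> Z ==> norm (e z) \<le> E"
  using bounds_exist by blast
 \<comment> \<open>The ball is centred at x + (h/W) e z near the boundary. The size of W keeps the
   hull within h/4 of x, and \<open>ck\<close> W \<le> cm/2 keeps the ball inside the cone of
   directions.\<close>
 define W where "W = 4 * (E + cm + 1)"
 have W: "W > 0" "W \<ge> 4" using b by (auto simp: W_def)
 define ck where "ck = min (1/8) (cm / (2 * W))"
 have ck: "ck > 0" "ck \<le> 1/8" "ck * W \<le> cm / 2"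
 proof -
  show "ck > 0" "ck \<le> 1/8" using b W by (auto simp: ck_def)
  have "ck \<le> cm / (2 * W)" by (simp add: ck_def)
  then show "ck * W \<le> cm / 2" using W by (simp add: field_simps)
 qed
 define h1 where "h1 = min rh (rm / 2)"
 have h1: "h1 > 0" using b rh by (simp add: h1_def)
 have hull_form: "\<exists>lam y. 0 \<le> lam \<and> lam \<le> 1 \<and> y \<in> cball z R \<and> w = x + lam *R (y - x)"
  if w: "w \<in> convex hull (insert x (cball z R))" and R: "R \<ge> 0" for w x z :: "real^'d" and R
 proof -
  have "cball z R \<noteq> {}" using R by simp
  from w obtain u v b where "u \<ge> 0" "v \<ge> 0" "u + v = 1" "b \<in> convex hull (cball z R)" "w = u *R x + v *R b"
   unfolding convex_hull_insert[OF \<open>cball z R \<noteq> {}\<close>] by blast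
  moreover from this have "u = 1 - v" by simp
  moreover have "convex hull (cball z R) = cball z R" by (simp add: convex_hull_eq)
  ultimately show ?thesis by (intro exI[of _ v] exI[of _ b]) (auto simp: algebra_simps)
 qed
 show ?thesis
 proof (rule exI[of _ ck], rule conjI[OF ck(1)], rule exI[of _ h1], rule conjI[OF h1], intro ballI allI impI)
  fix x h assume x: "x \<in> Om" and h: "0 < h \<and> h \<le> h1"
  have xc: "x \<in> closure Om" using x closure_subset by blast
  have R: "ck * h \<ge> 0" using ck h by simp
  show "\<exists>z. convex hull (insert x (cball z (ck * h))) \<subseteq> Om \<and> (\<forall>w\<in>convex hull (insert x (cball z (ck * h))). dist x w < h / 2)"
  proof (cases "\<exists>z\<in>Z. x \<in> ball z (r z / 2)")
   case False
   have sub: "convex hull (insert x (cball x (ck * h))) \<subseteq> cball x (ck * h)"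
    by (rule hull_minimal) (use R in auto)
   have "ck * h \<le> (1/8) * h" using ck h by (intro mult_right_mono) auto
   then have kh: "ck * h < h / 2" using h by linarith
   then have kr: "ck * h \<le> rh" using h unfolding h1_def by linarith
   have "cball x rh \<subseteq> Om" using rh(2)[OF xc] False by blast
   moreover have "cball x (ck * h) \<subseteq> cball x rh" by (rule subset_cball[OF kr])
   ultimately show ?thesis using sub kh by (intro exI[of _ x]) (fastforce simp: subset_iff)
  next
   case True
   then obtain z where z: "z \<in> Z" "x \<in> ball z (r z / 2)" by blast
   define ta where "ta = h / W"
   have ta: "ta > 0" "ta < r z"
   proof -
    show "ta > 0" using h W by (simp add: ta_def)
    have "ta \<le> h / 1" unfolding ta_def using h W by (intro divide_left_mono) auto
    then show "ta < r z" using h b(1) b(4)[OF z(1)] by (simp add: h1_def)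
   qed
   have form: "\<exists>lam w'. 0 \<le> lam \<and> lam \<le> 1 \<and> norm (w' - e z) \<le> cm / 2 \<and> w = x + (lam * ta) *R w'"
    if w: "w \<in> convex hull (insert x (cball (x + ta *R e z) (ck * h)))" for w
   proof -
    obtain lam y where l: "0 \<le> lam" "lam \<le> 1" "y \<in> cball (x + ta *R e z) (ck * h)" "w = x + lam *R (y - x)"
     using hull_form[OF w R] by blast
    define w' where "w' = (1 / ta) *R (y - x)"
    have yx: "y - x = ta *R w'" using ta by (simp add: w'_def)
    have "ta *R (w' - e z) = y - (x + ta *R e z)" using yx by (simp add: scaleR_diff_right)
    then have "ta * norm (w' - e z) = norm (y - (x + ta *R e z))" using ta by (metis abs_of_pos norm_scaleR)
    also have "... \<le> ck * h" using l(3) by (simp add: dist_norm norm_minus_commute)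
    also have "ck * h = ta * (ck * W)" using W by (simp add: ta_def)
    also have "... \<le> ta * (cm / 2)" using ck(3) ta by (intro mult_left_mono) auto
    finally have "norm (w' - e z) \<le> cm / 2" using ta by simp
    then show ?thesis using l yx by (intro exI[of _ lam] exI[of _ w']) simp
   qed
   have "w \<in> Om \<and> dist x w < h / 2" if w: "w \<in> convex hull (insert x (cball (x + ta *R e z) (ck * h)))" for w
   proof -
    obtain lam w' where l: "0 \<le> lam" "lam \<le> 1" "norm (w' - e z) \<le> cm / 2" "w = x + (lam * ta) *R w'"
     using form[OF w] by blast
    have "norm w' \<le> E + cm" using norm_triangle_ineq[of "w' - e z" "e z"] l(3) b(2) b(6)[OF z(1)] by simp
    then have "(lam * ta) * norm w' \<le> (1 * ta) * (E + cm)"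
     using l ta b by (intro mult_mono mult_right_mono) auto
    also have "... < (1 * ta) * (E + cm + 1)" using ta by (intro mult_strict_left_mono) auto
    also have "... = h / 4" using W by (simp add: ta_def W_def field_simps)
    finally have "dist x w < h / 2" using l ta h by (simp add: dist_norm)
    moreover have "w \<in> Om"
    proof (cases "lam = 0")
     case False
     have "lam * ta \<le> 1 * ta" using l ta by (intro mult_right_mono) auto
     then have "lam * ta < r z" using ta by linarith
     then show ?thesis unfolding l(4)
      using False l ta b(2) b(5)[OF z(1)] z pos(2)[OF z(1)] xc by (intro cone[OF z(1)]) auto
    qed (use l x in simp)
    ultimately show ?thesis by simp
   qed
   then show ?thesis by blast
  qed
 qed
qed

text \<open>A bump of class C^1, the square of a positive part. Its radius of 3/4 \<open>r z\<close>
  lies strictly between the half ball and the ball on which the cone condition holds.\<close>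

definition chi :: "real^'d => real^'d => real" where
 "chi z x = (max 0 ((3 / 4 * r z)\<^sup>2 - (x - z) \<bullet> (x - z)))\<^sup>2"

definition V :: "real^'d => real^'d" where "V x = (\<Sum>z\<in>Z. chi z x *R e z)"

definition DV :: "real^'d => real^'d^'d" where
 "DV x = (\<chi> i j. \<Sum>z\<in>Z. e z $ i * (- 4 * max 0 ((3 / 4 * r z)\<^sup>2 - (x - z) \<bullet> (x - z)) * (x - z) $ j))"

lemma DERIV_max0_square: "((%t::real. (max 0 t)\<^sup>2) has_real_derivative 2 * max 0 t) (at t)"
proof (cases t "0::real" rule: linorder_cases)
 case less
 have "((%t::real. 0) has_real_derivative 2 * max 0 t) (at t)" using less by simp
 then show ?thesis
  by (rule DERIV_cong_ev[OF refl _ refl, THEN iffD1, rotated])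
   (use less in \<open>auto simp: eventually_nhds intro!: exI[of _ "{..<0}"]\<close>)
next
 case greater
 have "((%t::real. t\<^sup>2) has_real_derivative 2 * max 0 t) (at t)" using greater by (auto intro!: derivative_eq_intros)
 then show ?thesis
  by (rule DERIV_cong_ev[OF refl _ refl, THEN iffD1, rotated])
   (use greater in \<open>auto simp: eventually_nhds intro!: exI[of _ "{0<..}"]\<close>)
next
 case equal
 have "((%h::real. (max 0 h)\<^sup>2 / h) \<longlongrightarrow> 0) (at 0)"
 proof (rule Lim_null_comparison)
  show "\<forall>\<^sub>F h in at (0::real). norm ((max 0 h)\<^sup>2 / h) \<le> \<bar>h\<bar>"
   by (intro always_eventually allI) (auto simp: max_def power2_eq_square)
  show "((%h::real. \<bar>h\<bar>) \<longlongrightarrow> 0) (at 0)" by (intro tendsto_eq_intros) auto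
 qed
 then show ?thesis using equal by (simp add: has_field_derivative_iff)
qed

lemma chi_deriv: "(chi z has_derivative (%h. - 4 * max 0 ((3 / 4 * r z)\<^sup>2 - (x - z) \<bullet> (x - z)) * ((x - z) \<bullet> h))) (at x)"
proof -
 have "((%x. (3 / 4 * r z)\<^sup>2 - (x - z) \<bullet> (x - z)) has_derivative (%h. - 2 * ((x - z) \<bullet> h))) (at x)"
  by (auto intro!: derivative_eq_intros simp: inner_commute)
 from DERIV_compose_FDERIV[OF DERIV_max0_square this] show ?thesis
  unfolding chi_def[abs_def] by (simp add: mult_ac)
qed

lemma V_deriv: "(V has_derivative (*v) (DV x)) (at x)"
proof -
 define K where "K = (%z. - 4 * max 0 ((3 / 4 * r z)\<^sup>2 - (x - z) \<bullet> (x - z)))"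
 have "(V has_derivative (%h. \<Sum>z\<in>Z. (K z * ((x - z) \<bullet> h)) *R e z)) (at x)"
  unfolding V_def[abs_def] K_def by (intro has_derivative_sum has_derivative_scaleR_left chi_deriv)
 moreover have "(\<Sum>z\<in>Z. (K z * ((x - z) \<bullet> h)) *R e z) = DV x *v h" for h
 proof -
  have "(\<Sum>z\<in>Z. (K z * ((x - z) \<bullet> h)) *R e z) $ i = (DV x *v h) $ i" for i
  proof -
   have "(DV x *v h) $ i = (\<Sum>j\<in>UNIV. \<Sum>z\<in>Z. e z $ i * (K z * (x - z) $ j) * h $ j)"
    unfolding DV_def matrix_vector_mult_def K_def by (simp only: vec_lambda_beta sum_distrib_right)
   also have "... = (\<Sum>z\<in>Z. \<Sum>j\<in>UNIV. e z $ i * (K z * (x - z) $ j) * h $ j)"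
    by (rule sum.swap)
   also have "... = (\<Sum>z\<in>Z. (K z * ((x - z) \<bullet> h)) * e z $ i)"
    by (intro sum.cong refl) (simp add: inner_vec_def sum_distrib_left sum_distrib_right mult_ac)
   finally show ?thesis by simp
  qed
  then show ?thesis by (intro vec_eq_iff[THEN iffD2] allI)
 qed
 ultimately show ?thesis by simp
qed

lemma V_cont: "continuous_on UNIV V"
 by (intro continuous_at_imp_continuous_on ballI has_derivative_continuous[OF V_deriv])

lemma DV_cont: "continuous_on UNIV DV"
 unfolding DV_def by (intro continuous_on_vec_lambda continuous_intros)

lemma chi_bounds: "0 \<le> chi z x" "r z \<ge> 0 ==> chi z x \<le> (r z) ^ 4"
proof -
 show "0 \<le> chi z x" by (simp add: chi_def)
 assume "r z \<ge> 0"
 have "max 0 ((3 / 4 * r z)\<^sup>2 - (x - z) \<bullet> (x - z)) \<le> (r z)\<^sup>2"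
 proof -
  have "(3 / 4 * r z)\<^sup>2 \<le> (r z)\<^sup>2" using \<open>r z \<ge> 0\<close> by (intro power_mono) auto
  moreover have "0 \<le> (x - z) \<bullet> (x - z)" by (rule inner_ge_zero)
  ultimately have "(3 / 4 * r z)\<^sup>2 - (x - z) \<bullet> (x - z) \<le> (r z)\<^sup>2" by linarith
  then show ?thesis by (intro max.boundedI) simp_all
 qed
 then have "chi z x \<le> ((r z)\<^sup>2)\<^sup>2" unfolding chi_def by (intro power_mono) auto
 then show "chi z x \<le> (r z) ^ 4" by (simp add: power_mult[symmetric])
qed

lemma chi_support: "chi z x > 0 ==> r z > 0 ==> dist x z < 3 / 4 * r z"
proof -
 assume "chi z x > 0" "r z > 0"
 then have "(x - z) \<bullet> (x - z) < (3 / 4 * r z)\<^sup>2"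
  unfolding chi_def by (cases "(x - z) \<bullet> (x - z) < (3 / 4 * r z)\<^sup>2") auto
 then have "(norm (x - z))\<^sup>2 < (3 / 4 * r z)\<^sup>2" by (simp only: power2_norm_eq_inner)
 then have "norm (x - z) < 3 / 4 * r z" by (rule power2_less_imp_less) (use \<open>r z > 0\<close> in simp)
 then show ?thesis by (simp add: dist_norm)
qed

lemma chi_lower: "x \<in> ball z (r z / 2) ==> r z > 0 ==> chi z x \<ge> (5 / 16 * (r z)\<^sup>2)\<^sup>2"
proof -
 assume x: "x \<in> ball z (r z / 2)" and r: "r z > 0"
 have "(norm (x - z))\<^sup>2 \<le> (r z / 2)\<^sup>2"
  using x by (intro power_mono) (auto simp: dist_norm norm_minus_commute)
 then have "(x - z) \<bullet> (x - z) \<le> (r z / 2)\<^sup>2" by (simp only: power2_norm_eq_inner)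
 then have "5 / 16 * (r z)\<^sup>2 \<le> max 0 ((3 / 4 * r z)\<^sup>2 - (x - z) \<bullet> (x - z))"
  by (simp add: power_mult_distrib power_divide le_max_iff_disj field_simps)
 then show ?thesis unfolding chi_def by (intro power_mono) auto
qed

text \<open>A displacement along V + a is a sum over z of displacements in directions close to e z.
  Performed one at a time, each is a cone step from a point of the closure near z. The perturbation
  a is split among them in proportion to the weights, whose sum is at least m near the
  boundary.\<close>

lemma V_inward:
 "\<exists>t0>0. \<exists>et>0. \<exists>Vm. (\<forall>x. norm (V x) \<le> Vm) \<and> (\<forall>t a x. 0 < t \<and> t \<le> t0 \<and> norm a \<le> et \<and> x \<in> closure Om --> x + t *R (V x + a) \<in> Om)"
proof -
 obtain rm cm E where b: "rm > 0" "cm > 0" "E > 0" "\<And>z. z \<in> Z ==> rm \<le> r z" "\<And>z. z \<in> Z ==> cm \<le> c z" "\<And>z. z \<in> Z ==> norm (e z) \<le> E"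
  using bounds_exist by blast
 define X where "X = (\<Sum>z\<in>Z. (r z) ^ 4) + 1"
 have X: "X > 0" "\<And>z x. z \<in> Z ==> chi z x \<le> X" "\<And>S x. S \<subseteq> Z ==> (\<Sum>z\<in>S. chi z x) \<le> X"
 proof -
  show "X > 0" unfolding X_def by (intro add_nonneg_pos sum_nonneg) (auto simp: less_imp_le pos(2))
  have rn: "z \<in> Z ==> r z \<ge> 0" for z using pos(2)[of z] by simp
  show 1: "(\<Sum>z\<in>S. chi z x) \<le> X" if "S \<subseteq> Z" for S x
  proof -
   have "(\<Sum>z\<in>S. chi z x) \<le> (\<Sum>z\<in>Z. chi z x)" using finZ that chi_bounds(1) by (intro sum_mono2) auto
   also have "... \<le> (\<Sum>z\<in>Z. (r z) ^ 4)" by (intro sum_mono chi_bounds(2) rn)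
   finally show ?thesis by (simp add: X_def)
  qed
  show "chi z x \<le> X" if "z \<in> Z" for z x using 1[of "{z}" x] that by simp
 qed
 define m where "m = (5 / 16 * rm\<^sup>2)\<^sup>2"
 have m: "m > 0" using b by (simp add: m_def)
 define et where "et = min 1 (m * cm / 2)"
 have et: "et > 0" "et \<le> 1" "et / m < cm"
  using m b by (auto simp: et_def min_def field_simps)
 define Vm where "Vm = X * E"
 have Vb: "norm (V x) \<le> Vm" for x
 proof -
  have "norm (V x) \<le> (\<Sum>z\<in>Z. chi z x * E)"
   unfolding V_def by (rule sum_norm_le) (use chi_bounds(1) b(6) in \<open>simp add: mult_left_mono\<close>)
  also have "... = (\<Sum>z\<in>Z. chi z x) * E" by (simp add: sum_distrib_right)
  also have "... \<le> Vm" unfolding Vm_def using X(3)[of Z x] b(3) by (intro mult_right_mono) auto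
  finally show ?thesis .
 qed
 have Vm: "Vm \<ge> 0" using X b by (simp add: Vm_def)
 \<comment> \<open>The entries ensure, in order, that points away from the boundary move by at most
   \<open>rh\<close>, that intermediate points stay within rm/8 of x, and that every cone step has
   parameter at most rm/2.\<close>
 define t0 where "t0 = min (rh / (Vm + 1)) (min (rm / (8 * X * (E + cm))) (rm / (2 * X)))"
 have t0: "t0 > 0" using rh Vm b X by (simp add: t0_def)
 have main: "x + t *R (V x + a) \<in> Om" if t: "0 < t" "t \<le> t0" and a: "norm a \<le> et" and x: "x \<in> closure Om" for t a x
 proof (cases "\<exists>z\<in>Z. x \<in> ball z (r z / 2)")
  case False
  have "norm (t *R (V x + a)) \<le> t0 * (Vm + 1)"
  proof -
   have "norm (V x + a) \<le> Vm + 1" using norm_triangle_ineq[of "V x" a] Vb[of x] a et by linarith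
   then show ?thesis using t Vm by (simp add: mult_mono)
  qed
  also have "... \<le> rh / (Vm + 1) * (Vm + 1)" using Vm by (intro mult_right_mono) (auto simp: t0_def)
  also have "... = rh" using Vm by simp
  finally have "x + t *R (V x + a) \<in> cball x rh" by (simp add: dist_norm)
  then show ?thesis using rh(2)[OF x] False by blast
 next
  case True
  then obtain z0 where z0: "z0 \<in> Z" "x \<in> ball z0 (r z0 / 2)" by blast
  define s where "s = (\<Sum>z\<in>Z. chi z x)"
  have "m \<le> chi z0 x"
  proof -
   have "m \<le> (5 / 16 * (r z0)\<^sup>2)\<^sup>2" unfolding m_def using b(1) b(4)[OF z0(1)] by (intro power_mono mult_left_mono) auto
   then show ?thesis using chi_lower[OF z0(2) pos(2)[OF z0(1)]] by simp
  qed
  moreover have "chi z0 x \<le> s" unfolding s_def using finZ z0 chi_bounds(1) by (intro member_le_sum) auto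
  ultimately have s: "s \<ge> m" "s > 0" "chi z0 x > 0" using m by auto
  define w where "w = (%z. e z + (1 / s) *R a)"
  have we: "norm (w z - e z) < cm" for z
  proof -
   have "norm (w z - e z) = norm a / s" using s by (simp add: w_def)
   also have "... \<le> et / m" using a s m et(1) by (intro frac_le) auto
   finally show ?thesis using et(3) by simp
  qed
  \<comment> \<open>Before the first positive weight the point is only known to lie in the closure,
    which is all that the cone condition asks for; afterwards it is in the domain. The positive
    weight at \<open>z0\<close> settles the final point.\<close>
  have claim: "(x + t *R (\<Sum>z\<in>S. chi z x *R w z) \<in> closure Om) \<and>
    ((\<exists>z\<in>S. chi z x > 0) --> x + t *R (\<Sum>z\<in>S. chi z x *R w z) \<in> Om)" if "finite S" "S \<subseteq> Z" for S
   using that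
  proof (induction S rule: finite_induct)
   case empty
   then show ?case using x by simp
  next
   case (insert y S)
   define q where "q = x + t *R (\<Sum>z\<in>S. chi z x *R w z)"
   have y: "y \<in> Z" using insert by simp
   have eq: "x + t *R (\<Sum>z\<in>insert y S. chi z x *R w z) = q + (t * chi y x) *R w y"
    using insert by (simp add: q_def scaleR_add_right)
   have IH: "q \<in> closure Om" "(\<exists>z\<in>S. chi z x > 0) ==> q \<in> Om" using insert by (auto simp: q_def)
   show ?case
   proof (cases "chi y x > 0")
    case False
    then have "chi y x = 0" using chi_bounds(1)[of y x] by simp
    then show ?thesis unfolding eq using IH by auto
   next
    case True
    have "norm (t *R (\<Sum>z\<in>S. chi z x *R w z)) \<le> t * (X * (E + cm))"
    proof -
     have "norm (\<Sum>z\<in>S. chi z x *R w z) \<le> (\<Sum>z\<in>S. chi z x * (E + cm))"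
     proof (rule sum_norm_le)
      fix z assume "z \<in> S"
      then have "z \<in> Z" using insert by auto
      then have "norm (w z) \<le> E + cm" using norm_triangle_ineq[of "w z - e z" "e z"] we[of z] b(6)[of z] by simp
      then show "norm (chi z x *R w z) \<le> chi z x * (E + cm)" using chi_bounds(1)[of z x] by (simp add: mult_left_mono)
     qed
     also have "... = (\<Sum>z\<in>S. chi z x) * (E + cm)" by (simp add: sum_distrib_right)
     also have "... \<le> X * (E + cm)" using X(3)[of S x] insert.prems b by (intro mult_right_mono) auto
     finally show ?thesis using t by (simp add: mult_left_mono)
    qed
    also have "... \<le> (rm / (8 * X * (E + cm))) * (X * (E + cm))"
     using t X b by (intro mult_right_mono) (auto simp: t0_def)
    also have "... = rm / 8"
    proof -
     have q: "rm / (8 * Q) * Q = rm / 8" if "Q > 0" for Q :: real using that by simp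
     have "X * (E + cm) > 0" using X b by simp
     from q[OF this] show ?thesis by (simp only: mult.assoc)
    qed
    finally have "dist q x \<le> rm / 8" by (simp add: q_def dist_norm)
    moreover have "dist x y < 3 / 4 * r y" by (rule chi_support[OF True pos(2)[OF y]])
    ultimately have "dist q y < r y"
     using dist_triangle[of q y x] b(4)[OF y] pos(2)[OF y] by linarith
    moreover have "t * chi y x < r y"
    proof -
     have "t * chi y x \<le> (rm / (2 * X)) * X" using t X(2)[OF y] chi_bounds(1) X(1) b by (intro mult_mono) (auto simp: t0_def)
     also have "... = rm / 2" using X by simp
     finally show ?thesis using b(1) b(4)[OF y] by simp
    qed
    ultimately have "q + (t * chi y x) *R w y \<in> Om"
     using t True we[of y] b(5)[OF y] IH(1) by (intro cone[OF y]) (auto simp: dist_commute)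
    then show ?thesis unfolding eq using closure_subset by blast
   qed
  qed
  have "x + t *R (\<Sum>z\<in>Z. chi z x *R w z) \<in> Om" using claim[OF finZ] z0(1) s(3) by blast
  moreover have "(\<Sum>z\<in>Z. chi z x *R w z) = V x + a"
  proof -
   have "(\<Sum>z\<in>Z. chi z x *R w z) = V x + (\<Sum>z\<in>Z. chi z x *R ((1 / s) *R a))"
    by (simp add: w_def V_def scaleR_add_right sum.distrib)
   also have "(\<Sum>z\<in>Z. chi z x *R ((1 / s) *R a)) = s *R ((1 / s) *R a)"
    unfolding s_def by (rule scaleR_sum_left[symmetric])
   finally show ?thesis using s by simp
  qed
  ultimately show ?thesis by simp
 qed
 show ?thesis using t0 et(1) Vb main by blast
qed

end

text \<open>For fixed x the point x + t (V x + a) is an affine function of a, whatever V is.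
  Averaging over the ball of radius et therefore leads to integrals of F over balls of radius t (Vm
  + et); the powers of t cancel and the ratio of volumes remains. If every a exceeded this bound, so
  would the average.\<close>

lemma average_translation_le:
 fixes F :: "real^'d::finite => ennreal" and V :: "real^'d => real^'d"
 assumes [measurable]: "F \<in> borel_fun" "V \<in> borel_fun" "S \<in> sets borel"
  and t: "t > 0" and et: "et > 0" and Vm: "\<And>x. norm (V x) \<le> Vm"
 shows "\<exists>a\<in>ball 0 et. (NN x. indicator S x * F (x + t *R (V x + a)))
  \<le> ennreal (((Vm + et) / et) ^ CARD('d)) * (NN y. F y)"
proof (rule ccontr)
 have Vm0: "Vm \<ge> 0" using Vm norm_ge_zero order_trans by blast
 define C where "C = ennreal (((Vm + et) / et) ^ CARD('d))"
 define I where "I = (NN y. F y)"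
 assume "\<not> ?thesis"
 then have gt: "C * I < (NN x. indicator S x * F (x + t *R (V x + a)))" if "a \<in> ball 0 et" for a
  using that by (auto simp: C_def I_def not_le)
 define T where "T = (%a. NN x. indicator S x * F (x + t *R (V x + a)))"
 have [measurable]: "T \<in> borel_fun" unfolding T_def by measurable
 define v where "v = unit_ball_vol (real CARD('d))"
 have v: "v > 0" by (simp add: v_def)
 have eball: "emeasure lborel (ball (a::real^'d) s) = ennreal (v * s ^ CARD('d))" if "s \<ge> 0" for a s
  using emeasure_ball[OF that, of a] by (simp add: v_def)
 have "(NN a. (if norm a < et then T a else 0)) \<le> (C * I) * emeasure lborel (ball (0::real^'d) et)"
 proof -
  have "(NN a. (if norm a < et then T a else 0)) =
    (NN a. NN x. (if norm a < et then indicator S x * F (x + t *R (V x + a)) else 0))"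
   by (intro nn_integral_cong) (simp add: T_def)
  also have "... = (NN x. NN a. (if norm a < et then indicator S x * F (x + t *R (V x + a)) else 0))"
   by (rule lborel_pair.Fubini') measurable
  also have "... \<le> (NN x. ennreal ((1 / t) ^ CARD('d)) * (NN y. (if dist x y < t * (Vm + et) then F y else 0)))"
  proof (rule nn_integral_mono)
   fix x
   define H where "H = (%y. if dist x y < t * (Vm + et) then F y else 0)"
   have [measurable]: "H \<in> borel_fun" unfolding H_def by measurable
   have "(NN a. (if norm a < et then indicator S x * F (x + t *R (V x + a)) else 0))
    \<le> (NN a. H ((x + t *R V x) + t *R a))"
   proof (rule nn_integral_mono)
    fix a :: "real^'d"
    have d: "dist x (x + t *R (V x + a)) < t * (Vm + et)" if "norm a < et"
    proof -
     have "norm (V x + a) < Vm + et" using norm_triangle_ineq[of "V x" a] Vm[of x] that by linarith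
     then show ?thesis using t by (simp add: dist_norm)
    qed
    have eq: "(x + t *R V x) + t *R a = x + t *R (V x + a)" by (simp add: scaleR_add_right)
    have "H ((x + t *R V x) + t *R a) = F (x + t *R (V x + a))" if "norm a < et"
     unfolding H_def eq using d[OF that] by (simp only: if_True)
    then show "(if norm a < et then indicator S x * F (x + t *R (V x + a)) else 0) \<le> H ((x + t *R V x) + t *R a)"
     by (auto simp: indicator_def)
   qed
   also have "... = ennreal ((1 / t) ^ CARD('d)) * (NN y. H y)"
   proof -
    have "ennreal ((1 / t) ^ CARD('d)) * (NN y. H y) =
     ennreal ((1 / t) ^ CARD('d)) * (ennreal (t ^ CARD('d)) * (NN a. H ((x + t *R V x) + t *R a)))"
     using nn_integral_lborel_affine[of H t "x + t *R V x"] t by simp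
    also have "... = (NN a. H ((x + t *R V x) + t *R a))"
    proof -
     have "(1 / t) ^ CARD('d) * t ^ CARD('d) = 1" using t by (simp add: power_mult_distrib[symmetric])
     then have "ennreal ((1 / t) ^ CARD('d)) * ennreal (t ^ CARD('d)) = 1"
      using t by (subst ennreal_mult'[symmetric]) auto
     then show ?thesis by (simp add: mult.assoc[symmetric])
    qed
    finally show ?thesis by simp
   qed
   finally show "(NN a. (if norm a < et then indicator S x * F (x + t *R (V x + a)) else 0))
    \<le> ennreal ((1 / t) ^ CARD('d)) * (NN y. (if dist x y < t * (Vm + et) then F y else 0))"
    by (simp add: H_def)
  qed
  also have "... = ennreal ((1 / t) ^ CARD('d)) * (NN x. NN y. (if dist x y < t * (Vm + et) then F y else 0))"
   by (rule nn_integral_cmult) measurable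
  also have "(NN x. NN y. (if dist x y < t * (Vm + et) then F y else 0)) =
    (NN y. NN x. (if dist x y < t * (Vm + et) then F y else 0))"
   by (rule lborel_pair.Fubini') measurable
  also have "... = (NN y. F y * ennreal (v * (t * (Vm + et)) ^ CARD('d)))"
  proof (rule nn_integral_cong)
   fix y
   have "(NN x. (if dist x y < t * (Vm + et) then F y else 0)) = (NN x. F y * indicator (ball y (t * (Vm + et))) x)"
    by (intro nn_integral_cong) (auto simp: indicator_def dist_commute)
   also have "... = F y * emeasure lborel (ball y (t * (Vm + et)))"
    by (rule nn_integral_cmult_indicator) simp
   finally show "(NN x. (if dist x y < t * (Vm + et) then F y else 0)) = F y * ennreal (v * (t * (Vm + et)) ^ CARD('d))"
    using t Vm0 et by (subst eball[symmetric, of _ y]) auto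
  qed
  also have "... = I * ennreal (v * (t * (Vm + et)) ^ CARD('d))"
   unfolding I_def by (rule nn_integral_multc) measurable
  also have "ennreal ((1 / t) ^ CARD('d)) * (I * ennreal (v * (t * (Vm + et)) ^ CARD('d))) =
    I * ennreal ((1 / t) ^ CARD('d) * (v * (t * (Vm + et)) ^ CARD('d)))"
  proof -
   have "ennreal ((1 / t) ^ CARD('d)) * ennreal (v * (t * (Vm + et)) ^ CARD('d)) = ennreal ((1 / t) ^ CARD('d) * (v * (t * (Vm + et)) ^ CARD('d)))"
    by (rule ennreal_mult'[symmetric]) (use t in simp)
   then show ?thesis by (simp only: mult.left_commute)
  qed
  also have "(1 / t) ^ CARD('d) * (v * (t * (Vm + et)) ^ CARD('d)) = ((Vm + et) / et) ^ CARD('d) * (v * et ^ CARD('d))"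
   using t et by (simp add: power_mult_distrib power_divide)
  also have "I * ennreal (((Vm + et) / et) ^ CARD('d) * (v * et ^ CARD('d))) = (C * I) * emeasure lborel (ball (0::real^'d) et)"
   using et Vm0 v by (simp add: C_def ennreal_mult' eball mult_ac)
  finally show ?thesis .
 qed
 moreover have "(C * I) * emeasure lborel (ball (0::real^'d) et) < (NN a. (if norm a < et then T a else 0))"
 proof -
  \<comment> \<open>Pointwise strict inequality passes to the integrals only if the smaller one is
    finite, which follows from c < T 0.\<close>
  define c where "c = C * I"
  have "c < T 0" unfolding c_def T_def by (rule gt) (use et in simp)
  then have cfin: "c < \<infinity>" by (rule order_less_le_trans) simp
  have eqc: "c * emeasure lborel (ball (0::real^'d) et) = (NN a. c * indicator (ball (0::real^'d) et) a)"
   by (rule nn_integral_cmult_indicator[symmetric]) simp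
  have cle: "(NN a. c * indicator (ball (0::real^'d) et) a) \<noteq> \<infinity>"
   unfolding eqc[symmetric] using cfin emeasure_lborel_ball_finite[of "0::real^'d" et]
   by (auto simp: ennreal_mult_eq_top_iff)
  have "(NN a. c * indicator (ball (0::real^'d) et) a) < (NN a. (if norm a < et then T a else 0))"
  proof (rule nn_integral_less)
   show "(%a. c * indicator (ball (0::real^'d) et) a) \<in> borel_measurable lborel"
    by (intro borel_measurable_times_ennreal borel_measurable_const borel_measurable_indicator) simp
   show "(%a. if norm a < et then T a else 0) \<in> borel_measurable lborel" by measurable
   show "AE a in lborel. c * indicator (ball 0 et) a \<le> (if norm a < et then T a else 0)"
    using gt by (intro AE_I2) (auto simp: c_def T_def indicator_def less_imp_le)
   show "\<not> (AE a in lborel. (if norm a < et then T a else 0) \<le> c * indicator (ball 0 et) a)"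
   proof
    assume "AE a in lborel. (if norm a < et then T a else 0) \<le> c * indicator (ball 0 et) a"
    then have "AE a in lborel. a \<notin> ball (0::real^'d) et"
    proof eventually_elim
     case (elim a)
     show ?case
     proof
      assume "a \<in> ball 0 et"
      then show False using elim gt[of a] by (auto simp: c_def T_def)
     qed
    qed
    then have "ball (0::real^'d) et \<in> null_sets lborel" by (subst AE_iff_null_sets) auto
    then show False using eball[of et 0] v et by (simp add: null_sets_def)
   qed
  qed (use cle in simp)
  then show ?thesis by (simp only: eqc[symmetric] c_def[symmetric])
 qed
 ultimately show False by simp
qed

text \<open>Covers two cases at once: a parallel section has \<open>sg\<close> = 0, and the
  difference of sections of two fields has \<open>sg\<close> of the size of the difference of the
  fields. The number et bounds the L^p norm of \<open>sg\<close>; being positive, it can serve as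
  \<open>La\<close> in \<open>pot_le\<close>.\<close>

definition grad_bound :: "(real^'d::finite) set => real => real => (real^'d => real^'n::finite) => real => bool" where
 "grad_bound Om p P w et \<longleftrightarrow> et > 0 \<and> (\<exists>A be sg. (\<forall>x\<in>Om. (w has_derivative (*v) (A x)) (at x)) \<and> continuous_on Om A \<and>
  be \<in> borel_fun \<and> sg \<in> borel_fun \<and> (\<forall>x. be x \<ge> 0 \<and> sg x \<ge> 0) \<and>
  (\<forall>x\<in>Om. norm (A x) \<le> be x * norm (w x) + sg x) \<and> pint p be \<le> ennreal P \<and> pint p sg \<le> ennreal (et powr p))"

text \<open>A Harnack type comparison. The maximum S of |w| on the hull exceeds |w y| by at most S/4
  plus a multiple of et, from two oscillations that cost S/8 each; absorbing S/4 leaves a factor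
  below 2. The constant C depends on h but not on w or on the hull.\<close>

lemma grad_bound_hull:
 fixes Om :: "(real^'d::finite) set"
 assumes p: "p > real CARD('d)" and P: "P \<ge> 0" and ck: "ck > 0"
 shows "\<exists>h0>0. \<forall>h. 0 < h \<and> h \<le> h0 --> (\<exists>C\<ge>0. \<forall>x z. \<forall>w :: real^'d => real^'n::finite. \<forall>et.
  convex hull (insert x (cball z (ck * h))) \<subseteq> Om --> (\<forall>y\<in>convex hull (insert x (cball z (ck * h))). dist x y < h / 2) -->
  grad_bound Om p P w et -->
  (\<forall>x'\<in>convex hull (insert x (cball z (ck * h))). \<forall>y\<in>convex hull (insert x (cball z (ck * h))). norm (w x') \<le> 2 * norm (w y) + C * et))"
proof -
 have p': "p > real DIM(real^'d)" using p by simp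
 have p0: "p > 0" using p by (meson of_nat_0_le_iff order_le_less_trans)
 have "\<exists>h0>0. \<forall>h. 0 < h \<and> h \<le> h0 --> (\<forall>g :: real^'d => real. \<forall>x z :: real^'d.
  g \<in> borel_fun --> pint p g \<le> ennreal P -->
  ennreal h * pot h (%z. ennreal (norm (g z))) x \<le> ennreal (1/8) * emeasure lborel (ball z (ck * h)))"
  by (rule pot_small[OF p' P ck]) simp
 then obtain h0 where h0: "h0 > 0" and H0: "\<forall>h. 0 < h \<and> h \<le> h0 --> (\<forall>g :: real^'d => real. \<forall>x z :: real^'d.
  g \<in> borel_fun --> pint p g \<le> ennreal P -->
  ennreal h * pot h (%z. ennreal (norm (g z))) x \<le> ennreal (1/8) * emeasure lborel (ball z (ck * h)))"
  by (elim exE conjE)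
 define v where "v = unit_ball_vol (real CARD('d))"
 have v: "v > 0" by (simp add: v_def)
 define C1 where "C1 = 1 / (1 - real CARD('d) / p)"
 have C1: "C1 > 0" using p p0 by (simp add: C1_def)
 show ?thesis
 proof (rule exI[of _ h0], rule conjI[OF h0], intro allI impI)
  fix h assume h: "0 < h \<and> h \<le> h0"
  define V where "V = v * (ck * h) ^ CARD('d)"
  have V: "V > 0" using v ck h by (simp add: V_def)
  have eball: "emeasure lborel (ball (z::real^'d) (ck * h)) = ennreal V" for z
   using emeasure_ball[of "ck * h" z] ck h by (simp add: V_def v_def)
  \<comment> \<open>The bound for h times the potential of \<open>sg\<close> per unit of et, as
    given by \<open>pot_le\<close> with \<open>La\<close> = et.\<close>
  define C2 where "C2 = h * (C1 * (v * h ^ CARD('d) + 1))"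
  have C2: "C2 > 0" using h C1 v by (simp add: C2_def add_pos_pos)
  define C where "C = 4 * C2 / V"
  have C: "C \<ge> 0" using C2 V by (simp add: C_def)
  have main: "norm (w x') \<le> 2 * norm (w y) + C * et"
   if sub: "convex hull (insert x (cball z (ck * h))) \<subseteq> Om" and near: "\<forall>y\<in>convex hull (insert x (cball z (ck * h))). dist x y < h / 2"
    and gb: "grad_bound Om p P w et" and x': "x' \<in> convex hull (insert x (cball z (ck * h)))" and y: "y \<in> convex hull (insert x (cball z (ck * h)))"
   for x z x' y and w :: "real^'d => real^'n" and et
  proof -
   define H where "H = convex hull (insert x (cball z (ck * h)))"
   define B where "B = ball z (ck * h)"
   have Hc: "compact H" unfolding H_def by (intro compact_convex_hull compact_insert) simp
   have H: "convex H" "H \<in> sets borel" "H \<subseteq> Om" "x' \<in> H" "y \<in> H"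
    using sub x' y borel_compact[OF Hc] by (auto simp: H_def)
   have BH: "B \<subseteq> H" unfolding B_def H_def using hull_subset[of "insert x (cball z (ck * h))" convex] by auto
   have Bb: "B \<in> sets borel" by (simp add: B_def)
   have near2: "dist a b < h" if "a \<in> H" "b \<in> H" for a b
   proof -
    have "dist x a < h / 2" "dist x b < h / 2" using near that unfolding H_def by blast+
    then show ?thesis using dist_triangle3[of a b x] by linarith
   qed
   from gb obtain A be sg where et: "et > 0" and wd: "\<And>x. x \<in> Om ==> (w has_derivative (*v) (A x)) (at x)"
    and Ac: "continuous_on Om A" and [measurable]: "be \<in> borel_fun" "sg \<in> borel_fun"
    and nn: "\<And>x. be x \<ge> 0" "\<And>x. sg x \<ge> 0" and Ale: "\<And>x. x \<in> Om ==> norm (A x) \<le> be x * norm (w x) + sg x"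
    and beP: "pint p be \<le> ennreal P" and sget: "pint p sg \<le> ennreal (et powr p)"
    unfolding grad_bound_def by blast
   have wc: "continuous_on H w"
    using wd H(3) has_derivative_continuous by (meson continuous_at_imp_continuous_on subsetD)
   have "\<exists>s\<in>H. \<forall>t\<in>H. norm (w t) \<le> norm (w s)"
    by (intro continuous_attains_sup Hc continuous_intros wc) (use H in auto)
   then obtain s where s: "s \<in> H" "\<And>t. t \<in> H ==> norm (w t) \<le> norm (w s)" by blast
   let ?S = "norm (w s)"
   have pb: "ennreal h * pot h (%z. ennreal (be z)) q \<le> ennreal (V / 8)" for q
   proof -
    have "ennreal h * pot h (%z. ennreal (norm (be z))) q \<le> ennreal (1/8) * emeasure lborel (ball z (ck * h))"
     using H0[rule_format, OF h, of be q z] beP by simp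
    also have "... = ennreal (1 / 8 * V)" unfolding eball by (rule ennreal_mult'[symmetric]) simp
    finally show ?thesis using nn by simp
   qed
   have ps: "ennreal h * pot h (%z. ennreal (sg z)) q \<le> ennreal (C2 * et)" for q
   proof -
    have "ennreal h * pot h (%z. ennreal (norm (sg z))) q \<le> ennreal h * (ennreal C1 *
      (ennreal (et * v * h ^ CARD('d)) + ennreal (et powr (1 - p)) * pint p sg))"
     using pot_le[of sg p et h q] p' et h by (intro mult_left_mono) (auto simp: C1_def v_def)
    also have "... \<le> ennreal h * (ennreal C1 * (ennreal (et * v * h ^ CARD('d)) + ennreal (et powr (1 - p)) * ennreal (et powr p)))"
     by (intro mult_left_mono add_left_mono sget) auto
    also have "... = ennreal (h * (C1 * (et * v * h ^ CARD('d) + et powr (1 - p) * et powr p)))"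
     using h C1 et v by (simp add: ennreal_mult' ennreal_plus)
    also have "et powr (1 - p) * et powr p = et" using et by (simp add: powr_add[symmetric])
    also have "h * (C1 * (et * v * h ^ CARD('d) + et)) = C2 * et" by (simp add: C2_def algebra_simps)
    finally show ?thesis using nn by simp
   qed
   have osc: "(NN t. indicator B t * ennreal (norm (w q - w t))) \<le> ennreal (?S * (V / 8) + C2 * et)" if q: "q \<in> H" for q
   proof -
    have "(NN t. indicator B t * ennreal (norm (w q - w t))) \<le>
      ennreal h * pot h (%z. indicator H z * ennreal (norm (A z))) q"
    proof (rule oscillation_matrix_le_pot[OF H(1,2) q BH Bb])
     show "dist q t < h" if "t \<in> B" for t using near2[OF q] BH that by blast
     show "(w has_derivative (*v) (A z)) (at z)" if "z \<in> H" for z using wd H(3) that by blast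
     show "continuous_on H A" by (rule continuous_on_subset[OF Ac H(3)])
    qed
    also have "... \<le> ennreal h * pot h (%z. ennreal ?S * ennreal (be z) + ennreal (sg z)) q"
    proof (intro mult_left_mono pot_mono)
     fix t
     have "norm (A t) \<le> ?S * be t + sg t" if "t \<in> H"
     proof -
      have "norm (A t) \<le> be t * norm (w t) + sg t" using Ale that H(3) by blast
      also have "... \<le> be t * ?S + sg t" using s(2)[OF that] nn by (intro add_right_mono mult_left_mono) auto
      finally show ?thesis by (simp add: mult.commute)
     qed
     then show "indicator H t * ennreal (norm (A t)) \<le> ennreal ?S * ennreal (be t) + ennreal (sg t)"
      using nn by (auto simp: indicator_def ennreal_mult'[symmetric] ennreal_plus[symmetric] intro!: ennreal_leI simp del: ennreal_plus)
    qed simp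
    also have "... = ennreal ?S * (ennreal h * pot h (%z. ennreal (be z)) q) + ennreal h * pot h (%z. ennreal (sg z)) q"
     by (subst pot_add) (auto simp: pot_cmult distrib_left mult.left_commute)
    also have "... \<le> ennreal ?S * ennreal (V / 8) + ennreal (C2 * et)"
     by (intro add_mono mult_left_mono pb ps) auto
    also have "... = ennreal (?S * (V / 8) + C2 * et)"
     using V C2 et by (simp add: ennreal_mult'[symmetric] ennreal_plus[symmetric] del: ennreal_plus)
    finally show ?thesis .
   qed
   have diff: "norm (w a - w b) \<le> ?S / 4 + (2 * C2 / V) * et" if a: "a \<in> H" and b: "b \<in> H" for a b
   proof -
    have wm: "(%t. indicator B t *R w t) \<in> borel_fun"
     by (rule borel_measurable_continuous_on_indicator[OF Bb continuous_on_subset[OF wc BH]])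
    have m1: "(%t. indicator B t * ennreal (norm (w q - w t))) \<in> borel_fun" for q
    proof -
     have "(%t. norm (indicator B t *R w q - indicator B t *R w t)) \<in> borel_fun"
      by (intro borel_measurable_norm[THEN measurable_compose_rev] borel_measurable_diff wm borel_measurable_scaleR borel_measurable_indicator Bb borel_measurable_const)
     then have "(%t. ennreal (norm (indicator B t *R w q - indicator B t *R w t))) \<in> borel_fun"
      by (rule measurable_compose[OF _ measurable_ennreal])
     moreover have "ennreal (norm (indicator B t *R w q - indicator B t *R w t)) = indicator B t * ennreal (norm (w q - w t))" for t
      by (auto simp: indicator_def)
     ultimately show ?thesis by simp
    qed
    have "ennreal (V * norm (w a - w b)) = (NN t. ennreal (norm (w a - w b)) * indicator B t)"
     unfolding B_def using V by (subst nn_integral_cmult_indicator) (simp_all add: eball ennreal_mult' mult.commute)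
    also have "... \<le> (NN t. indicator B t * ennreal (norm (w a - w t)) + indicator B t * ennreal (norm (w b - w t)))"
    proof (rule nn_integral_mono)
     fix t
     have "norm (w a - w b) \<le> norm (w a - w t) + norm (w b - w t)"
      using norm_triangle_ineq4[of "w a - w t" "w b - w t"] by simp
     then show "ennreal (norm (w a - w b)) * indicator B t \<le> indicator B t * ennreal (norm (w a - w t)) + indicator B t * ennreal (norm (w b - w t))"
      by (auto simp: indicator_def ennreal_plus[symmetric] ennreal_leI simp del: ennreal_plus)
    qed
    also have "... = (NN t. indicator B t * ennreal (norm (w a - w t))) + (NN t. indicator B t * ennreal (norm (w b - w t)))"
     by (rule nn_integral_add) (simp_all add: m1)
    also have "... \<le> ennreal (?S * (V / 8) + C2 * et) + ennreal (?S * (V / 8) + C2 * et)"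
     by (intro add_mono osc a b)
    also have "... = ennreal (V * (?S / 4 + (2 * C2 / V) * et))"
     using V C2 et by (simp add: ennreal_plus[symmetric] algebra_simps del: ennreal_plus)
    finally have "V * norm (w a - w b) \<le> V * (?S / 4 + (2 * C2 / V) * et)"
     using V C2 et by (subst (asm) ennreal_le_iff) (auto intro!: mult_nonneg_nonneg add_nonneg_nonneg)
    then show ?thesis using V by simp
   qed
   have "?S \<le> norm (w y) + norm (w s - w y)" using norm_triangle_sub[of "w s" "w y"] by simp
   also have "... \<le> norm (w y) + (?S / 4 + (2 * C2 / V) * et)" by (intro add_left_mono diff s(1) H)
   finally have "3 * ?S \<le> 4 * norm (w y) + 4 * ((2 * C2 / V) * et)" by simp
   moreover have "(2 * C2 / V) * et \<ge> 0" using C2 V et by simp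
   ultimately have "?S \<le> 2 * norm (w y) + 2 * ((2 * C2 / V) * et)" using norm_ge_zero[of "w y"] by linarith
   then show ?thesis using s(2)[OF H(4)] by (simp add: C_def)
  qed
  show "\<exists>C\<ge>0. \<forall>x z. \<forall>w :: real^'d => real^'n. \<forall>et.
  convex hull (insert x (cball z (ck * h))) \<subseteq> Om --> (\<forall>y\<in>convex hull (insert x (cball z (ck * h))). dist x y < h / 2) -->
  grad_bound Om p P w et -->
  (\<forall>x'\<in>convex hull (insert x (cball z (ck * h))). \<forall>y\<in>convex hull (insert x (cball z (ck * h))). norm (w x') \<le> 2 * norm (w y) + C * et)"
   by (rule exI[of _ C], rule conjI[OF C], intro allI impI ballI, rule main)
 qed
qed

context cone_domain
begin

text \<open>Comparability of |w x| and |w y|, up to et and with constants independent of w, is an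
  equivalence relation with open classes. So every point is comparable with x0, but with a constant
  depending on the point. The cones give uniformity: each x is comparable, with one constant, with a
  whole ball inside the domain, and finitely many reference points meet all these balls.\<close>

lemma stability:
 assumes p: "p > real CARD('d)" and P: "P \<ge> 0" and conn: "connected Om" and bdd: "bounded Om" and x0: "x0 \<in> Om"
 shows "\<exists>C>0. \<forall>w :: real^'d => real^'n::finite. \<forall>et. grad_bound Om p P w et --> (\<forall>x\<in>Om. norm (w x) \<le> C * (norm (w x0) + et))"
proof -
 obtain ck0 h1 where ck0: "ck0 > 0" and h1: "h1 > 0" and ic: "\<And>x h. x \<in> Om ==> 0 < h \<and> h \<le> h1 ==>
  \<exists>z. convex hull (insert x (cball z (ck0 * h))) \<subseteq> Om \<and> (\<forall>w\<in>convex hull (insert x (cball z (ck0 * h))). dist x w < h / 2)"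
  using interior_cone by blast
 \<comment> \<open>At most 1/4, so that a concentric ball of radius ck h obeys the bound h/2
   required of the hulls.\<close>
 define ck where "ck = min ck0 (1/4)"
 have ck: "ck > 0" "ck \<le> ck0" "ck \<le> 1/4" using ck0 by (auto simp: ck_def)
 from grad_bound_hull[OF p P ck(1), of Om, where 'n='n]
 obtain h0 where h0: "h0 > 0" and gh: "\<And>h. 0 < h \<and> h \<le> h0 ==> (\<exists>C\<ge>0. \<forall>x z. \<forall>w :: real^'d => real^'n. \<forall>et.
  convex hull (insert x (cball z (ck * h))) \<subseteq> Om --> (\<forall>y\<in>convex hull (insert x (cball z (ck * h))). dist x y < h / 2) -->
  grad_bound Om p P w et -->
  (\<forall>x'\<in>convex hull (insert x (cball z (ck * h))). \<forall>y\<in>convex hull (insert x (cball z (ck * h))). norm (w x') \<le> 2 * norm (w y) + C * et))"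
  by (elim exE conjE) blast
 define R where "R = (%x y. \<exists>C>0. \<forall>w :: real^'d => real^'n. \<forall>et. grad_bound Om p P w et -->
  norm (w y) \<le> C * (norm (w x) + et) \<and> norm (w x) \<le> C * (norm (w y) + et))"
 have etpos: "et > 0" if "grad_bound Om p P w et" for w :: "real^'d => real^'n" and et using that by (simp add: grad_bound_def)
 have R: "R x0 x" if "x \<in> Om" for x
 proof (rule connected_equivalence_relation[OF conn x0 that, of R])
  show "R y x" if "R x y" for x y using that unfolding R_def by blast
  show "R x z" if "R x y" "R y z" for x y z
  proof -
   from that(1) obtain C where C: "C > 0" "\<forall>w :: real^'d => real^'n. \<forall>et. grad_bound Om p P w et -->
     norm (w y) \<le> C * (norm (w x) + et) \<and> norm (w x) \<le> C * (norm (w y) + et)"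
    unfolding R_def by (elim exE conjE)
   from that(2) obtain D where D: "D > 0" "\<forall>w :: real^'d => real^'n. \<forall>et. grad_bound Om p P w et -->
     norm (w z) \<le> D * (norm (w y) + et) \<and> norm (w y) \<le> D * (norm (w z) + et)"
    unfolding R_def by (elim exE conjE)
   have comb: "a \<le> (C + 1) * (D + 1) * (c + et)" if "a \<le> D * (b + et)" "b \<le> C * (c + et)" "0 < et" "0 \<le> c" for a b c et
   proof -
    have "a \<le> D * (C * (c + et) + et)" using that D(1) by (meson add_right_mono less_imp_le mult_left_mono order_trans)
    also have "... \<le> (D + 1) * ((C + 1) * (c + et))"
     using that C(1) D(1) by (intro mult_mono) (auto simp: algebra_simps)
    finally show ?thesis by (simp add: mult_ac)
   qed
   have comb2: "a \<le> (C + 1) * (D + 1) * (c + et)" if "a \<le> C * (b + et)" "b \<le> D * (c + et)" "0 < et" "0 \<le> c" for a b c et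
   proof -
    have "a \<le> C * (D * (c + et) + et)" using that C(1) by (meson add_right_mono less_imp_le mult_left_mono order_trans)
    also have "... \<le> (C + 1) * ((D + 1) * (c + et))"
     using that C(1) D(1) by (intro mult_mono) (auto simp: algebra_simps)
    finally show ?thesis by (simp add: mult_ac)
   qed
   show ?thesis unfolding R_def
   proof (intro exI[of _ "(C + 1) * (D + 1)"] conjI allI impI)
    show "(C + 1) * (D + 1) > 0" using C(1) D(1) by simp
    fix w :: "real^'d => real^'n" and et assume g: "grad_bound Om p P w et"
    show "norm (w z) \<le> (C + 1) * (D + 1) * (norm (w x) + et)"
     by (rule comb[of _ "norm (w y)"]) (use C(2)[rule_format, OF g] D(2)[rule_format, OF g] etpos[OF g] in auto)
    show "norm (w x) \<le> (C + 1) * (D + 1) * (norm (w z) + et)"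
     by (rule comb2[of _ "norm (w y)"]) (use C(2)[rule_format, OF g] D(2)[rule_format, OF g] etpos[OF g] in auto)
   qed
  qed
  fix a assume a: "a \<in> Om"
  obtain e where e: "e > 0" "cball a e \<subseteq> Om" using open_Om a open_contains_cball by blast
  define h where "h = min e h0"
  have h: "0 < h \<and> h \<le> h0" using e h0 by (simp add: h_def)
  have kh: "ck * h \<le> h / 4" using ck(3) h mult_right_mono[of ck "1/4" h] by simp
  have hull: "convex hull (insert a (cball a (ck * h))) = cball a (ck * h)"
   using ck(1) h by (simp add: insert_absorb convex_hull_eq)
  have sub: "cball a (ck * h) \<subseteq> Om"
  proof -
   have "ck * h \<le> e" using kh h unfolding h_def by linarith
   then show ?thesis using e(2) subset_cball by (meson order_trans)
  qed
  obtain C where C: "C \<ge> 0" "\<And>w et x' y. grad_bound Om p P (w :: real^'d => real^'n) et ==> x' \<in> cball a (ck * h) ==> y \<in> cball a (ck * h) ==> norm (w x') \<le> 2 * norm (w y) + C * et"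
  proof -
   from gh[OF h] obtain C where C: "C \<ge> 0" and CC: "\<forall>x z. \<forall>w :: real^'d => real^'n. \<forall>et.
   convex hull (insert x (cball z (ck * h))) \<subseteq> Om --> (\<forall>y\<in>convex hull (insert x (cball z (ck * h))). dist x y < h / 2) -->
   grad_bound Om p P w et -->
   (\<forall>x'\<in>convex hull (insert x (cball z (ck * h))). \<forall>y\<in>convex hull (insert x (cball z (ck * h))). norm (w x') \<le> 2 * norm (w y) + C * et)"
    by (elim exE conjE)
   have "\<forall>y\<in>cball a (ck * h). dist a y < h / 2"
   proof
    fix y assume "y \<in> cball a (ck * h)"
    then have "dist a y \<le> ck * h" by simp
    then show "dist a y < h / 2" using kh h by linarith
   qed
   then show ?thesis using that[OF C] CC[rule_format, of a a, unfolded hull, OF sub] by blast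
  qed
  have "R a y" if y: "y \<in> ball a (ck * h)" for y
   unfolding R_def
  proof (intro exI[of _ "C + 2"] conjI allI impI)
   show "C + 2 > 0" using C(1) by simp
   fix w :: "real^'d => real^'n" and et assume g: "grad_bound Om p P w et"
   have ay: "a \<in> cball a (ck * h)" "y \<in> cball a (ck * h)" using y ck(1) h by auto
   have st: "s \<le> (C + 2) * (t + et)" if "s \<le> 2 * t + C * et" "0 \<le> t" for s t
   proof -
    have "0 \<le> C * t + 2 * et" using C(1) that(2) etpos[OF g] by simp
    then show ?thesis using that by (simp add: algebra_simps)
   qed
   show "norm (w y) \<le> (C + 2) * (norm (w a) + et)" by (rule st[OF C(2)[OF g ay(2,1)]]) simp
   show "norm (w a) \<le> (C + 2) * (norm (w y) + et)" by (rule st[OF C(2)[OF g ay(1,2)]]) simp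
  qed
  moreover have "openin (top_of_set Om) (ball a (ck * h))" by (intro open_subset subset_trans[OF ball_subset_cball sub] open_ball)
  moreover have "a \<in> ball a (ck * h)" using ck(1) h by simp
  ultimately show "\<exists>T. openin (top_of_set Om) T \<and> a \<in> T \<and> (\<forall>x\<in>T. R a x)" by blast
 qed
 define h where "h = min h0 h1"
 have h: "0 < h \<and> h \<le> h0" "0 < h \<and> h \<le> h1" using h0 h1 by (auto simp: h_def)
 from gh[OF h(1)] obtain C where C: "C \<ge> 0" and CC: "\<forall>x z. \<forall>w :: real^'d => real^'n. \<forall>et.
   convex hull (insert x (cball z (ck * h))) \<subseteq> Om --> (\<forall>y\<in>convex hull (insert x (cball z (ck * h))). dist x y < h / 2) -->
   grad_bound Om p P w et -->
   (\<forall>x'\<in>convex hull (insert x (cball z (ck * h))). \<forall>y\<in>convex hull (insert x (cball z (ck * h))). norm (w x') \<le> 2 * norm (w y) + C * et)"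
  by (elim exE conjE)
 have ic': "\<exists>z. cball z (ck * h) \<subseteq> Om \<and> (\<forall>w :: real^'d => real^'n. \<forall>et. grad_bound Om p P w et --> (\<forall>y\<in>cball z (ck * h). norm (w x) \<le> 2 * norm (w y) + C * et))"
  if x: "x \<in> Om" for x
 proof -
  obtain z where z: "convex hull (insert x (cball z (ck0 * h))) \<subseteq> Om" "\<forall>w\<in>convex hull (insert x (cball z (ck0 * h))). dist x w < h / 2"
   using ic[OF x h(2)] by blast
  have "insert x (cball z (ck * h)) \<subseteq> insert x (cball z (ck0 * h))"
   using ck(2) h(1) by (intro insert_mono subset_cball mult_right_mono) auto
  then have sub: "convex hull (insert x (cball z (ck * h))) \<subseteq> convex hull (insert x (cball z (ck0 * h)))" by (rule hull_mono)
  have ins: "insert x (cball z (ck * h)) \<subseteq> convex hull (insert x (cball z (ck * h)))" by (rule hull_subset)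
  have s1: "convex hull (insert x (cball z (ck * h))) \<subseteq> Om" using sub z(1) by blast
  have s2: "\<forall>y\<in>convex hull (insert x (cball z (ck * h))). dist x y < h / 2" using sub z(2) by blast
  have "norm (w x) \<le> 2 * norm (w y) + C * et" if "grad_bound Om p P w et" "y \<in> cball z (ck * h)" for w :: "real^'d => real^'n" and et y
   using CC[rule_format, OF s1 s2[rule_format] that(1), of x y] ins that(2) by blast
  moreover have "cball z (ck * h) \<subseteq> Om" using s1 ins by blast
  ultimately show ?thesis by blast
 qed
 have "\<forall>x. \<exists>z. x \<in> Om --> cball z (ck * h) \<subseteq> Om \<and> (\<forall>w :: real^'d => real^'n. \<forall>et. grad_bound Om p P w et --> (\<forall>y\<in>cball z (ck * h). norm (w x) \<le> 2 * norm (w y) + C * et))"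
  using ic' by blast
 then obtain ze where ze: "\<And>x. x \<in> Om ==> cball (ze x) (ck * h) \<subseteq> Om"
  "\<And>x w et y. x \<in> Om ==> grad_bound Om p P (w :: real^'d => real^'n) et ==> y \<in> cball (ze x) (ck * h) ==> norm (w x) \<le> 2 * norm (w y) + C * et"
  by metis
 have kh: "ck * h > 0" using ck h by simp
 have "compact (closure Om)" using bdd by (simp add: compact_closure)
 then obtain Y where Y: "finite Y" "closure Om \<subseteq> (\<Union>y\<in>Y. ball y (ck * h / 2))"
 proof -
  assume cc: "compact (closure Om)"
  have "closure Om \<subseteq> (\<Union>y\<in>closure Om. ball y (ck * h / 2))"
  proof
   fix y assume "y \<in> closure Om"
   then show "y \<in> (\<Union>y\<in>closure Om. ball y (ck * h / 2))" using kh by (intro UN_I[of y]) simp_all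
  qed
  then obtain Y where "Y \<subseteq> closure Om" "finite Y" "closure Om \<subseteq> (\<Union>y\<in>Y. ball y (ck * h / 2))"
   by (rule compactE_image[OF cc, rotated]) auto
  then show ?thesis using that by blast
 qed
 \<comment> \<open>One reference point for each ball of the finite cover, taken among the centres
   \<open>ze x\<close> that it contains. The default x0 keeps q in the domain when there is
   none.\<close>
 define q where "q = (%y. if \<exists>x\<in>Om. ze x \<in> ball y (ck * h / 2) then ze (SOME x. x \<in> Om \<and> ze x \<in> ball y (ck * h / 2)) else x0)"
 have q: "q y \<in> Om" "(\<exists>x\<in>Om. ze x \<in> ball y (ck * h / 2)) ==> q y \<in> ball y (ck * h / 2)" for y
 proof -
  have *: "q y \<in> Om \<and> q y \<in> ball y (ck * h / 2)" if ex: "\<exists>x\<in>Om. ze x \<in> ball y (ck * h / 2)"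
  proof -
   define t where "t = (SOME x. x \<in> Om \<and> ze x \<in> ball y (ck * h / 2))"
   have t: "t \<in> Om \<and> ze t \<in> ball y (ck * h / 2)" unfolding t_def by (rule someI_ex) (use ex in blast)
   have "q y = ze t" using ex by (simp add: q_def t_def)
   moreover have "ze t \<in> cball (ze t) (ck * h)" using kh by simp
   ultimately show ?thesis using t ze(1)[of t] by auto
  qed
  then show "q y \<in> Om" using x0 by (cases "\<exists>x\<in>Om. ze x \<in> ball y (ck * h / 2)") (auto simp: q_def)
  show "q y \<in> ball y (ck * h / 2)" if "\<exists>x\<in>Om. ze x \<in> ball y (ck * h / 2)" using *[OF that] by blast
 qed
 have "\<forall>y. \<exists>D>0. \<forall>w :: real^'d => real^'n. \<forall>et. grad_bound Om p P w et --> norm (w (q y)) \<le> D * (norm (w x0) + et)"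
  using R[OF q(1)] unfolding R_def by blast
 then obtain D where D: "\<And>y. D y > 0" "\<And>y w et. grad_bound Om p P (w :: real^'d => real^'n) et ==> norm (w (q y)) \<le> D y * (norm (w x0) + et)"
  by metis
 define E where "E = (\<Sum>y\<in>Y. D y)"
 have E: "y \<in> Y ==> D y \<le> E" for y unfolding E_def using Y(1) D(1) by (intro member_le_sum) (auto simp: less_imp_le)
 have E0: "E \<ge> 0" unfolding E_def using D(1) by (intro sum_nonneg) (auto simp: less_imp_le)
 have "norm (w x) \<le> (2 * E + C + 1) * (norm (w x0) + et)" if g: "grad_bound Om p P w et" and x: "x \<in> Om" for w :: "real^'d => real^'n" and et x
 proof -
  have "ze x \<in> cball (ze x) (ck * h)" using kh by simp
  then have "ze x \<in> closure Om" using ze(1)[OF x] closure_subset by blast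
  then obtain y where y: "y \<in> Y" "ze x \<in> ball y (ck * h / 2)" using Y(2) by blast
  have "q y \<in> ball y (ck * h / 2)" using q(2)[of y] x y(2) by blast
  then have "q y \<in> cball (ze x) (ck * h)" using y(2) dist_triangle3[of "ze x" "q y" y] by simp
  then have "norm (w x) \<le> 2 * norm (w (q y)) + C * et" by (rule ze(2)[OF x g])
  also have "norm (w (q y)) \<le> E * (norm (w x0) + et)"
   using D(2)[OF g, of y] E[OF y(1)] etpos[OF g] by (intro order_trans[OF D(2)[OF g]] mult_right_mono) auto
  finally have "norm (w x) \<le> 2 * (E * (norm (w x0) + et)) + C * et" by simp
  also have "... \<le> (2 * E + C + 1) * (norm (w x0) + et)"
  proof -
   have "0 \<le> C * norm (w x0) + norm (w x0) + et" using C etpos[OF g] by (simp add: add_nonneg_nonneg less_imp_le)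
   then show ?thesis by (simp add: algebra_simps)
  qed
  finally show ?thesis .
 qed
 moreover have "2 * E + C + 1 > 0" using E0 C by simp
 ultimately show ?thesis by blast
qed

end

section \<open>Convergence of parallel sections when the fields converge in L^p\<close>

lemma indicator_restrict_measurable:
 fixes f :: "'a::euclidean_space => 'b::euclidean_space"
 assumes "open Om" "continuous_on Om f"
 shows "(%x. indicator Om x *R f x) \<in> borel_fun"
 by (rule borel_measurable_continuous_on_indicator) (use assms in auto)

lemma grad_boundI:
 assumes "et > 0" "\<forall>x\<in>Om. (w has_derivative (*v) (A x)) (at x)" "continuous_on Om A"
  "be \<in> borel_fun" "sg \<in> borel_fun" "\<forall>x. be x \<ge> 0 \<and> sg x \<ge> 0"
  "\<forall>x\<in>Om. norm (A x) \<le> be x * norm (w x) + sg x" "pint p be \<le> ennreal P" "pint p sg \<le> ennreal (et powr p)"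
 shows "grad_bound Om p P w et"
 unfolding grad_bound_def using assms by blast

context cone_domain
begin

text \<open>Stability is used twice. For the sections, with \<open>sg\<close> = 0, it gives the
  uniform bound S; for their differences, with \<open>sg\<close> = S |Bs m - Bs k|, it shows that
  they form a uniform Cauchy sequence.\<close>

lemma csol_limit:
 fixes B :: "real^'d => real^'n::finite^'d^'n"
 assumes p: "p > real CARD('d)" and conn: "connected Om" and bdd: "bounded Om" and x0: "x0 \<in> Om"
  and Bm: "B \<in> borel_fun" and Bp: "pint p B < \<infinity>"
  and Bc: "\<And>m. continuous_on Om (Bs m)" and Bl: "(%m. pint p (%x. indicator Om x *R (Bs m x - B x))) ~~> 0"
  and u: "\<And>m. csol Om (Bs m) (u m)" and ub: "\<And>m. norm (u m x0) \<le> 1" and ul: "(%m. u m x0) ~~> v"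
 shows "\<exists>w S. continuous_on Om w \<and> w x0 = v \<and> (\<forall>x\<in>Om. norm (w x) \<le> S) \<and>
   (\<forall>\<^sub>F m in sequentially. \<forall>x\<in>Om. norm (u m x) \<le> S) \<and> uniform_limit Om u w sequentially"
proof -
 have p0: "p > 0" using p by (meson of_nat_0_le_iff order_le_less_trans)
 define be where "be = (%m x. norm (indicator Om x *R Bs m x))"
 have BsM: "(%x. indicator Om x *R Bs m x) \<in> borel_fun" for m
  by (rule indicator_restrict_measurable[OF open_Om Bc])
 have bem [measurable]: "be m \<in> borel_fun" for m
  unfolding be_def by (rule measurable_compose[OF BsM borel_measurable_norm])
 have indB: "(%x. indicator Om x *R B x) \<in> borel_fun"
  using open_Om Bm by (intro borel_measurable_scaleR borel_measurable_indicator) auto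
 define D where "D = (%m x. indicator Om x *R (Bs m x - B x))"
 have Dm: "D m \<in> borel_fun" for m
  unfolding D_def scaleR_diff_right by (intro borel_measurable_diff BsM indB)
 note [measurable] = Dm Bm
 define ep where "ep = (%m. pint p (D m))"
 have epl: "ep ~~> 0" using Bl by (simp add: ep_def D_def)
 have pnorm: "pint p (%x. norm (f x)) = pint p f" for f :: "real^'d => 'z::real_normed_vector"
  by (simp add: pint_def)
 obtain b where b: "pint p B = ennreal b" "b \<ge> 0" using Bp by (cases "pint p B") auto
 \<comment> \<open>Bounds the p-th powers of all fields Bs m that are within 1 of B in the sense of
   \<open>ep\<close>.\<close>
 define P where "P = 2 powr p * (b + 1)"
 have P: "P \<ge> 0" using b by (simp add: P_def)
 have "\<forall>\<^sub>F m in sequentially. ep m < 1" using epl by (rule order_tendstoD) simp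
 then obtain m0 where m0: "\<And>m. m \<ge> m0 ==> ep m < 1" by (auto simp: eventually_sequentially)
 have beP: "pint p (be m) \<le> ennreal P" if "m \<ge> m0" for m
 proof -
  have "pint p (be m) \<le> ennreal (2 powr p) * (pint p (D m) + pint p B)"
  proof (rule pint_add_le)
   fix x
   show "norm (be m x) \<le> norm (D m x) + norm (B x)"
    using norm_triangle_ineq[of "Bs m x - B x" "B x"] by (cases "x \<in> Om") (auto simp: be_def D_def)
  qed (use p0 in auto)
  also have "... \<le> ennreal (2 powr p) * (1 + ennreal b)"
   using m0[OF that] b by (intro mult_left_mono add_mono) (auto simp: ep_def)
  also have "... = ennreal P" using b by (simp add: P_def ennreal_mult' ennreal_plus add.commute flip: ennreal_1)
  finally show ?thesis .
 qed
 obtain C where C: "C > 0" "\<And>w et x. grad_bound Om p P (w :: real^'d => real^'n) et ==> x \<in> Om ==> norm (w x) \<le> C * (norm (w x0) + et)"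
  using stability[OF p P conn bdd x0, where 'n='n] by (elim exE conjE) blast
 have ud: "(u m has_derivative (*v) (- bmul (Bs m x) (u m x))) (at x)" if "x \<in> Om" for m x
 proof -
  have "(%h. - (bmul (Bs m x) (u m x) *v h)) = (*v) (- bmul (Bs m x) (u m x))"
   by (simp add: fun_eq_iff matrix_vector_mult_def vec_eq_iff sum_negf)
  then show ?thesis using u[of m] that unfolding csol_def by metis
 qed
 have uc: "continuous_on Om (u m)" for m
  by (intro continuous_at_imp_continuous_on ballI has_derivative_continuous[OF ud])
 \<comment> \<open>From |u m x0| \<le> 1 and et = 1, since with \<open>sg\<close> = 0 any positive
   et is admissible.\<close>
 define S where "S = C * 2"
 have S0: "S > 0" using C by (simp add: S_def)
 have uS: "norm (u m x) \<le> S" if m: "m \<ge> m0" and x: "x \<in> Om" for m x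
 proof -
  have "grad_bound Om p P (u m) 1"
  proof (rule grad_boundI[where A="%x. - bmul (Bs m x) (u m x)" and be="be m" and sg="%_. 0"])
   show "\<forall>x\<in>Om. (u m has_derivative (*v) (- bmul (Bs m x) (u m x))) (at x)" using ud by blast
   show "continuous_on Om (%x. - bmul (Bs m x) (u m x))" by (intro continuous_intros continuous_on_bmul Bc uc)
   show "\<forall>x\<in>Om. norm (- bmul (Bs m x) (u m x)) \<le> be m x * norm (u m x) + 0"
    using norm_bmul_le by (auto simp: be_def)
   show "pint p (be m) \<le> ennreal P" by (rule beP[OF m])
   show "pint p (%_. 0 :: real) \<le> ennreal (1 powr p)" using p0 by (simp add: pint_def)
   show "\<forall>x. 0 \<le> be m x \<and> 0 \<le> (0::real)" by (simp add: be_def)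
  qed (auto intro: bem)
  from C(2)[OF this x] have "norm (u m x) \<le> C * (norm (u m x0) + 1)" .
  also have "... \<le> C * 2" using ub[of m] C(1) by (intro mult_left_mono) auto
  finally show ?thesis by (simp add: S_def)
 qed
 have "uniformly_Cauchy_on Om (%m. u (m + m0))"
  unfolding uniformly_Cauchy_on_def
 proof (intro allI impI)
  fix e :: real assume e: "e > 0"
  \<comment> \<open>The final bound is C times twice \<open>et\<close>, that is e/2. The tolerance
    \<open>ta\<close> is such that two field errors, with the factors from S and
    \<open>pint_add_le\<close>, give exactly et^p.\<close>
  define et where "et = e / (4 * C)"
  have et: "et > 0" using e C by (simp add: et_def)
  define ta where "ta = et powr p / (S powr p * 2 powr p * 2)"
  have ta: "ta > 0" using et S0 by (simp add: ta_def)
  have "\<forall>\<^sub>F m in sequentially. ep m < ennreal ta" using epl by (rule order_tendstoD) (use ta in simp)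
  moreover have "\<forall>\<^sub>F m in sequentially. dist (u m x0) v < et / 2" by (rule tendstoD[OF ul]) (use et in simp)
  ultimately have "\<forall>\<^sub>F m in sequentially. ep m < ennreal ta \<and> dist (u m x0) v < et / 2" by (rule eventually_conj)
  then obtain N where N: "\<And>m. m \<ge> N ==> ep m < ennreal ta \<and> dist (u m x0) v < et / 2" by (auto simp: eventually_sequentially)
  have main: "dist (u m x) (u k x) < e" if m: "m \<ge> N" "m \<ge> m0" and k: "k \<ge> N" "k \<ge> m0" and x: "x \<in> Om" for m k x
  proof -
   define w where "w = (%x. u m x - u k x)"
   define sg where "sg = (%x. S * norm (D m x - D k x))"
   have sgm [measurable]: "sg \<in> borel_fun" unfolding sg_def by measurable
   have "grad_bound Om p P w et"
   proof (rule grad_boundI[where A="%x. - bmul (Bs m x) (u m x) - - bmul (Bs k x) (u k x)" and be="be m" and sg=sg])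
    show "\<forall>x\<in>Om. (w has_derivative (*v) (- bmul (Bs m x) (u m x) - - bmul (Bs k x) (u k x))) (at x)"
    proof
     fix x assume x: "x \<in> Om"
     have "(w has_derivative (%h. (- bmul (Bs m x) (u m x)) *v h - (- bmul (Bs k x) (u k x)) *v h)) (at x)"
      unfolding w_def by (rule has_derivative_diff[OF ud[OF x] ud[OF x]])
     moreover have "(%h. (- bmul (Bs m x) (u m x)) *v h - (- bmul (Bs k x) (u k x)) *v h) = (*v) (- bmul (Bs m x) (u m x) - - bmul (Bs k x) (u k x))"
      by (rule ext) (rule matrix_vector_mult_diff_rdistrib[symmetric])
     ultimately show "(w has_derivative (*v) (- bmul (Bs m x) (u m x) - - bmul (Bs k x) (u k x))) (at x)" by simp
    qed
    show "continuous_on Om (%x. - bmul (Bs m x) (u m x) - - bmul (Bs k x) (u k x))"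
     by (intro continuous_intros continuous_on_bmul Bc uc)
    show "\<forall>x\<in>Om. norm (- bmul (Bs m x) (u m x) - - bmul (Bs k x) (u k x)) \<le> be m x * norm (w x) + sg x"
    proof
     fix x assume x: "x \<in> Om"
     have "- bmul (Bs m x) (u m x) - - bmul (Bs k x) (u k x) = - (bmul (Bs m x) (w x) + bmul (Bs m x - Bs k x) (u k x))"
      by (simp add: w_def bmul_diff_left bmul_diff_right)
     also have "norm ... \<le> norm (bmul (Bs m x) (w x)) + norm (bmul (Bs m x - Bs k x) (u k x))"
      unfolding norm_minus_cancel by (rule norm_triangle_ineq)
     also have "... \<le> norm (Bs m x) * norm (w x) + norm (Bs m x - Bs k x) * S"
      by (intro add_mono norm_bmul_le order_trans[OF norm_bmul_le] mult_left_mono uS k x) auto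
     finally show "norm (- bmul (Bs m x) (u m x) - - bmul (Bs k x) (u k x)) \<le> be m x * norm (w x) + sg x"
      using x by (simp add: be_def sg_def D_def mult.commute)
    qed
    show "pint p (be m) \<le> ennreal P" by (rule beP[OF m(2)])
    have "pint p sg \<le> ennreal (S powr p) * pint p (%x. D m x - D k x)"
     by (rule pint_scale_le) (use p0 S0 in \<open>auto simp: sg_def\<close>)
    also have "... \<le> ennreal (S powr p) * (ennreal (2 powr p) * (ep m + ep k))"
     unfolding ep_def by (intro mult_left_mono pint_add_le norm_triangle_ineq4) (use p0 in auto)
    also have "... \<le> ennreal (S powr p) * (ennreal (2 powr p) * (ennreal ta + ennreal ta))"
     using N[OF m(1)] N[OF k(1)] by (intro mult_left_mono add_mono) auto
    also have "... = ennreal (S powr p * 2 powr p * 2 * ta)"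
     using ta by (simp add: ennreal_mult'[symmetric] ennreal_plus[symmetric] algebra_simps del: ennreal_plus)
    also have "S powr p * 2 powr p * 2 * ta = et powr p" using S0 by (simp add: ta_def)
    finally show "pint p sg \<le> ennreal (et powr p)" .
    show "\<forall>x. 0 \<le> be m x \<and> 0 \<le> sg x" using S0 by (simp add: be_def sg_def)
   qed (use et in \<open>auto intro: bem sgm\<close>)
   from C(2)[OF this x] have "norm (w x) \<le> C * (norm (w x0) + et)" .
   also have "... < C * (et + et)"
   proof -
    have "norm (w x0) \<le> dist (u m x0) v + dist (u k x0) v"
     unfolding w_def by (metis dist_norm dist_triangle2)
    then have "norm (w x0) < et" using N[OF m(1)] N[OF k(1)] by linarith
    then show ?thesis using C(1) by simp
   qed
   also have "... = e / 2" using C by (simp add: et_def)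
   finally show ?thesis using e by (simp add: w_def dist_norm)
  qed
  show "\<exists>M. \<forall>x\<in>Om. \<forall>m\<ge>M. \<forall>n\<ge>M. dist (u (m + m0) x) (u (n + m0) x) < e"
   by (intro exI[of _ N] ballI allI impI main) auto
 qed
 then have "uniformly_convergent_on Om (%m. u (m + m0))" by (rule Cauchy_uniformly_convergent)
 then obtain w where w': "uniform_limit Om (%m. u (m + m0)) w sequentially"
  by (auto simp: uniformly_convergent_on_def)
 have w: "uniform_limit Om u w sequentially"
 proof (rule uniform_limitI)
  fix e :: real assume "e > 0"
  then have "\<forall>\<^sub>F m in sequentially. \<forall>x\<in>Om. dist (u (m + m0) x) (w x) < e" by (rule uniform_limitD[OF w'])
  then show "\<forall>\<^sub>F m in sequentially. \<forall>x\<in>Om. dist (u m x) (w x) < e"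
   by (rule eventually_sequentially_seg[THEN iffD1])
 qed
 have lim: "(%m. u m x) ~~> w x" if "x \<in> Om" for x by (rule tendsto_uniform_limitI[OF w that])
 have wc: "continuous_on Om w"
  by (rule uniform_limit_theorem[OF _ w]) (auto intro!: always_eventually uc)
 have ev: "\<forall>\<^sub>F m in sequentially. \<forall>x\<in>Om. norm (u m x) \<le> S"
  using uS by (auto simp: eventually_sequentially)
 have "norm (w x) \<le> S" if x: "x \<in> Om" for x
 proof (rule tendsto_upperbound[OF tendsto_norm[OF lim[OF x]]])
  show "\<forall>\<^sub>F m in sequentially. norm (u m x) \<le> S" using ev by eventually_elim (use x in blast)
 qed simp
 moreover have "w x0 = v" using LIMSEQ_unique[OF lim[OF x0] ul] .
 ultimately show ?thesis using wc ev w by blast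
qed

end

section \<open>Integration by parts against test functions\<close>

lemma integral_of_partial_eq_0:
 fixes w W :: "real^'d::finite => real"
 assumes W: "\<And>x. ((%t. w (x + t *R axis j 1)) has_real_derivative W x) (at 0)" and M: "\<And>x. \<bar>W x\<bar> \<le> M"
  and w: "integrable lborel w" and out: "\<And>x. norm x > R ==> w x = 0"
  and Wm: "W \<in> borel_fun"
 shows "(INT x. W x) = 0"
proof -
 define e where "e = (axis j 1 :: real^'d)"
 have ne: "norm e = 1" by (simp add: e_def)
 define X where "X = (%n. 1 / real (Suc n))"
 have X: "X n > 0" "X n \<le> 1" for n by (auto simp: X_def)
 have Xl: "X ~~> 0" unfolding X_def by (rule LIMSEQ_Suc[OF lim_1_over_n])
 have [measurable]: "w \<in> borel_fun" using w by auto
 have shift: "integrable lborel (%x. w (x + s *R e))" "(INT x. w (x + s *R e)) = (INT x. w x)" for s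
 proof -
  have "integrable (distr lborel borel ((+) (s *R e))) w" by (subst lborel_distr_plus) (rule w)
  then have "integrable lborel (%x. w (s *R e + x))" by (subst (asm) integrable_distr_eq) auto
  then show "integrable lborel (%x. w (x + s *R e))" by (simp add: add.commute)
  have "(INT x. w x) = (\<integral>x. w x \<partial>(distr lborel borel ((+) (s *R e))))" by (subst lborel_distr_plus) simp
  also have "... = (INT x. w (s *R e + x))" by (rule integral_distr) auto
  finally show "(INT x. w (x + s *R e)) = (INT x. w x)" by (simp add: add.commute)
 qed
 have quot: "\<bar>(w (x + t *R e) - w x) / t\<bar> \<le> M" if "t > 0" for x t
 proof -
  have dl: "((%s. w (x + s *R e)) has_real_derivative W (x + s *R e)) (at s)" for s
   by (rule has_real_derivative_line_shift[OF W[folded e_def]])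
  have "norm (w (x + t *R e) - w (x + 0 *R e)) \<le> M * norm (t - 0)"
   by (rule field_differentiable_bound[where S=UNIV and f'="%s. W (x + s *R e)"]) (use M dl in auto)
  then show ?thesis using that by (simp add: divide_le_eq)
 qed
 \<comment> \<open>Each difference quotient has integral 0 by translation invariance. They are
   bounded and vanish outside a common ball, so the integral of W is their limit.\<close>
 have "(%n. INT x. (w (x + X n *R e) - w x) / X n) ~~> (INT x. W x)"
 proof (rule integral_dominated_convergence[where w="%x. M * indicator (cball 0 (R + 1)) x"])
  show "integrable lborel (%x. M * indicator (cball (0::real^'d) (R + 1)) x)"
   using emeasure_lborel_cball_less_top[of "0::real^'d" "R + 1"]
   by (intro integrable_mult_right integrable_real_indicator) auto
  show "AE x in lborel. (%n. (w (x + X n *R e) - w x) / X n) ~~> W x"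
  proof (rule AE_I2)
   fix x
   have "((%t. (w (x + t *R e) - w (x + 0 *R e)) / (t - 0)) \<longlongrightarrow> W x) (at 0)"
    using W[of x, folded e_def] unfolding has_field_derivative_iff by simp
   then show "(%n. (w (x + X n *R e) - w x) / X n) ~~> W x"
    unfolding tendsto_at_iff_sequentially comp_def using X(1) Xl by (auto simp: less_imp_neq[symmetric])
  qed
  show "AE x in lborel. norm ((w (x + X n *R e) - w x) / X n) \<le> M * indicator (cball 0 (R + 1)) x" for n
  proof (rule AE_I2)
   fix x
   show "norm ((w (x + X n *R e) - w x) / X n) \<le> M * indicator (cball 0 (R + 1)) x"
   proof (cases "norm x \<le> R + 1")
    case True
    then show ?thesis using quot[OF X(1), of x n] by simp
   next
    case False
    have "norm x \<le> norm (x + X n *R e) + norm (X n *R e)" using norm_triangle_ineq4[of "x + X n *R e" "X n *R e"] by simp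
    then have "norm (x + X n *R e) > R" using False X[of n] ne by simp
    then show ?thesis using False out[of x] out[of "x + X n *R e"] by simp
   qed
  qed
  show "W \<in> borel_measurable lborel" using Wm by simp
  show "(%x. (w (x + X n *R e) - w x) / X n) \<in> borel_measurable lborel" for n by measurable
 qed
 moreover have "(INT x. (w (x + X n *R e) - w x) / X n) = 0" for n
  using shift[of "X n"] w by simp
 ultimately have "(%n::nat. 0::real) ~~> (INT x. W x)" by (simp only:)
 then show ?thesis by (simp add: LIMSEQ_const_iff)
qed

lemma test_funD:
 fixes ph :: "real^'d::finite => real"
 assumes "test_fun Om ph"
 shows "continuous_on UNIV ph" "continuous_on UNIV (partial j ph)"
  "((%t. ph (x + t *R axis j 1)) has_real_derivative partial j ph x) (at 0)"
  "compact (closure {x. ph x \<noteq> 0})" "closure {x. ph x \<noteq> 0} \<subseteq> Om"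
  "x \<notin> closure {x. ph x \<noteq> 0} ==> ph x = 0" "x \<notin> closure {x. ph x \<noteq> 0} ==> partial j ph x = 0"
proof -
 have sm: "smooth_on UNIV ph" using assms by (simp add: test_fun_def)
 show "continuous_on UNIV ph" using sm[unfolded smooth_on_def, rule_format, of "[]"] by simp
 show "continuous_on UNIV (partial j ph)" using sm[unfolded smooth_on_def, rule_format, of "[j]"] by simp
 show d: "((%t. ph (x + t *R axis j 1)) has_real_derivative partial j ph x) (at 0)"
  using sm[unfolded smooth_on_def, rule_format, of "[]"] unfolding partial_def
  by (simp add: DERIV_deriv_iff_real_differentiable)
 show "compact (closure {x. ph x \<noteq> 0})" "closure {x. ph x \<noteq> 0} \<subseteq> Om" using assms by (auto simp: test_fun_def)
 show "ph x = 0" if "x \<notin> closure {x. ph x \<noteq> 0}" using that closure_subset[of "{x. ph x \<noteq> 0}"] by blast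
 show "partial j ph x = 0" if x: "x \<notin> closure {x. ph x \<noteq> 0}"
 proof -
  let ?T = "(%t. x + t *R axis j 1) -` (- closure {x. ph x \<noteq> 0})"
  have "open ?T" by (intro open_vimage open_Compl closed_closure continuous_intros)
  moreover have "0 \<in> ?T" using x by simp
  moreover have "ph (x + t *R axis j 1) = 0" if "t \<in> ?T" for t
   using that closure_subset[of "{x. ph x \<noteq> 0}"] by auto
  ultimately have "\<forall>\<^sub>F t in nhds 0. ph (x + t *R axis j 1) = 0" unfolding eventually_nhds by blast
  then have "((%t. ph (x + t *R axis j 1)) has_real_derivative 0) (at 0)"
   by (subst DERIV_cong_ev[OF refl _ refl, where g="%_. 0"]) auto
  then show ?thesis using d DERIV_unique by blast
 qed
qed

lemma test_fun_bounded:
 assumes "test_fun Om (ph :: real^'d::finite => real)"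
 shows "\<exists>M\<ge>0. \<forall>x. \<bar>ph x\<bar> \<le> M \<and> \<bar>partial j ph x\<bar> \<le> M"
proof -
 obtain R where R: "\<And>x. x \<in> closure {x. ph x \<noteq> 0} ==> norm x \<le> R"
  using compact_imp_bounded[OF test_funD(4)[OF assms]] unfolding bounded_iff by blast
 have z: "ph x = 0" "partial j ph x = 0" if "norm x \<ge> R + 1" for x
  using test_funD(6,7)[OF assms, of x] R[of x] that by fastforce+
 obtain M1 where "\<And>x. \<bar>ph x\<bar> \<le> M1" "M1 \<ge> 0" using compact_support_bounded[OF test_funD(1)[OF assms] z(1)] by blast
 moreover obtain M2 where "\<And>x. \<bar>partial j ph x\<bar> \<le> M2" "M2 \<ge> 0" using compact_support_bounded[OF test_funD(2)[OF assms] z(2)] by blast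
 ultimately show ?thesis by (intro exI[of _ "max M1 M2"]) (auto simp: le_max_iff_disj)
qed

text \<open>The product of a component of u with the test function, extended by zero, has partial
  derivatives on the whole space although u solves the equation only on the domain. The integral of
  such a derivative vanishes.\<close>

lemma csol_weak:
 fixes B :: "real^'d::finite => real^'n::finite^'d^'n"
 assumes Om: "open Om" and B: "continuous_on Om B" and u: "csol Om B u" and ph: "test_fun Om ph"
 shows "(INT x. (indicator Om x *R u x) $ i * partial j ph x) = (INT x. (indicator Om x *R bmul (B x) (u x)) $ i $ j * ph x)"
proof -
 let ?K = "closure {x. ph x \<noteq> 0}"
 note t = test_funD[OF ph]
 have uc: "continuous_on Om u"
  using u unfolding csol_def by (meson continuous_at_imp_continuous_on has_derivative_continuous)
 define w where "w = (%x. if x \<in> ?K then u x $ i * ph x else 0)"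
 define W1 where "W1 = (%x. if x \<in> ?K then u x $ i * partial j ph x else 0)"
 define W2 where "W2 = (%x. if x \<in> ?K then bmul (B x) (u x) $ i $ j * ph x else 0)"
 have int: "integrable lborel (%x. if x \<in> ?K then f x else 0)" if "continuous_on ?K f" for f :: "real^'d => real"
 proof -
  have "integrable lborel (%x. indicator ?K x *R f x)" by (rule borel_integrable_compact[OF t(4) that])
  moreover have "(%x. indicator ?K x *R f x) = (%x. if x \<in> ?K then f x else 0)" by (auto simp: fun_eq_iff)
  ultimately show ?thesis by simp
 qed
 have cu: "continuous_on ?K u" "continuous_on ?K B" using uc B t(5) continuous_on_subset by blast+
 have cp: "continuous_on ?K ph" "continuous_on ?K (partial j ph)" using t(1) t(2)[of j] continuous_on_subset by blast+
 have iw: "integrable lborel w" "integrable lborel W1" "integrable lborel W2"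
  unfolding w_def W1_def W2_def by (intro int continuous_intros cu cp continuous_on_bmul)+
 have bd: "\<exists>M. \<forall>x. \<bar>if x \<in> ?K then f x else 0\<bar> \<le> M" if "continuous_on ?K f" for f :: "real^'d => real"
 proof -
  have "bounded (f ` ?K)" by (intro compact_imp_bounded compact_continuous_image that t(4))
  then obtain M where "\<forall>z\<in>f ` ?K. norm z \<le> M" unfolding bounded_iff by blast
  then show ?thesis by (intro exI[of _ "max M 0"]) (auto simp: le_max_iff_disj)
 qed
 obtain M1 M2 where M: "\<And>x. \<bar>W1 x\<bar> \<le> M1" "\<And>x. \<bar>W2 x\<bar> \<le> M2"
 proof -
  have "\<exists>M. \<forall>x. \<bar>W1 x\<bar> \<le> M" "\<exists>M. \<forall>x. \<bar>W2 x\<bar> \<le> M"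
   unfolding W1_def W2_def by (intro bd continuous_intros cu cp continuous_on_bmul)+
  then show ?thesis using that by blast
 qed
 obtain R where R: "\<And>x. x \<in> ?K ==> norm x \<le> R"
  using compact_imp_bounded[OF t(4)] unfolding bounded_iff by blast
 have "(INT x. W1 x - W2 x) = 0"
 proof (rule integral_of_partial_eq_0[where w=w and M="M1 + M2" and R=R and j=j])
  fix x
  show "\<bar>W1 x - W2 x\<bar> \<le> M1 + M2" using M(1)[of x] M(2)[of x] by linarith
  show "((%s. w (x + s *R axis j 1)) has_real_derivative W1 x - W2 x) (at 0)"
  proof (cases "x \<in> Om")
   case True
   have weq: "w y = u y $ i * ph y" for y using t(6)[of y] by (auto simp: w_def)
   have "((%s. x + s *R axis j 1) has_derivative (%s. s *R axis j 1)) (at 0)" by (auto intro!: derivative_eq_intros)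
   moreover have "(u has_derivative (%h. - (bmul (B x) (u x) *v h))) (at (x + 0 *R axis j 1))"
    using u True by (simp add: csol_def)
   ultimately have "((%s. u (x + s *R axis j 1)) has_derivative (%s. - (bmul (B x) (u x) *v (s *R axis j 1)))) (at 0)"
    by (rule has_derivative_compose)
   then have "((%s. u (x + s *R axis j 1) $ i) has_derivative (%s. (- (bmul (B x) (u x) *v (s *R axis j 1))) $ i)) (at 0)"
    by (rule bounded_linear.has_derivative[OF bounded_linear_vec_nth])
   moreover have "(%s. (- (bmul (B x) (u x) *v (s *R axis j 1))) $ i) = (*) (- bmul (B x) (u x) $ i $ j)"
    by (auto simp: fun_eq_iff matrix_vector_mult_scaleR matrix_vector_mult_basis column_def)
   ultimately have "((%s. u (x + s *R axis j 1) $ i) has_real_derivative - bmul (B x) (u x) $ i $ j) (at 0)"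
    by (simp add: has_field_derivative_def)
   from DERIV_mult[OF this t(3)[of x j]]
   have "((%s. u (x + s *R axis j 1) $ i * ph (x + s *R axis j 1)) has_real_derivative
     (u x $ i * partial j ph x - bmul (B x) (u x) $ i $ j * ph x)) (at 0)"
    by (simp add: mult.commute)
   moreover have "u x $ i * partial j ph x - bmul (B x) (u x) $ i $ j * ph x = W1 x - W2 x"
    using t(6)[of x] t(7)[of x j] by (auto simp: W1_def W2_def)
   ultimately show ?thesis by (simp add: weq)
  next
   case False
   then have x: "x \<notin> ?K" using t(5) by blast
   let ?T = "(%s. x + s *R axis j 1) -` (- ?K)"
   have "open ?T" by (intro open_vimage open_Compl closed_closure continuous_intros)
   moreover have "0 \<in> ?T" using x by simp
   moreover have "w (x + s *R axis j 1) = 0" if "s \<in> ?T" for s using that by (simp add: w_def)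
   ultimately have "\<forall>\<^sub>F s in nhds 0. w (x + s *R axis j 1) = 0" unfolding eventually_nhds by blast
   then have "((%s. w (x + s *R axis j 1)) has_real_derivative 0) (at 0)"
    by (subst DERIV_cong_ev[OF refl _ refl, where g="%_. 0"]) auto
   then show ?thesis using x by (simp add: W1_def W2_def)
  qed
  show "w x = 0" if "norm x > R" using R[of x] that by (auto simp: w_def)
 qed (use iw in auto)
 then have "(INT x. W1 x) = (INT x. W2 x)" using iw by simp
 moreover have "W1 x = (indicator Om x *R u x) $ i * partial j ph x" for x
  using t(5) t(7)[of x j] by (auto simp: W1_def indicator_def)
 moreover have "W2 x = (indicator Om x *R bmul (B x) (u x)) $ i $ j * ph x" for x
  using t(5) t(6)[of x] by (auto simp: W2_def indicator_def)
 ultimately show ?thesis by simp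
qed

section \<open>Borel representatives of functions on the domain\<close>

lemma borel_version:
 fixes f :: "'a::euclidean_space => 'b::euclidean_space"
 assumes Om: "open Om" and f: "f \<in> borel_measurable (lebesgue_on Om)"
 shows "\<exists>g. g \<in> borel_fun \<and> (\<forall>x. x \<notin> Om --> g x = 0) \<and> (AE x in lborel. x \<in> Om --> f x = g x)"
proof -
 have Omb: "Om \<in> sets borel" using Om by simp
 have "(%x. indicator Om x *R f x) \<in> borel_measurable lebesgue"
  using f Omb by (subst (asm) borel_measurable_restrict_space_iff) auto
 then have "(%x. (indicator Om x *R f x) \<bullet> b) \<in> borel_measurable lebesgue" for b
  by (intro borel_measurable_inner) auto
 then have "\<forall>b. \<exists>g. g \<in> borel_measurable lborel \<and> (AE x in lborel. (indicator Om x *R f x) \<bullet> b = g x)"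
  using completion_ex_borel_measurable_real by blast
 then obtain g where g: "\<And>b. g b \<in> borel_measurable lborel" "\<And>b. AE x in lborel. (indicator Om x *R f x) \<bullet> b = g b x"
  by metis
 have [measurable]: "g b \<in> borel_fun" for b using g(1)[of b] by simp
 define h where "h = (%x. indicator Om x *R (\<Sum>b\<in>Basis. g b x *R b))"
 have "h \<in> borel_fun"
  unfolding h_def using Omb by (intro borel_measurable_scaleR borel_measurable_indicator borel_measurable_sum) auto
 moreover have "AE x in lborel. x \<in> Om --> f x = h x"
 proof -
  have "AE x in lborel. \<forall>b\<in>Basis. (indicator Om x *R f x) \<bullet> b = g b x"
   by (rule AE_finite_allI[OF finite_Basis]) (rule g(2))
  then show ?thesis
  proof eventually_elim
   case (elim x)
   show ?case
   proof
    assume x: "x \<in> Om"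
    have "f x = (\<Sum>b\<in>Basis. (f x \<bullet> b) *R b)" by (rule euclidean_representation[symmetric])
    also have "... = h x" using elim x by (simp add: h_def)
    finally show "f x = h x" .
   qed
  qed
 qed
 ultimately show ?thesis by (intro exI[of _ h]) (auto simp: h_def)
qed

text \<open>The definitions use the restricted Lebesgue measure, the arguments Borel functions on
  the whole space that vanish off the domain; this is the dictionary between them.\<close>

lemma lebesgue_on_transfer:
 fixes f g :: "'a::euclidean_space => 'b::euclidean_space"
 assumes Om: "open Om" and g: "g \<in> borel_fun" and z: "\<And>x. x \<notin> Om ==> g x = 0"
  and eq: "AE x in lborel. x \<in> Om --> f x = g x"
 shows "f \<in> borel_measurable (lebesgue_on Om)"
  and "integrable (lebesgue_on Om) f \<longleftrightarrow> integrable lborel g"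
  and "integral\<^sup>L (lebesgue_on Om) f = integral\<^sup>L lborel g"
proof -
 have Oms: "Om \<inter> space lebesgue \<in> sets lebesgue" using Om by simp
 have gl: "g \<in> borel_measurable lborel" using g by simp
 have gm: "g \<in> borel_measurable lebesgue" using gl by (rule measurable_completion)
 have "AE x in lborel. g x = indicator Om x *R f x"
  using eq by eventually_elim (use z in \<open>auto simp: indicator_def\<close>)
 then have ae: "AE x in lebesgue. g x = indicator Om x *R f x" by (rule AE_completion)
 have fm: "(%x. indicator Om x *R f x) \<in> borel_measurable lebesgue" by (rule borel_measurable_AE[OF gm ae])
 then show "f \<in> borel_measurable (lebesgue_on Om)"
  using borel_measurable_restrict_space_iff[OF Oms, of f] by simp
 show "integrable (lebesgue_on Om) f \<longleftrightarrow> integrable lborel g"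
  unfolding integrable_restrict_space[OF Oms] integrable_completion[OF gl, symmetric]
  by (rule integrable_cong_AE[OF fm gm]) (use ae in eventually_elim, simp)
 show "integral\<^sup>L (lebesgue_on Om) f = integral\<^sup>L lborel g"
  unfolding integral_restrict_space[OF Oms] integral_completion[OF gl, symmetric]
  by (rule integral_cong_AE[OF fm gm]) (use ae in eventually_elim, simp)
qed

lemma AE_lebesgue_on_iff:
 fixes Om :: "'a::euclidean_space set"
 assumes "open Om"
 shows "(AE x in lebesgue_on Om. P x) \<longleftrightarrow> (AE x in lborel. x \<in> Om --> P x)"
 using assms by (subst AE_restrict_space_iff) (auto simp: AE_completion_iff)

lemma pint_integral:
 fixes g :: "'a::euclidean_space => 'b::euclidean_space"
 assumes "integrable lborel (%x. norm (g x) powr p)"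
 shows "pint p g = ennreal (integral\<^sup>L lborel (%x. norm (g x) powr p))"
 unfolding pint_def by (rule nn_integral_eq_integral[OF assms]) simp

lemma Lp_on_pint:
 fixes f g :: "'a::euclidean_space => 'b::euclidean_space"
 assumes Om: "open Om" and g: "g \<in> borel_fun" and z: "\<And>x. x \<notin> Om ==> g x = 0"
  and eq: "AE x in lborel. x \<in> Om --> f x = g x" and p: "p > 0"
 shows "Lp_on p Om f \<longleftrightarrow> pint p g < \<infinity>"
proof -
 have "(%x. norm (g x) powr p) \<in> borel_fun" using g by measurable
 moreover have "AE x in lborel. x \<in> Om --> norm (f x) powr p = norm (g x) powr p"
  using eq by eventually_elim simp
 ultimately have "integrable (lebesgue_on Om) (%x. norm (f x) powr p) \<longleftrightarrow> integrable lborel (%x. norm (g x) powr p)"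
  by (intro lebesgue_on_transfer(2)[OF Om]) (use z p in auto)
 also have "... \<longleftrightarrow> pint p g < \<infinity>"
  using g by (auto simp: integrable_iff_bounded pint_def)
 finally show ?thesis using lebesgue_on_transfer(1)[OF Om g z eq] by (simp add: Lp_on_def)
qed

text \<open>Integrability is settled first: a Bochner integral that does not converge is 0 by
  convention, and \<open>Lp_dist\<close> would then say nothing. A function continuous on the
  compact closure is bounded, hence in L^p of the domain.\<close>

lemma Lp_dist_pint:
 fixes f g h :: "'a::euclidean_space => 'b::euclidean_space"
 assumes Om: "open Om" "bounded Om" and g: "g \<in> borel_fun" and z: "\<And>x. x \<notin> Om ==> g x = 0"
  and eq: "AE x in lborel. x \<in> Om --> f x = g x" and p: "p > 0" and fin: "pint p g < \<infinity>" and h: "continuous_on (closure Om) h"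
 shows "pint p (%x. indicator Om x *R (h x - g x)) = ennreal ((Lp_dist p Om f h) powr p)"
proof -
 have hm: "(%x. indicator Om x *R h x) \<in> borel_fun"
  by (rule indicator_restrict_measurable[OF Om(1) continuous_on_subset[OF h closure_subset]])
 have deq: "indicator Om x *R (h x - g x) = indicator Om x *R h x - g x" for x
  using z[of x] by (cases "x \<in> Om") auto
 have dm: "(%x. indicator Om x *R (h x - g x)) \<in> borel_fun"
  unfolding deq by (intro borel_measurable_diff hm g)
 have "bounded (h ` closure Om)" using Om(2) by (intro compact_imp_bounded compact_continuous_image h) (simp add: compact_closure)
 then obtain M where "\<forall>z\<in>h ` closure Om. norm z \<le> M" unfolding bounded_iff by blast
 then have M: "norm (h x) \<le> max M 0" if "x \<in> Om" for x using that closure_subset by (force simp: le_max_iff_disj)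
 have "pint p (%x. indicator Om x *R h x) \<le> ennreal (max M 0 powr p) * emeasure lborel Om"
  by (rule pint_bounded_le) (use M Om p in \<open>auto simp: indicator_def\<close>)
 also have "... < \<infinity>" using emeasure_bounded_finite[OF Om(2)] by (simp add: ennreal_mult_less_top)
 finally have hfin: "pint p (%x. indicator Om x *R h x) < \<infinity>" .
 have "pint p (%x. indicator Om x *R (h x - g x)) \<le> ennreal (2 powr p) * (pint p (%x. indicator Om x *R h x) + pint p g)"
  unfolding deq by (rule pint_add_le[OF hm g p norm_triangle_ineq4])
 also have "... < \<infinity>" using hfin fin by (simp add: ennreal_mult_less_top)
 finally have dfin: "pint p (%x. indicator Om x *R (h x - g x)) < \<infinity>" .
 let ?N = "%x. norm (indicator Om x *R (h x - g x)) powr p"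
 have Nm: "?N \<in> borel_fun" using dm by measurable
 have Ni: "integrable lborel ?N" using Nm dfin by (simp add: integrable_iff_bounded pint_def)
 have "AE x in lborel. x \<in> Om --> norm (f x - h x) powr p = ?N x"
  using eq by eventually_elim (auto simp: norm_minus_commute)
 then have "integral\<^sup>L (lebesgue_on Om) (%x. norm (f x - h x) powr p) = integral\<^sup>L lborel ?N"
  by (intro lebesgue_on_transfer(3)[OF Om(1) Nm]) (use p in auto)
 then have "Lp_dist p Om f h powr p = integral\<^sup>L lborel ?N"
  using p by (simp add: Lp_dist_def powr_powr)
 then show ?thesis using pint_integral[OF Ni] by simp
qed

text \<open>Hoelder's inequality on a set of finite measure, in an additive form with a free
  parameter c.\<close>

lemma pint1_le:
 fixes f :: "'a::euclidean_space => 'b::euclidean_space"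
 assumes [measurable]: "f \<in> borel_fun" and S: "S \<in> sets borel" "\<And>x. x \<notin> S ==> f x = 0" and c: "c > 0" and p: "p \<ge> 1"
 shows "pint 1 f \<le> ennreal c * emeasure lborel S + ennreal (c powr (1 - p)) * pint p f"
proof -
 have yng: "t \<le> c + c powr (1 - p) * t powr p" if "t \<ge> 0" for t
 proof (cases "t \<le> c")
  case False
  have "t = t powr (1 - p) * t powr p" using False c by (simp add: powr_add[symmetric])
  also have "... \<le> c powr (1 - p) * t powr p" using False c p by (intro mult_right_mono powr_mono2') auto
  finally show ?thesis using c by linarith
 qed (use c in \<open>simp add: add_increasing2\<close>)
 have "pint 1 f \<le> (NN x. ennreal c * indicator S x + ennreal (c powr (1 - p)) * ennreal (norm (f x) powr p))"
  unfolding pint_def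
 proof (rule nn_integral_mono)
  fix x
  show "ennreal (norm (f x) powr 1) \<le> ennreal c * indicator S x + ennreal (c powr (1 - p)) * ennreal (norm (f x) powr p)"
   using yng[of "norm (f x)"] c S(2)[of x]
   by (cases "x \<in> S") (auto simp: ennreal_mult'[symmetric] ennreal_plus[symmetric] intro!: ennreal_leI simp del: ennreal_plus)
 qed
 also have "... = ennreal c * emeasure lborel S + ennreal (c powr (1 - p)) * pint p f"
 proof -
  have [measurable]: "(%x. indicator S x :: ennreal) \<in> borel_fun" using S(1) by (intro borel_measurable_indicator)
  show ?thesis
   using S(1) by (subst nn_integral_add) (auto simp: nn_integral_cmult nn_integral_cmult_indicator pint_def)
 qed
 finally show ?thesis .
qed

lemma pint1_tendsto_0:
 fixes f :: "nat => 'a::euclidean_space => 'b::euclidean_space"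
 assumes f: "\<And>m. f m \<in> borel_fun" and S: "S \<in> sets borel" "bounded S" "\<And>m x. x \<notin> S ==> f m x = 0" and p: "p \<ge> 1"
  and lim: "(%m. pint p (f m)) ~~> 0"
 shows "(%m. pint 1 (f m)) ~~> 0"
proof (rule order_tendstoI)
 fix a :: ennreal assume "0 < a"
 then obtain e :: real where e: "e > 0" "ennreal e \<le> a"
  by (metis ennreal_cases ennreal_less_zero_iff order_refl top_greatest zero_less_one)
 define V where "V = measure lborel S"
 have V: "emeasure lborel S = ennreal V" "V \<ge> 0"
  using emeasure_bounded_finite[OF S(2)] by (auto simp: V_def emeasure_eq_ennreal_measure)
 define c where "c = e / (2 * (V + 1))"
 have c: "c > 0" "c * V < e / 2" using e V by (auto simp: c_def field_simps)
 have "(%m. ennreal (c powr (1 - p)) * pint p (f m)) ~~> ennreal (c powr (1 - p)) * 0"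
  by (intro tendsto_mult_ennreal tendsto_const lim) auto
 then have "\<forall>\<^sub>F m in sequentially. ennreal (c powr (1 - p)) * pint p (f m) < ennreal (e / 2)"
  by (intro order_tendstoD(2)) (use e in auto)
 then show "\<forall>\<^sub>F m in sequentially. pint 1 (f m) < a"
 proof eventually_elim
  case (elim m)
  have "pint 1 (f m) \<le> ennreal c * emeasure lborel S + ennreal (c powr (1 - p)) * pint p (f m)"
   by (rule pint1_le[OF f S(1) S(3) c(1) p])
  also have "... < ennreal (e / 2) + ennreal (e / 2)"
   using c V e elim by (intro add_strict_mono) (auto simp: ennreal_mult'[symmetric] ennreal_lessI)
  also have "... = ennreal e" using e by (simp add: ennreal_plus[symmetric] del: ennreal_plus)
  finally show ?case using e(2) by simp
 qed
qed simp

lemma simultaneous_subsequence: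
 fixes v :: "nat => nat => 'a::euclidean_space"
 assumes "\<And>m l. l < k ==> norm (v m l) \<le> 1"
 shows "\<exists>r a. strict_mono (r :: nat => nat) \<and> (\<forall>l<k. (%m. v (r m) l) ~~> a l)"
 using assms
proof (induction k)
 case 0
 show ?case by (intro exI[of _ id]) (auto simp: strict_mono_def)
next
 case (Suc k)
 then obtain r a where r: "strict_mono r" "\<forall>l<k. (%m. v (r m) l) ~~> a l" by (metis less_Suc_eq)
 have "compact (cball (0::'a) 1)" by simp
 moreover have "\<forall>m. v (r m) k \<in> cball 0 1" using Suc.prems by simp
 ultimately obtain b s where s: "strict_mono (s :: nat => nat)" "((%m. v (r m) k) \<circ> s) ~~> b"
  using compact_def[THEN iffD1, rule_format, of "cball (0::'a) 1" "%m. v (r m) k"] by blast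
 have "(%m. v ((r \<circ> s) m) l) ~~> (a(k := b)) l" if "l < Suc k" for l
 proof (cases "l = k")
  case False
  then have "(%m. v (r m) l) ~~> a l" using r that by auto
  from LIMSEQ_subseq_LIMSEQ[OF this s(1)] show ?thesis using False by (simp add: o_def)
 qed (use s(2) in \<open>simp add: o_def\<close>)
 then show ?case using strict_mono_o[OF r(1) s(1)] by blast
qed

text \<open>The values at x0 form a subspace, so an orthonormal basis is available. It is preferred
  because orthonormality passes to limits, while mere independence does not.\<close>

lemma csol_orthonormal:
 fixes B :: "real^'d::finite => real^'n::finite^'d^'n"
 assumes "k \<le> dim {u x0 |u. csol Om B u}"
 shows "\<exists>u. \<forall>l<k. csol Om B (u l) \<and> norm (u l x0) = 1 \<and> (\<forall>l'<k. l \<noteq> l' --> u l x0 \<bullet> u l' x0 = 0)"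
proof -
 define S where "S = {u x0 |u. csol Om B u}"
 have "subspace S" unfolding S_def by (rule subspace_csol_values)
 have "\<exists>b. b \<subseteq> S \<and> pairwise orthogonal b \<and> (\<forall>x\<in>b. norm x = 1) \<and> independent b \<and> card b = dim S"
  by (rule orthonormal_basis_subspace[OF \<open>subspace S\<close>]) (intro exI conjI ballI; assumption?; simp)
 then obtain b where b: "b \<subseteq> S" "pairwise orthogonal b" "\<forall>x\<in>b. norm x = 1" "independent b" "card b = dim S"
  by (elim exE conjE)
 have kS: "k \<le> dim S" using assms by (simp add: S_def)
 have "finite b" using b(4) by (rule independent_imp_finite)
 from ex_bij_betw_nat_finite[OF this] obtain e where e: "bij_betw e {0..<card b} b" by (elim exE)
 have el: "e l \<in> b" if "l < k" for l using bij_betwE[OF e] kS b(5) that by auto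
 have "\<forall>l. \<exists>u. l < k --> csol Om B u \<and> u x0 = e l"
 proof
  fix l
  show "\<exists>u. l < k --> csol Om B u \<and> u x0 = e l"
  proof (cases "l < k")
   case True
   then have "e l \<in> S" using el b(1) by (rule_tac subsetD)
   then obtain u where "e l = u x0" "csol Om B u" unfolding S_def mem_Collect_eq by (elim exE conjE)
   then show ?thesis by (intro exI[of _ u]) simp
  qed simp
 qed
 from choice[OF this] obtain u where "\<forall>l. l < k --> csol Om B (u l) \<and> u l x0 = e l" by (elim exE)
 then have u: "\<And>l. l < k ==> csol Om B (u l) \<and> u l x0 = e l" by blast
 have "e l \<noteq> e l'" if "l < k" "l' < k" "l \<noteq> l'" for l l'
  using e that kS b(5) unfolding bij_betw_def inj_on_def by auto
 then have "e l \<bullet> e l' = 0" if "l < k" "l' < k" "l \<noteq> l'" for l l'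
  using b(2) el that unfolding pairwise_def orthogonal_def by blast
 then show ?thesis using u el b(3) by (intro exI[of _ u]) auto
qed

context cone_domain
begin

lemma weak_limit:
 fixes B :: "real^'d => real^'n::finite^'d^'n"
 assumes p: "p \<ge> 1" and bdd: "bounded Om" and Bm: "B \<in> borel_fun" and Bz: "\<And>x. x \<notin> Om ==> B x = 0" and Bp: "pint p B < \<infinity>"
  and Bc: "\<And>m. continuous_on Om (Bs m)" and Bl: "(%m. pint p (%x. indicator Om x *R (Bs m x - B x))) ~~> 0"
  and u: "\<And>m. csol Om (Bs m) (u m)" and wc: "continuous_on Om w" and wS: "\<forall>x\<in>Om. norm (w x) \<le> S"
  and uS: "\<And>m x. x \<in> Om ==> norm (u m x) \<le> S" and ul: "uniform_limit Om u w sequentially"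
  and ph: "test_fun Om ph"
 shows "(INT x. (indicator Om x *R w x) $ i * partial j ph x) = (INT x. (indicator Om x *R bmul (B x) (w x)) $ i $ j * ph x)"
proof -
 obtain M where M: "M \<ge> 0" "\<And>x. \<bar>ph x\<bar> \<le> M" "\<And>x. \<bar>partial j ph x\<bar> \<le> M" using test_fun_bounded[OF ph, of j] by blast
 have [measurable]: "ph \<in> borel_fun" "partial j ph \<in> borel_fun"
  using test_funD(1,2)[OF ph] borel_measurable_continuous_onI by blast+
 have uc: "continuous_on Om (u m)" for m
  using u[of m] unfolding csol_def by (meson continuous_at_imp_continuous_on has_derivative_continuous)
 define S' where "S' = max S 0"
 have S': "S' \<ge> 0" "\<And>m x. x \<in> Om ==> norm (u m x) \<le> S'" "\<And>x. x \<in> Om ==> norm (w x) \<le> S'"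
  using uS wS by (auto simp: S'_def le_max_iff_disj)
 define U where "U = (%m x. indicator Om x *R u m x)"
 define W where "W = (%x. indicator Om x *R w x)"
 define BB where "BB = (%m x. indicator Om x *R Bs m x)"
 have [measurable]: "U m \<in> borel_fun" "W \<in> borel_fun" "BB m \<in> borel_fun" for m
  unfolding U_def W_def BB_def by (intro indicator_restrict_measurable[OF open_Om] uc wc Bc)+
 note [measurable] = Bm borel_measurable_bmul
 have Ub: "norm (U m x) \<le> S'" "norm (W x) \<le> S'" for m x using S' by (auto simp: U_def W_def indicator_def)
 have lim: "(%m. U m x) ~~> W x" for x
  using tendsto_uniform_limitI[OF ul, of x] by (cases "x \<in> Om") (auto simp: U_def W_def)
 have cm: "(%x. f x $ i) \<in> borel_fun" if "f \<in> borel_fun" for f :: "real^'d => real^'n"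
  by (rule measurable_compose[OF that]) (intro borel_measurable_continuous_onI continuous_intros)
 have Ucm: "(%x. U m x $ i * partial j ph x) \<in> borel_measurable lborel" "(%x. W x $ i * partial j ph x) \<in> borel_measurable lborel" for m
  by (auto intro!: borel_measurable_times cm)
 have Omi: "integrable lborel (%x. c * indicator Om x)" for c :: real
  using open_Om emeasure_bounded_finite[OF bdd] by (intro integrable_mult_right integrable_real_indicator) auto
 have B1: "integrable lborel (%x. norm (B x))"
 proof -
  have "pint 1 B \<le> ennreal 1 * emeasure lborel Om + ennreal (1 powr (1 - p)) * pint p B"
   by (rule pint1_le) (use Bm Bz open_Om p in auto)
  also have "... < \<infinity>" using emeasure_bounded_finite[OF bdd] Bp by simp
  finally have "pint 1 B < \<infinity>" .
  then show ?thesis using Bm by (simp add: integrable_iff_bounded pint_def)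
 qed
 have l1: "(%m. INT x. U m x $ i * partial j ph x) ~~> (INT x. W x $ i * partial j ph x)"
 proof (rule integral_dominated_convergence[where w="%x. (S' * M) * indicator Om x"])
  show "AE x in lborel. (%m. U m x $ i * partial j ph x) ~~> W x $ i * partial j ph x"
   by (intro AE_I2 tendsto_intros lim)
  show "AE x in lborel. norm (U m x $ i * partial j ph x) \<le> (S' * M) * indicator Om x" for m
  proof (rule AE_I2)
   fix x
   have "\<bar>U m x $ i\<bar> * \<bar>partial j ph x\<bar> \<le> S' * M"
    using component_le_norm_cart[of "U m x" i] Ub(1)[of m x] M S'(1) by (intro mult_mono) auto
   then show "norm (U m x $ i * partial j ph x) \<le> (S' * M) * indicator Om x"
    by (cases "x \<in> Om") (auto simp: abs_mult U_def)
  qed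
 qed (use Omi Ucm in auto)
 \<comment> \<open>a is the true integrand, \<open>a'\<close> has B in place of the approximating
   field, and \<open>a0\<close> is the limit. From a to \<open>a'\<close> one uses L^1 convergence
   of the fields and the bound on u; from \<open>a'\<close> to \<open>a0\<close> dominated
   convergence with a multiple of |B|.\<close>
 define a where "a = (%m x. bmul (BB m x) (U m x) $ i $ j * ph x)"
 define a' where "a' = (%m x. bmul (B x) (U m x) $ i $ j * ph x)"
 define a0 where "a0 = (%x. bmul (B x) (W x) $ i $ j * ph x)"
 have nth: "\<bar>bmul b v $ i $ j\<bar> \<le> norm b * norm v" for b :: "real^'n^'d^'n" and v
  using component_le_norm_cart[of "bmul b v $ i" j] Finite_Cartesian_Product.norm_nth_le[of "bmul b v" i] norm_bmul_le[of b v]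
  by linarith
 have nthm: "(%x. bmul (f x) (g x) $ i $ j) \<in> borel_fun"
  if "f \<in> borel_fun" "g \<in> borel_fun" for f :: "real^'d => real^'n^'d^'n" and g
 proof -
  have "(%x. bmul (f x) (g x)) \<in> borel_fun" using that by (rule borel_measurable_bmul)
  moreover have "(%A::real^'d^'n. A $ i $ j) \<in> borel_fun"
   by (intro borel_measurable_continuous_onI continuous_intros)
  ultimately show ?thesis by (rule measurable_compose)
 qed
 have am[measurable]: "a m \<in> borel_fun" "a' m \<in> borel_fun" "a0 \<in> borel_fun" for m
  unfolding a_def a'_def a0_def by (intro borel_measurable_times nthm; measurable)+
 have l2: "(%m. INT x. a' m x) ~~> (INT x. a0 x)"
 proof (rule integral_dominated_convergence[where w="%x. (S' * M) * norm (B x)"])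
  show "AE x in lborel. (%m. a' m x) ~~> a0 x"
  proof (rule AE_I2)
   fix x
   have "continuous_on UNIV (%v. bmul (B x) v $ i $ j * ph x)" by (intro continuous_intros continuous_on_bmul)
   then have "isCont (%v. bmul (B x) v $ i $ j * ph x) (W x)" by (simp add: continuous_on_eq_continuous_at)
   from isCont_tendsto_compose[OF this lim[of x]] show "(%m. a' m x) ~~> a0 x" by (simp add: a'_def a0_def)
  qed
  show "AE x in lborel. norm (a' m x) \<le> (S' * M) * norm (B x)" for m
  proof (rule AE_I2)
   fix x
   have "\<bar>bmul (B x) (U m x) $ i $ j\<bar> * \<bar>ph x\<bar> \<le> (norm (B x) * S') * M"
    using M S'(1) Ub(1)[of m x] by (intro mult_mono order_trans[OF nth] mult_left_mono) auto
   then show "norm (a' m x) \<le> (S' * M) * norm (B x)" by (simp add: a'_def abs_mult mult_ac)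
  qed
  show "integrable lborel (%x. (S' * M) * norm (B x))" using B1 by simp
 qed measurable
 have aI': "integrable lborel (a' m)" for m
 proof (rule Bochner_Integration.integrable_bound)
  show "integrable lborel (%x. (S' * M) * norm (B x))" using B1 by simp
  show "AE x in lborel. norm (a' m x) \<le> norm ((S' * M) * norm (B x))"
  proof (rule AE_I2)
   fix x
   have "\<bar>bmul (B x) (U m x) $ i $ j\<bar> * \<bar>ph x\<bar> \<le> (norm (B x) * S') * M"
    using M S'(1) Ub(1)[of m x] by (intro mult_mono order_trans[OF nth] mult_left_mono) auto
   then show "norm (a' m x) \<le> norm ((S' * M) * norm (B x))" using S'(1) M(1) by (simp add: a'_def abs_mult mult_ac)
  qed
 qed (simp add: am)
 define D where "D = (%m x. indicator Om x *R (Bs m x - B x))"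
 have Deq: "D m x = BB m x - B x" for m x using Bz[of x] by (cases "x \<in> Om") (auto simp: D_def BB_def)
 have Dm: "D m \<in> borel_fun" for m
 proof -
  have "D m = (%x. BB m x - B x)" by (rule ext) (rule Deq)
  then show ?thesis by simp
 qed
 have D1: "(%m. pint 1 (D m)) ~~> 0"
  by (rule pint1_tendsto_0[where S=Om]) (use Dm open_Om bdd p Bl in \<open>auto simp: D_def\<close>)
 have diff: "ennreal \<bar>(INT x. a m x) - (INT x. a' m x)\<bar> \<le> ennreal (S' * M) * pint 1 (D m)" if fin: "pint 1 (D m) < \<infinity>" for m
 proof -
  have pt: "norm (a m x - a' m x) \<le> (S' * M) * norm (D m x)" for x
  proof -
   have "a m x - a' m x = bmul (D m x) (U m x) $ i $ j * ph x"
    by (simp add: a_def a'_def Deq bmul_diff_left algebra_simps)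
   moreover have "\<bar>bmul (D m x) (U m x) $ i $ j\<bar> * \<bar>ph x\<bar> \<le> (norm (D m x) * S') * M"
    using M S'(1) Ub(1)[of m x] by (intro mult_mono order_trans[OF nth] mult_left_mono) auto
   ultimately show ?thesis by (simp add: abs_mult mult_ac)
  qed
  have Di: "integrable lborel (%x. (S' * M) * norm (D m x))"
  proof -
   have "integrable lborel (%x. norm (D m x))" using fin Dm[of m] by (simp add: integrable_iff_bounded pint_def)
   then show ?thesis by simp
  qed
  have "integrable lborel (%x. a m x - a' m x)"
  proof (rule Bochner_Integration.integrable_bound[OF Di])
   show "AE x in lborel. norm (a m x - a' m x) \<le> norm ((S' * M) * norm (D m x))"
    using pt S'(1) M(1) by (intro AE_I2) (metis abs_ge_self order_trans real_norm_def)
  qed (simp add: am)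
  then have i1: "integrable lborel (%x. a m x - a' m x)" .
  from Bochner_Integration.integrable_add[OF this aI'[of m]] have ai: "integrable lborel (a m)" by simp
  have "ennreal \<bar>(INT x. a m x) - (INT x. a' m x)\<bar> = ennreal (norm (INT x. a m x - a' m x))"
   using ai aI'[of m] by simp
  also have "... \<le> (NN x. ennreal (norm (a m x - a' m x)))" by (rule integral_norm_bound_ennreal[OF i1])
  also have "... \<le> (NN x. ennreal (S' * M) * ennreal (norm (D m x)))"
   using pt S'(1) M(1) by (intro nn_integral_mono) (auto simp: ennreal_mult'[symmetric] intro!: ennreal_leI)
  also have "... = ennreal (S' * M) * pint 1 (D m)"
   unfolding pint_def using Dm[of m] by (subst nn_integral_cmult) auto
  finally show ?thesis .
 qed
 have l3: "(%m. (INT x. a m x) - (INT x. a' m x)) ~~> 0"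
 proof -
  have "(%m. ennreal (S' * M) * pint 1 (D m)) ~~> ennreal (S' * M) * 0"
   by (intro tendsto_mult_ennreal tendsto_const D1) auto
  then have t0: "(%m. ennreal (S' * M) * pint 1 (D m)) ~~> 0" by simp
  have "\<forall>\<^sub>F m in sequentially. pint 1 (D m) < \<infinity>" using D1 by (rule order_tendstoD) simp
  then have ev: "\<forall>\<^sub>F m in sequentially. ennreal \<bar>(INT x. a m x) - (INT x. a' m x)\<bar> \<le> ennreal (S' * M) * pint 1 (D m)"
   by eventually_elim (rule diff)
  have "(%m. ennreal \<bar>(INT x. a m x) - (INT x. a' m x)\<bar>) ~~> ennreal 0"
   by (rule tendsto_sandwich[OF _ ev tendsto_const]) (use t0 in auto)
  then have "(%m. \<bar>(INT x. a m x) - (INT x. a' m x)\<bar>) ~~> 0"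
   by (subst (asm) tendsto_ennreal_iff) auto
  then show ?thesis by (rule tendsto_rabs_zero_cancel)
 qed
 have "(%m. INT x. a m x) ~~> (INT x. a0 x)"
  using tendsto_add[OF l3 l2] by simp
 moreover have "(INT x. a m x) = (INT x. U m x $ i * partial j ph x)" for m
 proof -
  have "a m x = (indicator Om x *R bmul (Bs m x) (u m x)) $ i $ j * ph x" for x
   by (cases "x \<in> Om") (auto simp: a_def BB_def U_def bmul_zero_right)
  then show ?thesis using csol_weak[OF open_Om Bc u ph, of m i j] by (simp add: U_def)
 qed
 ultimately have "(INT x. W x $ i * partial j ph x) = (INT x. a0 x)"
  using LIMSEQ_unique l1 by simp
 moreover have "a0 x = (indicator Om x *R bmul (B x) (w x)) $ i $ j * ph x" for x
  by (cases "x \<in> Om") (auto simp: a0_def W_def bmul_zero_right)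
 ultimately show ?thesis by (simp add: W_def)
qed

end

section \<open>Kernel elements as limits of parallel sections\<close>

lemma kernelN_iff:
 fixes B B0 :: "real^'d::finite => real^'n::finite^'d^'n"
 assumes Om: "open Om"
  and B0: "B0 \<in> borel_fun" "\<And>x. x \<notin> Om ==> B0 x = 0" "AE x in lborel. x \<in> Om --> B x = B0 x"
  and mu0: "mu0 \<in> borel_fun" "\<And>x. x \<notin> Om ==> mu0 x = 0" "AE x in lborel. x \<in> Om --> mu x = mu0 x"
 shows "mu \<in> kernelN Om B \<longleftrightarrow> pint 2 mu0 < \<infinity> \<and>
  (\<forall>ph i j. test_fun Om ph --> (INT x. mu0 x $ i * partial j ph x) = (INT x. bmul (B0 x) (mu0 x) $ i $ j * ph x))"
proof -
 have Lp: "Lp_on 2 Om mu \<longleftrightarrow> pint 2 mu0 < \<infinity>" using Lp_on_pint[OF Om mu0, of 2] by simp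
 have "(- integral\<^sup>L (lebesgue_on Om) (%x. mu x $ i * partial j ph x)
    + integral\<^sup>L (lebesgue_on Om) (%x. (\<Sum>k\<in>UNIV. B x $ i $ j $ k * mu x $ k) * ph x) = 0) \<longleftrightarrow>
  (INT x. mu0 x $ i * partial j ph x) = (INT x. bmul (B0 x) (mu0 x) $ i $ j * ph x)" if ph: "test_fun Om ph" for ph i j
 proof -
  have phm: "ph \<in> borel_fun" "partial j ph \<in> borel_fun"
   using test_funD(1,2)[OF ph] borel_measurable_continuous_onI by blast+
  have c1: "(%x. mu0 x $ i) \<in> borel_fun"
   by (rule measurable_compose[OF mu0(1)]) (intro borel_measurable_continuous_onI continuous_intros)
  have c2: "(%x. bmul (B0 x) (mu0 x) $ i $ j) \<in> borel_fun"
   by (rule measurable_compose[OF borel_measurable_bmul[OF B0(1) mu0(1)]]) (intro borel_measurable_continuous_onI continuous_intros)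
  have "integral\<^sup>L (lebesgue_on Om) (%x. mu x $ i * partial j ph x) = (INT x. mu0 x $ i * partial j ph x)"
  proof (rule lebesgue_on_transfer(3)[OF Om])
   show "(%x. mu0 x $ i * partial j ph x) \<in> borel_fun" by (intro borel_measurable_times c1 phm)
   show "AE x in lborel. x \<in> Om --> mu x $ i * partial j ph x = mu0 x $ i * partial j ph x"
    using mu0(3) by eventually_elim simp
  qed (simp add: mu0(2))
  moreover have "integral\<^sup>L (lebesgue_on Om) (%x. (\<Sum>k\<in>UNIV. B x $ i $ j $ k * mu x $ k) * ph x) = (INT x. bmul (B0 x) (mu0 x) $ i $ j * ph x)"
  proof (rule lebesgue_on_transfer(3)[OF Om])
   show "(%x. bmul (B0 x) (mu0 x) $ i $ j * ph x) \<in> borel_fun" by (intro borel_measurable_times c2 phm)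
   show "AE x in lborel. x \<in> Om --> (\<Sum>k\<in>UNIV. B x $ i $ j $ k * mu x $ k) * ph x = bmul (B0 x) (mu0 x) $ i $ j * ph x"
    using mu0(3) B0(3) by eventually_elim (simp add: bmul_nth)
  qed (simp add: mu0(2) bmul_zero_right)
  ultimately show ?thesis by auto
 qed
 then show ?thesis unfolding kernelN_def mem_Collect_eq Lp by blast
qed

lemma continuous_AE_eq_0:
 fixes f :: "'a::euclidean_space => 'b::real_normed_vector"
 assumes U: "open U" and f: "continuous_on U f" and ae: "AE x in lborel. x \<in> U --> f x = 0" and x: "x \<in> U"
 shows "f x = 0"
proof (rule ccontr)
 assume nz: "f x \<noteq> 0"
 have "open (U \<inter> f -` (- {0}))" by (rule continuous_open_preimage[OF f U]) auto
 moreover have "x \<in> U \<inter> f -` (- {0})" using x nz by auto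
 ultimately obtain r where r: "r > 0" "ball x r \<subseteq> U \<inter> f -` (- {0})" using open_contains_ball by blast
 have "AE y in lborel. y \<notin> ball x r" using ae by eventually_elim (use r in auto)
 then have "ball x r \<in> null_sets lborel" by (subst (asm) AE_iff_null_sets[symmetric]) auto
 then have "emeasure lborel (ball x r) = 0" by blast
 then show False using content_ball_pos[OF r(1), of x] by (simp add: measure_def)
qed

context cone_domain
begin

lemma csol_limit_kernelN:
 fixes B B0 :: "real^'d => real^'n::finite^'d^'n"
 assumes p: "p > real CARD('d)" and conn: "connected Om" and bdd: "bounded Om" and x0: "x0 \<in> Om"
  and B0: "B0 \<in> borel_fun" "\<And>x. x \<notin> Om ==> B0 x = 0" "AE x in lborel. x \<in> Om --> B x = B0 x" and Bp: "pint p B0 < \<infinity>"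
  and Bc: "\<And>m. continuous_on Om (Bs m)" and Bl: "(%m. pint p (%x. indicator Om x *R (Bs m x - B0 x))) ~~> 0"
  and u: "\<And>m. csol Om (Bs m) (u m)" and ub: "\<And>m. norm (u m x0) \<le> 1" and ul: "(%m. u m x0) ~~> v"
 shows "\<exists>w \<in> kernelN Om B. continuous_on Om w \<and> w x0 = v"
proof -
 obtain w S where w: "continuous_on Om w" "w x0 = v" "\<forall>x\<in>Om. norm (w x) \<le> S"
   "\<forall>\<^sub>F m in sequentially. \<forall>x\<in>Om. norm (u m x) \<le> S" "uniform_limit Om u w sequentially"
  using csol_limit[OF p conn bdd x0 B0(1) Bp Bc Bl u ub ul] by (elim exE conjE)
 \<comment> \<open>The uniform bound S holds only from some index on, so the sequence is
   shifted.\<close>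
 obtain N where "\<forall>m\<ge>N. \<forall>x\<in>Om. norm (u m x) \<le> S"
  using w(4) unfolding eventually_sequentially by (elim exE)
 then have N: "norm (u (m + N) x) \<le> S" if "x \<in> Om" for m x using that by simp
 have "1 \<le> CARD('d)" by (simp add: Suc_leI)
 then have p1: "p \<ge> 1" using p by linarith
 have ul': "uniform_limit Om (%m. u (m + N)) w sequentially"
  using filterlim_compose[OF w(5) filterlim_add_const_nat_at_top[of N]] .
 have "test_fun Om ph ==> (INT x. (indicator Om x *R w x) $ i * partial j ph x) = (INT x. (indicator Om x *R bmul (B0 x) (w x)) $ i $ j * ph x)" for ph i j
  by (rule weak_limit[OF p1 bdd B0(1) B0(2) Bp Bc LIMSEQ_ignore_initial_segment[OF Bl, of N] u w(1,3) N ul'])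
 moreover have "(indicator Om x *R bmul (B0 x) (w x)) = bmul (B0 x) (indicator Om x *R w x)" for x
  by (cases "x \<in> Om") (auto simp: bmul_zero_right)
 ultimately have "\<forall>ph i j. test_fun Om ph --> (INT x. (indicator Om x *R w x) $ i * partial j ph x) = (INT x. bmul (B0 x) (indicator Om x *R w x) $ i $ j * ph x)"
  by simp
 moreover have "pint 2 (%x. indicator Om x *R w x) < \<infinity>"
 proof -
  have "norm (w x) \<le> max S 0" if "x \<in> Om" for x using w(3) that by (auto simp: le_max_iff_disj)
  then have "pint 2 (%x. indicator Om x *R w x) \<le> ennreal (max S 0 powr 2) * emeasure lborel Om"
   by (intro pint_bounded_le) (use open_Om in \<open>auto simp: indicator_def\<close>)
  also have "... < \<infinity>" using emeasure_bounded_finite[OF bdd] by (simp add: ennreal_mult_less_top)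
  finally show ?thesis .
 qed
 ultimately have "w \<in> kernelN Om B"
  by (subst kernelN_iff[OF open_Om B0, of "%x. indicator Om x *R w x"])
   (auto intro: indicator_restrict_measurable[OF open_Om w(1)])
 then show ?thesis using w(1,2) by blast
qed

lemma at_least_conservative_imp_kernelN:
 fixes B :: "real^'d => real^'n::finite^'d^'n"
 assumes p: "p > real CARD('d)" and conn: "connected Om" and bdd: "bounded Om" and ne: "Om \<noteq> {}" and B: "Lp_on p Om B"
  and k: "at_least_conservative p Om B k"
 shows "\<exists>fs. length fs = k \<and> set fs \<subseteq> kernelN Om B \<and> ae_lin_indep Om fs"
proof -
 have p0: "p > 0" using p by (meson of_nat_0_le_iff order_le_less_trans)
 obtain x0 where x0: "x0 \<in> Om" using ne by blast
 have "B \<in> borel_measurable (lebesgue_on Om)" using B by (simp add: Lp_on_def)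
 from borel_version[OF open_Om this] obtain B0 where
  "B0 \<in> borel_fun \<and> (\<forall>x. x \<notin> Om --> B0 x = 0) \<and> (AE x in lborel. x \<in> Om --> B x = B0 x)" by (elim exE)
 then have B0: "B0 \<in> borel_fun" "\<And>x. x \<notin> Om ==> B0 x = 0" "AE x in lborel. x \<in> Om --> B x = B0 x" by blast+
 have Bp: "pint p B0 < \<infinity>" using B Lp_on_pint[OF open_Om B0 p0] by simp
 have "\<forall>m::nat. \<exists>B'. continuous_on (closure Om) B' \<and> (\<exists>k'\<ge>k. k_conservative_cont Om B' k') \<and> Lp_dist p Om B B' < 1 / real (Suc m)"
  using k unfolding at_least_conservative_def by simp
 from choice[OF this] obtain Bs where Bs: "\<forall>m::nat. continuous_on (closure Om) (Bs m) \<and> (\<exists>k'\<ge>k. k_conservative_cont Om (Bs m) k') \<and> Lp_dist p Om B (Bs m) < 1 / real (Suc m)"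
  by (elim exE)
 have Bc: "continuous_on Om (Bs m)" for m using Bs continuous_on_subset closure_subset by blast
 have Bl: "(%m. pint p (%x. indicator Om x *R (Bs m x - B0 x))) ~~> 0"
 proof -
  have nn: "0 \<le> Lp_dist p Om B (Bs m)" for m by (simp add: Lp_dist_def)
  have "(%m. Lp_dist p Om B (Bs m)) ~~> 0"
  proof (rule tendsto_sandwich[OF _ _ tendsto_const])
   show "(%m. 1 / real (Suc m)) ~~> 0" by (rule LIMSEQ_Suc[OF lim_1_over_n])
   show "\<forall>\<^sub>F m in sequentially. Lp_dist p Om B (Bs m) \<le> 1 / real (Suc m)" using Bs by (intro always_eventually) (auto intro: less_imp_le)
  qed (use nn in auto)
  then have "(%m. Lp_dist p Om B (Bs m) powr p) ~~> 0 powr p"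
   by (intro tendsto_powr2[OF _ tendsto_const]) (use nn p0 in auto)
  then have "(%m. ennreal (Lp_dist p Om B (Bs m) powr p)) ~~> ennreal 0" using p0 by (intro tendsto_ennrealI) simp
  moreover have "pint p (%x. indicator Om x *R (Bs m x - B0 x)) = ennreal (Lp_dist p Om B (Bs m) powr p)" for m
   by (rule Lp_dist_pint[OF open_Om bdd B0 p0 Bp]) (use Bs in blast)+
  ultimately show ?thesis by simp
 qed
 have "\<forall>m. \<exists>u. \<forall>l<k. csol Om (Bs m) (u l) \<and> norm (u l x0) = 1 \<and> (\<forall>l'<k. l \<noteq> l' --> u l x0 \<bullet> u l' x0 = 0)"
 proof
  fix m
  have "k \<le> dim {u x0 |u. csol Om (Bs m) u}"
   using k_conservative_cont_iff[OF open_Om conn Bc x0, of k m] Bs by blast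
  then show "\<exists>u. \<forall>l<k. csol Om (Bs m) (u l) \<and> norm (u l x0) = 1 \<and> (\<forall>l'<k. l \<noteq> l' --> u l x0 \<bullet> u l' x0 = 0)"
   by (rule csol_orthonormal)
 qed
 from choice[OF this] obtain u where u0: "\<forall>m. \<forall>l<k. csol Om (Bs m) (u m l) \<and> norm (u m l x0) = 1 \<and> (\<forall>l'<k. l \<noteq> l' --> u m l x0 \<bullet> u m l' x0 = 0)"
  by (elim exE)
 then have u: "csol Om (Bs m) (u m l)" "norm (u m l x0) = 1" if "l < k" for m l using that by blast+
 have uo: "u m l x0 \<bullet> u m l' x0 = 0" if "l < k" "l' < k" "l \<noteq> l'" for m l l' using u0 that by blast
 have "\<exists>r a. strict_mono (r :: nat => nat) \<and> (\<forall>l<k. (%m. u (r m) l x0) ~~> a l)"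
  using simultaneous_subsequence[of k "%m l. u m l x0"] u(2) by simp
 then obtain r a where r: "strict_mono (r :: nat => nat)" "\<forall>l<k. (%m. u (r m) l x0) ~~> a l" by (elim exE conjE)
 have "\<forall>l. \<exists>w. l < k --> w \<in> kernelN Om B \<and> continuous_on Om w \<and> w x0 = a l"
 proof
  fix l
  show "\<exists>w. l < k --> w \<in> kernelN Om B \<and> continuous_on Om w \<and> w x0 = a l"
  proof (cases "l < k")
   case True
   have "\<exists>w \<in> kernelN Om B. continuous_on Om w \<and> w x0 = a l"
   proof (rule csol_limit_kernelN[OF p conn bdd x0 B0 Bp, where Bs="%m. Bs (r m)" and u="%m. u (r m) l"])
    show "(%m. pint p (%x. indicator Om x *R (Bs (r m) x - B0 x))) ~~> 0"
     using LIMSEQ_subseq_LIMSEQ[OF Bl r(1)] by (simp add: o_def)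
   qed (use Bc u True r(2) in auto)
   then show ?thesis by blast
  qed simp
 qed
 from choice[OF this] obtain w where "\<forall>l. l < k --> w l \<in> kernelN Om B \<and> continuous_on Om (w l) \<and> w l x0 = a l" by (elim exE)
 then have w: "w l \<in> kernelN Om B" "continuous_on Om (w l)" "w l x0 = a l" if "l < k" for l using that by blast+
 have an: "a l \<bullet> a l = 1" if l: "l < k" for l
 proof -
  have "(%m. norm (u (r m) l x0)) ~~> norm (a l)" using r(2) l by (intro tendsto_norm) auto
  then have "norm (a l) = 1" using u(2)[OF l] LIMSEQ_unique by (fastforce simp: LIMSEQ_const_iff)
  then show ?thesis by (simp add: norm_eq_1)
 qed
 have ao: "a l \<bullet> a l' = 0" if l: "l < k" "l' < k" "l \<noteq> l'" for l l'
 proof -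
  have "(%m. u (r m) l x0 \<bullet> u (r m) l' x0) ~~> a l \<bullet> a l'" using r(2) l by (intro tendsto_inner) auto
  then show ?thesis using uo[OF l] by (simp add: LIMSEQ_const_iff)
 qed
 \<comment> \<open>A combination that vanishes almost everywhere vanishes at x0 by continuity, and
   there the values are orthonormal.\<close>
 define fs where "fs = map w [0..<k]"
 have "ae_lin_indep Om fs"
  unfolding ae_lin_indep_def
 proof (intro allI impI)
  fix c :: "nat => real" and l
  assume ae: "AE x in lebesgue_on Om. (\<Sum>l<length fs. c l *R (fs ! l) x) = 0" and "l < length fs"
  then have l: "l < k" by (simp add: fs_def)
  have "AE x in lborel. x \<in> Om --> (\<Sum>l<k. c l *R w l x) = 0"
   using ae unfolding AE_lebesgue_on_iff[OF open_Om] by (simp add: fs_def)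
  moreover have "continuous_on Om (%x. \<Sum>l<k. c l *R w l x)" by (intro continuous_intros) (use w(2) in auto)
  ultimately have "(\<Sum>l<k. c l *R w l x0) = 0" by (intro continuous_AE_eq_0[OF open_Om _ _ x0])
  then have "0 = (\<Sum>l'<k. c l' *R a l') \<bullet> a l" using w(3) by simp
  also have "... = (\<Sum>l'<k. if l' = l then c l else 0)"
   unfolding inner_sum_left by (rule sum.cong) (use an ao l in auto)
  also have "... = c l" using l by simp
  finally show "c l = 0" by simp
 qed
 moreover have "set fs \<subseteq> kernelN Om B" using w(1) by (auto simp: fs_def)
 ultimately show ?thesis by (intro exI[of _ fs]) (simp add: fs_def)
qed

end

section \<open>Exact solutions near a compact set\<close>

text \<open>The tensor product of E and w, a field value that maps v to (w . v) E. When w belongs to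
  a family dual to M, adding it changes the action on one member of M only.\<close>

definition outer :: "real^'d::finite^'n::finite => real^'n => real^'n^'d^'n" where
 "outer E w = (\<chi> i j. (E $ i $ j) *R w)"

lemma bmul_outer: "bmul (outer E w) v = (w \<bullet> v) *R E"
 by (simp add: vec_eq_iff bmul_nth outer_def inner_vec_def sum_distrib_left mult_ac)

lemma norm_outer: "norm (outer E w) = norm E * norm w"
 by (simp add: outer_def norm_vec_def[of "\<chi> i j. E $ i $ j *R w"] norm_vec_def[of "\<chi> j. E $ i $ j *R w" for i]
   norm_vec_def[of E] norm_vec_def[of "E $ i" for i] L2_set_left_distrib)

lemma continuous_on_outer:
 assumes "continuous_on S f" "continuous_on S g"
 shows "continuous_on S (%x. outer (f x) (g x))"
 unfolding outer_def by (intro continuous_on_vec_lambda continuous_intros assms)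

lemma bmul_sum_left: "bmul (\<Sum>l\<in>A. f l) v = (\<Sum>l\<in>A. bmul (f l) v)"
 by (simp add: vec_eq_iff bmul_nth sum_distrib_right sum.swap[of _ A])

text \<open>N is what remains of M j after its components along the earlier M i, read off by the w
  i, are removed. Correcting N by the earlier w i makes it orthogonal to the earlier M i, and its
  product with M j becomes N . N. So \<open>w'\<close> is dual to M j, and subtracting multiples of
  it repairs the earlier w l.\<close>

lemma dual_step:
 fixes M w :: "nat => 'v::real_inner" and j :: nat
 defines "N \<equiv> M j - (\<Sum>i<j. (w i \<bullet> M j) *R M i)"
 defines "w' \<equiv> (1 / (N \<bullet> N)) *R (N - (\<Sum>i<j. (M i \<bullet> N) *R w i))"
 defines "W \<equiv> %l. if l = j then w' else w l - (w l \<bullet> M j) *R w'"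
 assumes dual: "\<And>l m. l < j ==> m < j ==> w l \<bullet> M m = (if l = m then 1 else 0)" and N: "N \<noteq> 0"
  and l: "l < Suc j" and m: "m < Suc j"
 shows "W l \<bullet> M m = (if l = m then 1 else 0)"
proof -
 have w'M: "w' \<bullet> M m = 0" if "m < j" for m
 proof -
  have "(\<Sum>i<j. (M i \<bullet> N) *R w i) \<bullet> M m = (\<Sum>i<j. if i = m then M m \<bullet> N else 0)"
   unfolding inner_sum_left by (rule sum.cong) (use dual that in auto)
  also have "... = M m \<bullet> N" using that by simp
  finally show ?thesis by (simp add: w'_def inner_diff_left inner_commute[of "M m" N])
 qed
 have "N \<bullet> N = N \<bullet> M j - (\<Sum>i<j. (w i \<bullet> M j) * (N \<bullet> M i))"
  by (subst (2) N_def) (simp add: inner_diff_right inner_sum_right)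
 also have "... = (N - (\<Sum>i<j. (M i \<bullet> N) *R w i)) \<bullet> M j"
  by (simp add: inner_diff_left inner_sum_left inner_commute[of N "M i" for i] mult.commute)
 finally have NN: "(N - (\<Sum>i<j. (M i \<bullet> N) *R w i)) \<bullet> M j = N \<bullet> N" by simp
 have "w' \<bullet> M j = 1" unfolding w'_def inner_scaleR_left NN using N by simp
 then show ?thesis using w'M dual l m by (auto simp: W_def inner_diff_left less_Suc_eq)
qed

text \<open>The bound C depends on k, ck and L only and not on the family, since it has to be fixed
  before it is known which mollifications of the kernel elements are used. The lower bound ck is a
  quantitative, triangular form of independence at every point of K.\<close>

lemma dual_family:
 fixes ck L :: real
 assumes ck: "ck > 0" and L: "L \<ge> 0"
 shows "\<exists>C\<ge>0. \<forall>K (M :: nat => 'a::topological_space => 'v::real_inner).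
  (\<forall>l<k. continuous_on K (M l)) --> (\<forall>l<k. \<forall>x\<in>K. norm (M l x) \<le> L) -->
  (\<forall>m<k. \<forall>c. \<forall>x\<in>K. ck \<le> norm (M m x - (\<Sum>i<m. c i *R M i x))) -->
  (\<exists>w. \<forall>l<k. continuous_on K (w l) \<and> (\<forall>x\<in>K. norm (w l x) \<le> C) \<and> (\<forall>m<k. \<forall>x\<in>K. w l x \<bullet> M m x = (if l = m then 1 else 0)))"
proof (induction k)
 case 0
 show ?case by (intro exI[of _ 0]) auto
next
 case (Suc j)
 then obtain C where C: "C \<ge> 0" and IH: "\<forall>K (M :: nat => 'a::topological_space => 'v::real_inner).
  (\<forall>l<j. continuous_on K (M l)) --> (\<forall>l<j. \<forall>x\<in>K. norm (M l x) \<le> L) -->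
  (\<forall>m<j. \<forall>c. \<forall>x\<in>K. ck \<le> norm (M m x - (\<Sum>i<m. c i *R M i x))) -->
  (\<exists>w. \<forall>l<j. continuous_on K (w l) \<and> (\<forall>x\<in>K. norm (w l x) \<le> C) \<and> (\<forall>m<j. \<forall>x\<in>K. w l x \<bullet> M m x = (if l = m then 1 else 0)))"
  by (elim exE conjE)
 \<comment> \<open>C1 bounds the new vector \<open>w'\<close>, using |N| \<ge> ck; \<open>C'\<close>
   also covers the earlier vectors after their correction by \<open>w'\<close>.\<close>
 define C1 where "C1 = (1 / ck) * (1 + real j * L * C)"
 have C1: "C1 \<ge> 0" using ck L C by (simp add: C1_def)
 define C' where "C' = C + (C * L + 1) * C1"
 have C': "C' \<ge> 0" "C1 \<le> C'" "C + C * L * C1 \<le> C'" using C L C1 by (auto simp: C'_def algebra_simps)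
 show ?case
 proof (intro exI[of _ C'] conjI allI impI C'(1))
  fix K and M :: "nat => 'a => 'v"
  assume M: "\<forall>l<Suc j. continuous_on K (M l)" and Mb: "\<forall>l<Suc j. \<forall>x\<in>K. norm (M l x) \<le> L"
   and Mck: "\<forall>m<Suc j. \<forall>c. \<forall>x\<in>K. ck \<le> norm (M m x - (\<Sum>i<m. c i *R M i x))"
  have "\<exists>w. \<forall>l<j. continuous_on K (w l) \<and> (\<forall>x\<in>K. norm (w l x) \<le> C) \<and> (\<forall>m<j. \<forall>x\<in>K. w l x \<bullet> M m x = (if l = m then 1 else 0))"
   by (rule IH[rule_format]) (use M Mb Mck in auto)
  then obtain w where w0: "\<forall>l<j. continuous_on K (w l) \<and> (\<forall>x\<in>K. norm (w l x) \<le> C) \<and> (\<forall>m<j. \<forall>x\<in>K. w l x \<bullet> M m x = (if l = m then 1 else 0))"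
   by (elim exE)
  then have w: "continuous_on K (w l)" "x \<in> K ==> norm (w l x) \<le> C" "x \<in> K ==> m < j ==> w l x \<bullet> M m x = (if l = m then 1 else 0)"
   if "l < j" for l m x using that by blast+
  define N where "N = (%x. M j x - (\<Sum>i<j. (w i x \<bullet> M j x) *R M i x))"
  define w' where "w' = (%x. (1 / (N x \<bullet> N x)) *R (N x - (\<Sum>i<j. (M i x \<bullet> N x) *R w i x)))"
  define W where "W = (%l x. if l = j then w' x else w l x - (w l x \<bullet> M j x) *R w' x)"
  have Nck: "ck \<le> norm (N x)" if "x \<in> K" for x
   using Mck[rule_format, OF lessI that] unfolding N_def .
  then have N0: "N x \<noteq> 0" if "x \<in> K" for x using ck that by fastforce
  have Nc: "continuous_on K N" unfolding N_def by (intro continuous_intros) (use M w in auto)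
  have w'c: "continuous_on K w'" unfolding w'_def by (intro continuous_intros Nc) (use M w N0 in auto)
  have w'b: "norm (w' x) \<le> C1" if x: "x \<in> K" for x
  proof -
   have "norm (\<Sum>i<j. (M i x \<bullet> N x) *R w i x) \<le> (\<Sum>i<j. (L * norm (N x)) * C)"
   proof (rule sum_norm_le)
    fix i assume i: "i \<in> {..<j}"
    have "\<bar>M i x \<bullet> N x\<bar> \<le> L * norm (N x)"
     by (rule order_trans[OF Cauchy_Schwarz_ineq2]) (use Mb i x in \<open>auto intro!: mult_right_mono\<close>)
    then show "norm ((M i x \<bullet> N x) *R w i x) \<le> (L * norm (N x)) * C"
     using w(2)[of i x] i x L by (auto intro!: mult_mono)
   qed
   then have "norm (N x - (\<Sum>i<j. (M i x \<bullet> N x) *R w i x)) \<le> norm (N x) * (1 + real j * L * C)"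
    using norm_triangle_ineq4[of "N x" "\<Sum>i<j. (M i x \<bullet> N x) *R w i x"] by (simp add: algebra_simps)
   then have "norm (w' x) \<le> (1 / (N x \<bullet> N x)) * (norm (N x) * (1 + real j * L * C))"
    by (simp add: w'_def divide_right_mono)
   also have "... = (1 / norm (N x)) * (1 + real j * L * C)"
    using N0[OF x] by (simp add: dot_square_norm power2_eq_square)
   also have "... \<le> C1" unfolding C1_def
    using Nck[OF x] ck L C by (intro mult_right_mono frac_le) auto
   finally show ?thesis .
  qed
  have "continuous_on K (W l) \<and> (\<forall>x\<in>K. norm (W l x) \<le> C') \<and> (\<forall>m<Suc j. \<forall>x\<in>K. W l x \<bullet> M m x = (if l = m then 1 else 0))" if l: "l < Suc j" for l
  proof (intro conjI ballI allI impI)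
   show "continuous_on K (W l)"
    unfolding W_def using l M w(1) by (cases "l = j") (auto intro!: continuous_intros w'c)
   show "norm (W l x) \<le> C'" if x: "x \<in> K" for x
   proof (cases "l = j")
    case True
    then show ?thesis using w'b[OF x] C'(2) by (simp add: W_def)
   next
    case False
    then have lj: "l < j" using l by simp
    have "\<bar>w l x \<bullet> M j x\<bar> \<le> C * L"
     by (rule order_trans[OF Cauchy_Schwarz_ineq2]) (use w(2)[OF lj x] Mb x C in \<open>auto intro!: mult_mono\<close>)
    then have "norm ((w l x \<bullet> M j x) *R w' x) \<le> (C * L) * C1" using w'b[OF x] C L by (auto intro!: mult_mono)
    then have "norm (W l x) \<le> C + C * L * C1"
     using False w(2)[OF lj x] norm_triangle_ineq4[of "w l x" "(w l x \<bullet> M j x) *R w' x"] by (simp add: W_def)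
    then show ?thesis using C'(3) by linarith
   qed
   show "W l x \<bullet> M m x = (if l = m then 1 else 0)" if "m < Suc j" "x \<in> K" for m x
    using dual_step[of j "%i. w i x" "%i. M i x" l m] w(3)[OF _ that(2)] N0[OF that(2)] l that(1)
    unfolding W_def w'_def N_def by simp
  qed
  then show "\<exists>w. \<forall>l<Suc j. continuous_on K (w l) \<and> (\<forall>x\<in>K. norm (w l x) \<le> C') \<and> (\<forall>m<Suc j. \<forall>x\<in>K. w l x \<bullet> M m x = (if l = m then 1 else 0))"
   by (intro exI[of _ W]) blast
 qed
qed

text \<open>Compactness of K alone is not enough, because the coefficients c are unbounded.
  Inductively the first j members have a bounded dual family, which recovers from any combination
  the residual N at the cost of a factor q; and N is continuous and nonzero on K.\<close>

lemma dual_lower_bound: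
 fixes M :: "nat => 'a::topological_space => 'v::real_inner"
 assumes K: "compact K" and M: "\<And>l. l < k ==> continuous_on K (M l)"
  and ind: "\<And>x c m. x \<in> K ==> m < k ==> M m x - (\<Sum>i<m. c i *R M i x) \<noteq> 0"
  and L: "\<And>l x. l < k ==> x \<in> K ==> norm (M l x) \<le> L" "L \<ge> 0"
 shows "\<exists>ck>0. \<forall>m<k. \<forall>c. \<forall>x\<in>K. ck \<le> norm (M m x - (\<Sum>i<m. c i *R M i x))"
 using M ind L(1)
proof (induction k)
 case 0
 show ?case by (intro exI[of _ 1]) auto
next
 case (Suc j)
 then have "\<exists>ck>0. \<forall>m<j. \<forall>c. \<forall>x\<in>K. ck \<le> norm (M m x - (\<Sum>i<m. c i *R M i x))" by simp
 then obtain ck where ck: "ck > 0" "\<forall>m<j. \<forall>c. \<forall>x\<in>K. ck \<le> norm (M m x - (\<Sum>i<m. c i *R M i x))" by (elim exE conjE)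
 obtain C where C: "C \<ge> 0" and IH: "\<forall>K (M :: nat => 'a::topological_space => 'v::real_inner).
  (\<forall>l<j. continuous_on K (M l)) --> (\<forall>l<j. \<forall>x\<in>K. norm (M l x) \<le> L) -->
  (\<forall>m<j. \<forall>c. \<forall>x\<in>K. ck \<le> norm (M m x - (\<Sum>i<m. c i *R M i x))) -->
  (\<exists>w. \<forall>l<j. continuous_on K (w l) \<and> (\<forall>x\<in>K. norm (w l x) \<le> C) \<and> (\<forall>m<j. \<forall>x\<in>K. w l x \<bullet> M m x = (if l = m then 1 else 0)))"
  using dual_family[OF ck(1) L(2), of j] by (elim exE conjE)
 have "\<exists>w. \<forall>l<j. continuous_on K (w l) \<and> (\<forall>x\<in>K. norm (w l x) \<le> C) \<and> (\<forall>m<j. \<forall>x\<in>K. w l x \<bullet> M m x = (if l = m then 1 else 0))"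
  by (rule IH[rule_format]) (use Suc.prems ck(2) in auto)
 then obtain w where w0: "\<forall>l<j. continuous_on K (w l) \<and> (\<forall>x\<in>K. norm (w l x) \<le> C) \<and> (\<forall>m<j. \<forall>x\<in>K. w l x \<bullet> M m x = (if l = m then 1 else 0))"
  by (elim exE)
 then have w: "continuous_on K (w l)" "x \<in> K ==> norm (w l x) \<le> C" "x \<in> K ==> m < j ==> w l x \<bullet> M m x = (if l = m then 1 else 0)"
  if "l < j" for l m x using that by blast+
 define N where "N = (%x. M j x - (\<Sum>i<j. (w i x \<bullet> M j x) *R M i x))"
 have Nc: "continuous_on K N" unfolding N_def by (intro continuous_intros) (use Suc.prems(1) w in auto)
 have N0: "N x \<noteq> 0" if "x \<in> K" for x unfolding N_def by (rule Suc.prems(2)[OF that lessI])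
 have "\<exists>nu>0. \<forall>x\<in>K. nu \<le> norm (N x)"
 proof (cases "K = {}")
  case False
  have "continuous_on K (%x. norm (N x))" by (intro continuous_intros Nc)
  from continuous_attains_inf[OF K False this] obtain x where "x \<in> K" "\<forall>y\<in>K. norm (N x) \<le> norm (N y)" by blast
  then show ?thesis using N0 by (intro exI[of _ "norm (N x)"]) auto
 qed (auto intro: exI[of _ 1])
 then obtain nu where nu: "nu > 0" "\<forall>x\<in>K. nu \<le> norm (N x)" by blast
 define q where "q = 1 + real j * C * L"
 have q: "q > 0" using C L(2) by (simp add: q_def add_pos_nonneg)
 have main: "nu / q \<le> norm (M j x - (\<Sum>i<j. c i *R M i x))" if x: "x \<in> K" for c x
 proof -
  define s where "s = M j x - (\<Sum>i<j. c i *R M i x)"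
  have ws: "w i x \<bullet> s = w i x \<bullet> M j x - c i" if i: "i < j" for i
  proof -
   have "w i x \<bullet> (\<Sum>m<j. c m *R M m x) = (\<Sum>m<j. if m = i then c i else 0)"
    unfolding inner_sum_right by (rule sum.cong) (use w(3)[OF i x] in auto)
   then show ?thesis using i by (simp add: s_def inner_diff_right)
  qed
  have "N x = s - (\<Sum>i<j. (w i x \<bullet> s) *R M i x)"
  proof -
   have "(\<Sum>i<j. (w i x \<bullet> s) *R M i x) = (\<Sum>i<j. (w i x \<bullet> M j x) *R M i x) - (\<Sum>i<j. c i *R M i x)"
    unfolding sum_subtractf[symmetric] by (rule sum.cong) (auto simp: ws scaleR_diff_left)
   then show ?thesis by (simp add: N_def s_def)
  qed
  moreover have "norm (\<Sum>i<j. (w i x \<bullet> s) *R M i x) \<le> (\<Sum>i<j. (C * norm s) * L)"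
  proof (rule sum_norm_le)
   fix i assume i: "i \<in> {..<j}"
   have "\<bar>w i x \<bullet> s\<bar> \<le> C * norm s"
    by (rule order_trans[OF Cauchy_Schwarz_ineq2]) (use w(2)[of i x] i x in \<open>auto intro!: mult_right_mono\<close>)
   then show "norm ((w i x \<bullet> s) *R M i x) \<le> (C * norm s) * L"
    using Suc.prems(3)[of i x] i x C by (auto intro!: mult_mono)
  qed
  ultimately have "norm (N x) \<le> norm s + real j * (C * norm s * L)"
   using norm_triangle_ineq4[of s "\<Sum>i<j. (w i x \<bullet> s) *R M i x"] by simp
  then have "nu \<le> norm s * q" using nu(2) x by (fastforce simp: q_def algebra_simps)
  then show ?thesis using q by (simp add: s_def field_simps)
 qed
 show ?case
 proof (intro exI[of _ "min ck (nu / q)"] conjI allI impI ballI)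
  show "min ck (nu / q) > 0" using ck nu q by simp
  fix m c x assume "m < Suc j" "x \<in> K"
  then show "min ck (nu / q) \<le> norm (M m x - (\<Sum>i<m. c i *R M i x))"
   using ck(2) main[of x c] by (cases "m = j") (auto simp: min_le_iff_disj)
 qed
qed

lemma triangular_sum:
 fixes M :: "nat => 'v::real_vector"
 assumes "m < k"
 shows "M m - (\<Sum>i<m. c i *R M i) = (\<Sum>l<k. (if l = m then 1 else if l < m then - c l else 0) *R M l)"
  (is "_ = (\<Sum>l<k. ?d l *R M l)")
proof -
 have "(\<Sum>l<k. ?d l *R M l) = (\<Sum>l<Suc m. ?d l *R M l)"
  using assms by (intro sum.mono_neutral_right) auto
 also have "... = (\<Sum>l<m. - (c l *R M l)) + M m"
 proof -
  have "(\<Sum>l<m. ?d l *R M l) = (\<Sum>l<m. - (c l *R M l))" by (rule sum.cong) auto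
  then show ?thesis by simp
 qed
 finally show ?thesis by (simp add: sum_negf)
qed

text \<open>Carries the lower bound over to nearby families. Pairing a combination with the dual
  vector of its largest coefficient, which is at least 1, gives that coefficient up to an error of
  at most half of it.\<close>

lemma dual_perturb:
 fixes M M' w :: "nat => 'v::real_inner"
 assumes dual: "\<And>l m. l < k ==> m < k ==> w l \<bullet> M m = (if l = m then 1 else 0)"
  and C: "\<And>l. l < k ==> norm (w l) \<le> C" "C > 0" and dt: "\<And>l. l < k ==> norm (M' l - M l) \<le> dt" "real k * (C * dt) \<le> 1 / 2"
  and m: "m < k"
 shows "1 / (2 * C) \<le> norm (M' m - (\<Sum>i<m. c i *R M' i))"
proof -
 define d where "d = (%l. if l = m then 1 else if l < m then - c l else 0)"
 define s where "s = M' m - (\<Sum>i<m. c i *R M' i)"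
 have sd: "s = (\<Sum>l<k. d l *R M' l)" unfolding s_def d_def by (rule triangular_sum[OF m])
 define mx where "mx = Max ((%l. \<bar>d l\<bar>) ` {..<k})"
 have fin: "finite ((%l. \<bar>d l\<bar>) ` {..<k})" "(%l. \<bar>d l\<bar>) ` {..<k} \<noteq> {}" using m by auto
 obtain l where l: "l < k" "\<bar>d l\<bar> = mx" using Max_in[OF fin] by (auto simp: mx_def)
 have mxge: "\<bar>d i\<bar> \<le> mx" if "i < k" for i unfolding mx_def using fin that by (intro Max_ge) auto
 have mx1: "mx \<ge> 1" using mxge[OF m] by (simp add: d_def)
 have "w l \<bullet> s = (\<Sum>i<k. d i * (w l \<bullet> M i)) + (\<Sum>i<k. d i * (w l \<bullet> (M' i - M i)))"
  unfolding sd inner_sum_right sum.distrib[symmetric] by (simp add: inner_diff_right algebra_simps)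
 moreover have "(\<Sum>i<k. d i * (w l \<bullet> M i)) = d l"
 proof -
  have "(\<Sum>i<k. d i * (w l \<bullet> M i)) = (\<Sum>i<k. if i = l then d l else 0)" by (rule sum.cong) (use dual l in auto)
  then show ?thesis using l by simp
 qed
 moreover have "\<bar>\<Sum>i<k. d i * (w l \<bullet> (M' i - M i))\<bar> \<le> (\<Sum>i<k. mx * (C * dt))"
 proof (rule order_trans[OF sum_abs], rule sum_mono)
  fix i assume i: "i \<in> {..<k}"
  have "\<bar>w l \<bullet> (M' i - M i)\<bar> \<le> C * dt"
   by (rule order_trans[OF Cauchy_Schwarz_ineq2]) (use C dt(1) l i in \<open>auto intro!: mult_mono\<close>)
  then show "\<bar>d i * (w l \<bullet> (M' i - M i))\<bar> \<le> mx * (C * dt)"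
   using mxge i mx1 by (auto simp: abs_mult intro!: mult_mono)
 qed
 moreover have "(\<Sum>i<k. mx * (C * dt)) \<le> mx * (1 / 2)"
  using mult_left_mono[OF dt(2), of mx] mx1 by (simp add: algebra_simps)
 ultimately have "\<bar>w l \<bullet> s\<bar> \<ge> 1 / 2" using l(2) mx1 by linarith
 moreover have "\<bar>w l \<bullet> s\<bar> \<le> C * norm s"
  by (rule order_trans[OF Cauchy_Schwarz_ineq2]) (use C l in \<open>auto intro!: mult_right_mono\<close>)
 ultimately show ?thesis using C(2) by (simp add: s_def field_simps)
qed

abbreviation wsol :: "(real^'d::finite) set => (real^'d => real^'n::finite^'d^'n) => real => real => (real^'d => real^'n) => bool" where
 "wsol Om B p R f \<equiv> weak_solution Om f (%x. - bmul (B x) (f x)) (%x. norm (B x)) p R"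

section \<open>Kernel elements as weak solutions, independent at every point\<close>

lemma integrable_mult_bounded:
 fixes f ph :: "'a::euclidean_space => real"
 assumes f: "integrable lborel f" and ph: "ph \<in> borel_fun" "\<And>x. \<bar>ph x\<bar> \<le> M"
 shows "integrable lborel (%x. f x * ph x)"
proof (rule Bochner_Integration.integrable_bound)
 show "integrable lborel (%x. M * norm (f x))" using f by simp
 have "M \<ge> 0" using ph(2) abs_ge_zero order_trans by blast
 show "AE x in lborel. norm (f x * ph x) \<le> norm (M * norm (f x))"
 proof (rule AE_I2)
  fix x
  have "\<bar>f x\<bar> * \<bar>ph x\<bar> \<le> \<bar>f x\<bar> * M" by (rule mult_left_mono[OF ph(2)]) simp
  then show "norm (f x * ph x) \<le> norm (M * norm (f x))" using \<open>M \<ge> 0\<close> by (simp add: abs_mult mult.commute)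
 qed
 show "(%x. f x * ph x) \<in> borel_measurable lborel" using f ph(1) by (intro borel_measurable_times) auto
qed

lemma integrable_nth: "integrable M f ==> integrable M (%x. f x $ i)" for f :: "'a => 'b::{banach,second_countable_topology,euclidean_space}^'n::finite"
 using integrable_bounded_linear[OF bounded_linear_vec_nth] by blast

lemma kernel_weak_solution:
 fixes B :: "real^'d::finite => real^'n::finite^'d^'n"
 assumes Om: "open Om" "Om \<subseteq> cball 0 R" and B: "B \<in> borel_fun" "pint p B < \<infinity>"
  and p: "p > real CARD('d)" "p \<ge> 2"
  and mu: "mu \<in> borel_fun" "\<And>x. x \<notin> Om ==> mu x = 0" "pint 2 mu < \<infinity>"
  and weak: "\<And>ph i j. test_fun Om ph ==> (INT x. mu x $ i * partial j ph x) = (INT x. bmul (B x) (mu x) $ i $ j * ph x)"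
 shows "wsol Om B p R mu"
proof
 have S: "Om \<in> sets borel" using Om(1) by simp
 have fin: "emeasure lborel Om < \<infinity>" using bounded_subset[OF bounded_cball Om(2)] by (rule emeasure_bounded_finite)
 note [measurable] = B(1) mu(1)
 have gm: "(%x. - bmul (B x) (mu x)) \<in> borel_fun"
  using borel_measurable_bmul[OF B(1) mu(1)] by simp
 show "open Om" by (rule Om(1))
 have "pint 1 mu \<le> ennreal 1 * emeasure lborel Om + ennreal (1 powr (1 - 2)) * pint 2 mu"
  by (rule pint1_le[OF mu(1) S mu(2)]) auto
 also have "... < \<infinity>" using fin mu(3) by simp
 finally show "integrable lborel mu" using mu(1) by (simp add: integrable_iff_bounded pint_def)
 \<comment> \<open>mu is only in L^2, so |B| |mu| is integrable because p \<ge> 2 places |B| in L^2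
   of the bounded domain; the indicator pays for the region where |B| \<le> 1.\<close>
 have pt: "ennreal (norm (B x) * norm (mu x)) \<le> indicator Om x + (ennreal (norm (B x) powr p) + ennreal (norm (mu x) powr 2))" for x
 proof (cases "x \<in> Om")
  case True
  define b m where "b = norm (B x)" and "m = norm (mu x)"
  have "b * m \<le> b\<^sup>2 + m\<^sup>2"
  proof -
   have "0 \<le> (b - m)\<^sup>2 + b\<^sup>2 + m\<^sup>2" by simp
   then show ?thesis by (simp add: power2_eq_square algebra_simps)
  qed
  moreover have "b\<^sup>2 \<le> 1 + b powr p"
  proof (cases "b \<le> 1")
   case True
   then have "b\<^sup>2 \<le> 1" by (simp add: b_def power_le_one)
   then show ?thesis by (simp add: add_increasing2)
  next
   case False
   then have "b powr 2 \<le> b powr p" using p(2) by (intro powr_mono) auto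
   then show ?thesis using False by (simp add: powr_numeral)
  qed
  moreover have "m\<^sup>2 = m powr 2" using norm_ge_zero[of "mu x"] by (cases "m = 0") (auto simp: m_def powr_numeral)
  ultimately have "b * m \<le> 1 + (b powr p + m powr 2)" by linarith
  then have "ennreal (b * m) \<le> ennreal (1 + (b powr p + m powr 2))" by (rule ennreal_leI)
  also have "... = 1 + (ennreal (b powr p) + ennreal (m powr 2))" by simp
  finally show ?thesis using True by (simp add: b_def m_def)
 qed (simp add: mu(2))
 have "(NN x. ennreal (norm (B x) * norm (mu x))) \<le>
   (NN x. indicator Om x + (ennreal (norm (B x) powr p) + ennreal (norm (mu x) powr 2)))"
  by (intro nn_integral_mono pt)
 also have "... = emeasure lborel Om + (pint p B + pint 2 mu)"
 proof -
  have [measurable]: "(%x. indicator Om x :: ennreal) \<in> borel_fun" using S by (intro borel_measurable_indicator)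
  show ?thesis using S by (subst nn_integral_add) (auto simp: nn_integral_add pint_def)
 qed
 also have "... < \<infinity>" using fin B(2) mu(3) by simp
 finally show bf: "(NN x. ennreal (norm (B x) * norm (mu x))) < \<infinity>" .
 have "(NN x. ennreal (norm (- bmul (B x) (mu x)))) \<le> (NN x. ennreal (norm (B x) * norm (mu x)))"
  by (intro nn_integral_mono ennreal_leI) (simp add: norm_bmul_le)
 also have "... < \<infinity>" by (rule bf)
 finally show "integrable lborel (%x. - bmul (B x) (mu x))" using gm by (simp add: integrable_iff_bounded)
 have out: "mu x = 0" if "norm x > R" for x using Om(2) that by (intro mu(2)) auto
 show "norm x > R ==> mu x = 0" for x by (rule out)
 show "norm x > R ==> - bmul (B x) (mu x) = 0" for x using out by (simp add: bmul_zero_right)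
 show "weak_grad Om mu (%x. - bmul (B x) (mu x))" unfolding weak_grad_def using weak by simp
 show "(%x. norm (B x)) \<in> borel_fun" by measurable
 show "norm (- bmul (B x) (mu x)) \<le> norm (B x) * norm (mu x)" for x by (simp add: norm_bmul_le)
 show "pint p (%x. norm (B x)) < \<infinity>" using B(2) by (simp add: pint_def)
 show "p > real CARD('d)" by (rule p(1))
qed simp

lemma weak_solution_add_scale:
 fixes B :: "real^'d::finite => real^'n::finite^'d^'n"
 assumes f1: "wsol Om B p R f1" and f2: "wsol Om B p R f2"
 shows "wsol Om B p R (%x. f1 x + c *R f2 x)"
proof -
 interpret s1: weak_solution Om f1 "%x. - bmul (B x) (f1 x)" "%x. norm (B x)" p R by (rule f1)
 interpret s2: weak_solution Om f2 "%x. - bmul (B x) (f2 x)" "%x. norm (B x)" p R by (rule f2)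
 have ge: "- bmul (B x) (f1 x + c *R f2 x) = - bmul (B x) (f1 x) + c *R (- bmul (B x) (f2 x))" for x
  by (simp add: bmul_add_right bmul_scaleR_right)
 have "integrable lborel (%x. - bmul (B x) (f1 x) + c *R (- bmul (B x) (f2 x)))"
  by (intro Bochner_Integration.integrable_add integrable_scaleR_right s1.g_int s2.g_int)
 then have gi: "integrable lborel (%x. - bmul (B x) (f1 x + c *R f2 x))" unfolding ge .
 show ?thesis
 proof
  show "integrable lborel (%x. f1 x + c *R f2 x)"
   by (intro Bochner_Integration.integrable_add integrable_scaleR_right s1.f_int s2.f_int)
  show "norm x > R ==> f1 x + c *R f2 x = 0" for x using s1.f_out s2.f_out by simp
  then show "norm x > R ==> - bmul (B x) (f1 x + c *R f2 x) = 0" for x by (simp add: bmul_zero_right)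
  have "(NN x. ennreal (norm (B x) * norm (f1 x + c *R f2 x)))
    \<le> (NN x. ennreal (norm (B x) * norm (f1 x)) + ennreal \<bar>c\<bar> * ennreal (norm (B x) * norm (f2 x)))"
  proof (rule nn_integral_mono)
   fix x
   have "norm (B x) * norm (f1 x + c *R f2 x) \<le> norm (B x) * (norm (f1 x) + \<bar>c\<bar> * norm (f2 x))"
    using norm_triangle_ineq[of "f1 x" "c *R f2 x"] by (intro mult_left_mono) auto
   then have "ennreal (norm (B x) * norm (f1 x + c *R f2 x)) \<le> ennreal (norm (B x) * norm (f1 x) + \<bar>c\<bar> * (norm (B x) * norm (f2 x)))"
    by (intro ennreal_leI) (simp add: algebra_simps)
   also have "... = ennreal (norm (B x) * norm (f1 x)) + ennreal \<bar>c\<bar> * ennreal (norm (B x) * norm (f2 x))"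
    by (subst ennreal_plus) (auto simp: ennreal_mult'[symmetric])
   finally show "ennreal (norm (B x) * norm (f1 x + c *R f2 x)) \<le> ennreal (norm (B x) * norm (f1 x)) + ennreal \<bar>c\<bar> * ennreal (norm (B x) * norm (f2 x))" .
  qed
  also have "... = (NN x. ennreal (norm (B x) * norm (f1 x))) + ennreal \<bar>c\<bar> * (NN x. ennreal (norm (B x) * norm (f2 x)))"
  proof -
   have "(%x. ennreal (norm (B x) * norm (f1 x))) \<in> borel_measurable lborel" "(%x. ennreal (norm (B x) * norm (f2 x))) \<in> borel_measurable lborel"
    using s1.b_meas s1.fg_meas(1) s2.fg_meas(1) by measurable
   then show ?thesis by (simp add: nn_integral_add nn_integral_cmult)
  qed
  also have "... < \<infinity>" using s1.bf_int s2.bf_int by (simp add: ennreal_mult_less_top)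
  finally show "(NN x. ennreal (norm (B x) * norm (f1 x + c *R f2 x))) < \<infinity>" .
  show "weak_grad Om (%x. f1 x + c *R f2 x) (%x. - bmul (B x) (f1 x + c *R f2 x))"
   unfolding weak_grad_def
  proof (intro allI impI)
   fix ph i j assume ph: "test_fun Om ph"
   have phm: "ph \<in> borel_fun" "partial j ph \<in> borel_fun"
    using test_funD(1,2)[OF ph] borel_measurable_continuous_onI by blast+
   obtain M where M: "M \<ge> 0" "\<And>x. \<bar>ph x\<bar> \<le> M" "\<And>x. \<bar>partial j ph x\<bar> \<le> M" using test_fun_bounded[OF ph, of j] by blast
   have i1: "integrable lborel (%x. f1 x $ i * partial j ph x)" "integrable lborel (%x. f2 x $ i * partial j ph x)"
    by (rule integrable_mult_bounded[OF integrable_nth phm(2) M(3)], rule s1.f_int s2.f_int)+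
   have i2: "integrable lborel (%x. (- bmul (B x) (f1 x)) $ i $ j * ph x)" "integrable lborel (%x. (- bmul (B x) (f2 x)) $ i $ j * ph x)"
    by (rule integrable_mult_bounded[OF integrable_nth[OF integrable_nth] phm(1) M(2)], rule s1.g_int s2.g_int)+
   have "(INT x. (f1 x + c *R f2 x) $ i * partial j ph x) = (INT x. f1 x $ i * partial j ph x + c * (f2 x $ i * partial j ph x))"
    by (simp add: algebra_simps)
   also have "... = (INT x. f1 x $ i * partial j ph x) + c * (INT x. f2 x $ i * partial j ph x)"
    using i1 by simp
   also have "... = - (INT x. (- bmul (B x) (f1 x)) $ i $ j * ph x) + c * (- (INT x. (- bmul (B x) (f2 x)) $ i $ j * ph x))"
    unfolding s1.weak[unfolded weak_grad_def, rule_format, OF ph] s2.weak[unfolded weak_grad_def, rule_format, OF ph] ..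
   also have "... = - (INT x. (- bmul (B x) (f1 x)) $ i $ j * ph x + c * ((- bmul (B x) (f2 x)) $ i $ j * ph x))"
    using i2 by (subst Bochner_Integration.integral_add) (auto simp del: vector_uminus_component)
   also have "... = - (INT x. (- bmul (B x) (f1 x + c *R f2 x)) $ i $ j * ph x)"
    unfolding ge by (simp add: algebra_simps)
   finally show "(INT x. (f1 x + c *R f2 x) $ i * partial j ph x) = - (INT x. (- bmul (B x) (f1 x + c *R f2 x)) $ i $ j * ph x)" .
  qed
  show "norm (- bmul (B x) (f1 x + c *R f2 x)) \<le> norm (B x) * norm (f1 x + c *R f2 x)" for x by (simp add: norm_bmul_le)
 qed (rule gi s1.openU s1.b_meas s1.b_nonneg s1.b_Lp s1.p_gt)+
qed

lemma weak_solution_sum: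
 fixes k :: nat
 assumes "wsol Om B p R (%_. 0)" "\<And>l. l < k ==> wsol Om B p R (mu l)"
 shows "wsol Om B p R (%x. \<Sum>l<k. c l *R mu l x)"
 using assms(2)
proof (induction k)
 case (Suc k)
 have "wsol Om B p R (%x. (\<Sum>l<k. c l *R mu l x) + c k *R mu k x)"
  by (intro weak_solution_add_scale Suc) auto
 then show ?case by simp
qed (simp add: assms(1))

text \<open>A linear combination of weak solutions is again one. If its continuous representative
  vanishes at a point, unique continuation makes it vanish everywhere, and independence almost
  everywhere applies.\<close>

lemma kernel_pointwise_independent:
 fixes B :: "real^'d::finite => real^'n::finite^'d^'n" and k :: nat
 assumes conn: "connected Om" and z: "wsol Om B p R (%_. 0)" and mu: "\<And>l. l < k ==> wsol Om B p R (mu l)"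
  and ind: "\<And>c l. AE x in lborel. x \<in> Om --> (\<Sum>l<k. c l *R mu l x) = 0 ==> l < k ==> c l = (0::real)"
  and x: "x \<in> Om" "(\<Sum>l<k. c l *R weak_solution.Fl (mu l) x) = 0" and l: "l < k"
 shows "c l = 0"
proof (rule ind[OF _ l])
 define f where "f = (%x. \<Sum>l<k. c l *R mu l x)"
 have "wsol Om B p R f" unfolding f_def
  by (rule weak_solution_sum[OF z mu])
 then interpret s: weak_solution Om f "%x. - bmul (B x) (f x)" "%x. norm (B x)" p R .
 have fl: "AE y in lborel. \<forall>l\<in>{..<k}. y \<in> Om --> mu l y = weak_solution.Fl (mu l) y"
  by (rule AE_finite_allI[OF finite_lessThan]) (use weak_solution.f_eq_Fl[OF mu] in auto)
 have "AE y in lborel. y \<in> Om --> s.Fl y - (\<Sum>l<k. c l *R weak_solution.Fl (mu l) y) = 0"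
  using fl s.f_eq_Fl
 proof eventually_elim
  case (elim y)
  then show ?case by (auto simp: f_def intro!: sum.cong)
 qed
 moreover have "continuous_on Om (%y. s.Fl y - (\<Sum>l<k. c l *R weak_solution.Fl (mu l) y))"
  by (intro continuous_intros s.Fl_cont) (use weak_solution.Fl_cont[OF mu] in auto)
 ultimately have "s.Fl x - (\<Sum>l<k. c l *R weak_solution.Fl (mu l) x) = 0"
  using x(1) by (intro continuous_AE_eq_0[OF s.openU])
 then have "s.Fl x = 0" using x(2) by simp
 then have "s.Fl y = 0" if "y \<in> Om" for y using s.Fl_unique_continuation[OF conn x(1) _ that] by simp
 then show "AE x in lborel. x \<in> Om --> (\<Sum>l<k. c l *R mu l x) = 0"
  using s.f_eq_Fl by (auto simp: f_def)
qed

lemma pint_sum_tendsto_0: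
 fixes f :: "nat => nat => 'a::euclidean_space => 'b::euclidean_space"
 assumes "\<And>l n. l < k ==> f l n \<in> borel_fun" "\<And>l. l < k ==> (%n. pint p (f l n)) ~~> 0" and p: "p > 0"
 shows "(%n. pint p (%x. \<Sum>l<k. f l n x)) ~~> 0"
 using assms(1,2)
proof (induction k)
 case 0
 have "pint p (%x::'a. 0::'b) = 0" using p by (simp add: pint_def)
 then show ?case by simp
next
 case (Suc k)
 have le: "pint p (%x. \<Sum>l<Suc k. f l n x) \<le> ennreal (2 powr p) * (pint p (%x. \<Sum>l<k. f l n x) + pint p (f k n))" for n
  by (rule pint_add_le[OF _ _ p]) (use Suc.prems(1) in \<open>auto intro: norm_triangle_ineq\<close>)
 have "(%n. ennreal (2 powr p) * (pint p (%x. \<Sum>l<k. f l n x) + pint p (f k n))) ~~> ennreal (2 powr p) * (0 + 0)"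
  by (intro tendsto_mult_ennreal tendsto_const tendsto_add Suc) (use Suc.prems in auto)
 then have t: "(%n. ennreal (2 powr p) * (pint p (%x. \<Sum>l<k. f l n x) + pint p (f k n))) ~~> 0" by simp
 show ?case by (rule tendsto_sandwich[OF _ _ tendsto_const t]) (use le in auto)
qed

lemma pint_mono_AE:
 assumes "AE x in lborel. norm (f x) \<le> norm (g x)" "p > 0"
 shows "pint p f \<le> pint p g"
 unfolding pint_def using assms by (intro nn_integral_mono_AE) (auto intro!: ennreal_leI powr_mono2)

text \<open>The order of the choices matters. The limits \<open>Fl\<close> give a lower bound on
  independence and a dual family; \<open>dual_perturb\<close> transfers the lower bound to all close
  families, which fixes the bound C on their dual vectors. Only then are the continuous
  approximation h of B and the mollification index n chosen, with errors small relative to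
  C.\<close>

lemma local_approximation:
 fixes B :: "real^'d::finite => real^'n::finite^'d^'n" and k :: nat
 assumes conn: "connected Om" and K: "compact K" "K \<subseteq> Om" and z: "wsol Om B p R (%_. 0)" and mu: "\<And>l. l < k ==> wsol Om B p R (mu l)"
  and B: "B \<in> borel_fun" "\<And>x. norm x > R ==> B x = 0"
  and ind: "\<And>c l. AE x in lborel. x \<in> Om --> (\<Sum>l<k. c l *R mu l x) = 0 ==> l < k ==> c l = (0::real)"
  and e: "e > 0"
 shows "\<exists>A M. continuous_on K A \<and> (\<forall>l<k. \<forall>x\<in>K. (M l has_derivative (%h. - (bmul (A x) (M l x) *v h))) (at x))
   \<and> (\<forall>x\<in>K. \<forall>c. (\<Sum>l<k. c l *R M l x) = 0 --> (\<forall>l<k. c l = 0))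
   \<and> pint p (%x. indicator K x *R (A x - B x)) < ennreal e"
proof -
 interpret z: weak_solution Om "%_. 0 :: real^'n" "%x. - bmul (B x) 0" "%x. norm (B x)" p R by (rule z)
 have p0: "p > 0" using z.p_ge1 by simp
 have Bp: "pint p B < \<infinity>" using z.b_Lp by (simp add: pint_def)
 define g where "g = (%l x. - bmul (B x) (mu l x))"
 define Fl where "Fl = (%l. weak_solution.Fl (mu l))"
 define F where "F = (%l. weak_solution.F (mu l))"
 define G where "G = (%l. weak_solution.G (g l))"
 have Fl_cont: "continuous_on K (Fl l)" if "l < k" for l
  unfolding Fl_def by (rule continuous_on_subset[OF weak_solution.Fl_cont[OF mu[OF that]] K(2)])
 have F_cont: "continuous_on S (F l n)" if "l < k" for l n S
  unfolding F_def by (rule continuous_on_subset[OF weak_solution.F_cont[OF mu[OF that]]]) simp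
 have G_cont: "continuous_on S (G l n)" if "l < k" for l n S
  unfolding G_def g_def by (rule continuous_on_subset[OF weak_solution.G_cont[OF mu[OF that]]]) simp
 have F_deriv: "(F l n has_derivative (%h. G l n x *v h)) (at x)" if "l < k" "cball x (1 / real (Suc n)) \<subseteq> Om" for l n x
  unfolding F_def G_def g_def by (rule weak_solution.F_deriv[OF mu[OF that(1)] that(2)])
 have Gm: "G l n \<in> borel_fun" if "l < k" for l n
  using G_cont[OF that, of UNIV n] by (rule borel_measurable_continuous_onI)
 have gm: "g l \<in> borel_fun" if "l < k" for l
  unfolding g_def by (rule weak_solution.fg_meas(2)[OF mu[OF that]])
 have F_lim: "uniform_limit K (F l) (Fl l) sequentially" if "l < k" for l
  unfolding F_def Fl_def by (rule weak_solution.Fl_uniform_limit[OF mu[OF that] K])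
 have G_lim: "(%n. pint p (%x. indicator K x *R (G l n x - g l x))) ~~> 0" if "l < k" for l
  unfolding G_def g_def by (rule weak_solution.G_Lp_tendsto_compact[OF mu[OF that] K])
 have f_eq: "AE x in lborel. \<forall>l\<in>{..<k}. x \<in> Om --> mu l x = Fl l x"
  unfolding Fl_def by (rule AE_finite_allI[OF finite_lessThan]) (use weak_solution.f_eq_Fl[OF mu] in auto)
 have "\<forall>l. \<exists>C. l < k --> C \<ge> 0 \<and> (\<forall>x\<in>K. norm (Fl l x) \<le> C)"
  using weak_solution.f_bounded_on_compact[OF mu K] unfolding Fl_def by blast
 from choice[OF this] obtain Cb where Cb: "\<forall>l. l < k --> Cb l \<ge> 0 \<and> (\<forall>x\<in>K. norm (Fl l x) \<le> Cb l)" by (elim exE)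
 \<comment> \<open>The additive 1 leaves room for the mollifications, which stay within
   \<open>dt\<close> \<le> 1 of the limits.\<close>
 define L where "L = (\<Sum>l<k. Cb l) + 1"
 have L1: "L \<ge> 1" unfolding L_def using Cb by (auto intro!: sum_nonneg)
 have FlL: "norm (Fl l x) \<le> L - 1" if "l < k" "x \<in> K" for l x
 proof -
  have "norm (Fl l x) \<le> Cb l" using Cb that by blast
  also have "... \<le> (\<Sum>l<k. Cb l)" by (rule member_le_sum) (use Cb that in auto)
  finally show ?thesis by (simp add: L_def)
 qed
 have tri: "Fl m x - (\<Sum>i<m. c i *R Fl i x) \<noteq> 0" if "x \<in> K" "m < k" for x c m
 proof
  assume a: "Fl m x - (\<Sum>i<m. c i *R Fl i x) = 0"
  define d where "d = (%l. if l = m then 1 else if l < m then - c l else 0)"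
  have "(\<Sum>l<k. d l *R weak_solution.Fl (mu l) x) = 0"
   using triangular_sum[OF that(2), of "%l. Fl l x" c] a by (simp add: Fl_def d_def)
  moreover have "x \<in> Om" using that(1) K(2) by auto
  ultimately have "d m = 0" by (intro kernel_pointwise_independent[where c=d and l=m, OF conn z mu _ _ _ that(2)] ind)
  then show False by (simp add: d_def)
 qed
 have "\<exists>ck>0. \<forall>m<k. \<forall>c. \<forall>x\<in>K. ck \<le> norm (Fl m x - (\<Sum>i<m. c i *R Fl i x))"
  by (rule dual_lower_bound[where L=L, OF K(1) Fl_cont tri]) (use FlL L1 in force)+
 then obtain ck0 where ck0: "ck0 > 0" "\<forall>m<k. \<forall>c. \<forall>x\<in>K. ck0 \<le> norm (Fl m x - (\<Sum>i<m. c i *R Fl i x))" by (elim exE conjE)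
 have L0: "L \<ge> 0" using L1 by simp
 obtain C0 where C0: "C0 \<ge> 0" "\<forall>K (M :: nat => real^'d => real^'n).
  (\<forall>l<k. continuous_on K (M l)) --> (\<forall>l<k. \<forall>x\<in>K. norm (M l x) \<le> L) -->
  (\<forall>m<k. \<forall>c. \<forall>x\<in>K. ck0 \<le> norm (M m x - (\<Sum>i<m. c i *R M i x))) -->
  (\<exists>w. \<forall>l<k. continuous_on K (w l) \<and> (\<forall>x\<in>K. norm (w l x) \<le> C0) \<and> (\<forall>m<k. \<forall>x\<in>K. w l x \<bullet> M m x = (if l = m then 1 else 0)))"
  using dual_family[OF ck0(1) L0, where k=k and 'a="real^'d" and 'v="real^'n"] by (elim exE conjE)
 have "\<exists>w. \<forall>l<k. continuous_on K (w l) \<and> (\<forall>x\<in>K. norm (w l x) \<le> C0) \<and> (\<forall>m<k. \<forall>x\<in>K. w l x \<bullet> Fl m x = (if l = m then 1 else 0))"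
  by (rule C0(2)[rule_format]) (use Fl_cont FlL L1 ck0(2) in force)+
 then obtain w0 where w0: "\<forall>l<k. continuous_on K (w0 l) \<and> (\<forall>x\<in>K. norm (w0 l x) \<le> C0) \<and> (\<forall>m<k. \<forall>x\<in>K. w0 l x \<bullet> Fl m x = (if l = m then 1 else 0))"
  by (elim exE)
 define C1 where "C1 = C0 + 1"
 have C1: "C1 > 0" using C0(1) by (simp add: C1_def)
 define ck where "ck = 1 / (2 * C1)"
 have ck: "ck > 0" using C1 by (simp add: ck_def)
 obtain C where C: "C \<ge> 0" "\<forall>K (M :: nat => real^'d => real^'n).
  (\<forall>l<k. continuous_on K (M l)) --> (\<forall>l<k. \<forall>x\<in>K. norm (M l x) \<le> L) -->
  (\<forall>m<k. \<forall>c. \<forall>x\<in>K. ck \<le> norm (M m x - (\<Sum>i<m. c i *R M i x))) -->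
  (\<exists>w. \<forall>l<k. continuous_on K (w l) \<and> (\<forall>x\<in>K. norm (w l x) \<le> C) \<and> (\<forall>m<k. \<forall>x\<in>K. w l x \<bullet> M m x = (if l = m then 1 else 0)))"
  using dual_family[OF ck L0, where k=k and 'a="real^'d" and 'v="real^'n"] by (elim exE conjE)
 define Q where "Q = 2 powr p"
 have Q: "Q \<ge> 1" unfolding Q_def using p0 by (intro ge_one_powr_ge_zero) auto
 \<comment> \<open>Three errors of size \<open>e3\<close> are summed by two nested uses of
   \<open>pint_add_le\<close>, with a total of at most 3 Q^2 e3 < e.\<close>
 define e3 where "e3 = e / (4 * Q\<^sup>2)"
 have e3: "e3 > 0" using e Q by (simp add: e3_def)
 \<comment> \<open>The coefficient of |h - B| in the final estimate: one direct occurrence and k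
   more through the correction terms.\<close>
 define c1 where "c1 = 1 + real k * C * L"
 have c1: "c1 > 0" using C(1) L0 by (simp add: c1_def add_pos_nonneg)
 have "e3 / c1 powr p > 0" using e3 c1 by simp
 then have "\<exists>h. continuous_on UNIV h \<and> (\<forall>x. norm x > R + 1 --> h x = 0) \<and> pint p (%x. B x - h x) < ennreal (e3 / c1 powr p)"
  by (intro dense_continuous B Bp p0)
 then obtain h where h: "continuous_on UNIV h" "pint p (%x. B x - h x) < ennreal (e3 / c1 powr p)"
  by (elim exE conjE)
 have hm: "h \<in> borel_fun" using h(1) by (rule borel_measurable_continuous_onI)
 have "bounded (h ` K)" by (intro compact_imp_bounded compact_continuous_image continuous_on_subset[OF h(1)] K(1)) simp
 then obtain H0 where "\<forall>y\<in>h ` K. norm y \<le> H0" unfolding bounded_iff by (elim exE)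
 then obtain H where H: "H \<ge> 0" "\<And>x. x \<in> K ==> norm (h x) \<le> H" by (intro that[of "max H0 0"]) (auto simp: le_max_iff_disj)
 have Ks: "K \<in> sets borel" using K(1) by (simp add: borel_compact)
 define V where "V = measure lborel K"
 have V: "emeasure lborel K = ennreal V" "V \<ge> 0"
  using emeasure_bounded_finite[OF compact_imp_bounded[OF K(1)]] by (auto simp: V_def emeasure_eq_ennreal_measure)
 define th where "th = (e3 / (V + 1)) powr (1 / p)"
 have th: "th > 0" "th powr p * V \<le> e3"
 proof -
  show "th > 0" using e3 V(2) by (simp add: th_def)
  have "th powr p = e3 / (V + 1)" using e3 V(2) p0 by (simp add: th_def powr_powr)
  then have "th powr p * V + th powr p = e3" using e3 V(2) by (simp add: field_simps)
  then show "th powr p * V \<le> e3" using powr_ge_zero[of th p] by linarith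
 qed
 \<comment> \<open>The entries keep |M| \<le> L, make \<open>dual_perturb\<close> applicable, and
   bound by \<open>th\<close> the error k C H dt caused by replacing the limits with
   mollifications.\<close>
 define dt where "dt = min 1 (min (1 / (2 * (real k * C1 + 1))) (th / (real k * C * H + 1)))"
 have kC: "real k * C1 + 1 > 0" "real k * C * H + 1 > 0" using C1 C(1) H(1) by (auto intro!: add_nonneg_pos)
 have dt: "dt > 0" "dt \<le> 1" "real k * (C1 * dt) \<le> 1 / 2" "real k * C * H * dt \<le> th"
 proof -
  show d0: "dt > 0" "dt \<le> 1" using kC th(1) by (auto simp: dt_def)
  have "dt \<le> 1 / (2 * (real k * C1 + 1))" by (simp add: dt_def)
  then have "(real k * C1 + 1) * dt \<le> 1 / 2" using kC(1) by (simp add: field_simps)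
  then show "real k * (C1 * dt) \<le> 1 / 2" using d0 by (simp add: algebra_simps)
  have "dt \<le> th / (real k * C * H + 1)" by (simp add: dt_def)
  then have "dt * (real k * C * H + 1) \<le> th" using kC(2) by (simp add: pos_le_divide_eq)
  then show "real k * C * H * dt \<le> th" using d0 by (simp add: algebra_simps)
 qed
 define gd where "gd = (%l n x. C * norm (indicator K x *R (G l n x - g l x)))"
 have gdm: "gd l n \<in> borel_fun" if "l < k" for l n
  unfolding gd_def using Gm[OF that] gm[OF that] Ks by (intro borel_measurable_times borel_measurable_norm borel_measurable_scaleR borel_measurable_indicator borel_measurable_diff) auto
 have gd0: "(%n. pint p (gd l n)) ~~> 0" if l: "l < k" for l
 proof -
  have m: "(%x. indicator K x *R (G l n x - g l x)) \<in> borel_fun" for n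
   using Gm[OF l] gm[OF l] Ks by (intro borel_measurable_scaleR borel_measurable_indicator borel_measurable_diff) auto
  have le: "pint p (gd l n) \<le> ennreal (C powr p) * pint p (%x. indicator K x *R (G l n x - g l x))" for n
   by (rule pint_scale_le[OF m _ p0 C(1)]) (use C(1) in \<open>simp add: gd_def abs_mult\<close>)
  have "(%n. ennreal (C powr p) * pint p (%x. indicator K x *R (G l n x - g l x))) ~~> ennreal (C powr p) * 0"
   by (intro tendsto_mult_ennreal tendsto_const G_lim l) auto
  then have t: "(%n. ennreal (C powr p) * pint p (%x. indicator K x *R (G l n x - g l x))) ~~> 0" by simp
  show ?thesis by (rule tendsto_sandwich[OF _ _ tendsto_const t]) (use le in auto)
 qed
 have "(%n. pint p (%x. \<Sum>l<k. gd l n x)) ~~> 0"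
  by (rule pint_sum_tendsto_0[OF gdm gd0 p0])
 then have ev1: "\<forall>\<^sub>F n in sequentially. pint p (%x. \<Sum>l<k. gd l n x) < ennreal e3"
  by (rule order_tendstoD) (use e3 in simp)
 have ev2: "\<forall>\<^sub>F n in sequentially. \<forall>l\<in>{..<k}. \<forall>x\<in>K. dist (F l n x) (Fl l x) < dt"
  by (rule eventually_ball_finite) (use uniform_limitD[OF F_lim dt(1)] in auto)
 obtain rh where rh: "rh > 0" "(\<Union>x\<in>K. cball x rh) \<subseteq> Om"
  using compact_subset_open_imp_cball_epsilon_subset[OF K(1) z.openU K(2)] by blast
 have "(%n. 1 / real (Suc n)) ~~> 0" by (rule LIMSEQ_Suc[OF lim_1_over_n])
 then have ev3: "\<forall>\<^sub>F n in sequentially. 1 / real (Suc n) < rh" by (rule order_tendstoD) (rule rh(1))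
 obtain n where n: "pint p (%x. \<Sum>l<k. gd l n x) < ennreal e3" "\<forall>l\<in>{..<k}. \<forall>x\<in>K. dist (F l n x) (Fl l x) < dt" "1 / real (Suc n) < rh"
  using eventually_happens'[OF sequentially_bot eventually_conj[OF ev1 eventually_conj[OF ev2 ev3]]] by (elim exE conjE)
 define M where "M = (%l. F l n)"
 have MF: "norm (M l x - Fl l x) \<le> dt" if "l < k" "x \<in> K" for l x
  using n(2) that by (force simp: M_def dist_norm less_imp_le)
 have MbL: "norm (M l x) \<le> L" if "l < k" "x \<in> K" for l x
  using MF[OF that] FlL[OF that] dt(2) norm_triangle_ineq[of "M l x - Fl l x" "Fl l x"] by simp
 have Mck: "ck \<le> norm (M m x - (\<Sum>i<m. c i *R M i x))" if "m < k" "x \<in> K" for m c x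
  unfolding ck_def
 proof (rule dual_perturb[where k=k and M="%l. Fl l x" and w="%l. w0 l x" and dt=dt, OF _ _ C1 _ dt(3) that(1)])
  show "norm (w0 l x) \<le> C1" if "l < k" for l using w0 that \<open>x \<in> K\<close> by (force simp: C1_def)
 qed (use w0 that MF in auto)
 have "\<exists>w. \<forall>l<k. continuous_on K (w l) \<and> (\<forall>x\<in>K. norm (w l x) \<le> C) \<and> (\<forall>m<k. \<forall>x\<in>K. w l x \<bullet> M m x = (if l = m then 1 else 0))"
  by (rule C(2)[rule_format]) (use F_cont MbL Mck in \<open>auto simp: M_def\<close>)
 then obtain w where w': "\<forall>l<k. continuous_on K (w l) \<and> (\<forall>x\<in>K. norm (w l x) \<le> C) \<and> (\<forall>m<k. \<forall>x\<in>K. w l x \<bullet> M m x = (if l = m then 1 else 0))"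
  by (elim exE)
 then have w: "continuous_on K (w l)" "x \<in> K ==> norm (w l x) \<le> C" "x \<in> K ==> m < k ==> w l x \<bullet> M m x = (if l = m then 1 else 0)"
  if "l < k" for l m x using that by blast+
 define E where "E = (%l x. - G l n x - bmul (h x) (M l x))"
 \<comment> \<open>E l is the defect of M l with respect to h. By duality the l-th correction adds E
   l to the product with M l and leaves the other members alone, so every M m satisfies the equation
   for A exactly on K.\<close>
 define A where "A = (%x. h x + (\<Sum>l<k. outer (E l x) (w l x)))"
 have hc: "continuous_on K h" by (rule continuous_on_subset[OF h(1)]) simp
 have Ec: "continuous_on K (E l)" if "l < k" for l
  unfolding E_def M_def by (intro continuous_intros continuous_on_bmul hc F_cont G_cont that)
 have Ac: "continuous_on K A"
  unfolding A_def by (intro continuous_intros hc continuous_on_outer) (use Ec w in auto)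
 have Aeq: "bmul (A x) (M m x) = - G m n x" if m: "m < k" and x: "x \<in> K" for m x
 proof -
  have "(\<Sum>l<k. (w l x \<bullet> M m x) *R E l x) = (\<Sum>l<k. if l = m then E m x else 0)"
   by (rule sum.cong) (use w(3)[OF _ x m] in auto)
  then have "(\<Sum>l<k. (w l x \<bullet> M m x) *R E l x) = E m x" using m by simp
  then show ?thesis by (simp add: A_def bmul_add_left bmul_sum_left bmul_outer E_def)
 qed
 have deriv: "(M l has_derivative (%h. - (bmul (A x) (M l x) *v h))) (at x)" if l: "l < k" and x: "x \<in> K" for l x
 proof -
  have "cball x (1 / real (Suc n)) \<subseteq> cball x rh" using n(3) by (intro subset_cball) simp
  then have "cball x (1 / real (Suc n)) \<subseteq> Om" using rh(2) x by blast
  moreover have "- (bmul (A x) (M l x) *v h) = G l n x *v h" for h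
   unfolding Aeq[OF l x] by (simp add: matrix_vector_mult_def sum_negf vec_eq_iff)
  ultimately show ?thesis using F_deriv[OF l] by (simp add: M_def)
 qed
 have indM: "c l = 0" if x: "x \<in> K" and s: "(\<Sum>l<k. c l *R M l x) = 0" and l: "l < k" for x c l
 proof -
  have "0 = w l x \<bullet> (\<Sum>m<k. c m *R M m x)" using s by simp
  also have "... = (\<Sum>m<k. if m = l then c l else 0)"
   unfolding inner_sum_right by (rule sum.cong) (use w(3)[OF l x] in auto)
  finally show ?thesis using l by simp
 qed
 define f1 where "f1 = (%x. c1 * norm (h x - B x))"
 define f2 where "f2 = (%x. \<Sum>l<k. gd l n x)"
 define f3 where "f3 = (%x. th * indicator K x :: real)"
 have f1m: "f1 \<in> borel_fun" unfolding f1_def using hm B(1) by measurable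
 have f2m: "f2 \<in> borel_fun" unfolding f2_def using gdm by (intro borel_measurable_sum) auto
 have f3m: "f3 \<in> borel_fun" unfolding f3_def using Ks by (intro borel_measurable_times borel_measurable_indicator) auto
 have nn: "f1 x \<ge> 0" "f2 x \<ge> 0" "f3 x \<ge> 0" for x
  using c1 C(1) th(1) by (auto simp: f1_def f2_def f3_def gd_def intro!: sum_nonneg)
 have pt: "AE x in lborel. norm (indicator K x *R (A x - B x)) \<le> norm (f1 x + (f2 x + f3 x))"
  using f_eq
 proof eventually_elim
  case (elim x)
  show ?case
  proof (cases "x \<in> K")
   case True
   have muF: "mu l x = Fl l x" if "l < k" for l using elim that True K(2) by auto
   have Eb: "norm (E l x) \<le> norm (G l n x - g l x) + norm (h x - B x) * L + H * dt" if l: "l < k" for l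
   proof -
    \<comment> \<open>As g l is minus the product of B and mu l, the defect splits into the
      mollification error of g, the error of h against B and the error of M against mu. The first
      two are small in L^p, the last uniformly.\<close>
    have "E l x = - (G l n x - g l x) - bmul (h x - B x) (mu l x) - bmul (h x) (M l x - mu l x)"
     by (simp add: E_def g_def bmul_diff_left bmul_diff_right)
    then have "norm (E l x) \<le> norm (G l n x - g l x) + norm (bmul (h x - B x) (mu l x)) + norm (bmul (h x) (M l x - mu l x))"
     using norm_triangle_ineq4[of "- (G l n x - g l x) - bmul (h x - B x) (mu l x)" "bmul (h x) (M l x - mu l x)"]
      norm_triangle_ineq4[of "- (G l n x - g l x)" "bmul (h x - B x) (mu l x)"] by (simp add: norm_minus_commute)
    moreover have "norm (bmul (h x - B x) (mu l x)) \<le> norm (h x - B x) * L"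
     by (rule order_trans[OF norm_bmul_le mult_left_mono]) (use FlL[OF l True] muF[OF l] in auto)
    moreover have "norm (bmul (h x) (M l x - mu l x)) \<le> H * dt"
     by (rule order_trans[OF norm_bmul_le mult_mono]) (use H(2)[OF True] H(1) MF[OF l True] muF[OF l] in auto)
    ultimately show ?thesis by linarith
   qed
   have "norm (\<Sum>l<k. outer (E l x) (w l x)) \<le> (\<Sum>l<k. gd l n x + (C * L * norm (h x - B x) + C * H * dt))"
   proof (rule sum_norm_le)
    fix l assume "l \<in> {..<k}"
    then have l: "l < k" by simp
    have "norm (outer (E l x) (w l x)) \<le> (norm (G l n x - g l x) + norm (h x - B x) * L + H * dt) * C"
     unfolding norm_outer by (rule mult_mono) (use Eb[OF l] w(2)[OF l True] H(1) dt(1) L0 in auto)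
    then show "norm (outer (E l x) (w l x)) \<le> gd l n x + (C * L * norm (h x - B x) + C * H * dt)"
     using True by (simp add: gd_def algebra_simps)
   qed
   also have "... = f2 x + real k * (C * L * norm (h x - B x) + C * H * dt)"
    by (simp add: f2_def sum.distrib)
   finally have "norm (A x - B x) \<le> norm (h x - B x) + (f2 x + real k * (C * L * norm (h x - B x) + C * H * dt))"
    using norm_triangle_ineq[of "h x - B x" "\<Sum>l<k. outer (E l x) (w l x)"] by (simp add: A_def algebra_simps)
   also have "... \<le> f1 x + (f2 x + f3 x)"
    using dt(4) True by (simp add: f1_def f3_def c1_def algebra_simps)
   finally show ?thesis using True nn[of x] by simp
  qed (use nn[of x] in simp)
 qed
 have "pint p (%x. indicator K x *R (A x - B x)) \<le> pint p (%x. f1 x + (f2 x + f3 x))" by (rule pint_mono_AE[OF pt p0])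
 also have "... \<le> ennreal Q * (pint p f1 + pint p (%x. f2 x + f3 x))"
  unfolding Q_def by (rule pint_add_le[OF f1m _ p0 norm_triangle_ineq]) (use f2m f3m in simp)
 also have "... \<le> ennreal Q * (pint p f1 + ennreal Q * (pint p f2 + pint p f3))"
  unfolding Q_def by (intro mult_left_mono add_left_mono pint_add_le[OF f2m f3m p0 norm_triangle_ineq]) auto
 also have "... \<le> ennreal Q * (ennreal e3 + ennreal Q * (ennreal e3 + ennreal e3))"
 proof (intro mult_left_mono add_mono)
  have "pint p f1 \<le> ennreal (c1 powr p) * pint p (%x. B x - h x)"
   by (rule pint_scale_le[OF _ _ p0]) (use hm B(1) c1 in \<open>auto simp: f1_def abs_mult norm_minus_commute\<close>)
  also have "... \<le> ennreal (c1 powr p) * ennreal (e3 / c1 powr p)" using h(2) by (intro mult_left_mono) auto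
  also have "... = ennreal e3" using c1 e3 by (simp add: ennreal_mult'[symmetric])
  finally show "pint p f1 \<le> ennreal e3" .
  show "pint p f2 \<le> ennreal e3" using n(1) by (simp add: f2_def)
  have "pint p f3 \<le> ennreal (th powr p) * emeasure lborel K"
   by (rule pint_bounded_le[OF _ _ Ks p0]) (use th(1) in \<open>auto simp: f3_def indicator_def\<close>)
  also have "... \<le> ennreal e3" using th(2) V by (simp add: ennreal_mult'[symmetric] ennreal_leI)
  finally show "pint p f3 \<le> ennreal e3" .
 qed auto
 also have "... = ennreal (Q * (e3 + Q * (e3 + e3)))"
  using Q e3 by (simp add: ennreal_mult'[symmetric] ennreal_plus[symmetric] del: ennreal_plus)
 also have "... < ennreal e"
 proof (rule ennreal_lessI[OF e])
  have "Q * e3 \<le> Q\<^sup>2 * e3" using Q e3 by (intro mult_right_mono) (auto simp: power2_eq_square)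
  then have "Q * (e3 + Q * (e3 + e3)) \<le> 3 * (Q\<^sup>2 * e3)" by (simp add: power2_eq_square algebra_simps)
  also have "... = 3 / 4 * e" using Q by (simp add: e3_def)
  finally show "Q * (e3 + Q * (e3 + e3)) < e" using e by linarith
 qed
 finally have "pint p (%x. indicator K x *R (A x - B x)) < ennreal e" .
 then show ?thesis using Ac deriv indM by (intro exI[of _ A] exI[of _ M] conjI) blast+
qed

section \<open>Pulling back to the closure\<close>

lemma independent_family_le_dim:
 fixes v :: "nat => 'a::euclidean_space"
 assumes ind: "\<And>c l. (\<Sum>l<k. c l *R v l) = 0 ==> l < k ==> c l = (0::real)" and S: "\<And>l. l < k ==> v l \<in> S"
 shows "k \<le> dim S"
proof -
 have inj: "inj_on v {..<k}"
 proof (rule inj_onI, rule ccontr)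
  fix l m assume lm: "l \<in> {..<k}" "m \<in> {..<k}" "v l = v m" "l \<noteq> m"
  define c where "c = (%i. if i = l then 1 else if i = m then - 1 else (0::real))"
  have "(\<Sum>i<k. c i *R v i) = (\<Sum>i\<in>{l, m}. c i *R v i)"
   using lm by (intro sum.mono_neutral_right) (auto simp: c_def)
  also have "... = 0" using lm by (simp add: c_def)
  finally have "c l = 0" using ind lm by simp
  then show False by (simp add: c_def)
 qed
 have "independent (v ` {..<k})"
 proof
  assume "dependent (v ` {..<k})"
  then obtain u where u: "\<exists>w\<in>v ` {..<k}. u w \<noteq> 0" "(\<Sum>w\<in>v ` {..<k}. u w *R w) = 0"
   using dependent_finite[of "v ` {..<k}"] by auto
  have "(\<Sum>l<k. u (v l) *R v l) = 0" using u(2) inj by (simp add: sum.reindex)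
  then have "u (v l) = 0" if "l < k" for l using ind[of "%l. u (v l)"] that by simp
  then show False using u(1) by auto
 qed
 then have "card (v ` {..<k}) \<le> dim S" using S by (intro independent_card_le_dim) auto
 then show ?thesis using inj by (simp add: card_image)
qed

text \<open>The pull-back of a matrix-valued one-form by a map with derivative A; the derivative
  acts on the index j.\<close>

definition pull_back :: "real^'n::finite^'d::finite^'n => real^'d^'d => real^'n^'d^'n" where
 "pull_back b A = (\<chi> i j. \<Sum>l\<in>UNIV. A $ l $ j *R b $ i $ l)"

lemma bmul_pull_back: "bmul (pull_back b A) v = bmul b v ** A"
proof -
 have "bmul (pull_back b A) v $ i $ j = (bmul b v ** A) $ i $ j" for i j
 proof -
  have "bmul (pull_back b A) v $ i $ j = (\<Sum>k\<in>UNIV. \<Sum>l\<in>UNIV. b $ i $ l $ k * v $ k * A $ l $ j)"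
   by (simp add: bmul_nth pull_back_def sum_distrib_right sum_distrib_left mult_ac)
  also have "... = (\<Sum>l\<in>UNIV. \<Sum>k\<in>UNIV. b $ i $ l $ k * v $ k * A $ l $ j)" by (rule sum.swap)
  also have "... = (bmul b v ** A) $ i $ j" by (simp add: bmul_nth matrix_matrix_mult_def sum_distrib_right)
  finally show ?thesis .
 qed
 then show ?thesis by (simp add: vec_eq_iff)
qed

lemma pull_back_id:
 fixes b :: "real^'n::finite^'d::finite^'n"
 shows "pull_back b (mat 1) = b"
proof -
 have "(\<Sum>l\<in>UNIV. mat 1 $ l $ j *R b $ i $ l) = b $ i $ j" for i and j :: 'd
 proof -
  have "(\<Sum>l\<in>UNIV. mat 1 $ l $ j *R b $ i $ l) = (\<Sum>l\<in>UNIV. if l = j then b $ i $ j else 0)"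
   by (rule sum.cong) (auto simp: mat_def)
  then show ?thesis by simp
 qed
 then show ?thesis by (simp add: pull_back_def vec_eq_iff)
qed

lemma pull_back_add_left: "pull_back (b + b') A = pull_back b A + pull_back b' A"
 and pull_back_diff_left: "pull_back (b - b') A = pull_back b A - pull_back b' A"
 and pull_back_add_right: "pull_back b (A + A') = pull_back b A + pull_back b A'"
 and pull_back_scaleR_left: "pull_back (c *R b) A = c *R pull_back b A"
 and pull_back_scaleR_right: "pull_back b (c *R A) = c *R pull_back b A"
 by (simp_all add: pull_back_def vec_eq_iff sum.distrib sum_subtractf sum_distrib_left algebra_simps)

lemma pull_back_bounded:
 "\<exists>c\<ge>0. \<forall>(b :: real^'n::finite^'d::finite^'n) A. norm (pull_back b A) \<le> c * norm b * norm A"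
proof -
 have "bilinear (pull_back :: real^'n^'d^'n => real^'d^'d => real^'n^'d^'n)"
  unfolding bilinear_def by (intro conjI allI linearI)
   (rule pull_back_add_left pull_back_add_right pull_back_scaleR_left pull_back_scaleR_right)+
 from bilinear_bounded[OF this] obtain c where c: "\<forall>(b :: real^'n^'d^'n) A. norm (pull_back b A) \<le> c * norm b * norm A" by (elim exE)
 have "norm (pull_back b A) \<le> max c 0 * norm b * norm A" for b :: "real^'n^'d^'n" and A
  by (rule order_trans[OF c[rule_format]]) (intro mult_right_mono, auto)
 then show ?thesis by (intro exI[of _ "max c 0"]) auto
qed

lemma continuous_on_pull_back:
 assumes "continuous_on S f" "continuous_on S g"
 shows "continuous_on S (%x. pull_back (f x) (g x))"
 unfolding pull_back_def by (intro continuous_on_vec_lambda continuous_intros assms)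

lemma csol_pull_back:
 assumes T: "\<And>x. x \<in> Om ==> (T has_derivative (*v) (J x)) (at x)"
  and M: "\<And>x. x \<in> Om ==> (M has_derivative (%h. - (bmul (A (T x)) (M (T x)) *v h))) (at (T x))"
 shows "csol Om (%x. pull_back (A (T x)) (J x)) (%x. M (T x))"
 unfolding csol_def
proof
 fix x assume x: "x \<in> Om"
 have "((%x. M (T x)) has_derivative (%h. - (bmul (A (T x)) (M (T x)) *v (J x *v h)))) (at x)"
  using diff_chain_at[OF T[OF x] M[OF x]] by (simp add: o_def)
 then show "((%x. M (T x)) has_derivative (%h. - (bmul (pull_back (A (T x)) (J x)) (M (T x)) *v h))) (at x)"
  by (simp add: bmul_pull_back matrix_vector_mul_assoc)
qed

context cone_domain
begin

lemma kernelN_imp_at_least_conservative: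
 fixes B :: "real^'d => real^'n::finite^'d^'n"
 assumes p: "p > real CARD('d)" "p \<ge> 2" and conn: "connected Om" and bdd: "bounded Om" and ne: "Om \<noteq> {}" and B: "Lp_on p Om B"
  and fs: "length fs = k" "set fs \<subseteq> kernelN Om B" "ae_lin_indep Om fs"
 shows "at_least_conservative p Om B k"
 unfolding at_least_conservative_def
proof (intro allI impI)
 fix ep :: real assume ep: "ep > 0"
 have p0: "p > 0" using p by linarith
 obtain x0 where x0: "x0 \<in> Om" using ne by blast
 obtain R where "\<forall>x\<in>Om. norm x \<le> R" using bdd unfolding bounded_iff by (elim exE)
 then have R: "Om \<subseteq> cball 0 R" by auto
 have "B \<in> borel_measurable (lebesgue_on Om)" using B by (simp add: Lp_on_def)
 from borel_version[OF open_Om this] obtain B0 where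
  "B0 \<in> borel_fun \<and> (\<forall>x. x \<notin> Om --> B0 x = 0) \<and> (AE x in lborel. x \<in> Om --> B x = B0 x)" by (elim exE)
 then have B0: "B0 \<in> borel_fun" "\<And>x. x \<notin> Om ==> B0 x = 0" "AE x in lborel. x \<in> Om --> B x = B0 x" by blast+
 have Bp: "pint p B0 < \<infinity>" using B Lp_on_pint[OF open_Om B0 p0] by simp
 have B0R: "B0 x = 0" if "norm x > R" for x using R that by (intro B0(2)) auto
 have fsN: "fs ! l \<in> kernelN Om B" if "l < k" for l using fs(1,2) that by (auto simp: subset_iff)
 have "\<forall>l. \<exists>mu. l < k --> mu \<in> borel_fun \<and> (\<forall>x. x \<notin> Om --> mu x = 0) \<and> (AE x in lborel. x \<in> Om --> (fs ! l) x = mu x)"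
 proof
  fix l
  show "\<exists>mu. l < k --> mu \<in> borel_fun \<and> (\<forall>x. x \<notin> Om --> mu x = 0) \<and> (AE x in lborel. x \<in> Om --> (fs ! l) x = mu x)"
  proof (cases "l < k")
   case True
   have "fs ! l \<in> borel_measurable (lebesgue_on Om)" using fsN[OF True] by (simp add: kernelN_def Lp_on_def)
   from borel_version[OF open_Om this] show ?thesis by blast
  qed simp
 qed
 from choice[OF this] obtain mu where "\<forall>l. l < k --> mu l \<in> borel_fun \<and> (\<forall>x. x \<notin> Om --> mu l x = 0) \<and> (AE x in lborel. x \<in> Om --> (fs ! l) x = mu l x)"
  by (elim exE)
 then have mu: "mu l \<in> borel_fun" "\<And>x. x \<notin> Om ==> mu l x = 0" "AE x in lborel. x \<in> Om --> (fs ! l) x = mu l x"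
  if "l < k" for l using that by blast+
 have ws: "wsol Om B0 p R (mu l)" if l: "l < k" for l
 proof -
  have k: "pint 2 (mu l) < \<infinity> \<and> (\<forall>ph i j. test_fun Om ph --> (INT x. mu l x $ i * partial j ph x) = (INT x. bmul (B0 x) (mu l x) $ i $ j * ph x))"
   using fsN[OF l] kernelN_iff[OF open_Om B0 mu[OF l]] by simp
  show ?thesis by (rule kernel_weak_solution[OF open_Om R B0(1) Bp p mu(1,2)[OF l]]) (use k in blast)+
 qed
 have z: "wsol Om B0 p R (%_. 0)"
  by (rule kernel_weak_solution[OF open_Om R B0(1) Bp p]) (auto simp: pint_def bmul_zero_right)
 have ind: "c l = 0" if ae: "AE x in lborel. x \<in> Om --> (\<Sum>l<k. c l *R mu l x) = 0" and l: "l < k" for c :: "nat => real" and l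
 proof -
  have "AE x in lborel. \<forall>l\<in>{..<k}. x \<in> Om --> (fs ! l) x = mu l x"
   by (rule AE_finite_allI[OF finite_lessThan]) (use mu(3) in auto)
  then have "AE x in lborel. x \<in> Om --> (\<Sum>l<k. c l *R (fs ! l) x) = 0" using ae
  proof eventually_elim
   case (elim x)
   show ?case
   proof
    assume x: "x \<in> Om"
    have "(\<Sum>l<k. c l *R (fs ! l) x) = (\<Sum>l<k. c l *R mu l x)" by (rule sum.cong) (use elim x in auto)
    then show "(\<Sum>l<k. c l *R (fs ! l) x) = 0" using elim x by simp
   qed
  qed
  then show ?thesis using fs(1,3) l unfolding ae_lin_indep_def AE_lebesgue_on_iff[OF open_Om] by blast
 qed

 obtain t0 et Vm where tV: "t0 > 0" "et > 0" "\<forall>x. norm (V x) \<le> Vm" "\<forall>t a x. 0 < t \<and> t \<le> t0 \<and> norm a \<le> et \<and> x \<in> closure Om --> x + t *R (V x + a) \<in> Om"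
  using V_inward by (elim exE conjE)
 have Vm0: "Vm \<ge> 0" using tV(3) norm_ge_zero order_trans by blast
 have cpt: "compact (closure Om)" using bdd by (simp add: compact_closure)
 have "bounded (DV ` closure Om)"
  by (intro compact_imp_bounded compact_continuous_image cpt continuous_on_subset[OF DV_cont]) simp
 then obtain D0 where "\<forall>y\<in>DV ` closure Om. norm y \<le> D0" unfolding bounded_iff by (elim exE)
 then obtain Dm where Dm: "Dm \<ge> 0" "\<And>x. x \<in> closure Om ==> norm (DV x) \<le> Dm" by (intro that[of "max D0 0"]) (auto simp: le_max_iff_disj)
 obtain cb where cb: "cb \<ge> 0" "\<forall>(b :: real^'n^'d^'n) (A :: real^'d^'d). norm (pull_back b A) \<le> cb * norm b * norm A"
  using pull_back_bounded[where 'n='n and 'd='d] by (elim exE conjE)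
 define Jm where "Jm = norm (mat 1 :: real^'d^'d) + Dm"
 have Jm: "Jm \<ge> 0" using Dm(1) by (simp add: Jm_def)
 define c where "c = ((Vm + et) / et) ^ CARD('d)"
 have c0: "c \<ge> 0" using Vm0 tV(2) by (simp add: c_def)
 define Q where "Q = 2 powr p"
 have Q: "Q > 0" by (simp add: Q_def)
 define q where "q = (cb * Jm) powr p * c"
 have q: "q \<ge> 0" using c0 by (simp add: q_def)
 \<comment> \<open>Collects the constants of the final sum. In q the power of cb Jm comes from the
   pull-back and c from the averaged composition; the additive 1 makes the last inequality
   strict.\<close>
 define W where "W = Q\<^sup>2 * (2 * q + 2) + 1"
 have W: "W > 0" unfolding W_def using q by (intro add_nonneg_pos mult_nonneg_nonneg) auto
 define e where "e = ep powr p"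
 have e: "e > 0" using ep by (simp add: e_def)
 define e1 where "e1 = e / W"
 have e1: "e1 > 0" using e W by (simp add: e1_def)
 have "\<exists>h. continuous_on UNIV h \<and> (\<forall>x. norm x > R + 1 --> h x = 0) \<and> pint p (%x. B0 x - h x) < ennreal e1"
  by (intro dense_continuous B0 B0R Bp p0 e1)
 then obtain h where h: "continuous_on UNIV h" "pint p (%x. B0 x - h x) < ennreal e1" by (elim exE conjE)
 have hm: "h \<in> borel_fun" using h(1) by (rule borel_measurable_continuous_onI)
 have "bounded (h ` closure Om)" by (intro compact_imp_bounded compact_continuous_image continuous_on_subset[OF h(1)] cpt) simp
 then obtain H0 where "\<forall>y\<in>h ` closure Om. norm y \<le> H0" unfolding bounded_iff by (elim exE)
 then obtain H where H: "H \<ge> 0" "\<And>x. x \<in> closure Om ==> norm (h x) \<le> H" by (intro that[of "max H0 0"]) (auto simp: le_max_iff_disj)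
 have Oms: "Om \<in> sets borel" using open_Om by simp
 define v where "v = measure lborel Om"
 have v: "emeasure lborel Om = ennreal v" "v \<ge> 0"
  using emeasure_bounded_finite[OF bdd] by (auto simp: v_def emeasure_eq_ennreal_measure)
 define th where "th = (e1 / (v + 1)) powr (1 / p)"
 have th: "th > 0" "th powr p * v \<le> e1"
 proof -
  show "th > 0" using e1 v(2) by (simp add: th_def)
  have "th powr p = e1 / (v + 1)" using e1 v(2) p0 by (simp add: th_def powr_powr)
  then have "th powr p * v + th powr p = e1" using e1 v(2) by (simp add: field_simps)
  then show "th powr p * v \<le> e1" using powr_ge_zero[of th p] by linarith
 qed
 have "uniformly_continuous_on (closure Om) h"
  by (intro compact_uniformly_continuous continuous_on_subset[OF h(1)] cpt) simp
 moreover have "th / (2 * (cb * Jm + 1)) > 0" using th(1) cb(1) Jm by (simp add: add_nonneg_pos)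
 ultimately obtain om where om: "om > 0" "\<forall>x\<in>closure Om. \<forall>x'\<in>closure Om. dist x' x < om --> dist (h x') (h x) < th / (2 * (cb * Jm + 1))"
  unfolding uniformly_continuous_on_def by blast
 \<comment> \<open>Besides t \<le> \<open>t0\<close>, the entries make T move points by less than
   the tolerance \<open>om\<close> for h, and make the difference between the derivative of T and
   the identity cost at most th/2.\<close>
 define t where "t = min (min t0 1) (min (om / (2 * (Vm + et))) (th / (2 * (cb * H * Dm + 1))))"
 have cH: "cb * H * Dm \<ge> 0" using cb(1) H(1) Dm(1) by simp
 have t: "t > 0" "t \<le> t0" "t \<le> 1" "t * (Vm + et) < om" "cb * H * Dm * t \<le> th / 2"
 proof -
  show t: "t > 0" "t \<le> t0" "t \<le> 1" using tV(1,2) om(1) th(1) Vm0 cH by (auto simp: t_def)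
  have "t \<le> om / (2 * (Vm + et))" by (simp add: t_def)
  then have "t * (2 * (Vm + et)) \<le> om" using tV(2) Vm0 by (simp add: pos_le_divide_eq)
  then show "t * (Vm + et) < om" using om(1) by (simp add: algebra_simps)
  have "t \<le> th / (2 * (cb * H * Dm + 1))" by (simp add: t_def)
  then have "t * (2 * (cb * H * Dm + 1)) \<le> th" using cH by (simp add: pos_le_divide_eq)
  then show "cb * H * Dm * t \<le> th / 2" using t(1) by (simp add: algebra_simps)
 qed
 \<comment> \<open>K contains the images for all admissible a at once, because A is constructed on K
   first and a is chosen afterwards in dependence on A.\<close>
 define K where "K = (%(x, a). x + t *R (V x + a)) ` (closure Om \<times> cball 0 et)"
 have K: "compact K"
  unfolding K_def case_prod_beta
  by (intro compact_continuous_image compact_Times cpt compact_cball continuous_intros continuous_on_compose2[OF V_cont]) auto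
 have KOm: "K \<subseteq> Om" using tV(4) t(1,2) by (auto simp: K_def)
 have Ks: "K \<in> sets borel" using K by (simp add: borel_compact)
 have "\<exists>A M. continuous_on K A \<and> (\<forall>l<k. \<forall>x\<in>K. (M l has_derivative (%h. - (bmul (A x) (M l x) *v h))) (at x))
   \<and> (\<forall>x\<in>K. \<forall>c. (\<Sum>l<k. c l *R M l x) = 0 --> (\<forall>l<k. c l = 0))
   \<and> pint p (%x. indicator K x *R (A x - B0 x)) < ennreal e1"
 proof (rule local_approximation[OF conn K KOm z ws B0(1) B0R _ e1])
  fix c :: "nat => real" and l
  assume "AE x in lborel. x \<in> Om --> (\<Sum>l<k. c l *R mu l x) = 0" "l < k"
  then show "c l = 0" by (rule ind[of c l])
 qed
 then obtain A M where A: "continuous_on K A" and M0: "\<forall>l<k. \<forall>x\<in>K. (M l has_derivative (%h. - (bmul (A x) (M l x) *v h))) (at x)"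
   and Mi0: "\<forall>x\<in>K. \<forall>c. (\<Sum>l<k. c l *R M l x) = 0 --> (\<forall>l<k. c l = 0)"
   and AB: "pint p (%x. indicator K x *R (A x - B0 x)) < ennreal e1"
  by (elim exE conjE)
 \<comment> \<open>A - h is small only in L^p, so its composition with T needs the averaging. The
   uniformly continuous h can be compared with its composition pointwise.\<close>
 define f where "f = (%x. indicator K x *R (A x - h x))"
 have fm: "f \<in> borel_fun" unfolding f_def
  by (intro borel_measurable_continuous_on_indicator Ks continuous_intros A continuous_on_subset[OF h(1)]) simp
 have kABm: "(%x. indicator K x *R (A x - B0 x)) \<in> borel_fun"
 proof -
  have "(%x. indicator K x *R A x) \<in> borel_fun" by (intro borel_measurable_continuous_on_indicator Ks A)
  moreover have "(%x. indicator K x *R B0 x) \<in> borel_fun"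
   using B0(1) Ks by (intro borel_measurable_scaleR borel_measurable_indicator) auto
  ultimately have "(%x. indicator K x *R A x - indicator K x *R B0 x) \<in> borel_fun" by (rule borel_measurable_diff)
  then show ?thesis by (simp add: scaleR_diff_right)
 qed
 have fp: "pint p f \<le> ennreal (Q * (2 * e1))"
 proof -
  have "pint p f \<le> ennreal Q * (pint p (%x. indicator K x *R (A x - B0 x)) + pint p (%x. B0 x - h x))"
   unfolding Q_def
  proof (rule pint_add_le[OF kABm _ p0])
   show "(%x. B0 x - h x) \<in> borel_fun" using B0(1) hm by simp
   show "norm (f x) \<le> norm (indicator K x *R (A x - B0 x)) + norm (B0 x - h x)" for x
    using norm_triangle_ineq[of "A x - B0 x" "B0 x - h x"] by (cases "x \<in> K") (auto simp: f_def)
  qed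
  also have "... \<le> ennreal Q * (ennreal e1 + ennreal e1)" using AB h(2) by (intro mult_left_mono add_mono) auto
  also have "... = ennreal (Q * (2 * e1))"
   using Q e1 by (simp add: ennreal_mult'[symmetric] ennreal_plus[symmetric] del: ennreal_plus)
  finally show ?thesis .
 qed
 define Fe where "Fe = (%x. ennreal (norm (f x) powr p))"
 have Fem: "Fe \<in> borel_fun" unfolding Fe_def using fm by measurable
 have "\<exists>a\<in>ball 0 et. (NN x. indicator Om x * Fe (x + t *R (V x + a)))
  \<le> ennreal (((Vm + et) / et) ^ CARD('d)) * (NN y. Fe y)"
  by (rule average_translation_le[OF Fem borel_measurable_continuous_onI[OF V_cont] Oms t(1) tV(2)]) (use tV(3) in blast)
 then obtain a where a: "a \<in> ball 0 et" "(NN x. indicator Om x * Fe (x + t *R (V x + a))) \<le> ennreal c * pint p f"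
  unfolding c_def pint_def Fe_def by (elim bexE)
 define T where "T = (%x. x + t *R (V x + a))"
 define J where "J = (%x. mat 1 + t *R DV x)"
 have TK: "T x \<in> K" if "x \<in> closure Om" for x unfolding K_def T_def by (rule image_eqI[of _ _ "(x, a)"]) (use that a(1) in auto)
 have Tc: "continuous_on S T" for S unfolding T_def by (intro continuous_intros continuous_on_subset[OF V_cont]) simp
 have Jc: "continuous_on S J" for S unfolding J_def by (intro continuous_intros continuous_on_subset[OF DV_cont]) simp
 have Td: "(T has_derivative (*v) (J x)) (at x)" for x
 proof -
  have "(T has_derivative (%h. h + t *R (DV x *v h + 0))) (at x)"
   unfolding T_def by (intro derivative_intros V_deriv)
  moreover have "(%h. h + t *R (DV x *v h + 0)) = (*v) (J x)"
   by (rule ext) (simp add: J_def matrix_vector_mult_add_rdistrib scaleR_matrix_vector_assoc)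
  ultimately show ?thesis by simp
 qed
 have Tm: "T \<in> borel_fun" using Tc by (rule borel_measurable_continuous_onI)
 have Jb: "norm (J x) \<le> Jm" if "x \<in> closure Om" for x
 proof -
  have "t * norm (DV x) \<le> 1 * Dm" using Dm(2)[OF that] t(1,3) by (intro mult_mono) auto
  then have "norm (t *R DV x) \<le> Dm" using t(1) by simp
  then show ?thesis unfolding J_def Jm_def using norm_triangle_ineq[of "mat 1" "t *R DV x"] by linarith
 qed
 define Bep where "Bep = (%x. pull_back (A (T x)) (J x))"
 have Bc: "continuous_on (closure Om) Bep"
  unfolding Bep_def by (intro continuous_on_pull_back Jc continuous_on_compose2[OF A Tc]) (use TK in auto)
 have sol: "csol Om Bep (%x. M l (T x))" if "l < k" for l
  unfolding Bep_def using that M0 TK closure_subset by (intro csol_pull_back Td) blast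
 have "\<exists>k'\<ge>k. k_conservative_cont Om Bep k'"
 proof (subst k_conservative_cont_iff[OF open_Om conn _ x0])
  show "continuous_on Om Bep" by (rule continuous_on_subset[OF Bc closure_subset])
  show "k \<le> dim {u x0 |u. csol Om Bep u}"
  proof (rule independent_family_le_dim[where v="%l. M l (T x0)"])
   show "M l (T x0) \<in> {u x0 |u. csol Om Bep u}" if "l < k" for l
    unfolding mem_Collect_eq using sol[OF that] by (intro exI[of _ "%x. M l (T x)"]) simp
   show "c l = 0" if "(\<Sum>l<k. c l *R M l (T x0)) = 0" "l < k" for c l
    using Mi0 TK closure_subset x0 that by blast
  qed
 qed
 moreover have "Lp_dist p Om B Bep < ep"
 proof -
  define f1 where "f1 = (%x. cb * Jm * norm (indicator Om x *R f (T x)))"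
  define f2 where "f2 = (%x. th * indicator Om x :: real)"
  define f3 where "f3 = (%x. norm (h x - B0 x))"
  have fTm: "(%x. indicator Om x *R f (T x)) \<in> borel_fun"
   using measurable_compose[OF Tm fm] Oms by (intro borel_measurable_scaleR borel_measurable_indicator) auto
  have f1m: "f1 \<in> borel_fun" unfolding f1_def using fTm by measurable
  have f2m: "f2 \<in> borel_fun" unfolding f2_def using Oms by (intro borel_measurable_times borel_measurable_indicator) auto
  have f3m: "f3 \<in> borel_fun" unfolding f3_def using hm B0(1) by measurable
  have nn: "f1 x \<ge> 0" "f2 x \<ge> 0" "f3 x \<ge> 0" for x
   using cb(1) Jm th(1) by (auto simp: f1_def f2_def f3_def)
  have pt: "norm (indicator Om x *R (Bep x - B0 x)) \<le> norm (f1 x + (f2 x + f3 x))" for x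
  proof (cases "x \<in> Om")
   case True
   then have x: "x \<in> closure Om" using closure_subset by blast
   then have Tx: "T x \<in> K" "T x \<in> closure Om" using TK KOm closure_subset by blast+
   \<comment> \<open>Write A(T x) as f(T x) + (h(T x) - h x) + h x, and expand J = 1 + t DV in the
     last term only.\<close>
   have "Bep x - B0 x = pull_back (f (T x)) (J x) + (pull_back (h (T x) - h x) (J x) + t *R pull_back (h x) (DV x)) + (h x - B0 x)"
    using Tx(1) by (simp add: Bep_def f_def J_def pull_back_diff_left pull_back_add_right pull_back_scaleR_right pull_back_id scaleR_diff_right)
   then have "norm (Bep x - B0 x) \<le> norm (pull_back (f (T x)) (J x)) + (norm (pull_back (h (T x) - h x) (J x)) + norm (t *R pull_back (h x) (DV x))) + norm (h x - B0 x)"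
    by (simp only:) (intro norm_triangle_mono norm_triangle_ineq order_refl)
   moreover have "norm (pull_back (f (T x)) (J x)) \<le> f1 x"
   proof -
    have "norm (pull_back (f (T x)) (J x)) \<le> cb * norm (f (T x)) * Jm"
     by (rule order_trans[OF cb(2)[rule_format]]) (use Jb[OF x] cb(1) in \<open>auto intro!: mult_left_mono\<close>)
    then show ?thesis using True by (simp add: f1_def mult_ac)
   qed
   moreover have "norm (pull_back (h (T x) - h x) (J x)) \<le> th / 2"
   proof -
    have "dist (T x) x \<le> t * (Vm + et)"
    proof -
     have "norm (V x + a) \<le> Vm + et" using tV(3) a(1) norm_triangle_ineq[of "V x" a] by (smt (verit) mem_ball_0)
     then show ?thesis using t(1) by (simp add: T_def dist_norm)
    qed
    then have "dist (h (T x)) (h x) < th / (2 * (cb * Jm + 1))" using om(2) Tx(2) x t(4) by simp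
    then have d: "norm (h (T x) - h x) \<le> th / (2 * (cb * Jm + 1))" by (simp add: dist_norm)
    have "norm (pull_back (h (T x) - h x) (J x)) \<le> cb * norm (h (T x) - h x) * Jm"
     by (rule order_trans[OF cb(2)[rule_format]]) (use Jb[OF x] cb(1) in \<open>auto intro!: mult_left_mono\<close>)
    also have "... = (cb * Jm) * norm (h (T x) - h x)" by simp
    also have "... \<le> (cb * Jm + 1) * (th / (2 * (cb * Jm + 1)))"
     by (rule mult_mono) (use d cb(1) Jm in auto)
    also have "... = th / 2"
    proof -
     have "cb * Jm + 1 > 0" using cb(1) Jm by (simp add: add_nonneg_pos)
     then show ?thesis by (simp add: field_simps)
    qed
    finally show ?thesis .
   qed
   moreover have "norm (t *R pull_back (h x) (DV x)) \<le> th / 2"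
   proof -
    have "norm (pull_back (h x) (DV x)) \<le> cb * H * Dm"
     by (rule order_trans[OF cb(2)[rule_format]]) (use H Dm x cb(1) in \<open>auto intro!: mult_mono mult_nonneg_nonneg\<close>)
    then have "t * norm (pull_back (h x) (DV x)) \<le> t * (cb * H * Dm)" using t(1) by (intro mult_left_mono) auto
    also have "... = cb * H * Dm * t" by simp
    also have "... \<le> th / 2" by (rule t(5))
    finally show ?thesis using t(1) by simp
   qed
   moreover have "f2 x = th" using True by (simp add: f2_def)
   ultimately have "norm (Bep x - B0 x) \<le> f1 x + (f2 x + f3 x)" unfolding f3_def by linarith
   then show ?thesis using True nn[of x] by simp
  qed (use nn[of x] in simp)
  have "pint p (%x. indicator Om x *R (Bep x - B0 x)) \<le> pint p (%x. f1 x + (f2 x + f3 x))" by (rule pint_mono[OF pt p0])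
  also have "... \<le> ennreal Q * (pint p f1 + pint p (%x. f2 x + f3 x))"
   unfolding Q_def by (rule pint_add_le[OF f1m _ p0 norm_triangle_ineq]) (use f2m f3m in simp)
  also have "... \<le> ennreal Q * (pint p f1 + ennreal Q * (pint p f2 + pint p f3))"
   unfolding Q_def by (intro mult_left_mono add_left_mono pint_add_le[OF f2m f3m p0 norm_triangle_ineq]) auto
  also have "... \<le> ennreal Q * (ennreal (q * (Q * (2 * e1))) + ennreal Q * (ennreal e1 + ennreal e1))"
  proof (intro mult_left_mono add_mono)
   have "pint p f1 \<le> ennreal ((cb * Jm) powr p) * pint p (%x. indicator Om x *R f (T x))"
    by (rule pint_scale_le[OF fTm _ p0]) (use cb(1) Jm in \<open>auto simp: f1_def abs_mult\<close>)
   also have "pint p (%x. indicator Om x *R f (T x)) = (NN x. indicator Om x * Fe (x + t *R (V x + a)))"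
    unfolding pint_def by (rule nn_integral_cong) (use p0 in \<open>auto simp: Fe_def T_def indicator_def\<close>)
   also have "... \<le> ennreal c * ennreal (Q * (2 * e1))"
    by (rule order_trans[OF a(2)]) (intro mult_left_mono fp, simp)
   finally have "pint p f1 \<le> ennreal ((cb * Jm) powr p) * (ennreal c * ennreal (Q * (2 * e1)))" by (simp add: mult_left_mono)
   also have "... = ennreal (q * (Q * (2 * e1)))"
    using c0 Q e1 by (simp add: q_def ennreal_mult'[symmetric] mult.assoc)
   finally show "pint p f1 \<le> ennreal (q * (Q * (2 * e1)))" .
   have "pint p f2 \<le> ennreal (th powr p) * emeasure lborel Om"
    by (rule pint_bounded_le[OF _ _ Oms p0]) (use th(1) in \<open>auto simp: f2_def indicator_def\<close>)
   also have "... \<le> ennreal e1" using th(2) v by (simp add: ennreal_mult'[symmetric] ennreal_leI)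
   finally show "pint p f2 \<le> ennreal e1" .
   have "pint p f3 = pint p (%x. B0 x - h x)" by (simp add: f3_def pint_def norm_minus_commute)
   then show "pint p f3 \<le> ennreal e1" using h(2) by simp
  qed auto
  also have "... = ennreal (Q\<^sup>2 * (2 * q + 2) * e1)"
  proof -
   have "ennreal Q * (ennreal (q * (Q * (2 * e1))) + ennreal Q * (ennreal e1 + ennreal e1)) = ennreal (Q * (q * (Q * (2 * e1)) + Q * (e1 + e1)))"
    using Q e1 q by (simp add: ennreal_mult'[symmetric] ennreal_plus[symmetric] del: ennreal_plus)
   also have "Q * (q * (Q * (2 * e1)) + Q * (e1 + e1)) = Q\<^sup>2 * (2 * q + 2) * e1" by (simp add: power2_eq_square algebra_simps)
   finally show ?thesis .
  qed
  also have "... < ennreal e"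
  proof (rule ennreal_lessI[OF e])
   have "W * e1 = e" using W by (simp add: e1_def)
   then show "Q\<^sup>2 * (2 * q + 2) * e1 < e" using e1 by (simp add: W_def algebra_simps)
  qed
  finally have "pint p (%x. indicator Om x *R (Bep x - B0 x)) < ennreal e" .
  then have "ennreal (Lp_dist p Om B Bep powr p) < ennreal e"
   using Lp_dist_pint[OF open_Om bdd B0 p0 Bp Bc] by simp
  then have lt: "Lp_dist p Om B Bep powr p < ep powr p" by (simp add: ennreal_less_iff e_def)
  show ?thesis
  proof (rule ccontr)
   assume "\<not> ?thesis"
   then have "ep powr p \<le> Lp_dist p Om B Bep powr p" using ep p0 by (intro powr_mono2) auto
   then show False using lt by simp
  qed
 qed
 ultimately show "\<exists>Bep. continuous_on (closure Om) Bep \<and> (\<exists>k'\<ge>k. k_conservative_cont Om Bep k') \<and> Lp_dist p Om B Bep < ep"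
  using Bc by (intro exI[of _ Bep] conjI)
qed

end

theorem theorem4p2:
 fixes \<Omega> :: "(real^'d) set" and B :: "real^'d \<Rightarrow> real^'n^'d^'n"
  and p :: real and k :: nat
 assumes "CARD('d) \<ge> 2"
  and "open \<Omega>" and "bounded \<Omega>" and "connected \<Omega>" and "\<Omega> \<noteq> {}"
  and "smooth_boundary \<Omega>"
  and "p > real CARD('d)"
  and "Lp_on p \<Omega> B"
  and "k \<le> CARD('n)"
 shows "ae_dim_eq \<Omega> (kernelN \<Omega> B) k \<longleftrightarrow> Lp_conservative p \<Omega> B k"
proof -
 obtain Z e c r \<rho> where "cone_domain \<Omega> Z e c r \<rho>" using cone_domain_exists[OF assms(2,3,6)] by (elim exE)
 then interpret cone_domain \<Omega> Z e c r \<rho> .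
 \<comment> \<open>This is the use of d \<ge> 2: it places B in L^2 of the bounded domain, so that
   products with L^2 functions are integrable.\<close>
 have p2: "p \<ge> 2" using assms(1,7) by linarith
 \<comment> \<open>Each side of the theorem is one of these properties at k together with its
   failure at k + 1, so their equivalence for every m is enough.\<close>
 have "(\<exists>fs. length fs = m \<and> set fs \<subseteq> kernelN \<Omega> B \<and> ae_lin_indep \<Omega> fs) \<longleftrightarrow> at_least_conservative p \<Omega> B m" for m
 proof
  assume "\<exists>fs. length fs = m \<and> set fs \<subseteq> kernelN \<Omega> B \<and> ae_lin_indep \<Omega> fs"
  then obtain fs where "length fs = m" "set fs \<subseteq> kernelN \<Omega> B" "ae_lin_indep \<Omega> fs" by (elim exE conjE)
  then show "at_least_conservative p \<Omega> B m"
   by (rule kernelN_imp_at_least_conservative[OF assms(7) p2 assms(4,3,5,8)])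
 next
  assume "at_least_conservative p \<Omega> B m"
  then show "\<exists>fs. length fs = m \<and> set fs \<subseteq> kernelN \<Omega> B \<and> ae_lin_indep \<Omega> fs"
   by (rule at_least_conservative_imp_kernelN[OF assms(7,4,3,5,8)])
 qed
 then show ?thesis unfolding ae_dim_eq_def Lp_conservative_def by simp
qed

end
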